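(* Let $\mathbf{k}$ be an algebraically closed field of characteristic 2, $G=O(2n+1)$ and $\mathfrak{g}=\mathfrak{o}(2n+1)$ over $\mathbf{k}$. For every nilpotent $\xi\in\mathfrak{g}^*$ there exist a unique $m\ge0$ and a unique sequence of modules $W_{l_i}(k_i)$, $i=1,\dots,s$, such that the form module $(V,\alpha,\beta_\xi)$ is equivalent to $V_{2m+1}\oplus W_{l_1}(k_1)\oplus\cdots\oplus W_{l_s}(k_s)$ with $[(k_i+1)/2]\le l_i\le k_i$, $k_1\ge\cdots\ge k_s$, $l_1\ge\cdots\ge l_s$ and $m\ge k_1-l_1\ge\cdots\ge k_s-l_s$ (the normal form). Two form modules are equivalent if and only if their normal forms are the same. Associating to the orbit of $\xi$ the pair of partitions $(m,k_1-l_1,\dots,k_s-l_s)(l_1,\dots,l_s)$ defines a bijection from the set of nilpotent $G$-orbits in $\mathfrak{g}^*$ to the set of pairs of partitions $\{(\nu,\mu)\mid\nu=(\nu_0,\nu_1,\dots,\nu_s),\ \mu=(\mu_1,\dots,\mu_s),\ |\mu|+|\nu|=n,\ \nu_i\le\mu_i,\ i=1,\dots,s\}$, which has cardinality $p_2(n)-p_2(n-2)$.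
   Context: $p_2(n)$ is the number of pairs of partitions $(\mu,\nu)$ with $|\mu|+|\nu|=n$ (zero for $n<0$). $V$ is a $(2n+1)$-dimensional $\mathbf{k}$-space with a non-degenerate quadratic form $\alpha$ and associated bilinear form $\beta$; $G=\{g\in GL(V)\mid\alpha(gv)=\alpha(v)\}$, $\mathfrak{g}=\{x\in\mathfrak{gl}(V)\mid\beta(xv,v)=0\ \forall v\in V,\ \mathrm{tr}(x)=0\}$; $G$ acts on $\mathfrak{g}^*$ by $(g.\xi)(x)=\xi(\mathrm{Ad}(g)^{-1}x)$. $\xi\in\mathfrak{g}^*$ is nilpotent if some $g.\xi$, $g\in G$, vanishes on the Lie algebra of a fixed Borel subgroup. For $\xi\in\mathfrak{g}^*$ choose $X\in\mathfrak{gl}(V)$ with $\xi(x)=\mathrm{tr}(Xx)$ on $\mathfrak{g}$ and set $\beta_\xi(v,w)=\beta(Xv,w)+\beta(v,Xw)$ (independent of $X$). The form module of $\xi$ is $(V,\alpha,\beta_\xi)$; two form modules are equivalent if there is a linear isomorphism preserving the quadratic form and the second bilinear form. $V_{2m+1}$ is the module with basis $v_0,\dots,v_m,u_0,\dots,u_{m-1}$, $\beta(v_i,u_j)=\delta_{i,j}$, $\beta_\xi(v_i,u_j)=\delta_{i,j+1}$, $\beta$ and $\beta_\xi$ zero on all pairs $(v_i,v_j)$ and $(u_i,u_j)$, $\alpha(v_i)=\delta_{i,m}$, $\alpha(u_i)=0$. $W_l(k)$ is the module of dimension $2k$ with basis $T^i\rho_1,T^i\rho_2$ ($0\le i\le k-1$),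 $T^k\rho_1=T^k\rho_2=0$, $\beta(T^i\rho_1,T^j\rho_2)=\delta_{i+j,k-1}$, $\beta(T^i\rho_1,T^j\rho_1)=\beta(T^i\rho_2,T^j\rho_2)=0$, $\alpha(T^i\rho_1)=\delta_{i,l-1}$, $\alpha(T^i\rho_2)=0$, $\beta_\xi(w,w')=\beta(Tw,w')$. Direct sums are orthogonal for both $\beta$ and $\beta_\xi$. *)

theory Defs
  imports
    Complex_Main
    "HOL-Library.Function_Algebras"
    "HOL-Computational_Algebra.Computational_Algebra"
    "HOL-Analysis.Abstract_Topology"
    "HOL-Algebra.Solvable_Groups"
begin

section \<open>Linear algebra over an arbitrary field\<close>

text \<open>A vector space is a type together with a scalar multiplication \<open>s\<close> satisfying
  \<^const>\<open>vector_space\<close>.\<close>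

definition gl :: "('k::field \<Rightarrow> 'v::ab_group_add \<Rightarrow> 'v) \<Rightarrow> ('v \<Rightarrow> 'v) set" where
  "gl s = {x. Vector_Spaces.linear s s x}"

definition GL :: "('k::field \<Rightarrow> 'v::ab_group_add \<Rightarrow> 'v) \<Rightarrow> ('v \<Rightarrow> 'v) set" where
  "GL s = {g \<in> gl s. bij g}"

definition GL_group :: "('k::field \<Rightarrow> 'v::ab_group_add \<Rightarrow> 'v) \<Rightarrow> ('v \<Rightarrow> 'v) monoid" where
  "GL_group s = \<lparr>carrier = GL s, mult = (\<circ>), one = id\<rparr>"

text \<open>The trace, computed in the basis that the library chooses by extending the empty set; for
  finite-dimensional spaces it does not depend on the basis.\<close>

definition lin_trace :: "('k::field \<Rightarrow> 'v::ab_group_add \<Rightarrow> 'v) \<Rightarrow> ('v \<Rightarrow> 'v) \<Rightarrow> 'k" where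
  "lin_trace s x =
     (let E = vector_space.extend_basis s {} in \<Sum>e\<in>E. module.representation s E (x e) e)"


section \<open>Zariski topology, Borel subgroups and Lie algebras in \<open>GL(V)\<close>\<close>

text \<open>The polynomial functions on \<open>End(V)\<close>: the algebra generated by the matrix coefficients.\<close>

inductive_set poly_funs :: "('k::field \<Rightarrow> 'v::ab_group_add \<Rightarrow> 'v) \<Rightarrow> (('v \<Rightarrow> 'v) \<Rightarrow> 'k) set"
  for s :: "'k::field \<Rightarrow> 'v::ab_group_add \<Rightarrow> 'v" where
  const: "(\<lambda>x. c) \<in> poly_funs s"
| coefficient: "Vector_Spaces.linear s (*) \<phi> \<Longrightarrow> (\<lambda>x. \<phi> (x v)) \<in> poly_funs s"
| add: "f \<in> poly_funs s \<Longrightarrow> h \<in> poly_funs s \<Longrightarrow> (\<lambda>x. f x + h x) \<in> poly_funs s"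
| mult: "f \<in> poly_funs s \<Longrightarrow> h \<in> poly_funs s \<Longrightarrow> (\<lambda>x. f x * h x) \<in> poly_funs s"

text \<open>The Zariski topology on \<open>GL(V)\<close> is generated by the principal open sets. Allowing negative
  powers of the determinant in the regular functions would not change these sets.\<close>

definition zariski :: "('k::field \<Rightarrow> 'v::ab_group_add \<Rightarrow> 'v) \<Rightarrow> ('v \<Rightarrow> 'v) topology" where
  "zariski s = topology_generated_by {{g \<in> GL s. f g \<noteq> 0} |f. f \<in> poly_funs s}"

definition closed_connected_solvable ::
  "('k::field \<Rightarrow> 'v::ab_group_add \<Rightarrow> 'v) \<Rightarrow> ('v \<Rightarrow> 'v) set \<Rightarrow> bool" where
  "closed_connected_solvable s H \<longleftrightarrow>
     subgroup H (GL_group s) \<and> closedin (zariski s) H \<and> connectedin (zariski s) H \<and>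
     solvable ((GL_group s)\<lparr>carrier := H\<rparr>)"

definition borel_subgroup ::
  "('k::field \<Rightarrow> 'v::ab_group_add \<Rightarrow> 'v) \<Rightarrow> ('v \<Rightarrow> 'v) set \<Rightarrow> ('v \<Rightarrow> 'v) set \<Rightarrow> bool" where
  "borel_subgroup s \<Gamma> B \<longleftrightarrow>
     B \<subseteq> \<Gamma> \<and> closed_connected_solvable s B \<and>
     (\<forall>H. B \<subseteq> H \<and> H \<subseteq> \<Gamma> \<and> closed_connected_solvable s H \<longrightarrow> H = B)"

text \<open>The Lie algebra of a closed subgroup is its tangent space at the identity: for every
  polynomial function \<open>f\<close> vanishing on the subgroup, the differential of \<open>f\<close> at the identity
  vanishes on \<open>x\<close>, i.e. the polynomial \<open>f (1 + t x)\<close> in \<open>t\<close> has derivative 0 at \<open>t = 0\<close>.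
  Over an infinite field the polynomial \<open>p\<close> below exists and is unique.\<close>

definition lie_algebra ::
  "('k::field \<Rightarrow> 'v::ab_group_add \<Rightarrow> 'v) \<Rightarrow> ('v \<Rightarrow> 'v) set \<Rightarrow> ('v \<Rightarrow> 'v) set" where
  "lie_algebra s H =
     {x \<in> gl s. \<forall>f\<in>poly_funs s. (\<forall>h\<in>H. f h = 0) \<longrightarrow>
        (\<forall>p. (\<forall>t. f (\<lambda>v. v + s t (x v)) = poly p t) \<longrightarrow> poly (pderiv p) 0 = 0)}"


section \<open>The orthogonal group, its Lie algebra and the dual\<close>

definition polar :: "('v::ab_group_add \<Rightarrow> 'k::field) \<Rightarrow> 'v \<Rightarrow> 'v \<Rightarrow> 'k" where
  "polar \<alpha> v w = \<alpha> (v + w) - \<alpha> v - \<alpha> w"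

definition quadratic_form ::
  "('k::field \<Rightarrow> 'v::ab_group_add \<Rightarrow> 'v) \<Rightarrow> ('v \<Rightarrow> 'k) \<Rightarrow> bool" where
  "quadratic_form s \<alpha> \<longleftrightarrow>
     (\<forall>c v. \<alpha> (s c v) = c\<^sup>2 * \<alpha> v) \<and>
     (\<forall>v. Vector_Spaces.linear s (*) (polar \<alpha> v)) \<and>
     (\<forall>w. Vector_Spaces.linear s (*) (\<lambda>v. polar \<alpha> v w))"

text \<open>In characteristic 2 the bilinear form of an odd-dimensional quadratic space is always
  degenerate. Non-degeneracy of \<open>\<alpha>\<close> means that \<open>\<alpha>\<close> has no non-trivial zero in the radical of
  its bilinear form.\<close>

definition nondegenerate_quad :: "('v::ab_group_add \<Rightarrow> 'k::field) \<Rightarrow> bool" where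
  "nondegenerate_quad \<alpha> \<longleftrightarrow> (\<forall>v. (\<forall>w. polar \<alpha> v w = 0) \<and> \<alpha> v = 0 \<longrightarrow> v = 0)"

definition odd_quadratic_space ::
  "('k::field \<Rightarrow> 'v::ab_group_add \<Rightarrow> 'v) \<Rightarrow> ('v \<Rightarrow> 'k) \<Rightarrow> nat \<Rightarrow> bool" where
  "odd_quadratic_space s \<alpha> n \<longleftrightarrow>
     vector_space s \<and> vector_space.dim s (UNIV :: 'v set) = 2 * n + 1 \<and>
     quadratic_form s \<alpha> \<and> nondegenerate_quad \<alpha>"

definition orth_group ::
  "('k::field \<Rightarrow> 'v::ab_group_add \<Rightarrow> 'v) \<Rightarrow> ('v \<Rightarrow> 'k) \<Rightarrow> ('v \<Rightarrow> 'v) set" where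
  "orth_group s \<alpha> = {g \<in> GL s. \<forall>v. \<alpha> (g v) = \<alpha> v}"

definition orth_lie ::
  "('k::field \<Rightarrow> 'v::ab_group_add \<Rightarrow> 'v) \<Rightarrow> ('v \<Rightarrow> 'k) \<Rightarrow> ('v \<Rightarrow> 'v) set" where
  "orth_lie s \<alpha> = {x \<in> gl s. (\<forall>v. polar \<alpha> (x v) v = 0) \<and> lin_trace s x = 0}"

text \<open>Linear functionals on the Lie algebra, extended by 0 outside of it so that equality of
  functions is equality of functionals.\<close>

definition orth_dual ::
  "('k::field \<Rightarrow> 'v::ab_group_add \<Rightarrow> 'v) \<Rightarrow> ('v \<Rightarrow> 'k) \<Rightarrow> (('v \<Rightarrow> 'v) \<Rightarrow> 'k) set" where
  "orth_dual s \<alpha> = {\<xi>.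
     (\<forall>x\<in>orth_lie s \<alpha>. \<forall>y\<in>orth_lie s \<alpha>. \<xi> (\<lambda>v. x v + y v) = \<xi> x + \<xi> y) \<and>
     (\<forall>c. \<forall>x\<in>orth_lie s \<alpha>. \<xi> (\<lambda>v. s c (x v)) = c * \<xi> x) \<and>
     (\<forall>x. x \<notin> orth_lie s \<alpha> \<longrightarrow> \<xi> x = 0)}"

definition coad :: "('v \<Rightarrow> 'v) \<Rightarrow> (('v \<Rightarrow> 'v) \<Rightarrow> 'k) \<Rightarrow> (('v \<Rightarrow> 'v) \<Rightarrow> 'k)" where
  "coad g \<xi> = (\<lambda>x. \<xi> (inv_into UNIV g \<circ> x \<circ> g))"

definition coad_orbit ::
  "('k::field \<Rightarrow> 'v::ab_group_add \<Rightarrow> 'v) \<Rightarrow> ('v \<Rightarrow> 'k) \<Rightarrow> (('v \<Rightarrow> 'v) \<Rightarrow> 'k) \<Rightarrow> (('v \<Rightarrow> 'v) \<Rightarrow> 'k) set"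
  where "coad_orbit s \<alpha> \<xi> = (\<lambda>g. coad g \<xi>) ` orth_group s \<alpha>"

definition nilpotent_dual ::
  "('k::field \<Rightarrow> 'v::ab_group_add \<Rightarrow> 'v) \<Rightarrow> ('v \<Rightarrow> 'k) \<Rightarrow> ('v \<Rightarrow> 'v) set \<Rightarrow> (('v \<Rightarrow> 'v) \<Rightarrow> 'k) set"
  where "nilpotent_dual s \<alpha> B =
     {\<xi> \<in> orth_dual s \<alpha>. \<exists>g\<in>orth_group s \<alpha>. \<forall>x\<in>lie_algebra s B. coad g \<xi> x = 0}"

definition beta_xi ::
  "('k::field \<Rightarrow> 'v::ab_group_add \<Rightarrow> 'v) \<Rightarrow> ('v \<Rightarrow> 'k) \<Rightarrow> (('v \<Rightarrow> 'v) \<Rightarrow> 'k) \<Rightarrow> 'v \<Rightarrow> 'v \<Rightarrow> 'k" where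
  "beta_xi s \<alpha> \<xi> v w =
     (let X = (SOME X. X \<in> gl s \<and> (\<forall>x\<in>orth_lie s \<alpha>. \<xi> x = lin_trace s (X \<circ> x)))
      in polar \<alpha> (X v) w + polar \<alpha> v (X w))"


section \<open>Form modules\<close>

record ('k, 'v) form_module =
  fm_space :: "'v set"
  fm_scale :: "'k \<Rightarrow> 'v \<Rightarrow> 'v"
  fm_quad :: "'v \<Rightarrow> 'k"
  fm_bil :: "'v \<Rightarrow> 'v \<Rightarrow> 'k"

definition form_equiv ::
  "('k::field, 'v::ab_group_add) form_module \<Rightarrow> ('k, 'w::ab_group_add) form_module \<Rightarrow> bool" where
  "form_equiv M N \<longleftrightarrow> (\<exists>f. bij_betw f (fm_space M) (fm_space N) \<and>
     (\<forall>v\<in>fm_space M. \<forall>w\<in>fm_space M. f (v + w) = f v + f w) \<and>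
     (\<forall>c. \<forall>v\<in>fm_space M. f (fm_scale M c v) = fm_scale N c (f v)) \<and>
     (\<forall>v\<in>fm_space M. fm_quad N (f v) = fm_quad M v) \<and>
     (\<forall>v\<in>fm_space M. \<forall>w\<in>fm_space M. fm_bil N (f v) (f w) = fm_bil M v w))"

definition xi_module ::
  "('k::field \<Rightarrow> 'v::ab_group_add \<Rightarrow> 'v) \<Rightarrow> ('v \<Rightarrow> 'k) \<Rightarrow> (('v \<Rightarrow> 'v) \<Rightarrow> 'k) \<Rightarrow> ('k, 'v) form_module"
  where "xi_module s \<alpha> \<xi> =
     \<lparr>fm_space = UNIV, fm_scale = s, fm_quad = \<alpha>, fm_bil = beta_xi s \<alpha> \<xi>\<rparr>"

text \<open>The external orthogonal direct sum of a list of form modules; its vectors are the families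
  indexed by the positions of the list, extended by 0.\<close>

definition direct_sum ::
  "('k::field, 'v::ab_group_add) form_module list \<Rightarrow> ('k, nat \<Rightarrow> 'v) form_module" where
  "direct_sum Ms =
     \<lparr>fm_space = {F. (\<forall>i<length Ms. F i \<in> fm_space (Ms ! i)) \<and> (\<forall>i\<ge>length Ms. F i = 0)},
      fm_scale = (\<lambda>c F i. if i < length Ms then fm_scale (Ms ! i) c (F i) else 0),
      fm_quad = (\<lambda>F. \<Sum>i<length Ms. fm_quad (Ms ! i) (F i)),
      fm_bil = (\<lambda>F F'. \<Sum>i<length Ms. fm_bil (Ms ! i) (F i) (F' i))\<rparr>"

text \<open>The standard modules are coordinate spaces. The vectors of the basis are indexed by
  \<open>Inl ` I \<union> Inr ` J\<close>. On it, \<open>pair_bil I J b\<close> is the symmetric bilinear form that is zero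
  on pairs of two \<open>Inl\<close>- or two \<open>Inr\<close>-vectors and equals \<open>b i j\<close> on the vectors
  \<open>Inl i\<close>, \<open>Inr j\<close>, and \<open>pair_quad I J b q\<close> is the quadratic form with this associated bilinear
  form and with value \<open>q i\<close> on \<open>Inl i\<close> and 0 on \<open>Inr j\<close>.\<close>

definition coord_space :: "nat set \<Rightarrow> nat set \<Rightarrow> (nat + nat \<Rightarrow> 'k::field) set" where
  "coord_space I J = {a. \<forall>e. e \<notin> Inl ` I \<union> Inr ` J \<longrightarrow> a e = 0}"

definition coord_scale :: "'k::field \<Rightarrow> (nat + nat \<Rightarrow> 'k) \<Rightarrow> (nat + nat \<Rightarrow> 'k)" where
  "coord_scale c a = (\<lambda>e. c * a e)"

definition pair_bil :: "nat set \<Rightarrow> nat set \<Rightarrow> (nat \<Rightarrow> nat \<Rightarrow> 'k) \<Rightarrow>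
    (nat + nat \<Rightarrow> 'k::field) \<Rightarrow> (nat + nat \<Rightarrow> 'k) \<Rightarrow> 'k" where
  "pair_bil I J b a a' =
     (\<Sum>i\<in>I. \<Sum>j\<in>J. b i j * (a (Inl i) * a' (Inr j) + a (Inr j) * a' (Inl i)))"

definition pair_quad :: "nat set \<Rightarrow> nat set \<Rightarrow> (nat \<Rightarrow> nat \<Rightarrow> 'k) \<Rightarrow> (nat \<Rightarrow> 'k) \<Rightarrow>
    (nat + nat \<Rightarrow> 'k::field) \<Rightarrow> 'k" where
  "pair_quad I J b q a =
     (\<Sum>i\<in>I. q i * (a (Inl i))\<^sup>2) + (\<Sum>i\<in>I. \<Sum>j\<in>J. b i j * a (Inl i) * a (Inr j))"

lemma polar_pair_quad:
  fixes b :: "nat \<Rightarrow> nat \<Rightarrow> 'k::field"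
  assumes "CHAR('k) = 2"
  shows "polar (pair_quad I J b q) = pair_bil I J b"
proof (intro ext)
  fix a a' :: "nat + nat \<Rightarrow> 'k"
  have "of_nat 2 = (0::'k)"
    using assms by (metis of_nat_CHAR)
  then have two: "2 * x = 0" for x :: 'k
    by simp
  have "(x + y)\<^sup>2 = x\<^sup>2 + y\<^sup>2" for x y :: 'k
    using two[of "x * y"] by (simp add: power2_sum mult.assoc)
  then show "polar (pair_quad I J b q) a a' = pair_bil I J b a a'"
    by (simp add: polar_def pair_quad_def pair_bil_def algebra_simps sum.distrib)
qed

text \<open>Here \<open>v_i\<close> is \<open>Inl i\<close> and \<open>u_i\<close> is \<open>Inr i\<close>.\<close>

definition V_module :: "nat \<Rightarrow> ('k::field, nat + nat \<Rightarrow> 'k) form_module" where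
  "V_module m =
     \<lparr>fm_space = coord_space {..m} {..<m},
      fm_scale = coord_scale,
      fm_quad = pair_quad {..m} {..<m} (\<lambda>i j. of_bool (i = j)) (\<lambda>i. of_bool (i = m)),
      fm_bil = pair_bil {..m} {..<m} (\<lambda>i j. of_bool (i = j + 1))\<rparr>"

text \<open>Here \<open>T^i \<rho>_1\<close> is \<open>Inl i\<close> and \<open>T^i \<rho>_2\<close> is \<open>Inr i\<close>, for \<open>i < k\<close>.\<close>

definition W_shift :: "nat \<Rightarrow> (nat + nat \<Rightarrow> 'k::field) \<Rightarrow> (nat + nat \<Rightarrow> 'k)" where
  "W_shift k a = (\<lambda>e. case e of
       Inl i \<Rightarrow> if 0 < i \<and> i < k then a (Inl (i - 1)) else 0
     | Inr i \<Rightarrow> if 0 < i \<and> i < k then a (Inr (i - 1)) else 0)"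

definition W_module :: "nat \<Rightarrow> nat \<Rightarrow> ('k::field, nat + nat \<Rightarrow> 'k) form_module" where
  "W_module l k =
     \<lparr>fm_space = coord_space {..<k} {..<k},
      fm_scale = coord_scale,
      fm_quad = pair_quad {..<k} {..<k} (\<lambda>i j. of_bool (i + j + 1 = k)) (\<lambda>i. of_bool (i + 1 = l)),
      fm_bil = (\<lambda>a a'. pair_bil {..<k} {..<k} (\<lambda>i j. of_bool (i + j + 1 = k)) (W_shift k a) a')\<rparr>"


section \<open>Normal forms and pairs of partitions\<close>

text \<open>The module with parameter \<open>(m, [(l_1, k_1), \<dots>, (l_s, k_s)])\<close> is the direct sum of
  \<open>V_{2m+1}\<close> and the \<open>W_{l_i}(k_i)\<close>. The summands are required to be non-zero (\<open>k_i \<ge> 1\<close>),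
  as the parameters could not be unique otherwise.\<close>

definition normal_form_params :: "nat \<times> (nat \<times> nat) list \<Rightarrow> bool" where
  "normal_form_params = (\<lambda>(m, lks).
     (\<forall>(l, k)\<in>set lks. 1 \<le> k \<and> (k + 1) div 2 \<le> l \<and> l \<le> k) \<and>
     sorted_wrt (\<ge>) (map snd lks) \<and>
     sorted_wrt (\<ge>) (map fst lks) \<and>
     sorted_wrt (\<ge>) (m # map (\<lambda>(l, k). k - l) lks))"

definition normal_form_module ::
  "nat \<times> (nat \<times> nat) list \<Rightarrow> ('k::field, nat \<Rightarrow> nat + nat \<Rightarrow> 'k) form_module" where
  "normal_form_module = (\<lambda>(m, lks). direct_sum (V_module m # map (\<lambda>(l, k). W_module l k) lks))"

definition has_normal_form ::
  "('k::field, 'v::ab_group_add) form_module \<Rightarrow> nat \<times> (nat \<times> nat) list \<Rightarrow> bool" where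
  "has_normal_form M P \<longleftrightarrow> normal_form_params P \<and> form_equiv M (normal_form_module P)"

definition normal_form ::
  "('k::field, 'v::ab_group_add) form_module \<Rightarrow> nat \<times> (nat \<times> nat) list" where
  "normal_form M = (THE P. has_normal_form M P)"

text \<open>A partition is the weakly decreasing sequence of its parts, followed by zeros.\<close>

definition is_partition :: "(nat \<Rightarrow> nat) \<Rightarrow> bool" where
  "is_partition p \<longleftrightarrow> antimono p \<and> finite {i. p i \<noteq> 0}"

definition part_size :: "(nat \<Rightarrow> nat) \<Rightarrow> nat" where
  "part_size p = (\<Sum>i | p i \<noteq> 0. p i)"

definition parts :: "nat list \<Rightarrow> nat \<Rightarrow> nat" where
  "parts xs i = (if i < length xs then xs ! i else 0)"

definition p2 :: "int \<Rightarrow> nat" where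
  "p2 N = card {(\<mu>, \<nu>). is_partition \<mu> \<and> is_partition \<nu> \<and> int (part_size \<mu> + part_size \<nu>) = N}"

definition partition_pair :: "nat \<times> (nat \<times> nat) list \<Rightarrow> (nat \<Rightarrow> nat) \<times> (nat \<Rightarrow> nat)" where
  "partition_pair = (\<lambda>(m, lks). (parts (m # map (\<lambda>(l, k). k - l) lks), parts (map fst lks)))"

text \<open>The parts of \<open>\<nu>\<close> are numbered from 0 and those of \<open>\<mu>\<close> from 1, so the \<open>i\<close>-th part of \<open>\<mu>\<close>
  is the value at \<open>i - 1\<close>.\<close>

definition orbit_partition_pairs :: "nat \<Rightarrow> ((nat \<Rightarrow> nat) \<times> (nat \<Rightarrow> nat)) set" where
  "orbit_partition_pairs n = {(\<nu>, \<mu>). is_partition \<nu> \<and> is_partition \<mu> \<and>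
     part_size \<mu> + part_size \<nu> = n \<and> (\<forall>i\<ge>1. \<nu> i \<le> \<mu> (i - 1))}"

end

theory Submission imports Defs "Jordan_Normal_Form.Determinant" begin

text \<open>By the Lie--Kolchin theorem a Borel subgroup of \<open>O(2n+1)\<close> is the stabilizer of an isotropic flag, so
  a nilpotent \<open>\<xi>\<close> is the same as an alternating form \<open>\<omega> = \<beta>_\<xi>\<close> that is strictly upper triangular in
  some adapted basis, and coadjoint orbits are equivalence classes of form modules. Following \<open>\<omega>\<close>
  from the radical of \<open>\<beta>\<close> produces \<open>V_{2m+1}\<close>; on its complement \<open>\<omega>(z, w) = \<beta>(T z, w)\<close> with a
  nilpotent self-adjoint \<open>T\<close>, from which blocks \<open>W_l(k)\<close> are split off. Among all decompositions with
  the same \<open>k_i\<close> one with the largest sum of the \<open>l_i\<close> is normal, since each violated inequality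
  allows a change of basis that increases one \<open>l_i\<close>.

  The parameters are read off the terminating \<open>\<omega>\<close>-chains \<open>\<omega>(x_i, \<cdot>) = \<beta>(x_{i+1}, \<cdot>)\<close>: the
  dimensions of the spaces of their heads determine the \<open>k_i\<close>, and the last place where \<open>\<alpha>\<close> does not
  vanish on a chain of length \<open>k_i\<close> determines \<open>l_i\<close>. The pairs of partitions violating
  \<open>\<nu>_i \<le> \<mu>_i\<close> are matched with all pairs of total size \<open>n - 2\<close> by exchanging tails at the first
  violation.\<close>

section \<open>Indexed bases\<close>

text \<open>In characteristic 2 the form \<open>bet\<close> is alternating and, the dimension being
  odd, has a one-dimensional radical. It represents only functionals that vanish there, and the
  representing vector is fixed only up to the radical; the missing coordinate is recovered from
  \<open>\<alpha>\<close>, whose values on the radical line are squares times a constant. Hence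
  \<open>\<omega>\<close> has no operator on the whole space, which is why the radical chain is
  split off and why invariants are read from chains and not from kernels of powers. Functionals and
  forms are linked by the rank-two elements \<open>xel v w\<close> of the Lie algebra: the trace of
  X composed with \<open>xel v w\<close> is \<open>bet (X v) w + bet v (X w)\<close>, so
  \<open>\<beta>_\<xi>\<close> is \<open>\<xi> (xel v w)\<close> for any choice of X, and these
  elements span. The Lie algebra of a Borel subgroup is only bounded from both sides, which
  suffices. A model of each normal form inside the given space yields surjectivity and also turns an
  equivalence with a normal form module into a family of vectors, so uniqueness is argued within one
  space.\<close>

locale vspace = vector_space s
  for s :: "'a::field \<Rightarrow> 'b::ab_group_add \<Rightarrow> 'b"
begin

text \<open>Bases are indexed families, so that a coordinate is addressed by a position, such as a
  block and a place in it, and not by a vector.\<close>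

definition ibasis :: "'i set \<Rightarrow> ('i \<Rightarrow> 'b) \<Rightarrow> bool" where
  "ibasis I e \<longleftrightarrow> finite I \<and> inj_on e I \<and> independent (e ` I) \<and> span (e ` I) = UNIV"

definition coord :: "'i set \<Rightarrow> ('i \<Rightarrow> 'b) \<Rightarrow> 'i \<Rightarrow> 'b \<Rightarrow> 'a" where
  "coord I e i v = representation (e ` I) v (e i)"

lemma vs_field: "vector_space ((*) :: 'a \<Rightarrow> 'a \<Rightarrow> 'a)"
  by unfold_locales (auto simp: algebra_simps)

lemma linear_formI:
  assumes "\<And>x y. f (x + y) = f x + f y" "\<And>c x. f (s c x) = c * f x"
  shows "Vector_Spaces.linear s (*) f"
  using vs_field assms by (simp add: Vector_Spaces.linear_iff vector_space_axioms)

lemma linear_coord: "ibasis I e \<Longrightarrow> Vector_Spaces.linear s (*) (coord I e i)"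
  by (rule linear_formI) (auto simp: coord_def ibasis_def representation_add representation_scale)

lemma coord_add: "ibasis I e \<Longrightarrow> coord I e i (v + w) = coord I e i v + coord I e i w"
  and coord_scale: "ibasis I e \<Longrightarrow> coord I e i (s c v) = c * coord I e i v"
  by (auto simp: coord_def ibasis_def representation_add representation_scale)

lemma sum_coord:
  assumes "ibasis I e" shows "(\<Sum>i\<in>I. s (coord I e i v) (e i)) = v"
proof -
  have "(\<Sum>i\<in>I. s (coord I e i v) (e i)) = (\<Sum>x\<in>e ` I. s (representation (e ` I) v x) x)"
    using assms by (simp add: coord_def sum.reindex ibasis_def)
  also have "\<dots> = v"
    using assms by (intro sum_representation_eq) (auto simp: ibasis_def)
  finally show ?thesis .
qed

lemma coord_basis: "ibasis I e \<Longrightarrow> i \<in> I \<Longrightarrow> j \<in> I \<Longrightarrow> coord I e i (e j) = of_bool (i = j)"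
  by (auto simp: coord_def ibasis_def representation_basis inj_on_eq_iff)

lemma coord_sum:
  assumes "ibasis I e" shows "coord I e i (sum f A) = (\<Sum>x\<in>A. coord I e i (f x))"
proof -
  interpret l: Vector_Spaces.linear s "(*)" "coord I e i" using assms by (rule linear_coord)
  show ?thesis by (rule l.sum)
qed

lemma coord_unique:
  assumes "ibasis I e" "i \<in> I"
  shows "coord I e i (\<Sum>j\<in>I. s (c j) (e j)) = c i"
proof -
  have "coord I e i (\<Sum>j\<in>I. s (c j) (e j)) = (\<Sum>j\<in>I. if j = i then c j else 0)"
    using assms by (auto simp: coord_sum coord_scale coord_basis intro!: sum.cong)
  also have "\<dots> = c i"
    using assms by (simp add: ibasis_def)
  finally show ?thesis .
qed

lemma coord_eqI:
  assumes "ibasis I e" "\<And>i. i \<in> I \<Longrightarrow> coord I e i v = coord I e i w"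
  shows "v = w"
proof -
  have "(\<Sum>i\<in>I. s (coord I e i v) (e i)) = (\<Sum>i\<in>I. s (coord I e i w) (e i))"
    by (intro sum.cong) (simp_all add: assms(2))
  then show ?thesis unfolding sum_coord[OF assms(1)] .
qed

lemma independent_familyI:
  assumes "finite I" "\<And>c. (\<Sum>i\<in>I. s (c i) (e i)) = 0 \<Longrightarrow> \<forall>i\<in>I. c i = 0"
  shows "inj_on e I" "independent (e ` I)"
proof -
  show inj: "inj_on e I"
  proof (rule inj_onI, rule ccontr)
    fix i j assume ij: "i \<in> I" "j \<in> I" "e i = e j" "i \<noteq> j"
    let ?c = "\<lambda>k. if k = i then 1 :: 'a else if k = j then - 1 else 0"
    have "(\<Sum>k\<in>I. s (?c k) (e k)) = (\<Sum>k\<in>{i, j}. s (?c k) (e k))"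
      using assms(1) ij(1,2) by (intro sum.mono_neutral_right) auto
    also have "\<dots> = 0"
      using ij(3,4) by simp
    finally have "\<forall>k\<in>I. ?c k = 0"
      by (rule assms(2))
    from bspec[OF this ij(1)] show False by simp
  qed
  show "independent (e ` I)"
  proof (rule independent_if_scalars_zero)
    show "finite (e ` I)" using assms(1) by simp
    fix f x assume f: "(\<Sum>x\<in>e ` I. s (f x) x) = 0" and x: "x \<in> e ` I"
    have "(\<Sum>i\<in>I. s (f (e i)) (e i)) = 0"
      using f inj by (simp add: sum.reindex)
    then show "f x = 0"
      using assms(2)[of "\<lambda>i. f (e i)"] x by blast
  qed
qed

lemma ibasis_spanI:
  assumes "finite I" "\<And>c. (\<Sum>i\<in>I. s (c i) (e i)) = 0 \<Longrightarrow> \<forall>i\<in>I. c i = 0"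
    and "\<And>v. \<exists>c. v = (\<Sum>i\<in>I. s (c i) (e i))"
  shows "ibasis I e"
proof -
  have "v \<in> span (e ` I)" for v
  proof -
    obtain c where "v = (\<Sum>i\<in>I. s (c i) (e i))" using assms(3) by blast
    moreover have "(\<Sum>i\<in>I. s (c i) (e i)) \<in> span (e ` I)"
      by (intro span_sum span_scale span_base) simp
    ultimately show ?thesis by simp
  qed
  then show ?thesis
    using independent_familyI[OF assms(1,2)] assms(1) by (auto simp: ibasis_def)
qed

lemma ibasis_card:
  assumes "ibasis I e" shows "card I = dim UNIV"
proof -
  have "card (e ` I) = dim UNIV"
    using assms by (intro basis_card_eq_dim) (auto simp: ibasis_def)
  with assms show ?thesis by (simp add: ibasis_def card_image)
qed

definition lift :: "'i set \<Rightarrow> ('i \<Rightarrow> 'b) \<Rightarrow> ('i \<Rightarrow> 'b) \<Rightarrow> 'b \<Rightarrow> 'b" where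
  "lift I e t v = (\<Sum>i\<in>I. s (coord I e i v) (t i))"

lemma linear_lift: "ibasis I e \<Longrightarrow> Vector_Spaces.linear s s (lift I e t)"
  by (simp add: Vector_Spaces.linear_iff vector_space_axioms lift_def coord_add coord_scale scale_left_distrib
      sum.distrib scale_sum_right)

lemma lift_basis:
  assumes "ibasis I e" "i \<in> I" shows "lift I e t (e i) = t i"
proof -
  have "lift I e t (e i) = (\<Sum>j\<in>I. if j = i then t j else 0)"
    using assms by (auto simp: lift_def coord_basis intro!: sum.cong)
  then show ?thesis using assms by (simp add: ibasis_def)
qed

lemma linear_eq_on_ibasis:
  assumes "ibasis I e" "Vector_Spaces.linear s scale2 f" "Vector_Spaces.linear s scale2 g"
    "\<And>i. i \<in> I \<Longrightarrow> f (e i) = g (e i)"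
  shows "f v = g v"
proof -
  interpret f: Vector_Spaces.linear s scale2 f by fact
  interpret g: Vector_Spaces.linear s scale2 g by fact
  have "f (\<Sum>i\<in>I. s (coord I e i v) (e i)) = g (\<Sum>i\<in>I. s (coord I e i v) (e i))"
    unfolding f.sum g.sum f.scale g.scale by (intro sum.cong) (simp_all add: assms(4))
  then show ?thesis unfolding sum_coord[OF assms(1)] .
qed

end

locale fin_vspace = vspace s + finite_dimensional_vector_space s Basis
  for s :: "'a::field \<Rightarrow> 'b::ab_group_add \<Rightarrow> 'b" and Basis
begin

lemma ibasis_dimI:
  assumes "finite I" "card I = dim UNIV"
    "\<And>c. (\<Sum>i\<in>I. s (c i) (e i)) = 0 \<Longrightarrow> \<forall>i\<in>I. c i = 0"
  shows "ibasis I e"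
proof -
  note i = independent_familyI[OF assms(1,3)]
  have "card (e ` I) = dim UNIV" using i assms by (simp add: card_image)
  then have "span (e ` I) = UNIV"
    using i(2) card_ge_dim_independent[of "e ` I" UNIV] by auto
  with i assms show ?thesis by (simp add: ibasis_def)
qed

end

section \<open>Quadratic spaces in characteristic 2\<close>

locale quad_space = vspace s
  for s :: "'k::alg_closed_field \<Rightarrow> 'v::ab_group_add \<Rightarrow> 'v" +
  fixes \<alpha> :: "'v \<Rightarrow> 'k" and n :: nat
  assumes char2: "CHAR('k) = 2" and odd_space: "odd_quadratic_space s \<alpha> n"
begin

abbreviation bet :: "'v \<Rightarrow> 'v \<Rightarrow> 'k" where "bet \<equiv> polar \<alpha>"

lemma two [simp]: "(2::'k) = 0"
proof -
  have "of_nat 2 = (0::'k)" using char2 by (metis of_nat_CHAR)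
  then show ?thesis by simp
qed

text \<open>The simplifier is set up for characteristic 2: signs on scalars and vectors disappear,
  and x + y = 0 becomes x = y.\<close>

lemma add_self [simp]: "(x::'k) + x = 0"
  unfolding mult_2[symmetric] by simp

lemma add_self_left [simp]: "(x::'k) + (x + y) = y"
  unfolding add.assoc[symmetric] by simp

lemma uminus_k [simp]: "- (x::'k) = x"
  by (rule minus_unique) simp

lemma diff_k [simp]: "(x::'k) - y = x + y"
  unfolding diff_conv_add_uminus by simp

lemma add_eq_0 [simp]: "(x::'k) + y = 0 \<longleftrightarrow> x = y"
  using right_minus_eq[of x y] by simp

lemma addv_self [simp]: "(v::'v) + v = 0"
  using scale_left_distrib[of 1 1 v] by simp

lemma addv_self_left [simp]: "(v::'v) + (v + w) = w"
  unfolding add.assoc[symmetric] by simp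

lemma uminus_v [simp]: "- (v::'v) = v"
  by (rule minus_unique) simp

lemma diff_v [simp]: "(v::'v) - w = v + w"
  unfolding diff_conv_add_uminus by simp

lemma addv_eq_0 [simp]: "(v::'v) + w = 0 \<longleftrightarrow> v = w"
  using right_minus_eq[of v w] by simp

lemma sq_add: "((x::'k) + y)\<^sup>2 = x\<^sup>2 + y\<^sup>2"
  by (simp add: power2_sum)

text \<open>With \<open>sq_eq\<close> this makes squaring bijective on the field; square roots serve
  to normalize values of \<open>\<alpha>\<close>.\<close>

lemma sqrt_ex: "\<exists>y. y\<^sup>2 = (x::'k)"
  by (rule nth_root_exists) simp

lemma sq_eq [simp]: "(x::'k)\<^sup>2 = y\<^sup>2 \<longleftrightarrow> x = y"
  using sq_add[of x y] by (metis add_eq_0 power_eq_0_iff zero_neq_numeral)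

lemma dim_space: "dim UNIV = 2 * n + 1"
  using odd_space by (simp add: odd_quadratic_space_def)

sublocale fin_vspace s "extend_basis {}"
proof
  have "dim UNIV \<noteq> 0" using dim_space by simp
  \<comment> \<open>\<open>dim\<close> is 0 when there is no finite basis, so the odd value forces
    one to exist.\<close>
  then obtain b where b: "independent b" "span b = UNIV" "finite b"
    unfolding dim_def by (metis (mono_tags, lifting) card.infinite some_eq_ex span_UNIV)
  show i: "independent (extend_basis {})"
    by (rule independent_extend_basis) (simp add: independent_empty)
  show "finite (extend_basis {})"
    using independent_span_bound[OF b(3) i] b by auto
  show "span (extend_basis {}) = UNIV"
    by (rule span_extend_basis) (simp add: independent_empty)
qed

declare dim_UNIV [simp del]

lemma \<alpha>_scale: "\<alpha> (s c v) = c\<^sup>2 * \<alpha> v"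
  using odd_space by (simp add: odd_quadratic_space_def quadratic_form_def)

lemma bet_linear2: "Vector_Spaces.linear s (*) (bet v)"
  and bet_linear1: "Vector_Spaces.linear s (*) (\<lambda>v. bet v w)"
  using odd_space by (simp_all add: odd_quadratic_space_def quadratic_form_def)

lemma \<alpha>_0 [simp]: "\<alpha> 0 = 0"
  using \<alpha>_scale[of 0 0] by simp

lemma \<alpha>_add: "\<alpha> (v + w) = \<alpha> v + \<alpha> w + bet v w"
  by (simp add: polar_def algebra_simps)

lemma bet_sym: "bet v w = bet w v"
  by (simp add: polar_def add.commute)

lemma bet_self [simp]: "bet v v = 0"
  by (simp add: polar_def)

lemma bet_simps [simp]:
  "bet (v + w) z = bet v z + bet w z" "bet z (v + w) = bet z v + bet z w"
  "bet (s c v) z = c * bet v z" "bet z (s c v) = c * bet z v"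
  "bet 0 z = 0" "bet z 0 = 0"
proof -
  interpret a: Vector_Spaces.linear s "(*)" "bet z" by (rule bet_linear2)
  interpret b: Vector_Spaces.linear s "(*)" "\<lambda>v. bet v z" by (rule bet_linear1)
  show "bet (v + w) z = bet v z + bet w z" "bet z (v + w) = bet z v + bet z w"
    "bet (s c v) z = c * bet v z" "bet z (s c v) = c * bet z v"
    "bet 0 z = 0" "bet z 0 = 0"
    by (rule b.add a.add b.scale a.scale b.zero a.zero)+
qed

lemma bet_sum1: "bet (sum f A) z = (\<Sum>x\<in>A. bet (f x) z)"
  and bet_sum2: "bet z (sum f A) = (\<Sum>x\<in>A. bet z (f x))"
  by (induction A rule: infinite_finite_induct; simp)+

lemma \<alpha>_sum_isotropic:
  assumes "\<And>x y. x \<in> A \<Longrightarrow> y \<in> A \<Longrightarrow> x \<noteq> y \<Longrightarrow> bet (f x) (f y) = 0"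
  shows "\<alpha> (sum f A) = (\<Sum>x\<in>A. \<alpha> (f x))"
  using assms
proof (induction A rule: infinite_finite_induct)
  case (insert x A)
  have "bet (f x) (sum f A) = 0"
    unfolding bet_sum2
  proof (intro sum.neutral ballI)
    fix y assume y: "y \<in> A"
    with insert(2) have "x \<noteq> y" by blast
    with y show "bet (f x) (f y) = 0" by (intro insert(4)) simp_all
  qed
  moreover have "\<alpha> (sum f A) = (\<Sum>x\<in>A. \<alpha> (f x))"
    by (rule insert(3)) (simp add: insert(4))
  ultimately show ?case using insert(1,2) by (simp add: \<alpha>_add)
qed auto

lemma nondeg:
  assumes "\<And>w. bet v w = 0" "\<alpha> v = 0" shows "v = 0"
proof -
  have "nondegenerate_quad \<alpha>" using odd_space unfolding odd_quadratic_space_def by blast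
  then have "(\<forall>w. bet v w = 0) \<and> \<alpha> v = 0 \<longrightarrow> v = 0"
    unfolding nondegenerate_quad_def by (rule spec)
  with assms show ?thesis by iprover
qed

text \<open>The sum v + w lies in the radical, and \<open>bet v w = bet w w = 0\<close> makes
  \<open>\<alpha>\<close> additive on it. This pins down vectors that \<open>bet\<close> alone
  leaves undetermined by a radical vector.\<close>

lemma radical_eqI:
  assumes "\<And>z. bet v z = bet w z" "\<alpha> v = \<alpha> w"
  shows "v = w"
proof -
  have "bet (v + w) z = 0" for z
    by (simp add: assms(1))
  moreover have "\<alpha> (v + w) = 0"
    unfolding \<alpha>_add assms(1) assms(2) by simp
  ultimately show ?thesis
    using nondeg[of "v + w"] by simp
qed

text \<open>A Witt basis: \<open>b i\<close> and \<open>b (2*n - i)\<close> form a hyperbolic pair,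
  and the radical vector \<open>b n\<close> sits in the middle. In this order the stabilizer of the
  isotropic flag is upper triangular.\<close>

definition adapted :: "(nat \<Rightarrow> 'v) \<Rightarrow> bool" where
  "adapted b \<longleftrightarrow> (\<forall>i\<le>2*n. \<forall>j\<le>2*n. bet (b i) (b j) = of_bool (i + j = 2*n \<and> i \<noteq> j)) \<and>
     (\<forall>i\<le>2*n. \<alpha> (b i) = of_bool (i = n))"

lemma adapted_ibasis:
  assumes b: "adapted b" shows "ibasis {..2*n} b"
proof (rule ibasis_dimI)
  show "finite {..2*n}" "card {..2*n} = dim UNIV"
    by (simp_all add: dim_space)
  fix c assume c: "(\<Sum>i\<le>2*n. s (c i) (b i)) = 0"
  have *: "c j = 0" if "j \<le> 2*n" "j \<noteq> n" for j
  proof -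
    have "0 = bet (\<Sum>i\<le>2*n. s (c i) (b i)) (b (2*n-j))" unfolding c by simp
    also have "\<dots> = (\<Sum>i\<le>2*n. c i * bet (b i) (b (2*n-j)))"
      by (simp add: bet_sum1)
    also have "\<dots> = (\<Sum>i\<le>2*n. c i * of_bool (i = j))"
    proof (rule sum.cong)
      fix i assume i: "i \<in> {..2*n}"
      have "bet (b i) (b (2*n-j)) = of_bool (i + (2*n-j) = 2*n \<and> i \<noteq> 2*n-j)"
        using b i unfolding adapted_def by auto
      also have "(i + (2*n-j) = 2*n \<and> i \<noteq> 2*n-j) = (i = j)"
        using i that by auto
      finally show "c i * bet (b i) (b (2*n-j)) = c i * of_bool (i = j)" by simp
    qed simp
    also have "\<dots> = c j" using that by (simp add: of_bool_def if_distrib cong: if_cong)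
    finally show ?thesis by simp
  qed
  have "(\<Sum>i\<le>2*n. s (c i) (b i)) = (\<Sum>i\<in>{n}. s (c i) (b i))"
    using * by (intro sum.mono_neutral_right) auto
  then have "s (c n) (b n) = 0" using c by simp
  then have "\<alpha> (s (c n) (b n)) = 0" by (simp only: \<alpha>_0)
  moreover have "\<alpha> (b n) = 1" using b unfolding adapted_def by auto
  ultimately have "c n = 0" by (simp add: \<alpha>_scale)
  with * show "\<forall>i\<in>{..2*n}. c i = 0" by auto
qed

end

section \<open>The Zariski topology on the general linear group\<close>

text \<open>Over a finite field the polynomial 1 + prod (x - a) would have no root.\<close>

lemma infinite_alg_closed: "infinite (UNIV :: 'k::alg_closed_field set)"
proof
  assume fin: "finite (UNIV :: 'k set)"
  define p where "p = (\<Prod>a\<in>(UNIV :: 'k set). [:- a, 1:])"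
  have deg: "degree p = card (UNIV :: 'k set)"
    unfolding p_def by (subst degree_prod_eq_sum_degree) auto
  have "poly p x = 0" for x
    unfolding p_def poly_prod using fin by (intro prod_zero) (auto intro: bexI[of _ x])
  then have no: "poly (p + 1) x \<noteq> 0" for x by simp
  have "degree p > 0" using fin deg by (simp add: card_gt_0_iff)
  then have "degree (p + 1) > 0" by (simp add: degree_add_eq_left)
  then obtain x where "poly (p + 1) x = 0"
    using alg_closed_imp_poly_has_root by blast
  with no show False by blast
qed

locale alg_vspace = fin_vspace s Basis
  for s :: "'k::alg_closed_field \<Rightarrow> 'v::ab_group_add \<Rightarrow> 'v" and Basis
begin

lemma gl_iff: "x \<in> gl s \<longleftrightarrow> (\<forall>v w. x (v + w) = x v + x w) \<and> (\<forall>c v. x (s c v) = s c (x v))"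
  by (auto simp: gl_def Vector_Spaces.linear_iff vector_space_axioms)

lemma gl_add: "x \<in> gl s \<Longrightarrow> x (v + w) = x v + x w"
  and gl_scale: "x \<in> gl s \<Longrightarrow> x (s c v) = s c (x v)"
  by (simp_all add: gl_iff)

lemma gl_zero: "x \<in> gl s \<Longrightarrow> x 0 = 0"
  using gl_scale[of x 0 0] by simp

lemma gl_minus: "x \<in> gl s \<Longrightarrow> x (v - w) = x v - x w"
  using gl_add[of x "v - w" w] by (simp add: algebra_simps)

lemma gl_sum: "x \<in> gl s \<Longrightarrow> x (sum f A) = (\<Sum>i\<in>A. x (f i))"
  by (induction A rule: infinite_finite_induct) (auto simp: gl_add gl_zero)

lemma gl_comp: "x \<in> gl s \<Longrightarrow> y \<in> gl s \<Longrightarrow> x \<circ> y \<in> gl s"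
  by (simp add: gl_iff)

lemma GL_gl: "g \<in> GL s \<Longrightarrow> g \<in> gl s" and GL_bij: "g \<in> GL s \<Longrightarrow> bij g"
  by (simp_all add: GL_def)

lemma GL_inv_app [simp]:
  assumes "g \<in> GL s" shows "g (inv_into UNIV g v) = v" "inv_into UNIV g (g v) = v"
  using GL_bij[OF assms] by (simp_all add: bij_is_surj surj_f_inv_f bij_is_inj)

lemma GL_inv:
  assumes g: "g \<in> GL s" shows "inv_into UNIV g \<in> GL s"
proof -
  have "inv_into UNIV g (v + w) = inv_into UNIV g v + inv_into UNIV g w" for v w
    using g gl_add[OF GL_gl[OF g], of "inv_into UNIV g v" "inv_into UNIV g w"] GL_inv_app[OF g]
    by metis
  moreover have "inv_into UNIV g (s c v) = s c (inv_into UNIV g v)" for c v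
    using g gl_scale[OF GL_gl[OF g], of c "inv_into UNIV g v"] GL_inv_app[OF g] by metis
  ultimately show ?thesis
    using GL_bij[OF g] by (simp add: GL_def gl_iff bij_imp_bij_inv)
qed

lemma GL_comp: "g \<in> GL s \<Longrightarrow> h \<in> GL s \<Longrightarrow> g \<circ> h \<in> GL s"
  by (simp add: GL_def gl_comp bij_comp)

lemma GL_id: "id \<in> GL s" by (simp add: GL_def gl_iff)

lemma group_GL: "group (GL_group s)"
proof (rule groupI)
  fix x assume x: "x \<in> carrier (GL_group s)"
  then have "inv_into UNIV x \<circ> x = id" by (auto simp: GL_group_def)
  with x show "\<exists>y\<in>carrier (GL_group s). y \<otimes>\<^bsub>GL_group s\<^esub> x = \<one>\<^bsub>GL_group s\<^esub>"
    by (intro bexI[of _ "inv_into UNIV x"]) (auto simp: GL_group_def GL_inv)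
qed (auto simp: GL_group_def GL_comp GL_id comp_assoc)

sublocale GLG: group "GL_group s" by (rule group_GL)

lemma GL_simps [simp]:
  "carrier (GL_group s) = GL s" "x \<otimes>\<^bsub>GL_group s\<^esub> y = x \<circ> y" "\<one>\<^bsub>GL_group s\<^esub> = id"
  by (simp_all add: GL_group_def)

lemma GL_inv_eq [simp]: "g \<in> GL s \<Longrightarrow> inv\<^bsub>GL_group s\<^esub> g = inv_into UNIV g"
  by (rule GLG.inv_equality) (auto simp: GL_inv)

abbreviation "linf \<equiv> Vector_Spaces.linear s ((*) :: 'k \<Rightarrow> 'k \<Rightarrow> 'k)"

lemma linf_add: "linf \<phi> \<Longrightarrow> \<phi> (v + w) = \<phi> v + \<phi> w"
  and linf_scale: "linf \<phi> \<Longrightarrow> \<phi> (s c v) = c * \<phi> v"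
  by (simp_all add: Vector_Spaces.linear_iff)

lemma linf_zero: "linf \<phi> \<Longrightarrow> \<phi> 0 = 0"
  using linf_scale[of \<phi> 0 0] by simp

lemma linf_sum: "linf \<phi> \<Longrightarrow> \<phi> (sum f A) = (\<Sum>i\<in>A. \<phi> (f i))"
  by (induction A rule: infinite_finite_induct) (auto simp: linf_add linf_zero)

lemma linf_comp: "linf \<phi> \<Longrightarrow> x \<in> gl s \<Longrightarrow> linf (\<lambda>v. \<phi> (x v))"
  by (rule linear_formI) (simp_all add: linf_add linf_scale gl_add gl_scale)

lemma pf_sum: "(\<And>i. i \<in> A \<Longrightarrow> f i \<in> poly_funs s) \<Longrightarrow> (\<lambda>x. \<Sum>i\<in>A. f i x) \<in> poly_funs s"
  by (induction A rule: infinite_finite_induct) (auto intro: poly_funs.intros)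

lemma pf_prod: "(\<And>i. i \<in> A \<Longrightarrow> f i \<in> poly_funs s) \<Longrightarrow> (\<lambda>x. \<Prod>i\<in>A. f i x) \<in> poly_funs s"
  by (induction A rule: infinite_finite_induct) (auto intro: poly_funs.intros)

lemma pf_power: "f \<in> poly_funs s \<Longrightarrow> (\<lambda>x. f x ^ k) \<in> poly_funs s"
  by (induction k) (auto intro: poly_funs.intros)

lemma pf_diff: "f \<in> poly_funs s \<Longrightarrow> h \<in> poly_funs s \<Longrightarrow> (\<lambda>x. f x - h x) \<in> poly_funs s"
  using poly_funs.add[OF _ poly_funs.mult[OF poly_funs.const[of "-1"]], of f s h] by simp

lemma pf_comp:
  assumes "f \<in> poly_funs s" "a \<in> gl s" shows "(\<lambda>x. f (a \<circ> x \<circ> c)) \<in> poly_funs s"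
  using assms(1)
proof induction
  case (coefficient \<phi> v)
  show ?case
    using poly_funs.coefficient[OF linf_comp[OF coefficient assms(2)], of "c v"] by simp
qed (auto intro: poly_funs.intros)

lemma topspace_zariski [simp]: "topspace (zariski s) = GL s"
proof -
  have "(\<lambda>x. 1) \<in> poly_funs s" by (rule poly_funs.const)
  then have "GL s \<in> {{g \<in> GL s. f g \<noteq> 0} |f. f \<in> poly_funs s}"
    by (intro CollectI exI[of _ "\<lambda>x. 1"]) simp
  then show ?thesis
    unfolding zariski_def topology_generated_by_topspace by blast
qed

lemma openin_zariski_basic: "f \<in> poly_funs s \<Longrightarrow> openin (zariski s) {g \<in> GL s. f g \<noteq> 0}"
  unfolding zariski_def openin_topology_generated_by_iff
  by (rule generate_topology_on.Basis) blast

lemma closedin_zariski_basic: "f \<in> poly_funs s \<Longrightarrow> closedin (zariski s) {g \<in> GL s. f g = 0}"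
proof -
  assume "f \<in> poly_funs s"
  moreover have "GL s - {g \<in> GL s. f g = 0} = {g \<in> GL s. f g \<noteq> 0}" by blast
  ultimately show ?thesis
    using openin_zariski_basic by (auto simp: closedin_def)
qed

lemma closedin_zariski_all:
  assumes "\<And>i. i \<in> I \<Longrightarrow> f i \<in> poly_funs s"
  shows "closedin (zariski s) {g \<in> GL s. \<forall>i\<in>I. f i g = 0}"
proof (cases "I = {}")
  case True
  then show ?thesis using closedin_topspace[of "zariski s"] by simp
next
  case False
  have "closedin (zariski s) (\<Inter>((\<lambda>i. {g \<in> GL s. f i g = 0}) ` I))"
    using False by (intro closedin_Inter) (auto intro: closedin_zariski_basic[OF assms])
  moreover have "\<Inter>((\<lambda>i. {g \<in> GL s. f i g = 0}) ` I) = {g \<in> GL s. \<forall>i\<in>I. f i g = 0}"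
    using False by auto
  ultimately show ?thesis by simp
qed

text \<open>Principal open sets are stable under intersection, by multiplying the functions, so they
  form a base and not merely a subbase.\<close>

lemma openin_zariski_nbhd:
  assumes "openin (zariski s) U" "x \<in> U"
  obtains f where "f \<in> poly_funs s" "f x \<noteq> 0" "{g \<in> GL s. f g \<noteq> 0} \<subseteq> U"
proof -
  have "generate_topology_on {{g \<in> GL s. f g \<noteq> 0} |f. f \<in> poly_funs s} U"
    using assms(1) by (simp add: zariski_def openin_topology_generated_by_iff)
  then have "\<forall>x\<in>U. \<exists>f\<in>poly_funs s. f x \<noteq> 0 \<and> {g \<in> GL s. f g \<noteq> 0} \<subseteq> U"
  proof induction
    case (Int a b)
    show ?case
    proof
      fix x assume x: "x \<in> a \<inter> b"
      obtain f where "f \<in> poly_funs s" "f x \<noteq> 0" "{g \<in> GL s. f g \<noteq> 0} \<subseteq> a"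
        using Int(3) x by blast
      moreover obtain h where "h \<in> poly_funs s" "h x \<noteq> 0" "{g \<in> GL s. h g \<noteq> 0} \<subseteq> b"
        using Int(4) x by blast
      ultimately show "\<exists>f\<in>poly_funs s. f x \<noteq> 0 \<and> {g \<in> GL s. f g \<noteq> 0} \<subseteq> a \<inter> b"
        by (intro bexI[of _ "\<lambda>x. f x * h x"] poly_funs.mult) auto
    qed
  next
    case (UN K)
    show ?case
    proof
      fix x assume "x \<in> \<Union>K"
      then obtain k where k: "k \<in> K" "x \<in> k" by blast
      then obtain f where "f \<in> poly_funs s" "f x \<noteq> 0" "{g \<in> GL s. f g \<noteq> 0} \<subseteq> k"
        using UN(2) by blast
      with k(1) show "\<exists>f\<in>poly_funs s. f x \<noteq> 0 \<and> {g \<in> GL s. f g \<noteq> 0} \<subseteq> \<Union>K" by blast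
    qed
  next
    case (Basis U)
    then obtain f where "f \<in> poly_funs s" "U = {g \<in> GL s. f g \<noteq> 0}" by blast
    then show ?case by (intro ballI bexI[of _ f]) simp_all
  qed simp
  with assms(2) that show thesis by blast
qed

text \<open>Two non-empty relatively open subsets of a rational curve meet, since the corresponding
  numerators have only finitely many zeros.\<close>

lemma rational_curve_connected:
  assumes fin: "finite (- S)" and GL: "\<And>t. t \<in> S \<Longrightarrow> \<gamma> t \<in> GL s"
    and coeff: "\<And>\<phi> v. linf \<phi> \<Longrightarrow> \<exists>p q. \<forall>t\<in>S. poly q t \<noteq> 0 \<and> \<phi> (\<gamma> t v) * poly q t = poly p t"
  shows "connectedin (zariski s) (\<gamma> ` S)"
proof -
  have rat: "\<exists>p q. \<forall>t\<in>S. poly q t \<noteq> 0 \<and> f (\<gamma> t) * poly q t = poly p t" if "f \<in> poly_funs s" for f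
    using that
  proof induction
    case (const c)
    show ?case by (intro exI[of _ "[:c:]"] exI[of _ 1]) auto
  next
    case (coefficient \<phi> v)
    then show ?case by (rule coeff)
  next
    case (add f h)
    then obtain p q p' q' where *: "\<forall>t\<in>S. poly q t \<noteq> 0 \<and> f (\<gamma> t) * poly q t = poly p t"
      "\<forall>t\<in>S. poly q' t \<noteq> 0 \<and> h (\<gamma> t) * poly q' t = poly p' t" by blast
    show ?case
    proof (intro exI ballI conjI)
      fix t assume t: "t \<in> S"
      show "poly (q * q') t \<noteq> 0" using * t by simp
      have "(f (\<gamma> t) + h (\<gamma> t)) * poly (q * q') t
        = (f (\<gamma> t) * poly q t) * poly q' t + (h (\<gamma> t) * poly q' t) * poly q t"
        by (simp add: algebra_simps)
      also have "\<dots> = poly (p * q' + p' * q) t"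
        unfolding bspec[OF *(1) t, THEN conjunct2] bspec[OF *(2) t, THEN conjunct2] by simp
      finally show "(f (\<gamma> t) + h (\<gamma> t)) * poly (q * q') t = poly (p * q' + p' * q) t" .
    qed
  next
    case (mult f h)
    then obtain p q p' q' where *: "\<forall>t\<in>S. poly q t \<noteq> 0 \<and> f (\<gamma> t) * poly q t = poly p t"
      "\<forall>t\<in>S. poly q' t \<noteq> 0 \<and> h (\<gamma> t) * poly q' t = poly p' t" by blast
    show ?case
    proof (intro exI ballI conjI)
      fix t assume t: "t \<in> S"
      show "poly (q * q') t \<noteq> 0" using * t by simp
      have "f (\<gamma> t) * h (\<gamma> t) * poly (q * q') t
        = (f (\<gamma> t) * poly q t) * (h (\<gamma> t) * poly q' t)"
        by (simp add: mult_ac)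
      also have "\<dots> = poly (p * p') t"
        unfolding bspec[OF *(1) t, THEN conjunct2] bspec[OF *(2) t, THEN conjunct2] by simp
      finally show "f (\<gamma> t) * h (\<gamma> t) * poly (q * q') t = poly (p * p') t" .
    qed
  qed
  have zeros: "finite {t \<in> S. f (\<gamma> t) = 0}"
    if f: "f \<in> poly_funs s" and t0: "t0 \<in> S" "f (\<gamma> t0) \<noteq> 0" for f t0
  proof -
    obtain p q where pq: "\<forall>t\<in>S. poly q t \<noteq> 0 \<and> f (\<gamma> t) * poly q t = poly p t"
      using rat[OF f] by blast
    have "f (\<gamma> t0) * poly q t0 = poly p t0" "poly q t0 \<noteq> 0" using pq t0 by simp_all
    with t0 have "poly p t0 \<noteq> 0" using mult_eq_0_iff[of "f (\<gamma> t0)" "poly q t0"] by simp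
    then have "p \<noteq> 0" by auto
    then have "finite {t. poly p t = 0}" by (rule poly_roots_finite)
    moreover have "{t \<in> S. f (\<gamma> t) = 0} \<subseteq> {t. poly p t = 0}"
    proof safe
      fix t assume t: "t \<in> S" "f (\<gamma> t) = 0"
      have "f (\<gamma> t) * poly q t = poly p t" using pq t(1) by simp
      then show "poly p t = 0" unfolding t(2) by simp
    qed
    ultimately show ?thesis by (rule finite_subset[rotated])
  qed
  show ?thesis
    unfolding connectedin
  proof (intro conjI notI)
    show "\<gamma> ` S \<subseteq> topspace (zariski s)" using GL by auto
    assume "\<exists>E1 E2. openin (zariski s) E1 \<and> openin (zariski s) E2 \<and> \<gamma> ` S \<subseteq> E1 \<union> E2 \<and>
      E1 \<inter> E2 \<inter> \<gamma> ` S = {} \<and> E1 \<inter> \<gamma> ` S \<noteq> {} \<and> E2 \<inter> \<gamma> ` S \<noteq> {}"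
    then obtain E1 E2 where E0: "openin (zariski s) E1" "openin (zariski s) E2"
      "E1 \<inter> E2 \<inter> \<gamma> ` S = {}" "E1 \<inter> \<gamma> ` S \<noteq> {}" "E2 \<inter> \<gamma> ` S \<noteq> {}" by (elim exE conjE)
    obtain t1 where t1: "t1 \<in> S" "\<gamma> t1 \<in> E1" using E0(4) by blast
    obtain t2 where t2: "t2 \<in> S" "\<gamma> t2 \<in> E2" using E0(5) by blast
    note E = E0(1-3) t1 t2
    obtain f1 where f1: "f1 \<in> poly_funs s" "f1 (\<gamma> t1) \<noteq> 0" "{g \<in> GL s. f1 g \<noteq> 0} \<subseteq> E1"
      using openin_zariski_nbhd[OF E(1,5)] .
    obtain f2 where f2: "f2 \<in> poly_funs s" "f2 (\<gamma> t2) \<noteq> 0" "{g \<in> GL s. f2 g \<noteq> 0} \<subseteq> E2"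
      using openin_zariski_nbhd[OF E(2,7)] .
    have fin3: "finite (- S \<union> {t \<in> S. f1 (\<gamma> t) = 0} \<union> {t \<in> S. f2 (\<gamma> t) = 0})"
      using fin zeros[OF f1(1) E(4) f1(2)] zeros[OF f2(1) E(6) f2(2)] by simp
    then obtain t where "t \<notin> - S \<union> {t \<in> S. f1 (\<gamma> t) = 0} \<union> {t \<in> S. f2 (\<gamma> t) = 0}"
      using ex_new_if_finite[OF infinite_alg_closed fin3] by (elim exE)
    then have t: "t \<in> S" "f1 (\<gamma> t) \<noteq> 0" "f2 (\<gamma> t) \<noteq> 0" by auto
    have "\<gamma> t \<in> E1" "\<gamma> t \<in> E2"
      using subsetD[OF f1(3), of "\<gamma> t"] subsetD[OF f2(3), of "\<gamma> t"] GL[OF t(1)] t(2,3) by simp_all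
    with E(3) t(1) show False by blast
  qed
qed

lemma connectedin_id_Union:
  assumes "\<And>x. x \<in> S \<Longrightarrow> \<exists>T. connectedin (zariski s) T \<and> id \<in> T \<and> x \<in> T \<and> T \<subseteq> S" "S \<noteq> {}"
  shows "connectedin (zariski s) S"
proof -
  let ?U = "{T. connectedin (zariski s) T \<and> id \<in> T \<and> T \<subseteq> S}"
  have "connectedin (zariski s) (\<Union>?U)"
    by (rule connectedin_Union) auto
  moreover have "\<Union>?U = S" using assms(1) by blast
  ultimately show ?thesis by simp
qed

text \<open>With finitely many pieces the union of the others is closed too, so a second piece
  meeting \<open>H\<close> would disconnect it. This is how a function with finitely many values and
  closed fibres is shown to be constant.\<close>

lemma connected_closed_cover:
  assumes con: "connectedin (zariski s) H" and fin: "finite I"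
    and cl: "\<And>i. i \<in> I \<Longrightarrow> closedin (zariski s) (E i)" and cov: "H \<subseteq> (\<Union>i\<in>I. E i)"
    and dis: "\<And>i j x. i \<in> I \<Longrightarrow> j \<in> I \<Longrightarrow> x \<in> H \<Longrightarrow> x \<in> E i \<Longrightarrow> x \<in> E j \<Longrightarrow> i = j"
    and i: "i \<in> I" "x \<in> H" "x \<in> E i"
  shows "H \<subseteq> E i"
proof (rule ccontr)
  assume n: "\<not> H \<subseteq> E i"
  let ?E2 = "\<Union>j\<in>I - {i}. E j"
  have "closedin (zariski s) ?E2"
    using fin cl by (intro closedin_Union) auto
  moreover have "H \<subseteq> E i \<union> ?E2" using cov by auto
  moreover have "E i \<inter> ?E2 \<inter> H = {}" using dis[OF i(1)] by blast
  moreover have "E i \<inter> H \<noteq> {}" using i by blast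
  moreover have "?E2 \<inter> H \<noteq> {}" using n cov by blast
  ultimately show False
    using con cl[OF i(1)] unfolding connectedin_closedin by blast
qed

section \<open>The Lie--Kolchin theorem\<close>

lemma pf_det:
  assumes "\<And>g. A g \<in> carrier_mat N N"
    and "\<And>i j. i < N \<Longrightarrow> j < N \<Longrightarrow> (\<lambda>g. A g $$ (i, j)) \<in> poly_funs s"
  shows "(\<lambda>g. det (A g)) \<in> poly_funs s"
proof -
  have "(\<lambda>g. \<Sum>p\<in>{p. p permutes {0..<N}}. signof p * (\<Prod>i = 0..<N. A g $$ (i, p i))) \<in> poly_funs s"
  proof (intro pf_sum poly_funs.mult poly_funs.const pf_prod)
    fix p i assume "p \<in> {p. p permutes {0..<N}}" "i \<in> {0..<N}"
    moreover from this have "p i < N" using permutes_in_image[of p "{0..<N}" i] by auto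
    ultimately show "(\<lambda>g. A g $$ (i, p i)) \<in> poly_funs s" using assms(2) by simp
  qed
  then show ?thesis using det_def'[OF assms(1)] by simp
qed

lemma ex_ibasis: obtains N and e :: "nat \<Rightarrow> 'v" where "ibasis {..<N} e"
proof -
  obtain f where f: "bij_betw f {0..<card Basis} Basis"
    using ex_bij_betw_nat_finite[OF finite_Basis] by blast
  have "f ` {..<card Basis} = Basis" "inj_on f {..<card Basis}"
    using f by (auto simp: bij_betw_def lessThan_atLeast0)
  then have "ibasis {..<card Basis} f"
    using independent_Basis span_Basis by (simp add: ibasis_def)
  then show thesis by (rule that)
qed

text \<open>Cramer's rule: the determinant times the inverse has polynomial entries. Since
  \<open>poly_funs\<close> contains no inverse of the determinant, the denominator \<open>D\<close>
  has to be carried along.\<close>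

lemma GL_inverse_rational:
  obtains D where "D \<in> poly_funs s" "\<And>g. g \<in> GL s \<Longrightarrow> D g \<noteq> 0"
    "\<And>\<phi> w. linf \<phi> \<Longrightarrow> \<exists>F\<in>poly_funs s. \<forall>g\<in>GL s. F g = D g * \<phi> (inv_into UNIV g w)"
proof -
  obtain N and e :: "nat \<Rightarrow> 'v" where e: "ibasis {..<N} e" by (rule ex_ibasis)
  let ?c = "coord {..<N} e"
  define M where "M g = mat N N (\<lambda>(i, j). ?c i (g (e j)))" for g
  have M: "M g \<in> carrier_mat N N" for g by (simp add: M_def)
  have Mpf: "(\<lambda>g. M g $$ (i, j)) \<in> poly_funs s" if "i < N" "j < N" for i j
    using poly_funs.coefficient[OF linear_coord[OF e], of i "e j"] that by (simp add: M_def)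
  have MM: "M g * M (inv_into UNIV g) = 1\<^sub>m N" if g: "g \<in> GL s" for g
  proof (rule eq_matI)
    fix i j assume ij: "i < dim_row (1\<^sub>m N :: 'k mat)" "j < dim_col (1\<^sub>m N :: 'k mat)"
    let ?w = "inv_into UNIV g (e j)"
    have "?c i (g ?w) = ?c i (g (\<Sum>k<N. s (?c k ?w) (e k)))"
      by (simp only: sum_coord[OF e])
    also have "\<dots> = (\<Sum>k<N. ?c k ?w * ?c i (g (e k)))"
      by (simp add: gl_sum[OF GL_gl[OF g]] gl_scale[OF GL_gl[OF g]] coord_sum[OF e] coord_scale[OF e])
    finally have "(\<Sum>k<N. ?c k ?w * ?c i (g (e k))) = ?c i (e j)"
      using g by simp
    with ij show "(M g * M (inv_into UNIV g)) $$ (i, j) = 1\<^sub>m N $$ (i, j)"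
      using coord_basis[OF e, of i j]
      by (simp add: M_def scalar_prod_def mult.commute lessThan_atLeast0)
  qed (simp_all add: M_def)
  define D where "D g = det (M g)" for g
  have D: "D \<in> poly_funs s"
    using pf_det[of M N, OF M Mpf] by (simp add: D_def[abs_def])
  have Dnz: "D g \<noteq> 0" if g: "g \<in> GL s" for g
  proof -
    have "det (M g) * det (M (inv_into UNIV g)) = 1"
      using det_mult[OF M M, of g "inv_into UNIV g"] MM[OF g] by simp
    then show ?thesis by (auto simp: D_def)
  qed
  have adj: "D g * ?c i (inv_into UNIV g (e j)) = adj_mat (M g) $$ (i, j)"
    if g: "g \<in> GL s" and ij: "i < N" "j < N" for g i j
  proof -
    have "adj_mat (M g) = adj_mat (M g) * (M g * M (inv_into UNIV g))"
      unfolding MM[OF g] right_mult_one_mat[OF adj_mat(1)[OF M]] ..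
    also have "\<dots> = adj_mat (M g) * M g * M (inv_into UNIV g)"
      by (rule assoc_mult_mat[symmetric, OF adj_mat(1)[OF M] M M])
    also have "\<dots> = det (M g) \<cdot>\<^sub>m M (inv_into UNIV g)"
      unfolding adj_mat(3)[OF M]
      using mult_smult_assoc_mat[OF one_carrier_mat M] left_mult_one_mat[OF M] by simp
    finally have "adj_mat (M g) = det (M g) \<cdot>\<^sub>m M (inv_into UNIV g)" .
    then show ?thesis using ij by (simp add: D_def M_def)
  qed
  have adjpf: "(\<lambda>g. adj_mat (M g) $$ (i, j)) \<in> poly_funs s" if ij: "i < N" "j < N" for i j
  proof -
    have "(\<lambda>g. (-1) ^ (j + i) * det (mat_delete (M g) j i)) \<in> poly_funs s"
    proof (intro poly_funs.mult poly_funs.const pf_det[of _ "N - 1"])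
      show "mat_delete (M g) j i \<in> carrier_mat (N - 1) (N - 1)" for g
        using M by (rule mat_delete_carrier)
      fix a b assume ab: "a < N - 1" "b < N - 1"
      have "(\<lambda>g. M g $$ (if a < j then a else Suc a, if b < i then b else Suc b)) \<in> poly_funs s"
        using ab by (intro Mpf) auto
      moreover have "mat_delete (M g) j i $$ (a, b)
        = M g $$ (if a < j then a else Suc a, if b < i then b else Suc b)" for g
        using ab M[of g] by (simp add: mat_delete_def)
      ultimately show "(\<lambda>g. mat_delete (M g) j i $$ (a, b)) \<in> poly_funs s" by simp
    qed
    moreover have "adj_mat (M g) $$ (i, j) = (-1) ^ (j + i) * det (mat_delete (M g) j i)" for g
      using ij M[of g] by (simp add: adj_mat_def cofactor_def)
    ultimately show ?thesis by simp
  qed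
  show thesis
  proof
    show "D \<in> poly_funs s" by (rule D)
    show "D g \<noteq> 0" if "g \<in> GL s" for g using that by (rule Dnz)
    fix \<phi> :: "'v \<Rightarrow> 'k" and w assume \<phi>: "linf \<phi>"
    let ?F = "\<lambda>g. \<Sum>i<N. \<Sum>j<N. (?c j w * \<phi> (e i)) * adj_mat (M g) $$ (i, j)"
    have "?F \<in> poly_funs s"
      by (intro pf_sum poly_funs.mult[OF poly_funs.const] adjpf) simp_all
    moreover have "?F g = D g * \<phi> (inv_into UNIV g w)" if g: "g \<in> GL s" for g
    proof -
      let ?h = "inv_into UNIV g"
      have h: "?h \<in> gl s" using g by (intro GL_gl GL_inv)
      have "?h w = ?h (\<Sum>j<N. s (?c j w) (e j))" by (simp only: sum_coord[OF e])
      also have "\<dots> = (\<Sum>j<N. s (?c j w) (?h (e j)))"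
        by (simp add: gl_sum[OF h] gl_scale[OF h])
      also have "\<dots> = (\<Sum>j<N. s (?c j w) (\<Sum>i<N. s (?c i (?h (e j))) (e i)))"
        by (simp only: sum_coord[OF e])
      finally have "\<phi> (?h w) = (\<Sum>j<N. ?c j w * (\<Sum>i<N. ?c i (?h (e j)) * \<phi> (e i)))"
        by (simp add: linf_sum[OF \<phi>] linf_scale[OF \<phi>])
      then have "D g * \<phi> (?h w) = (\<Sum>j<N. \<Sum>i<N. (?c j w * \<phi> (e i)) * (D g * ?c i (?h (e j))))"
        by (simp add: sum_distrib_left mult_ac)
      also have "\<dots> = (\<Sum>j<N. \<Sum>i<N. (?c j w * \<phi> (e i)) * adj_mat (M g) $$ (i, j))"
        by (intro sum.cong refl) (simp add: adj[OF g])
      also have "\<dots> = ?F g" by (rule sum.swap)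
      finally show ?thesis by simp
    qed
    ultimately show "\<exists>F\<in>poly_funs s. \<forall>g\<in>GL s. F g = D g * \<phi> (inv_into UNIV g w)"
      by (intro bexI[of _ ?F] ballI)
  qed
qed

lemma continuous_mult_left:
  assumes x: "x \<in> GL s" shows "continuous_map (zariski s) (zariski s) (\<lambda>g. x \<circ> g)"
  unfolding zariski_def[of s]
proof (rule continuous_on_generated_topo, fold zariski_def)
  fix U assume "U \<in> {{g \<in> GL s. f g \<noteq> 0} |f. f \<in> poly_funs s}"
  then obtain f where f: "f \<in> poly_funs s" "U = {g \<in> GL s. f g \<noteq> 0}" by blast
  have "(\<lambda>g. x \<circ> g) -` U \<inter> topspace (zariski s) = {g \<in> GL s. f (x \<circ> g) \<noteq> 0}"
    using x f(2) by (auto simp: GL_comp)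
  then show "openin (zariski s) ((\<lambda>g. x \<circ> g) -` U \<inter> topspace (zariski s))"
    using openin_zariski_basic[OF pf_comp[OF f(1) GL_gl[OF x], of id]] by simp
next
  show "(\<lambda>g. x \<circ> g) ` topspace (zariski s) \<subseteq> \<Union>{{g \<in> GL s. f g \<noteq> 0} |f. f \<in> poly_funs s}"
    unfolding topspace_zariski
      topspace_zariski[unfolded zariski_def topology_generated_by_topspace]
    using x by (auto simp: GL_comp)
qed

lemma continuous_commutator:
  assumes h: "h \<in> GL s"
  shows "continuous_map (zariski s) (zariski s) (\<lambda>g. g \<circ> h \<circ> inv_into UNIV g \<circ> inv_into UNIV h)"
    (is "continuous_map _ _ ?c")
proof -
  have cGL: "?c g \<in> GL s" if "g \<in> GL s" for g
    using that h by (intro GL_comp GL_inv)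
  obtain D where D: "D \<in> poly_funs s" "\<And>g. g \<in> GL s \<Longrightarrow> D g \<noteq> 0"
    "\<And>\<phi> w. linf \<phi> \<Longrightarrow> \<exists>F\<in>poly_funs s. \<forall>g\<in>GL s. F g = D g * \<phi> (inv_into UNIV g w)"
    by (rule GL_inverse_rational) blast
  obtain N and e :: "nat \<Rightarrow> 'v" where e: "ibasis {..<N} e" by (rule ex_ibasis)
  \<comment> \<open>A power of \<open>D\<close> clears the denominators of f composed with the
    commutator map. As \<open>D\<close> has no zero on the group, the nonvanishing set is unchanged
    and hence principal open.\<close>
  have main: "\<exists>F\<in>poly_funs s. \<exists>k. \<forall>g\<in>GL s. F g = D g ^ k * f (?c g)" if "f \<in> poly_funs s" for f
    using that
  proof induction
    case (const c)
    show ?case by (intro bexI[of _ "\<lambda>x. c"] exI[of _ 0] poly_funs.const) simp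
  next
    case (coefficient \<phi> v)
    let ?w = "inv_into UNIV h v"
    have "\<forall>i. \<exists>F\<in>poly_funs s. \<forall>g\<in>GL s. F g = D g * coord {..<N} e i (inv_into UNIV g ?w)"
      using D(3)[OF linear_coord[OF e]] by blast
    then obtain F where F: "\<And>i. F i \<in> poly_funs s"
      "\<And>i g. g \<in> GL s \<Longrightarrow> F i g = D g * coord {..<N} e i (inv_into UNIV g ?w)" by metis
    let ?G = "\<lambda>g. \<Sum>i<N. F i g * \<phi> (g (h (e i)))"
    have "?G \<in> poly_funs s"
      by (intro pf_sum poly_funs.mult F poly_funs.coefficient coefficient)
    moreover have "?G g = D g ^ 1 * \<phi> (?c g v)" if g: "g \<in> GL s" for g
    proof -
      let ?d = "\<lambda>i. coord {..<N} e i (inv_into UNIV g ?w)"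
      have gh: "g \<circ> h \<in> gl s" using g h by (intro GL_gl GL_comp)
      have "\<phi> (?c g v) = \<phi> ((g \<circ> h) (\<Sum>i<N. s (?d i) (e i)))"
        by (simp only: sum_coord[OF e] o_apply)
      also have "\<dots> = (\<Sum>i<N. ?d i * \<phi> (g (h (e i))))"
        unfolding gl_sum[OF gh] gl_scale[OF gh] linf_sum[OF coefficient] linf_scale[OF coefficient]
        by simp
      finally show ?thesis by (simp add: F(2)[OF g] sum_distrib_left mult_ac)
    qed
    ultimately show ?case by (intro bexI[of _ ?G] exI[of _ 1] ballI)
  next
    case (add f1 f2)
    obtain F1 k1 where 1: "F1 \<in> poly_funs s" "\<forall>g\<in>GL s. F1 g = D g ^ k1 * f1 (?c g)"
      using add(3) by blast
    obtain F2 k2 where 2: "F2 \<in> poly_funs s" "\<forall>g\<in>GL s. F2 g = D g ^ k2 * f2 (?c g)"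
      using add(4) by blast
    show ?case
    proof (intro bexI[of _ "\<lambda>g. D g ^ k2 * F1 g + D g ^ k1 * F2 g"] exI[of _ "k1 + k2"] ballI)
      show "(\<lambda>g. D g ^ k2 * F1 g + D g ^ k1 * F2 g) \<in> poly_funs s"
        by (intro poly_funs.add poly_funs.mult pf_power D 1 2)
      fix g assume g: "g \<in> GL s"
      show "D g ^ k2 * F1 g + D g ^ k1 * F2 g = D g ^ (k1 + k2) * (f1 (?c g) + f2 (?c g))"
        unfolding bspec[OF 1(2) g] bspec[OF 2(2) g] by (simp add: algebra_simps power_add)
    qed
  next
    case (mult f1 f2)
    obtain F1 k1 where 1: "F1 \<in> poly_funs s" "\<forall>g\<in>GL s. F1 g = D g ^ k1 * f1 (?c g)"
      using mult(3) by blast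
    obtain F2 k2 where 2: "F2 \<in> poly_funs s" "\<forall>g\<in>GL s. F2 g = D g ^ k2 * f2 (?c g)"
      using mult(4) by blast
    show ?case
    proof (intro bexI[of _ "\<lambda>g. F1 g * F2 g"] exI[of _ "k1 + k2"] ballI)
      show "(\<lambda>g. F1 g * F2 g) \<in> poly_funs s"
        by (intro poly_funs.mult 1 2)
      fix g assume g: "g \<in> GL s"
      show "F1 g * F2 g = D g ^ (k1 + k2) * (f1 (?c g) * f2 (?c g))"
        unfolding bspec[OF 1(2) g] bspec[OF 2(2) g] by (simp add: mult_ac power_add)
    qed
  qed
  show ?thesis
    unfolding zariski_def[of s]
  proof (rule continuous_on_generated_topo, fold zariski_def)
    fix U assume "U \<in> {{g \<in> GL s. f g \<noteq> 0} |f. f \<in> poly_funs s}"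
    then obtain f where f: "f \<in> poly_funs s" "U = {g \<in> GL s. f g \<noteq> 0}" by blast
    obtain F k where F: "F \<in> poly_funs s" "\<forall>g\<in>GL s. F g = D g ^ k * f (?c g)"
      using main[OF f(1)] by blast
    have "?c -` U \<inter> topspace (zariski s) = {g \<in> GL s. F g \<noteq> 0}"
      using f(2) F(2) D(2) cGL by auto
    then show "openin (zariski s) (?c -` U \<inter> topspace (zariski s))"
      using openin_zariski_basic[OF F(1)] by simp
  next
    show "?c ` topspace (zariski s) \<subseteq> \<Union>{{g \<in> GL s. f g \<noteq> 0} |f. f \<in> poly_funs s}"
      unfolding topspace_zariski
        topspace_zariski[unfolded zariski_def topology_generated_by_topspace]
      using cGL by blast
  qed
qed

lemma subgroup_GL: "subgroup H (GL_group s) \<Longrightarrow> h \<in> H \<Longrightarrow> h \<in> GL s"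
  by (auto dest: subgroup.mem_carrier)

lemma subgroup_inv: "subgroup H (GL_group s) \<Longrightarrow> h \<in> H \<Longrightarrow> inv_into UNIV h \<in> H"
  using subgroup.m_inv_closed[of H "GL_group s" h] subgroup_GL[of H h] by simp

lemma subgroup_comp: "subgroup H (GL_group s) \<Longrightarrow> h \<in> H \<Longrightarrow> g \<in> H \<Longrightarrow> h \<circ> g \<in> H"
  using subgroup.m_closed[of H "GL_group s" h g] by simp

lemma subgroup_id: "subgroup H (GL_group s) \<Longrightarrow> id \<in> H"
  using subgroup.one_closed[of H "GL_group s"] by simp

text \<open>The commutator of g and h lies in the image of \<open>H\<close> under g -> [g, h], a
  connected set that contains the identity. For a product xy, a connected set joining the identity
  to x is glued at x to the translate by x of one joining the identity to y.\<close>

lemma connected_derived: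
  assumes H: "subgroup H (GL_group s)" and con: "connectedin (zariski s) H"
  shows "connectedin (zariski s) (derived (GL_group s) H)"
proof (rule connectedin_id_Union)
  let ?D = "derived (GL_group s) H"
  define C where "C = derived_set (GL_group s) H"
  have Dgen: "?D = generate (GL_group s) C" unfolding derived_def C_def ..
  have H': "H \<subseteq> carrier (GL_group s)" using H by (rule subgroup.subset)
  have D: "subgroup ?D (GL_group s)" using H' by (rule GLG.derived_is_subgroup)
  have comm: "g \<circ> h \<circ> inv_into UNIV g \<circ> inv_into UNIV h \<in> C" if "g \<in> H" "h \<in> H" for g h
    unfolding C_def using that subgroup_GL[OF H, of g] subgroup_GL[OF H, of h]
    by (intro UN_I[of g] UN_I[of h]) simp_all
  have CD: "C \<subseteq> ?D" unfolding Dgen by (auto intro: generate.incl)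
  let ?P = "\<lambda>x. \<exists>T. connectedin (zariski s) T \<and> id \<in> T \<and> x \<in> T \<and> T \<subseteq> ?D"
  have PC: "?P x" if "x \<in> C" for x
  proof -
    from that obtain g h where gh: "g \<in> H" "h \<in> H"
      and x: "x = g \<circ> h \<circ> inv_into UNIV g \<circ> inv_into UNIV h"
      using subgroup_GL[OF H] unfolding C_def by auto
    let ?T = "(\<lambda>g. g \<circ> h \<circ> inv_into UNIV g \<circ> inv_into UNIV h) ` H"
    have "connectedin (zariski s) ?T"
      using continuous_commutator[OF subgroup_GL[OF H gh(2)]] con
      by (rule connectedin_continuous_map_image)
    moreover have "id \<in> ?T"
      using subgroup_id[OF H] subgroup_GL[OF H gh(2)] by (intro image_eqI[of _ _ id]) auto
    moreover have "?T \<subseteq> ?D" using comm gh(2) CD by blast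
    ultimately show ?thesis using x gh(1) by (intro exI[of _ ?T]) blast
  qed
  have invC: "inv\<^bsub>GL_group s\<^esub> x \<in> C" if "x \<in> C" for x
  proof -
    from that obtain g h where gh: "g \<in> H" "h \<in> H"
      and x: "x = g \<circ> h \<circ> inv_into UNIV g \<circ> inv_into UNIV h"
      using subgroup_GL[OF H] unfolding C_def by auto
    have GL: "g \<in> GL s" "h \<in> GL s" using gh subgroup_GL[OF H] by auto
    let ?y = "h \<circ> g \<circ> inv_into UNIV h \<circ> inv_into UNIV g"
    have "?y \<circ> x = id" unfolding x using GL by (intro ext) simp
    moreover have "x \<in> GL s" "?y \<in> GL s" unfolding x using GL by (intro GL_comp GL_inv; simp)+
    ultimately have "inv\<^bsub>GL_group s\<^esub> x = ?y" by (intro GLG.inv_equality) simp_all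
    then show ?thesis using comm[OF gh(2,1)] by simp
  qed
  show "?P x" if "x \<in> ?D" for x
    using that unfolding Dgen
  proof (induction rule: generate.induct)
    case one
    show ?case
    proof -
      have "connectedin (zariski s) {id}"
        unfolding connectedin_sing topspace_zariski by (rule GL_id)
      then show ?thesis
        unfolding GL_simps using subgroup_id[OF D, unfolded Dgen] by blast
    qed
  next
    case (incl h)
    then show ?case using PC unfolding Dgen by blast
  next
    case (inv h)
    then show ?case using PC[OF invC[OF inv]] unfolding Dgen by blast
  next
    case (eng x y)
    note D' = D[unfolded Dgen]
    obtain S where S: "connectedin (zariski s) S" "id \<in> S" "x \<in> S" "S \<subseteq> generate (GL_group s) C"
      using eng(3) by blast
    obtain T where T: "connectedin (zariski s) T" "id \<in> T" "y \<in> T" "T \<subseteq> generate (GL_group s) C"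
      using eng(4) by blast
    have x: "x \<in> GL s" using subgroup_GL[OF D' eng(1)] .
    have "connectedin (zariski s) (S \<union> (\<lambda>g. x \<circ> g) ` T)"
    proof (rule connectedin_Un[OF S(1) connectedin_continuous_map_image[OF continuous_mult_left[OF x] T(1)]])
      have "x \<in> (\<lambda>g. x \<circ> g) ` T" using T(2) by (intro image_eqI[of _ _ id]) auto
      with S(3) show "S \<inter> (\<lambda>g. x \<circ> g) ` T \<noteq> {}" by blast
    qed
    moreover have "(\<lambda>g. x \<circ> g) ` T \<subseteq> generate (GL_group s) C"
      using subgroup_comp[OF D' eng(1)] T(4) by blast
    ultimately show ?case
      unfolding GL_simps using S(2,4) T(3)
      by (intro exI[of _ "S \<union> (\<lambda>g. x \<circ> g) ` T"] conjI Un_least) blast+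
  qed
  show "?D \<noteq> {}" using subgroup_id[OF D] by blast
qed

section \<open>Polynomials in an endomorphism and eigenvalues modulo a subspace\<close>

definition peval :: "('v \<Rightarrow> 'v) \<Rightarrow> 'k poly \<Rightarrow> 'v \<Rightarrow> 'v" where
  "peval g p v = fold_coeffs (\<lambda>a r. s a v + g r) p 0"

lemma peval_0 [simp]: "peval g 0 v = 0"
  by (simp add: peval_def)

lemma peval_pCons [simp]:
  assumes "g \<in> gl s" shows "peval g (pCons a p) v = s a v + g (peval g p v)"
  by (cases "a = 0 \<and> p = 0") (auto simp: peval_def gl_zero[OF assms])

lemma peval_add:
  assumes g: "g \<in> gl s" shows "peval g (p + q) v = peval g p v + peval g q v"
proof (induction p arbitrary: q)
  case (pCons a p)
  show ?case
    by (cases q) (use pCons in \<open>simp add: g gl_add[OF g] scale_left_distrib algebra_simps\<close>)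
qed simp

lemma peval_smult:
  assumes g: "g \<in> gl s" shows "peval g (Polynomial.smult c p) v = s c (peval g p v)"
  by (induction p) (auto simp: g gl_scale[OF g] scale_right_distrib)

lemma peval_mult:
  assumes g: "g \<in> gl s" shows "peval g (p * q) v = peval g p (peval g q v)"
  by (induction p) (auto simp: g peval_add[OF g] peval_smult[OF g])

lemma peval_monom:
  assumes g: "g \<in> gl s" shows "peval g (monom c i) v = s c ((g ^^ i) v)"
  by (induction i) (auto simp: g monom_0 monom_Suc gl_scale[OF g] gl_zero[OF g])

lemma peval_sum:
  assumes g: "g \<in> gl s" shows "peval g (sum f A) v = (\<Sum>i\<in>A. peval g (f i) v)"
  by (induction A rule: infinite_finite_induct) (auto simp: peval_add[OF g])

lemma peval_linear:
  assumes g: "g \<in> gl s" shows "peval g p \<in> gl s"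
  by (induction p) (auto simp: g gl_iff gl_add[OF g] gl_scale[OF g] scale_right_distrib algebra_simps)

lemma annihilator_vec:
  assumes g: "g \<in> gl s" obtains p where "p \<noteq> 0" "peval g p v = 0"
proof -
  let ?n = "card Basis"
  have "\<exists>c. (\<Sum>i\<le>?n. s (c i) ((g ^^ i) v)) = 0 \<and> \<not> (\<forall>i\<in>{..?n}. c i = 0)"
  proof (rule ccontr)
    assume "\<not> ?thesis"
    then have *: "\<And>c. (\<Sum>i\<le>?n. s (c i) ((g ^^ i) v)) = 0 \<Longrightarrow> \<forall>i\<in>{..?n}. c i = 0" by blast
    note i = independent_familyI[OF finite_atMost *]
    have "card ((\<lambda>i. (g ^^ i) v) ` {..?n}) \<le> dim UNIV"
      using i(2) by (intro independent_card_le_dim) auto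
    then show False using i(1) by (simp add: card_image)
  qed
  then obtain c j where c: "(\<Sum>i\<le>?n. s (c i) ((g ^^ i) v)) = 0" and j: "j \<le> ?n" "c j \<noteq> 0" by blast
  let ?p = "\<Sum>i\<le>?n. monom (c i) i"
  have "coeff ?p j = c j"
    using j(1) by (simp add: coeff_sum)
  with j have "?p \<noteq> 0" by auto
  moreover have "peval g ?p v = 0"
    by (simp add: peval_sum[OF g] peval_monom[OF g] c)
  ultimately show thesis by (rule that)
qed

text \<open>The product of polynomials annihilating the single basis vectors works, because
  polynomials in \<open>g\<close> commute.\<close>

lemma annihilator:
  assumes g: "g \<in> gl s" obtains p where "p \<noteq> 0" "\<And>v. peval g p v = 0"
proof -
  obtain N and e :: "nat \<Rightarrow> 'v" where e: "ibasis {..<N} e" by (rule ex_ibasis)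
  have "\<forall>i. \<exists>p. p \<noteq> 0 \<and> peval g p (e i) = 0" using annihilator_vec[OF g] by blast
  then obtain p where p: "\<And>i. p i \<noteq> 0" "\<And>i. peval g (p i) (e i) = 0" by metis
  let ?P = "prod p {..<N}"
  have z: "peval g ?P (e i) = 0" if i: "i < N" for i
  proof -
    have "?P = prod p ({..<N} - {i}) * p i"
      using i by (simp add: prod.remove[of _ i] mult.commute)
    then have "peval g ?P (e i) = peval g (prod p ({..<N} - {i})) (peval g (p i) (e i))"
      by (simp only: peval_mult[OF g])
    also have "\<dots> = 0" unfolding p(2) by (rule gl_zero[OF peval_linear[OF g]])
    finally show ?thesis .
  qed
  have "peval g ?P v = 0" for v
  proof -
    have "peval g ?P v = peval g ?P (\<Sum>i<N. s (coord {..<N} e i v) (e i))"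
      by (simp only: sum_coord[OF e])
    also have "\<dots> = 0"
      unfolding gl_sum[OF peval_linear[OF g]] gl_scale[OF peval_linear[OF g]]
      by (intro sum.neutral) (simp add: z)
    finally show ?thesis .
  qed
  moreover have "?P \<noteq> 0" using p(1) by simp
  ultimately show thesis using that by blast
qed

text \<open>For invariant \<open>A\<close> these are the eigenvalues of the operator induced on the
  quotient by \<open>A\<close>.\<close>

definition eigs :: "('v \<Rightarrow> 'v) \<Rightarrow> 'v set \<Rightarrow> 'k set" where
  "eigs g A = {c. \<exists>w. w \<notin> A \<and> g w - s c w \<in> A}"

lemma peval_eigen:
  assumes g: "g \<in> gl s" and A: "subspace A" "g ` A \<subseteq> A" and w: "g w - s c w \<in> A"
  shows "peval g p w - s (poly p c) w \<in> A"
proof (induction p)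
  case 0
  show ?case using subspace_0[OF A(1)] by simp
next
  case (pCons a p)
  have "peval g (pCons a p) w - s (poly (pCons a p) c) w
    = g (peval g p w - s (poly p c) w) + s (poly p c) (g w - s c w)"
    by (simp add: g gl_minus[OF g] gl_scale[OF g] scale_left_distrib scale_right_diff_distrib
        mult.commute)
  moreover have "g (peval g p w - s (poly p c) w) \<in> A" using pCons A(2) by blast
  moreover have "s (poly p c) (g w - s c w) \<in> A" using A(1) w by (rule subspace_scale)
  ultimately show ?case using A(1) by (simp add: subspace_add)
qed

lemma finite_eigs:
  assumes g: "g \<in> gl s" and A: "subspace A" "g ` A \<subseteq> A"
  shows "finite (eigs g A)"
proof -
  obtain p where p: "p \<noteq> 0" "\<And>v. peval g p v = 0" using annihilator[OF g] by blast
  have "poly p c = 0" if "c \<in> eigs g A" for c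
  proof -
    from that obtain w where w: "w \<notin> A" "g w - s c w \<in> A" by (auto simp: eigs_def)
    have "0 - s (poly p c) w \<in> A"
      using peval_eigen[OF g A w(2), of p] unfolding p(2) .
    then have "s (poly p c) w \<in> A" using subspace_neg[OF A(1)] by force
    then have "s (inverse (poly p c)) (s (poly p c) w) \<in> A" by (rule subspace_scale[OF A(1)])
    then show ?thesis using w(1) by (cases "poly p c = 0") simp_all
  qed
  then have "eigs g A \<subseteq> {c. poly p c = 0}" by blast
  then show ?thesis using poly_roots_finite[OF p(1)] by (rule finite_subset)
qed

text \<open>Take p of least degree with p(g) w in \<open>A\<close>, and a root c of it, so p = (x -
  c) q. Minimality keeps w' = q(g) w outside \<open>A\<close>, while (g - c) w' = p(g) w lies in
  \<open>A\<close>.\<close>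

lemma eigenvector_mod:
  assumes g: "g \<in> gl s" and W: "subspace W" "g ` W \<subseteq> W" and A: "subspace A" and w: "w \<in> W" "w \<notin> A"
  obtains c w' where "w' \<in> W" "w' \<notin> A" "g w' - s c w' \<in> A"
proof -
  obtain p0 where p0: "p0 \<noteq> 0" "peval g p0 w = 0" using annihilator_vec[OF g] by blast
  let ?P = "\<lambda>p. p \<noteq> 0 \<and> peval g p w \<in> A"
  have "?P p0" using p0 subspace_0[OF A] by simp
  then obtain p where p: "?P p" and min: "\<And>q. ?P q \<Longrightarrow> degree p \<le> degree q"
    using ex_has_least_nat[of ?P p0 degree] by blast
  have "degree p > 0"
  proof (rule ccontr)
    assume "\<not> 0 < degree p"
    then obtain a where a: "p = [:a:]" using degree_eq_zeroE[of p] by auto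
    with p have "a \<noteq> 0" "s a w \<in> A" by (auto simp: g gl_zero[OF g])
    then show False using subspace_scale[OF A, of "s a w" "inverse a"] w(2) by auto
  qed
  then obtain c where "poly p c = 0" using alg_closed_imp_poly_has_root by blast
  then obtain q where q: "p = [:- c, 1:] * q" by (auto simp: poly_eq_0_iff_dvd elim: dvdE)
  have "q \<noteq> 0" using p q by auto
  moreover from this have "degree p = Suc (degree q)" unfolding q by (subst degree_mult_eq) auto
  ultimately have n: "peval g q w \<notin> A" using min[of q] by auto
  have "peval g p w = g (peval g q w) - s c (peval g q w)"
    unfolding q peval_mult[OF g] by (simp add: g gl_zero[OF g] algebra_simps)
  with p have "g (peval g q w) - s c (peval g q w) \<in> A" by simp
  moreover have "peval g q w \<in> W"
  proof (induction q)
    case (pCons a q)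
    then have "g (peval g q w) \<in> W" using W(2) by blast
    then show ?case using W(1) w(1) by (simp add: g subspace_add subspace_scale)
  qed (use subspace_0[OF W(1)] in simp)
  ultimately show thesis using that n by blast
qed

text \<open>Operators on the quotient of \<open>W\<close> by \<open>A\<close> are expressed by
  congruences modulo \<open>A\<close>. If some g is not scalar on the quotient, its eigenspace there
  is proper, nonzero and stable under the operators that commute with g, so induction on the
  dimension applies.\<close>

lemma commuting_eigenvector:
  assumes "\<And>g. g \<in> H \<Longrightarrow> g \<in> gl s" and A: "subspace A" "\<And>g. g \<in> H \<Longrightarrow> g ` A \<subseteq> A"
    and "subspace W" "A \<subset> W" "\<And>g. g \<in> H \<Longrightarrow> g ` W \<subseteq> W"
    and "\<And>g h w. g \<in> H \<Longrightarrow> h \<in> H \<Longrightarrow> w \<in> W \<Longrightarrow> g (h w) - h (g w) \<in> A"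
  shows "\<exists>w\<in>W - A. \<forall>g\<in>H. \<exists>c. g w - s c w \<in> A"
  using assms(4-7)
proof (induction "dim W" arbitrary: W rule: less_induct)
  case (less W)
  note gl = assms(1)
  show ?case
  proof (cases "\<forall>g\<in>H. \<exists>c. \<forall>w\<in>W. g w - s c w \<in> A")
    case True
    obtain w where "w \<in> W - A" using less(3) by blast
    with True show ?thesis by blast
  next
    case False
    then obtain g where g: "g \<in> H" "\<And>c. \<exists>w\<in>W. g w - s c w \<notin> A" by blast
    obtain w0 where w0: "w0 \<in> W" "w0 \<notin> A" using less(3) by blast
    obtain c w' where w': "w' \<in> W" "w' \<notin> A" "g w' - s c w' \<in> A"
      using eigenvector_mod[OF gl[OF g(1)] less(2) less(4)[OF g(1)] A(1) w0] by blast
    let ?W = "{w \<in> W. g w - s c w \<in> A}"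
    have sub: "subspace ?W"
    proof (rule subspaceI)
      show "0 \<in> ?W" using subspace_0[OF less(2)] subspace_0[OF A(1)] gl_zero[OF gl[OF g(1)]] by simp
      fix x y assume xy: "x \<in> ?W" "y \<in> ?W"
      have "g (x + y) - s c (x + y) = (g x - s c x) + (g y - s c y)"
        by (simp add: gl_add[OF gl[OF g(1)]] scale_right_distrib)
      with xy show "x + y \<in> ?W"
        using subspace_add[OF less(2)] subspace_add[OF A(1)] by auto
    next
      fix a x assume x: "x \<in> ?W"
      have "g (s a x) - s c (s a x) = s a (g x - s c x)"
        by (simp add: gl_scale[OF gl[OF g(1)]] scale_right_diff_distrib mult.commute)
      with x show "s a x \<in> ?W"
        using subspace_scale[OF less(2)] subspace_scale[OF A(1)] by auto
    qed
    have "?W \<subset> W" using g(2)[of c] by blast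
    then have dim: "dim ?W < dim W"
      using sub less(2) by (intro dim_psubset) (simp only: span_eq_iff[THEN iffD2])
    have "A \<subset> ?W"
    proof
      show "A \<subseteq> ?W"
      proof
        fix x assume x: "x \<in> A"
        then have "g x \<in> A" "s c x \<in> A" using A(2)[OF g(1)] subspace_scale[OF A(1)] by auto
        then show "x \<in> ?W" using x less(3) subspace_diff[OF A(1)] by auto
      qed
      show "A \<noteq> ?W" using w' by blast
    qed
    moreover have "h ` ?W \<subseteq> ?W" if h: "h \<in> H" for h
    proof safe
      fix w assume w: "w \<in> W" "g w - s c w \<in> A"
      show "h w \<in> W" using less(4)[OF h] w(1) by blast
      have "h (g w - s c w) \<in> A" using A(2)[OF h] w(2) by blast
      moreover have "g (h w) - h (g w) \<in> A" using less(5) g(1) h w(1) by blast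
      ultimately have "(g (h w) - h (g w)) + h (g w - s c w) \<in> A"
        using subspace_add[OF A(1)] by blast
      then show "g (h w) - s c (h w) \<in> A"
        by (simp add: gl_minus[OF gl[OF h]] gl_scale[OF gl[OF h]])
    qed
    ultimately have "\<exists>w\<in>?W - A. \<forall>g\<in>H. \<exists>c. g w - s c w \<in> A"
      using less(5) by (intro less(1) dim sub) auto
    then show ?thesis by blast
  qed
qed

text \<open>\<open>L g\<close> is an expression such as \<open>d (g w) - c (g w)\<close>.\<close>

lemma closedin_linear_condition:
  assumes A: "subspace A" and L: "\<And>\<phi>. linf \<phi> \<Longrightarrow> (\<lambda>g. \<phi> (L g)) \<in> poly_funs s"
  shows "closedin (zariski s) {g \<in> GL s. L g \<in> A}"
proof -
  let ?I = "{\<phi>. linf \<phi> \<and> (\<forall>a\<in>A. \<phi> a = 0)}"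
  have "v \<in> A" if v: "\<forall>\<phi>\<in>?I. \<phi> v = 0" for v
  proof (rule ccontr)
    assume nv: "v \<notin> A"
    obtain b where b: "b \<subseteq> A" "independent b" "span b = A"
      using maximal_independent_subset[of A] A
      by (metis span_eq_iff span_mono subset_antisym)
    have vb: "independent (insert v b)" "v \<notin> b"
      using nv b by (auto simp: independent_insert)
    interpret p: vector_space_pair s "(*) :: 'k \<Rightarrow> 'k \<Rightarrow> 'k"
      using vector_space_axioms vs_field by (simp add: vector_space_pair_def)
    let ?\<phi> = "p.construct (insert v b) (\<lambda>x. of_bool (x = v))"
    have 1: "linf ?\<phi>" using vb(1) by (rule p.linear_construct)
    have 2: "?\<phi> v = 1" using p.construct_basis[OF vb(1)] by simp
    have "?\<phi> a = 0" if "a \<in> b" for a using p.construct_basis[OF vb(1)] that vb(2) by auto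
    then have "span b \<subseteq> {a. ?\<phi> a = 0}"
      by (intro span_minimal) (auto intro!: subspaceI simp: linf_add[OF 1] linf_scale[OF 1] linf_zero[OF 1])
    then have "?\<phi> \<in> ?I" using 1 b(3) by blast
    with v 2 show False by force
  qed
  then have "L g \<in> A \<longleftrightarrow> (\<forall>\<phi>\<in>?I. \<phi> (L g) = 0)" for g by blast
  then have "{g \<in> GL s. L g \<in> A} = {g \<in> GL s. \<forall>\<phi>\<in>?I. \<phi> (L g) = 0}" by blast
  moreover have "closedin (zariski s) {g \<in> GL s. \<forall>\<phi>\<in>?I. \<phi> (L g) = 0}"
    using L by (intro closedin_zariski_all) blast
  ultimately show ?thesis by simp
qed

lemma weight_unique:
  assumes A: "subspace A" and w: "w \<notin> A" and c: "v - s c w \<in> A" "v - s c' w \<in> A"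
  shows "c = c'"
proof (rule ccontr)
  assume "c \<noteq> c'"
  have "(v - s c w) - (v - s c' w) = s (c' - c) w" by (simp add: scale_left_diff_distrib)
  then have "s (c' - c) w \<in> A" using subspace_diff[OF A c] by simp
  then have "s (inverse (c' - c)) (s (c' - c) w) \<in> A" using subspace_scale[OF A] by blast
  with w \<open>c \<noteq> c'\<close> show False by simp
qed

text \<open>The weight space \<open>U\<close> of the derived group is stable under \<open>H\<close>, and \<open>H\<close> acts on it by
  commuting operators: on \<open>H\<close> the weight \<open>\<chi>(g\<inverse> d g)\<close> and the scalar by which \<open>g\<close> and \<open>h\<close> fail to
  commute take finitely many values on closed sets, so they are constant.\<close>

theorem Lie_Kolchin:
  assumes H: "subgroup H (GL_group s)" "connectedin (zariski s) H"
    and solv: "(derived (GL_group s) ^^ k) H = {id}"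
    and A: "subspace A" "\<And>g. g \<in> H \<Longrightarrow> g ` A \<subseteq> A"
    and W: "subspace W" "\<And>g. g \<in> H \<Longrightarrow> g ` W \<subseteq> W" and AW: "A \<subset> W"
  shows "\<exists>w\<in>W - A. \<forall>g\<in>H. \<exists>c. g w - s c w \<in> A"
  using H solv A(2) W(2)
proof (induction k arbitrary: H)
  case 0
  obtain w where "w \<in> W - A" using AW by blast
  moreover have "id w - s 1 w \<in> A" using subspace_0[OF A(1)] by simp
  moreover have "H = {id}" using 0(3) by (simp only: funpow_0)
  ultimately show ?case by (intro bexI[of _ w] ballI exI[of _ 1]) auto
next
  case (Suc k)
  note H = Suc.prems(1) and con = Suc.prems(2) and AH = Suc.prems(4) and WH = Suc.prems(5)
  have HGL: "g \<in> GL s" if "g \<in> H" for g using subgroup_GL[OF H that] .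
  have Hgl: "g \<in> gl s" if "g \<in> H" for g using GL_gl[OF HGL[OF that]] .
  let ?D = "derived (GL_group s) H"
  have D: "subgroup ?D (GL_group s)"
    using subgroup.subset[OF H] by (rule GLG.derived_is_subgroup)
  have DH: "?D \<subseteq> H" by (rule GLG.derived_incl[OF subset_refl H])
  have conj: "inv_into UNIV h \<circ> d \<circ> h \<in> ?D" if h: "h \<in> H" and d: "d \<in> ?D" for h d
  proof -
    have "normal ?D (GL_group s\<lparr>carrier := H\<rparr>)" using H by (rule GLG.derived_subgroup_is_normal)
    then have "inv\<^bsub>GL_group s\<lparr>carrier := H\<rparr>\<^esub> h \<otimes>\<^bsub>GL_group s\<lparr>carrier := H\<rparr>\<^esub> d
        \<otimes>\<^bsub>GL_group s\<lparr>carrier := H\<rparr>\<^esub> h \<in> ?D"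
      using h d by (intro normal.inv_op_closed1) simp_all
    then show ?thesis
      using GLG.m_inv_consistent[OF H h] HGL[OF h] by simp
  qed
  have comm: "g \<circ> h \<circ> inv_into UNIV g \<circ> inv_into UNIV h \<in> ?D" if "g \<in> H" "h \<in> H" for g h
    unfolding derived_def using that HGL[of g] HGL[of h]
    by (intro generate.incl UN_I[of g] UN_I[of h]) simp_all
  have nA: "g w \<notin> A" if g: "g \<in> H" and w: "w \<notin> A" for g w
  proof
    assume "g w \<in> A"
    then have "inv_into UNIV g (g w) \<in> A" using AH[OF subgroup_inv[OF H g]] by blast
    with w HGL[OF g] show False by simp
  qed
  have "\<exists>w\<in>W - A. \<forall>g\<in>?D. \<exists>c. g w - s c w \<in> A"
  proof (rule Suc.IH[OF D connected_derived[OF H con]])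
    show "(derived (GL_group s) ^^ k) ?D = {id}" using Suc.prems(3) by (simp only: funpow_Suc_right o_apply)
  qed (use DH AH WH in blast)+
  then obtain w0 where w0: "w0 \<in> W" "w0 \<notin> A" "\<forall>g\<in>?D. \<exists>c. g w0 - s c w0 \<in> A" by blast
  obtain \<chi> where \<chi>: "\<forall>g\<in>?D. g w0 - s (\<chi> g) w0 \<in> A" using bchoice[OF w0(3)] by blast
  let ?U = "{w \<in> W. \<forall>d\<in>?D. d w - s (\<chi> d) w \<in> A}"
  have subU: "subspace ?U"
  proof (rule subspaceI)
    show "0 \<in> ?U"
    proof (intro CollectI conjI ballI)
      fix d assume "d \<in> ?D"
      then have "d 0 = 0" using DH by (intro gl_zero[OF Hgl]) blast
      then show "d 0 - s (\<chi> d) 0 \<in> A" using subspace_0[OF A(1)] by simp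
    qed (rule subspace_0[OF W(1)])
    fix x y assume xy: "x \<in> ?U" "y \<in> ?U"
    have "d (x + y) - s (\<chi> d) (x + y) \<in> A" if d: "d \<in> ?D" for d
    proof -
      have "d (x + y) - s (\<chi> d) (x + y) = (d x - s (\<chi> d) x) + (d y - s (\<chi> d) y)"
        using d DH by (simp add: gl_add[OF Hgl] subset_iff scale_right_distrib)
      with xy d show ?thesis using subspace_add[OF A(1)] by auto
    qed
    with xy show "x + y \<in> ?U" using subspace_add[OF W(1)] by auto
  next
    fix a x assume x: "x \<in> ?U"
    have "d (s a x) - s (\<chi> d) (s a x) \<in> A" if d: "d \<in> ?D" for d
    proof -
      have "d (s a x) - s (\<chi> d) (s a x) = s a (d x - s (\<chi> d) x)"
        using d DH by (simp add: gl_scale[OF Hgl] subset_iff scale_right_diff_distrib mult.commute)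
      with x d show ?thesis using subspace_scale[OF A(1)] by auto
    qed
    with x show "s a x \<in> ?U" using subspace_scale[OF W(1)] by auto
  qed
  have AU: "A \<subseteq> ?U"
  proof
    fix x assume x: "x \<in> A"
    have "d x - s (\<chi> d) x \<in> A" if "d \<in> ?D" for d
    proof (rule subspace_diff[OF A(1)])
      show "d x \<in> A" using AH[of d] that DH x by blast
      show "s (\<chi> d) x \<in> A" using subspace_scale[OF A(1) x] .
    qed
    then show "x \<in> ?U" using x AW by blast
  qed
  have hU: "h ` ?U \<subseteq> ?U" if h: "h \<in> H" for h
  proof safe
    fix w assume w: "w \<in> W" "\<forall>d\<in>?D. d w - s (\<chi> d) w \<in> A"
    show "h w \<in> W" using WH[OF h] w(1) by blast
    fix d assume d: "d \<in> ?D"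
    then have dH: "d \<in> H" using DH by blast
    show "d (h w) - s (\<chi> d) (h w) \<in> A"
    proof (cases "w \<in> A")
      case True
      then have "h w \<in> A" using AH[OF h] by blast
      moreover from this have "d (h w) \<in> A" using AH[OF dH] by blast
      ultimately show ?thesis using subspace_diff[OF A(1)] subspace_scale[OF A(1)] by blast
    next
      case False
      let ?E = "\<lambda>c. {g \<in> GL s. d (g w) - s c (g w) \<in> A}"
      have wt: "d (g w) - s (\<chi> (inv_into UNIV g \<circ> d \<circ> g)) (g w) \<in> A" if g: "g \<in> H" for g
      proof -
        let ?d = "inv_into UNIV g \<circ> d \<circ> g"
        have "?d w - s (\<chi> ?d) w \<in> A" using w(2) conj[OF g d] by blast
        then have "g (?d w - s (\<chi> ?d) w) \<in> A" using AH[OF g] by blast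
        then show ?thesis
          using HGL[OF g] by (simp add: gl_minus[OF Hgl[OF g]] gl_scale[OF Hgl[OF g]])
      qed
      have "H \<subseteq> ?E (\<chi> d)"
      proof (rule connected_closed_cover[OF con, where I = "eigs d A" and x = id])
        show "finite (eigs d A)" using finite_eigs[OF Hgl[OF dH] A(1) AH[OF dH]] .
        show "closedin (zariski s) (?E c)" for c
        proof (rule closedin_linear_condition[OF A(1)])
          fix \<phi> :: "'v \<Rightarrow> 'k" assume \<phi>: "linf \<phi>"
          have "(\<lambda>g. \<phi> (d (g w)) - c * \<phi> (g w)) \<in> poly_funs s"
            by (intro pf_diff poly_funs.mult poly_funs.const poly_funs.coefficient \<phi>
                poly_funs.coefficient[OF linf_comp[OF \<phi> Hgl[OF dH]]])
          moreover have "\<phi> (d (g w) - s c (g w)) = \<phi> (d (g w)) - c * \<phi> (g w)" for g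
            using linf_add[OF \<phi>, of "d (g w) - s c (g w)" "s c (g w)"] linf_scale[OF \<phi>]
            by (simp add: algebra_simps)
          ultimately show "(\<lambda>g. \<phi> (d (g w) - s c (g w))) \<in> poly_funs s" by simp
        qed
        show "H \<subseteq> (\<Union>c\<in>eigs d A. ?E c)"
        proof
          fix g assume g: "g \<in> H"
          then have "\<chi> (inv_into UNIV g \<circ> d \<circ> g) \<in> eigs d A"
            unfolding eigs_def using wt nA[OF g False] by blast
          with g wt HGL show "g \<in> (\<Union>c\<in>eigs d A. ?E c)" by blast
        qed
        show "c = c'" if "g \<in> H" "g \<in> ?E c" "g \<in> ?E c'" for c c' g
          using that weight_unique[OF A(1) nA[OF that(1) False]] by blast
        show "id \<in> H" using subgroup_id[OF H] .
        show "\<chi> d \<in> eigs d A" unfolding eigs_def using w(2) d False by blast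
        show "id \<in> ?E (\<chi> d)" using w(2) d GL_id by simp
      qed
      with h show ?thesis by blast
    qed
  qed
  have hgU: "g (h w) - h (g w) \<in> A" if g: "g \<in> H" and h: "h \<in> H" and w: "w \<in> ?U" for g h w
  proof -
    let ?d = "\<lambda>h. g \<circ> h \<circ> inv_into UNIV g \<circ> inv_into UNIV h"
    have gh: "g (h x) - s (\<chi> (?d h)) (h (g x)) \<in> A" if h: "h \<in> H" and x: "x \<in> ?U" for h x
    proof -
      have "h (g x) \<in> ?U" using hU[OF g] hU[OF h] x by blast
      then have "?d h (h (g x)) - s (\<chi> (?d h)) (h (g x)) \<in> A" using comm[OF g h] by blast
      then show ?thesis using HGL[OF g] HGL[OF h] by simp
    qed
    obtain c w1 where w1: "w1 \<in> ?U" "w1 \<notin> A" "g w1 - s c w1 \<in> A"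
    proof (rule eigenvector_mod[OF Hgl[OF g] subU hU[OF g] A(1)])
      show "w0 \<in> ?U" "w0 \<notin> A" using w0 \<chi> by auto
    qed
    have c: "c \<noteq> 0"
    proof
      assume "c = 0"
      with w1 have "g w1 \<in> A" by simp
      with nA[OF g w1(2)] show False by blast
    qed
    let ?E = "\<lambda>a. {f \<in> GL s. g (f w1) - s a (f (g w1)) \<in> A}"
    \<comment> \<open>Modulo \<open>A\<close>, g (f w1) is \<chi> times f (g w1), that is \<chi> c
      times f w1. So \<chi> c is one of the finitely many eigenvalues of g, which explains the
      division by c. The value 1 is added below because the identity lies in
      \<open>?E 1\<close>.\<close>
    let ?I = "(\<lambda>e. e / c) ` eigs g A"
    have eig: "\<chi> (?d f) \<in> ?I" if f: "f \<in> H" for f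
    proof -
      have "g (f w1) - s (\<chi> (?d f)) (f (g w1)) \<in> A" by (rule gh[OF f w1(1)])
      moreover have "s (\<chi> (?d f)) (f (g w1 - s c w1)) \<in> A"
        using AH[OF f] w1(3) subspace_scale[OF A(1)] by blast
      ultimately have "(g (f w1) - s (\<chi> (?d f)) (f (g w1))) + s (\<chi> (?d f)) (f (g w1 - s c w1)) \<in> A"
        by (rule subspace_add[OF A(1)])
      then have "g (f w1) - s (\<chi> (?d f) * c) (f w1) \<in> A"
        by (simp add: gl_minus[OF Hgl[OF f]] gl_scale[OF Hgl[OF f]] scale_right_diff_distrib)
      then have "\<chi> (?d f) * c \<in> eigs g A"
        unfolding eigs_def using nA[OF f w1(2)] by blast
      then show ?thesis using c by (intro image_eqI[of _ _ "\<chi> (?d f) * c"]) simp_all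
    qed
    have "H \<subseteq> ?E 1"
    proof (rule connected_closed_cover[OF con, where I = "insert 1 ?I" and x = id])
      show "finite (insert 1 ?I)" using finite_eigs[OF Hgl[OF g] A(1) AH[OF g]] by simp
      show "closedin (zariski s) (?E a)" for a
      proof (rule closedin_linear_condition[OF A(1)])
        fix \<phi> :: "'v \<Rightarrow> 'k" assume \<phi>: "linf \<phi>"
        have "(\<lambda>f. \<phi> (g (f w1)) - a * \<phi> (f (g w1))) \<in> poly_funs s"
          by (intro pf_diff poly_funs.mult poly_funs.const poly_funs.coefficient \<phi>
              poly_funs.coefficient[OF linf_comp[OF \<phi> Hgl[OF g]]])
        moreover have "\<phi> (g (f w1) - s a (f (g w1))) = \<phi> (g (f w1)) - a * \<phi> (f (g w1))" for f
          using linf_add[OF \<phi>, of "g (f w1) - s a (f (g w1))" "s a (f (g w1))"] linf_scale[OF \<phi>]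
          by (simp add: algebra_simps)
        ultimately show "(\<lambda>f. \<phi> (g (f w1) - s a (f (g w1)))) \<in> poly_funs s" by simp
      qed
      show "H \<subseteq> (\<Union>a\<in>insert 1 ?I. ?E a)"
      proof
        fix f assume f: "f \<in> H"
        with gh[OF f w1(1)] HGL have "f \<in> ?E (\<chi> (?d f))" by blast
        with eig[OF f] show "f \<in> (\<Union>a\<in>insert 1 ?I. ?E a)" by blast
      qed
      show "a = a'" if "f \<in> H" "f \<in> ?E a" "f \<in> ?E a'" for a a' f
        using that weight_unique[OF A(1) nA[OF that(1) nA[OF g w1(2)]]] by blast
      show "id \<in> H" using subgroup_id[OF H] .
      show "id \<in> ?E 1" using GL_id subspace_0[OF A(1)] by simp
    qed simp
    with h have "g (h w1) - s 1 (h (g w1)) \<in> A" by blast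
    then have "\<chi> (?d h) = 1"
      using weight_unique[OF A(1) nA[OF h nA[OF g w1(2)]] gh[OF h w1(1)]] by blast
    with gh[OF h w] show ?thesis by simp
  qed
  have "\<exists>w\<in>?U - A. \<forall>g\<in>H. \<exists>c. g w - s c w \<in> A"
  proof (rule commuting_eigenvector)
    show "A \<subset> ?U" using AU w0 \<chi> by blast
  qed (fact Hgl A(1) AH subU hU hgU)+
  then show ?case by blast
qed

end

section \<open>Invariant flags\<close>

context quad_space
begin

sublocale alg_vspace s "extend_basis {}" ..

abbreviation "orth \<equiv> orth_group s \<alpha>"

lemma orthD: "g \<in> orth \<Longrightarrow> g \<in> GL s" "g \<in> orth \<Longrightarrow> \<alpha> (g v) = \<alpha> v"
  by (simp_all add: orth_group_def)

lemma orth_gl: "g \<in> orth \<Longrightarrow> g \<in> gl s"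
  by (intro GL_gl orthD)

lemma orth_bet: "g \<in> orth \<Longrightarrow> bet (g v) (g w) = bet v w"
  by (simp add: polar_def orthD flip: gl_add[OF orth_gl])

lemma orth_inv: assumes "g \<in> orth" shows "inv_into UNIV g \<in> orth"
  unfolding orth_group_def
proof (intro CollectI conjI allI GL_inv orthD(1)[OF assms])
  fix v
  show "\<alpha> (inv_into UNIV g v) = \<alpha> v"
    using orthD(2)[OF assms, of "inv_into UNIV g v"] orthD(1)[OF assms] by simp
qed

lemma orth_bet_inv: assumes "g \<in> orth" shows "bet (g v) w = bet v (inv_into UNIV g w)"
  using orth_bet[OF assms, of v "inv_into UNIV g w"] orthD(1)[OF assms] by simp

section \<open>Hyperbolic pairs, the radical and isotropic flags\<close>

definition hyperbolic :: "nat \<Rightarrow> (nat \<Rightarrow> 'v) \<Rightarrow> (nat \<Rightarrow> 'v) \<Rightarrow> bool" where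
  "hyperbolic i b f \<longleftrightarrow> (\<forall>j<i. \<forall>l<i. bet (b j) (b l) = 0 \<and> bet (f j) (f l) = 0 \<and>
     bet (b j) (f l) = of_bool (j = l))"

text \<open>The projection to the orthogonal complement of the pairs; the component along the pairs
  is removed by adding it once more.\<close>

definition hproj :: "nat \<Rightarrow> (nat \<Rightarrow> 'v) \<Rightarrow> (nat \<Rightarrow> 'v) \<Rightarrow> 'v \<Rightarrow> 'v" where
  "hproj i b f z = z + ((\<Sum>j<i. s (bet z (f j)) (b j)) + (\<Sum>j<i. s (bet z (b j)) (f j)))"

lemma sum_of_bool_eq: "finite A \<Longrightarrow> (\<Sum>x\<in>A. c x * of_bool (x = a)) = (if a \<in> A then c a else (0::'k))"
  by (simp add: of_bool_def if_distrib cong: if_cong)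

lemma hyperbolicD:
  assumes "hyperbolic i b f" "j < i" "l < i"
  shows "bet (b j) (b l) = 0" "bet (f j) (f l) = 0" "bet (b j) (f l) = of_bool (j = l)"
    "bet (f l) (b j) = of_bool (j = l)"
  using assms bet_sym[of "f l" "b j"] unfolding hyperbolic_def by simp_all

lemma hproj_perp:
  assumes h: "hyperbolic i b f" and l: "l < i"
  shows "bet (hproj i b f z) (b l) = 0" "bet (hproj i b f z) (f l) = 0"
proof -
  have "(\<Sum>j<i. bet z (f j) * bet (b j) (b l)) = 0" "(\<Sum>j<i. bet z (b j) * bet (f j) (f l)) = 0"
    using hyperbolicD[OF h _ l] by (auto intro!: sum.neutral)
  moreover have "(\<Sum>j<i. bet z (f j) * bet (b j) (f l)) = bet z (f l)"
    "(\<Sum>j<i. bet z (b j) * bet (f j) (b l)) = bet z (b l)"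
  proof -
    have "(\<Sum>j<i. bet z (f j) * bet (b j) (f l)) = (\<Sum>j<i. bet z (f j) * of_bool (j = l))"
      using hyperbolicD(3)[OF h _ l] by (intro sum.cong) auto
    then show "(\<Sum>j<i. bet z (f j) * bet (b j) (f l)) = bet z (f l)"
      using l by (simp only: sum_of_bool_eq finite_lessThan) simp
    have "(\<Sum>j<i. bet z (b j) * bet (f j) (b l)) = (\<Sum>j<i. bet z (b j) * of_bool (j = l))"
      using hyperbolicD(4)[OF h l] by (intro sum.cong) auto
    then show "(\<Sum>j<i. bet z (b j) * bet (f j) (b l)) = bet z (b l)"
      using l by (simp only: sum_of_bool_eq finite_lessThan) simp
  qed
  ultimately show "bet (hproj i b f z) (b l) = 0" "bet (hproj i b f z) (f l) = 0"
    by (simp_all add: hproj_def bet_sum1)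
qed

lemma hyperbolic_extend:
  assumes h: "hyperbolic i b f" and w: "\<And>l. l < i \<Longrightarrow> bet w (b l) = 0" "\<And>l. l < i \<Longrightarrow> bet w (f l) = 0"
    and z: "bet w z \<noteq> 0"
  shows "\<exists>g. bet w g = 1 \<and> (\<forall>l<i. bet g (b l) = 0 \<and> bet g (f l) = 0)"
proof -
  let ?g = "hproj i b f (s (inverse (bet w z)) z)"
  have "bet w ?g = 1" using w z by (simp add: hproj_def bet_sum2)
  then show ?thesis using hproj_perp[OF h] by (intro exI[of _ ?g]) simp
qed

lemma hyperbolic_Suc:
  assumes h: "hyperbolic i b f" and w: "\<And>l. l < i \<Longrightarrow> bet w (b l) = 0" "\<And>l. l < i \<Longrightarrow> bet w (f l) = 0"
    and g: "bet w g = 1" "\<And>l. l < i \<Longrightarrow> bet g (b l) = 0" "\<And>l. l < i \<Longrightarrow> bet g (f l) = 0"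
  shows "hyperbolic (Suc i) (b(i := w)) (f(i := g))"
  unfolding hyperbolic_def
proof (intro allI impI)
  fix j l assume jl: "j < Suc i" "l < Suc i"
  note sw = w[unfolded bet_sym[of w]] g(2,3)[unfolded bet_sym[of g]]
  show "bet ((b(i := w)) j) ((b(i := w)) l) = 0 \<and> bet ((f(i := g)) j) ((f(i := g)) l) = 0 \<and>
    bet ((b(i := w)) j) ((f(i := g)) l) = of_bool (j = l)"
    using jl hyperbolicD[OF h, of j l] w[of l] g sw[of j] by (auto simp: less_Suc_eq)
qed

lemma hyperbolic_independent:
  assumes h: "hyperbolic i b f" and r: "\<And>z. bet r z = 0"
    and c: "(\<Sum>j<i. s (c j) (b j)) + (\<Sum>j<i. s (d j) (f j)) + r = 0"
  shows "\<forall>j<i. c j = 0 \<and> d j = 0"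
proof (intro allI impI)
  fix l assume l: "l < i"
  let ?v = "(\<Sum>j<i. s (c j) (b j)) + (\<Sum>j<i. s (d j) (f j)) + r"
  have "bet ?v (f l) = (\<Sum>j<i. c j * bet (b j) (f l)) + (\<Sum>j<i. d j * bet (f j) (f l))"
    by (simp add: bet_sum1 r)
  also have "(\<Sum>j<i. d j * bet (f j) (f l)) = 0"
    using hyperbolicD[OF h _ l] by (auto intro!: sum.neutral)
  also have "(\<Sum>j<i. c j * bet (b j) (f l)) = (\<Sum>j<i. c j * of_bool (j = l))"
    using hyperbolicD[OF h _ l] by (intro sum.cong) auto
  also have "\<dots> = c l" using l by (simp only: sum_of_bool_eq finite_lessThan) simp
  finally have 1: "c l = 0" unfolding c by simp
  have "bet ?v (b l) = (\<Sum>j<i. c j * bet (b j) (b l)) + (\<Sum>j<i. d j * bet (f j) (b l))"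
    by (simp add: bet_sum1 r)
  also have "(\<Sum>j<i. c j * bet (b j) (b l)) = 0"
    using hyperbolicD[OF h _ l] by (auto intro!: sum.neutral)
  also have "(\<Sum>j<i. d j * bet (f j) (b l)) = (\<Sum>j<i. d j * of_bool (j = l))"
    using hyperbolicD(4)[OF h l] by (intro sum.cong) auto
  also have "\<dots> = d l" using l by (simp only: sum_of_bool_eq finite_lessThan) simp
  finally show "c l = 0 \<and> d l = 0" using 1 unfolding c by simp
qed

definition hfam :: "nat \<Rightarrow> (nat \<Rightarrow> 'v) \<Rightarrow> (nat \<Rightarrow> 'v) \<Rightarrow> nat \<Rightarrow> 'v" where
  "hfam i b f k = (if k < i then b k else f (k - i))"

lemma sum_hfam:
  "(\<Sum>k<2*i. s (c k) (hfam i b f k)) = (\<Sum>j<i. s (c j) (b j)) + (\<Sum>j<i. s (c (j + i)) (f j))"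
proof -
  have "(\<Sum>k<2*i. s (c k) (hfam i b f k))
    = (\<Sum>k<i. s (c k) (hfam i b f k)) + (\<Sum>k=i..<i+i. s (c k) (hfam i b f k))"
    by (simp add: lessThan_atLeast0 sum.atLeastLessThan_concat mult_2)
  also have "(\<Sum>k=i..<i+i. s (c k) (hfam i b f k)) = (\<Sum>j=0..<i. s (c (j + i)) (hfam i b f (j + i)))"
    using sum.shift_bounds_nat_ivl[of "\<lambda>k. s (c k) (hfam i b f k)" 0 i i] by simp
  finally show ?thesis by (simp add: hfam_def lessThan_atLeast0)
qed

lemma hfam_independent:
  assumes h: "hyperbolic i b f" and c: "(\<Sum>k<2*i. s (c k) (hfam i b f k)) = 0"
  shows "\<forall>k\<in>{..<2*i}. c k = 0"
proof
  fix k assume k: "k \<in> {..<2*i}"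
  have *: "\<forall>j<i. c j = 0 \<and> c (j + i) = 0"
    using hyperbolic_independent[OF h, of 0 c "\<lambda>j. c (j + i)"] c unfolding sum_hfam by simp
  show "c k = 0"
  proof (cases "k < i")
    case False
    then have "k - i < i" "k - i + i = k" using k by auto
    with * show ?thesis by metis
  qed (use * in simp)
qed

lemma hyperbolic_bound:
  assumes h: "hyperbolic i b f" shows "i \<le> n"
proof -
  note ind = independent_familyI[OF finite_lessThan hfam_independent[OF h]]
  have "card (hfam i b f ` {..<2*i}) \<le> dim UNIV"
    using ind(2) by (intro independent_card_le_dim) auto
  then show ?thesis using ind(1) by (simp add: card_image dim_space)
qed

text \<open>The orthogonal complement of a maximal family of hyperbolic pairs lies in the radical. A
  zero radical would make the \<open>2*i\<close> vectors of the pairs a basis, but the dimension is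
  odd.\<close>

lemma radical_ex: "\<exists>r. (\<forall>z. bet r z = 0) \<and> \<alpha> r = 1"
proof -
  let ?P = "\<lambda>i. \<exists>b f. hyperbolic i b f"
  have "?P 0" by (simp add: hyperbolic_def)
  then have "\<exists>i. ?P i \<and> (\<forall>j. ?P j \<longrightarrow> id j \<le> id i)"
    by (rule ex_has_greatest_nat[of ?P 0 id "Suc n"]) (auto dest: hyperbolic_bound)
  then obtain i where i: "?P i" "\<And>j. ?P j \<Longrightarrow> j \<le> i" by auto
  then obtain b f where h: "hyperbolic i b f" by blast
  have rad: "bet w z = 0"
    if w: "\<And>l. l < i \<Longrightarrow> bet w (b l) = 0" "\<And>l. l < i \<Longrightarrow> bet w (f l) = 0" for w z
  proof (rule ccontr)
    assume "bet w z \<noteq> 0"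
    from hyperbolic_extend[OF h w this] obtain g where
      g: "bet w g = 1" "\<And>l. l < i \<Longrightarrow> bet g (b l) = 0" "\<And>l. l < i \<Longrightarrow> bet g (f l) = 0" by blast
    have "?P (Suc i)" using hyperbolic_Suc[OF h w g] by blast
    with i(2) show False by fastforce
  qed
  have "\<exists>r. (\<forall>z. bet r z = 0) \<and> r \<noteq> 0"
  proof (rule ccontr)
    assume "\<not> ?thesis"
    then have z: "\<And>r. (\<forall>z. bet r z = 0) \<Longrightarrow> r = 0" by blast
    have "hproj i b f v = 0" for v
      using rad[of "hproj i b f v", OF hproj_perp[OF h]] by (intro z allI)
    then have *: "v = (\<Sum>j<i. s (bet v (f j)) (b j)) + (\<Sum>j<i. s (bet v (b j)) (f j))" for v
      unfolding hproj_def by (simp only: addv_eq_0)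
    have "\<exists>c. v = (\<Sum>k<2*i. s (c k) (hfam i b f k))" for v
    proof
      show "v = (\<Sum>k<2*i. s (if k < i then bet v (f k) else bet v (b (k - i))) (hfam i b f k))"
        unfolding sum_hfam by (rule trans[OF *]) simp
    qed
    moreover have "\<forall>k\<in>{..<2*i}. c k = 0" if "(\<Sum>k<2*i. s (c k) (hfam i b f k)) = 0" for c
      using hfam_independent[OF h that] .
    ultimately have "ibasis {..<2*i} (hfam i b f)"
      by (intro ibasis_spanI) simp_all
    from ibasis_card[OF this] show False using dim_space by simp presburger
  qed
  then obtain r where r: "\<And>z. bet r z = 0" "r \<noteq> 0" by blast
  then have "\<alpha> r \<noteq> 0" using nondeg[of r] by blast
  moreover obtain y where y: "y\<^sup>2 = \<alpha> r" using sqrt_ex by blast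
  ultimately have 1: "\<alpha> (s (inverse y) r) = 1" by (simp add: \<alpha>_scale power_inverse y)
  have "bet (s (inverse y) r) z = 0" for z by (simp add: r(1))
  with 1 show ?thesis by blast
qed

text \<open>\<open>\<alpha>\<close> is injective on the radical, since nondegeneracy excludes a
  nonzero vector with value 0 and \<open>\<alpha>\<close> is additive there. Hence the radical is a
  line.\<close>

lemma radical_scalar:
  assumes r: "\<And>z. bet r z = 0" "\<alpha> r = 1" and v: "\<And>z. bet v z = 0"
  obtains c where "v = s c r" "c\<^sup>2 = \<alpha> v"
proof -
  obtain c where c: "c\<^sup>2 = \<alpha> v" using sqrt_ex by blast
  moreover have "v = s c r" using c by (intro radical_eqI) (simp_all add: r v \<alpha>_scale)
  ultimately show thesis using that by blast
qed

lemma orth_radical: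
  assumes r: "\<And>z. bet r z = 0" and g: "g \<in> orth" shows "g r = r"
  by (intro radical_eqI) (simp_all add: orth_bet_inv[OF g] r orthD(2)[OF g])

lemma \<alpha>_span_isotropic:
  assumes "\<And>x. x \<in> A \<Longrightarrow> \<alpha> x = 0" "\<And>x y. x \<in> A \<Longrightarrow> y \<in> A \<Longrightarrow> bet x y = 0" "v \<in> span A"
  shows "\<alpha> v = 0"
proof -
  have perp: "bet x v = 0" if "x \<in> A" "v \<in> span A" for x v
  proof -
    have "span A \<subseteq> {v. bet x v = 0}"
      using assms(2) that(1) by (intro span_minimal) (auto intro!: subspaceI)
    then show ?thesis using that(2) by blast
  qed
  have "\<alpha> v = 0 \<and> v \<in> span A" if "v \<in> span A"
    using that
  proof (induction rule: span_induct_alt)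
    case (step c x y)
    then have "bet x y = 0" using perp by blast
    with step assms(1) show ?case
      by (simp add: \<alpha>_add \<alpha>_scale span_add span_scale span_base)
  qed (simp add: span_zero)
  with assms(3) show ?thesis by blast
qed

lemma exp_derived_consistent:
  assumes "subgroup H (GL_group s)"
  shows "(derived (GL_group s\<lparr>carrier := H\<rparr>) ^^ k) H = (derived (GL_group s) ^^ k) H
    \<and> (derived (GL_group s) ^^ k) H \<subseteq> H"
proof (induction k)
  case (Suc k)
  then show ?case
    using GLG.derived_consistent[OF _ assms] GLG.derived_incl[OF _ assms] by simp
qed simp

text \<open>Lie-Kolchin is applied to the orthogonal of the flag modulo the flag and the radical.
  The eigenvector is then changed, within its class, to a singular vector, and singularity removes
  the radical component of its images.\<close>

lemma flag_step:
  assumes B: "B \<subseteq> orth" "closed_connected_solvable s B" and i: "i < n"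
    and r: "\<And>z. bet r z = 0" "\<alpha> r = 1"
    and h: "hyperbolic i b f" "\<forall>j<i. \<alpha> (b j) = 0 \<and> \<alpha> (f j) = 0"
      "\<forall>g\<in>B. \<forall>j<i. g (b j) \<in> span (b ` {..j})"
  shows "\<exists>b' f'. hyperbolic (Suc i) b' f' \<and> (\<forall>j<Suc i. \<alpha> (b' j) = 0 \<and> \<alpha> (f' j) = 0) \<and>
      (\<forall>g\<in>B. \<forall>j<Suc i. g (b' j) \<in> span (b' ` {..j}))"
proof -
  have Bsub: "subgroup B (GL_group s)" and Bcon: "connectedin (zariski s) B"
    and Bsolv: "solvable (GL_group s\<lparr>carrier := B\<rparr>)"
    using B(2) by (auto simp: closed_connected_solvable_def)
  have Bo: "g \<in> orth" if "g \<in> B" for g using B(1) that by blast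
  have Bgl: "g \<in> gl s" if "g \<in> B" for g using orth_gl[OF Bo[OF that]] .
  obtain k where k: "(derived (GL_group s) ^^ k) B = {id}"
  proof -
    interpret G: group "GL_group s\<lparr>carrier := B\<rparr>"
      using GLG.subgroup_imp_group[OF Bsub] .
    have "\<exists>k. (derived (GL_group s\<lparr>carrier := B\<rparr>) ^^ k) B = {id}"
      using G.solvable_imp_trivial_derived_seq[of B] Bsolv by (simp add: solvable_def)
    then show thesis using that exp_derived_consistent[OF Bsub] by auto
  qed
  let ?F = "span (b ` {..<i})"
  \<comment> \<open>\<open>r\<close> is included because it is fixed by the group and could
    otherwise be the eigenvector found; the flag needs a vector independent of the radical.\<close>
  let ?A = "span (insert r (b ` {..<i}))"
  let ?W = "{z. \<forall>j<i. bet (b j) z = 0}"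
  have bF: "b j \<in> ?F" if "j < i" for j using that by (intro span_base imageI) simp
  have FA: "?F \<subseteq> ?A" by (intro span_mono) blast
  have subW: "subspace ?W" by (auto intro!: subspaceI)
  have AW: "?A \<subseteq> ?W"
    using hyperbolicD(1)[OF h(1)] r(1) bet_sym[of _ r] subW by (intro span_minimal) auto
  have subg: "subspace {v. g v \<in> span S}" if g: "g \<in> B" for g S
    by (intro subspaceI) (simp_all add: gl_zero[OF Bgl[OF g]] gl_add[OF Bgl[OF g]]
        gl_scale[OF Bgl[OF g]] span_zero span_add span_scale)
  have gF: "g ` ?F \<subseteq> ?F" if g: "g \<in> B" for g
  proof -
    have "span (b ` {..<i}) \<subseteq> {v. g v \<in> ?F}"
    proof (rule span_minimal[OF _ subg[OF g]])
      show "b ` {..<i} \<subseteq> {v. g v \<in> ?F}"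
      proof safe
        fix j assume "j < i"
        then have "span (b ` {..j}) \<subseteq> ?F" by (intro span_mono image_mono) auto
        with h(3) g \<open>j < i\<close> show "g (b j) \<in> ?F" by blast
      qed
    qed
    then show ?thesis by blast
  qed
  have gA: "g ` ?A \<subseteq> ?A" if g: "g \<in> B" for g
  proof -
    have "?A \<subseteq> {v. g v \<in> ?A}"
    proof (rule span_minimal[OF _ subg[OF g]])
      have "g r = r" using orth_radical[OF r(1) Bo[OF g]] .
      then have "g r \<in> ?A" by (simp add: span_base)
      moreover have "g (b j) \<in> ?A" if "j < i" for j
        using subsetD[OF FA subsetD[OF gF[OF g] imageI[OF bF[OF that]]]] .
      ultimately show "insert r (b ` {..<i}) \<subseteq> {v. g v \<in> ?A}" by blast
    qed
    then show ?thesis by blast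
  qed
  have gW: "g ` ?W \<subseteq> ?W" if g: "g \<in> B" for g
  proof safe
    fix z j assume z: "\<forall>j<i. bet (b j) z = 0" and j: "j < i"
    have "?F \<subseteq> {v. bet v z = 0}"
      using z by (intro span_minimal) (auto intro!: subspaceI)
    moreover have "inv_into UNIV g (b j) \<in> ?F"
      using subsetD[OF gF[OF subgroup_inv[OF Bsub g]] imageI[OF bF[OF j]]] .
    ultimately have "bet (inv_into UNIV g (b j)) z = 0" by blast
    then show "bet (b j) (g z) = 0"
      unfolding bet_sym[of "b j"] orth_bet_inv[OF Bo[OF g]] bet_sym[of z] .
  qed
  \<comment> \<open>Equality would let the i pairs together with \<open>r\<close> span the space,
    but 2i + 1 is less than 2n + 1.\<close>
  have "?A \<noteq> ?W"
  proof
    assume eq: "?A = ?W"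
    let ?S = "insert r (hfam i b f ` {..<2*i})"
    have "v \<in> span ?S" for v
    proof -
      have "bet (b j) (hproj i b f v) = 0" if "j < i" for j
        using hproj_perp(1)[OF h(1) that, of v] unfolding bet_sym[of "b j"] .
      then have "hproj i b f v \<in> ?A" unfolding eq by blast
      moreover have "?A \<subseteq> span ?S"
      proof (intro span_mono insert_mono image_subsetI)
        fix j assume "j \<in> {..<i}"
        then show "b j \<in> hfam i b f ` {..<2*i}"
          by (intro image_eqI[of _ _ j]) (auto simp: hfam_def)
      qed
      ultimately have 1: "hproj i b f v \<in> span ?S" by blast
      have "(\<Sum>k<2*i. s ((\<lambda>k. if k < i then bet v (f k) else bet v (b (k - i))) k) (hfam i b f k)) \<in> span ?S"
        by (intro span_sum span_scale span_base insertI2 imageI)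
      then have 2: "(\<Sum>j<i. s (bet v (f j)) (b j)) + (\<Sum>j<i. s (bet v (b j)) (f j)) \<in> span ?S"
        unfolding sum_hfam by simp
      have "v = hproj i b f v + ((\<Sum>j<i. s (bet v (f j)) (b j)) + (\<Sum>j<i. s (bet v (b j)) (f j)))"
        by (simp add: hproj_def add.assoc)
      with span_add[OF 1 2] show ?thesis by simp
    qed
    then have "dim (UNIV :: 'v set) \<le> card ?S" by (intro dim_le_card) auto
    also have "\<dots> \<le> Suc (card (hfam i b f ` {..<2*i}))" by (rule card_insert_le_m1) auto
    also have "\<dots> \<le> Suc (2*i)" using card_image_le[of "{..<2*i}" "hfam i b f"] by simp
    finally show False using i by (simp add: dim_space)
  qed
  with AW have "?A \<subset> ?W" by blast
  from Lie_Kolchin[OF Bsub Bcon k subspace_span gA subW gW this]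
  have "\<exists>w\<in>?W - ?A. \<forall>g\<in>B. \<exists>c. g w - s c w \<in> ?A" .
  then obtain w where w: "w \<in> ?W" "w \<notin> ?A" "\<forall>g\<in>B. \<exists>c. g w - s c w \<in> ?A" by blast
  \<comment> \<open>Since \<open>w\<close> is already orthogonal to the flag, \<open>hproj\<close>
    adds only flag vectors to it. Then a multiple of \<open>r\<close> cancels
    \<open>\<alpha> w1\<close>. Both changes stay in the class of \<open>w\<close> modulo
    \<open>?A\<close>.\<close>
  define w1 where "w1 = hproj i b f w"
  obtain y where y: "y\<^sup>2 = \<alpha> w1" using sqrt_ex by blast
  define u where "u = w1 + s y r"
  define a0 where "a0 = (\<Sum>j<i. s (bet w (f j)) (b j)) + s y r"
  have "bet w (b j) = 0" if "j < i" for j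
    using w(1) that unfolding bet_sym[of w] by blast
  then have ua0: "u = w + a0"
    by (simp add: u_def w1_def a0_def hproj_def add.assoc)
  have a0: "a0 \<in> ?A"
    unfolding a0_def by (intro span_add span_sum span_scale span_base) auto
  have uA: "u \<notin> ?A"
  proof
    assume "u \<in> ?A"
    then have "u + a0 \<in> ?A" using a0 by (rule span_add)
    with ua0 w(2) show False by (simp add: add.assoc)
  qed
  have u\<alpha>: "\<alpha> u = 0"
    using y bet_sym[of w1 r] by (simp add: u_def \<alpha>_add \<alpha>_scale r)
  have ub: "bet u (b l) = 0" "bet u (f l) = 0" if "l < i" for l
    using hproj_perp[OF h(1) that] by (simp_all add: u_def w1_def r)
  have ug: "g u \<in> span (insert u (b ` {..<i}))" if g: "g \<in> B" for g
  proof -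
    obtain c where c: "g w - s c w \<in> ?A" using w(3) g by blast
    have "g a0 \<in> ?A" using gA[OF g] a0 by blast
    then have "(g w - s c w) + (g a0 + s c a0) \<in> ?A"
      using c a0 by (intro span_add span_scale)
    moreover have "(g w - s c w) + (g a0 + s c a0) = g u + s c u"
      by (simp add: ua0 gl_add[OF Bgl[OF g]] scale_right_distrib add_ac)
    ultimately have "g u + s c u \<in> ?A" by simp
    then obtain d where d: "(g u + s c u) - s d r \<in> ?F" using span_breakdown_eq by blast
    define a where "a = (g u + s c u) - s d r"
    have gu: "g u = s c u + a + s d r"
      by (simp add: a_def add_ac)
    have aF: "a \<in> ?F" using d unfolding a_def .
    have "\<alpha> a = 0"
      using h(2) hyperbolicD(1)[OF h(1)] by (intro \<alpha>_span_isotropic[OF _ _ aF]) auto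
    moreover have "bet u a = 0"
    proof -
      have "?F \<subseteq> {v. bet u v = 0}" using ub by (intro span_minimal) (auto intro!: subspaceI)
      then show ?thesis using aF by blast
    qed
    \<comment> \<open>All other terms are singular and mutually orthogonal, so
      \<open>\<alpha>\<close> sees exactly the radical component. As g preserves
      \<open>\<alpha>\<close> and u is singular, that component vanishes.\<close>
    ultimately have "\<alpha> (g u) = d\<^sup>2"
      using bet_sym[of u r] bet_sym[of a r] by (simp add: gu \<alpha>_add \<alpha>_scale u\<alpha> r)
    then have "d = 0" using orthD(2)[OF Bo[OF g], of u] u\<alpha> by simp
    then have "g u = s c u + a" using gu by simp
    moreover have "a \<in> span (insert u (b ` {..<i}))"
      using aF span_mono[of "b ` {..<i}" "insert u (b ` {..<i})"] by blast
    ultimately show ?thesis by (simp add: span_add span_scale span_base)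
  qed
  have "\<exists>z. bet u z \<noteq> 0"
  proof (rule ccontr)
    assume "\<not> ?thesis"
    then have "u = 0" using nondeg[of u] u\<alpha> by blast
    with uA show False by (simp add: span_zero)
  qed
  then obtain z where z: "bet u z \<noteq> 0" by blast
  obtain f1 where
    f1: "bet u f1 = 1" "\<And>l. l < i \<Longrightarrow> bet f1 (b l) = 0" "\<And>l. l < i \<Longrightarrow> bet f1 (f l) = 0"
    using hyperbolic_extend[OF h(1) ub z] by blast
  \<comment> \<open>Adding c u to f1 changes \<open>\<alpha> f1\<close> by c, because
    \<open>bet u f1 = 1\<close> and u is singular; c = \<open>\<alpha> f1\<close> gives a singular
    partner.\<close>
  define f2 where "f2 = f1 + s (\<alpha> f1) u"
  have f2: "bet u f2 = 1" "\<And>l. l < i \<Longrightarrow> bet f2 (b l) = 0" "\<And>l. l < i \<Longrightarrow> bet f2 (f l) = 0" "\<alpha> f2 = 0"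
    using f1 ub bet_sym[of f1 u] by (simp_all add: f2_def \<alpha>_add \<alpha>_scale u\<alpha>)
  show ?thesis
  proof (intro exI conjI)
    show "hyperbolic (Suc i) (b(i := u)) (f(i := f2))"
      by (rule hyperbolic_Suc[OF h(1) ub f2(1-3)])
    show "\<forall>j<Suc i. \<alpha> ((b(i := u)) j) = 0 \<and> \<alpha> ((f(i := f2)) j) = 0"
      using h(2) u\<alpha> f2(4) by (simp add: less_Suc_eq)
    show "\<forall>g\<in>B. \<forall>j<Suc i. g ((b(i := u)) j) \<in> span ((b(i := u)) ` {..j})"
    proof (intro ballI allI impI)
      fix g j assume g: "g \<in> B" and j: "j < Suc i"
      show "g ((b(i := u)) j) \<in> span ((b(i := u)) ` {..j})"
      proof (cases "j = i")
        case True
        have "insert u (b ` {..<i}) \<subseteq> (b(i := u)) ` {..i}"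
          by (auto intro!: image_eqI)
        then have "span (insert u (b ` {..<i})) \<subseteq> span ((b(i := u)) ` {..i})" by (rule span_mono)
        then show ?thesis using ug[OF g] True by auto
      next
        case False
        then have "(b(i := u)) ` {..j} = b ` {..j}" using j by (intro image_cong) auto
        then show ?thesis using h(3) g j False by simp
      qed
    qed
  qed
qed

section \<open>Borel subgroups of the orthogonal group\<close>

abbreviation "co b \<equiv> coord {..2*n} b"

definition upper :: "(nat \<Rightarrow> 'v) \<Rightarrow> ('v \<Rightarrow> 'v) set" where
  "upper b = {g \<in> orth. \<forall>j\<le>2*n. \<forall>i\<le>2*n. j < i \<longrightarrow> co b i (g (b j)) = 0}"

lemma adaptedD:
  assumes "adapted b" "i \<le> 2*n"
  shows "j \<le> 2*n \<Longrightarrow> bet (b i) (b j) = of_bool (i + j = 2*n \<and> i \<noteq> j)" "\<alpha> (b i) = of_bool (i = n)"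
  using assms unfolding adapted_def by simp_all

lemma adapted_radical:
  assumes b: "adapted b" shows "bet (b n) v = 0" "bet v (b n) = 0"
proof -
  have "bet (b n) (\<Sum>i\<le>2*n. s (co b i v) (b i)) = 0"
    unfolding bet_sum2 using adaptedD(1)[OF b, of n] by (intro sum.neutral) auto
  then show "bet (b n) v = 0" unfolding sum_coord[OF adapted_ibasis[OF b]] .
  then show "bet v (b n) = 0" using bet_sym by simp
qed

lemma co_bet:
  assumes b: "adapted b" and i: "i \<le> 2*n" "i \<noteq> n"
  shows "co b i v = bet v (b (2*n - i))"
proof -
  have "bet (\<Sum>j\<le>2*n. s (co b j v) (b j)) (b (2*n - i)) = (\<Sum>j\<le>2*n. co b j v * of_bool (j = i))"
    unfolding bet_sum1 bet_simps using i adaptedD(1)[OF b]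
    by (intro sum.cong refl arg_cong2[of _ _ _ _ "(*)"]) auto
  also have "\<dots> = co b i v" using i by (simp only: sum_of_bool_eq finite_atMost) simp
  finally show ?thesis unfolding sum_coord[OF adapted_ibasis[OF b]] by simp
qed

lemma bet_coord:
  assumes b: "adapted b"
  shows "bet v w = (\<Sum>i\<in>{..2*n}-{n}. co b i v * co b (2*n - i) w)"
proof -
  have "bet v w = bet (\<Sum>i\<le>2*n. s (co b i v) (b i)) w"
    by (simp only: sum_coord[OF adapted_ibasis[OF b]])
  also have "\<dots> = (\<Sum>i\<le>2*n. co b i v * bet (b i) w)"
    by (simp add: bet_sum1)
  also have "\<dots> = (\<Sum>i\<in>{..2*n}-{n}. co b i v * bet (b i) w)"
    using adapted_radical[OF b] by (intro sum.mono_neutral_right) auto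
  also have "\<dots> = (\<Sum>i\<in>{..2*n}-{n}. co b i v * co b (2*n - i) w)"
  proof (intro sum.cong refl)
    fix i assume i: "i \<in> {..2*n}-{n}"
    then have "co b (2*n - i) w = bet w (b (2*n - (2*n - i)))"
      by (intro co_bet[OF b]) auto
    then show "co b i v * bet (b i) w = co b i v * co b (2*n - i) w"
      using i bet_sym[of w] by simp
  qed
  finally show ?thesis .
qed

lemma \<alpha>_coord:
  assumes b: "adapted b"
  shows "\<alpha> v = (co b n v)\<^sup>2 + (\<Sum>i<n. co b i v * co b (2*n - i) v)"
proof -
  let ?t = "\<lambda>i. s (co b i v) (b i)"
  have split: "{..2*n} = {..<n} \<union> {n<..2*n} \<union> {n}" by auto
  have "(\<Sum>i\<le>2*n. ?t i) = sum ?t {..<n} + sum ?t {n<..2*n} + ?t n"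
    unfolding split by (subst sum.union_disjoint; auto simp: add.commute)+
  then have v: "v = sum ?t {..<n} + sum ?t {n<..2*n} + ?t n"
    unfolding sum_coord[OF adapted_ibasis[OF b]] .
  have z: "\<alpha> (sum ?t {..<n}) = 0" "\<alpha> (sum ?t {n<..2*n}) = 0"
    using adaptedD[OF b] by (subst \<alpha>_sum_isotropic; auto simp: \<alpha>_scale intro!: sum.neutral)+
  have "bet (sum ?t {..<n}) (sum ?t {n<..2*n}) = (\<Sum>i<n. co b i v * bet (b i) (sum ?t {n<..2*n}))"
    by (simp add: bet_sum1)
  also have "\<dots> = (\<Sum>i<n. co b i v * co b (2*n - i) v)"
  proof (intro sum.cong refl arg_cong2[of _ _ _ _ "(*)"])
    fix i assume i: "i \<in> {..<n}"
    have "bet (b i) (sum ?t {n<..2*n}) = (\<Sum>j\<in>{n<..2*n}. co b j v * of_bool (j = 2*n - i))"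
      unfolding bet_sum2 bet_simps using i adaptedD(1)[OF b]
      by (intro sum.cong refl arg_cong2[of _ _ _ _ "(*)"]) auto
    also have "\<dots> = co b (2*n - i) v"
      using i by (simp only: sum_of_bool_eq finite_greaterThanAtMost) auto
    finally show "bet (b i) (sum ?t {n<..2*n}) = co b (2*n - i) v" .
  qed
  finally have c: "bet (sum ?t {..<n}) (sum ?t {n<..2*n}) = (\<Sum>i<n. co b i v * co b (2*n - i) v)" .
  have "\<alpha> v = \<alpha> (sum ?t {..<n} + sum ?t {n<..2*n} + ?t n)" using v by simp
  also have "\<dots> = (co b n v)\<^sup>2 + (\<Sum>i<n. co b i v * co b (2*n - i) v)"
    unfolding \<alpha>_add[of _ "?t n"] \<alpha>_add[of "sum ?t {..<n}"] z c
    using adapted_radical[OF b] adaptedD(2)[OF b, of n] by (simp add: \<alpha>_scale add.commute)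
  finally show ?thesis .
qed

text \<open>A kernel vector would lie in the radical and have value 0; nondegeneracy gives
  injectivity, and finite dimension gives surjectivity.\<close>

lemma orthI:
  assumes x: "x \<in> gl s" and \<alpha>: "\<And>v. \<alpha> (x v) = \<alpha> v" shows "x \<in> orth"
proof -
  have bet: "bet (x v) (x w) = bet v w" for v w
    by (simp add: polar_def \<alpha> flip: gl_add[OF x])
  have "v = 0" if "x v = 0" for v
  proof (rule nondeg)
    show "bet v w = 0" for w using bet[of v w] that by simp
    show "\<alpha> v = 0" using \<alpha>[of v] that by simp
  qed
  then have inj: "inj x"
    using gl_minus[OF x] by (intro injI) (metis right_minus_eq)
  moreover have "surj x"
    using x inj by (intro linear_inj_imp_surj) (auto simp: gl_def)
  ultimately show ?thesis
    using x \<alpha> by (simp add: orth_group_def GL_def bij_def)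
qed

lemma orth_basisI:
  assumes b: "ibasis I b" and x: "x \<in> gl s" and \<alpha>: "\<And>i. i \<in> I \<Longrightarrow> \<alpha> (x (b i)) = \<alpha> (b i)"
    and bet: "\<And>i j. i \<in> I \<Longrightarrow> j \<in> I \<Longrightarrow> bet (x (b i)) (x (b j)) = bet (b i) (b j)"
  shows "x \<in> orth"
proof (rule orthI[OF x])
  fix v
  have "\<alpha> (x (\<Sum>i\<in>J. s (c i) (b i))) = \<alpha> (\<Sum>i\<in>J. s (c i) (b i))" if "J \<subseteq> I" for c J
  proof -
    have "finite J" using b that by (auto simp: ibasis_def intro: finite_subset)
    then show ?thesis using that
    proof induction
      case (insert j J)
      have "bet (x (b j)) (x (\<Sum>i\<in>J. s (c i) (b i))) = bet (b j) (\<Sum>i\<in>J. s (c i) (b i))"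
        unfolding gl_sum[OF x] gl_scale[OF x] bet_sum2 bet_simps
        using insert bet by (intro sum.cong) auto
      then show ?case
        using insert \<alpha> by (simp add: gl_add[OF x] gl_scale[OF x] \<alpha>_add \<alpha>_scale)
    qed (simp add: gl_zero[OF x])
  qed
  from this[of I "\<lambda>i. coord I b i v"] show "\<alpha> (x v) = \<alpha> v"
    unfolding sum_coord[OF b] by simp
qed

theorem Borel_upper_subset:
  assumes B: "B \<subseteq> orth" "closed_connected_solvable s B"
  obtains b where "adapted b" "B \<subseteq> upper b"
proof -
  obtain r where r: "\<And>z. bet r z = 0" "\<alpha> r = 1" using radical_ex by blast
  have "\<exists>b f. hyperbolic i b f \<and> (\<forall>j<i. \<alpha> (b j) = 0 \<and> \<alpha> (f j) = 0) \<and>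
      (\<forall>g\<in>B. \<forall>j<i. g (b j) \<in> span (b ` {..j}))" if "i \<le> n" for i
    using that
  proof (induction i)
    case 0
    show ?case by (simp add: hyperbolic_def)
  next
    case (Suc i)
    then obtain b f where h: "hyperbolic i b f" "\<forall>j<i. \<alpha> (b j) = 0 \<and> \<alpha> (f j) = 0"
      "\<forall>g\<in>B. \<forall>j<i. g (b j) \<in> span (b ` {..j})" by auto
    have "i < n" using Suc by simp
    from flag_step[OF B this r h] show ?case .
  qed
  from this[OF order_refl] obtain b f where h: "hyperbolic n b f"
    and \<alpha>0: "\<forall>j<n. \<alpha> (b j) = 0 \<and> \<alpha> (f j) = 0"
    and st: "\<forall>g\<in>B. \<forall>j<n. g (b j) \<in> span (b ` {..j})" by blast
  \<comment> \<open>The partners \<open>f\<close> are appended in reverse order, so that k is paired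
    with 2n - k around the radical vector at n.\<close>
  define e where "e k = (if k < n then b k else if k = n then r else f (2*n - k))" for k
  have r': "bet z r = 0" for z using r(1)[of z] unfolding bet_sym[of r] .
  have ad: "adapted e"
    unfolding adapted_def
  proof (intro conjI allI impI)
    fix i j assume ij: "i \<le> 2*n" "j \<le> 2*n"
    consider "i < n" "j < n" | "i = n \<or> j = n" | "i < n" "j > n" | "i > n" "j < n" | "i > n" "j > n"
      by linarith
    then show "bet (e i) (e j) = of_bool (i + j = 2*n \<and> i \<noteq> j)"
    proof cases
      case 1 then show ?thesis using hyperbolicD(1)[OF h] by (simp add: e_def)
    next
      case 2 then show ?thesis using r(1) r' by (auto simp: e_def)
    next
      case 3 then show ?thesis using hyperbolicD(3)[OF h, of i "2*n - j"] ij by (auto simp: e_def)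
    next
      case 4 then show ?thesis using hyperbolicD(4)[OF h, of j "2*n - i"] ij by (auto simp: e_def)
    next
      case 5 then show ?thesis using hyperbolicD(2)[OF h, of "2*n - i" "2*n - j"] ij by (auto simp: e_def)
    qed
  next
    fix i assume "i \<le> 2*n"
    then show "\<alpha> (e i) = of_bool (i = n)" using \<alpha>0 r(2) by (simp add: e_def)
  qed
  have Bsub: "subgroup B (GL_group s)" using B(2) by (simp add: closed_connected_solvable_def)
  have "g \<in> upper e" if g: "g \<in> B" for g
    unfolding upper_def
  proof (intro CollectI conjI allI impI)
    show go: "g \<in> orth" using B(1) g by blast
    have low: "h (e j) \<in> span (e ` {..j})" if "h \<in> B" "j < n" for h j
    proof -
      have "e ` {..j} = b ` {..j}" using that by (intro image_cong) (auto simp: e_def)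
      then show ?thesis using st that by (simp add: e_def)
    qed
    fix j i assume ji: "j \<le> 2*n" "i \<le> 2*n" "j < i"
    consider "j < n" | "j = n" | "j > n" by linarith
    then show "co e i (g (e j)) = 0"
    proof cases
      case 1
      have "span (e ` {..j}) \<subseteq> {v. co e i v = 0}"
      proof (rule span_minimal)
        show "e ` {..j} \<subseteq> {v. co e i v = 0}"
          using ji by (auto simp: coord_basis[OF adapted_ibasis[OF ad]])
        show "subspace {v. co e i v = 0}"
          using linf_zero[OF linear_coord[OF adapted_ibasis[OF ad]]]
          by (intro subspaceI) (auto simp: coord_add[OF adapted_ibasis[OF ad]] coord_scale[OF adapted_ibasis[OF ad]])
      qed
      then show ?thesis using low[OF g 1] by blast
    next
      case 2
      then have "g (e j) = e j"
        using orth_radical[OF _ go, of "e j"] r(1) by (simp add: e_def)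
      then show ?thesis using ji by (simp add: coord_basis[OF adapted_ibasis[OF ad]])
    next
      case 3
      \<comment> \<open>The columns after the middle follow from those before it: pairing moves g to
        its inverse, which belongs to \<open>B\<close> and stabilizes the isotropic flag.\<close>
      let ?h = "inv_into UNIV g"
      have "co e i (g (e j)) = bet (g (e j)) (e (2*n - i))"
        using ji 3 by (intro co_bet[OF ad]) auto
      also have "\<dots> = bet (e j) (?h (e (2*n - i)))" by (rule orth_bet_inv[OF go])
      also have "\<dots> = 0"
      proof -
        have "span (e ` {..2*n - i}) \<subseteq> {v. bet (e j) v = 0}"
          using ji 3 adaptedD(1)[OF ad, of j] by (intro span_minimal) (auto intro!: subspaceI)
        moreover have "?h (e (2*n - i)) \<in> span (e ` {..2*n - i})"
          using ji 3 by (intro low subgroup_inv[OF Bsub g]) auto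
        ultimately show ?thesis by blast
      qed
      finally show ?thesis .
    qed
  qed
  then show thesis using that[OF ad] by blast
qed

end

text \<open>This is (x-1)(y-1) - (y-1)(x-1) = xy - yx evaluated at a vector.\<close>

lemma double_diff_cancel:
  fixes p :: "'a::ab_group_add"
  shows "((p - q) - (r - w)) - ((t - r) - (q - w)) = p - t"
  by (simp add: algebra_simps)

section \<open>The upper triangular group is closed, solvable and connected\<close>

context quad_space
begin

text \<open>The span of the first j vectors of \<open>b\<close>, encoded by vanishing coordinates:
  the zero space for j = 0 and the whole space for j = 2n + 1.\<close>

definition fl :: "(nat \<Rightarrow> 'v) \<Rightarrow> nat \<Rightarrow> 'v set" where
  "fl b j = {v. \<forall>i\<le>2*n. j \<le> i \<longrightarrow> co b i v = 0}"

lemma subspace_fl: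
  assumes b: "adapted b" shows "subspace (fl b j)"
  using linf_zero[OF linear_coord[OF adapted_ibasis[OF b]]]
  by (intro subspaceI) (auto simp: fl_def coord_add[OF adapted_ibasis[OF b]] coord_scale[OF adapted_ibasis[OF b]])

lemma fl_mono: "j \<le> k \<Longrightarrow> fl b j \<subseteq> fl b k"
  by (auto simp: fl_def)

lemma fl_0: assumes b: "adapted b" and v: "v \<in> fl b 0" shows "v = 0"
proof (rule coord_eqI[OF adapted_ibasis[OF b]])
  fix i assume "i \<in> {..2*n}"
  then show "co b i v = co b i 0"
    using v linf_zero[OF linear_coord[OF adapted_ibasis[OF b]]] by (simp add: fl_def)
qed

lemma upper_orth: "g \<in> upper b \<Longrightarrow> g \<in> orth"
  by (simp add: upper_def)

lemma upperD: "g \<in> upper b \<Longrightarrow> j \<le> 2*n \<Longrightarrow> i \<le> 2*n \<Longrightarrow> j < i \<Longrightarrow> co b i (g (b j)) = 0"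
  by (simp add: upper_def)

lemma co_apply:
  assumes b: "adapted b" and g: "g \<in> gl s"
  shows "co b i (g v) = (\<Sum>j\<le>2*n. co b j v * co b i (g (b j)))"
proof -
  note ib = adapted_ibasis[OF b]
  have "co b i (g v) = co b i (g (\<Sum>j\<le>2*n. s (co b j v) (b j)))"
    by (simp only: sum_coord[OF ib])
  then show ?thesis
    by (simp add: gl_sum[OF g] gl_scale[OF g] coord_sum[OF ib] coord_scale[OF ib])
qed

lemma upper_fl:
  assumes b: "adapted b" and g: "g \<in> upper b" and v: "v \<in> fl b j"
  shows "g v \<in> fl b j"
  unfolding fl_def
proof (intro CollectI allI impI)
  fix i assume i: "i \<le> 2*n" "j \<le> i"
  have "co b k v * co b i (g (b k)) = 0" if "k \<le> 2*n" for k
  proof (cases "j \<le> k")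
    case True
    then show ?thesis using v that by (simp add: fl_def)
  next
    case False
    then show ?thesis using upperD[OF g that i(1)] i by simp
  qed
  then show "co b i (g v) = 0"
    by (subst co_apply[OF b orth_gl[OF upper_orth[OF g]]]) (intro sum.neutral, simp)
qed

lemma upperI:
  assumes b: "adapted b" and g: "g \<in> orth" "\<And>j v. v \<in> fl b j \<Longrightarrow> g v \<in> fl b j"
  shows "g \<in> upper b"
  unfolding upper_def
proof (intro CollectI conjI allI impI g(1))
  fix j i assume "j \<le> 2*n" "i \<le> 2*n" "j < i"
  moreover from this have "b j \<in> fl b (Suc j)"
    by (auto simp: fl_def coord_basis[OF adapted_ibasis[OF b]])
  ultimately show "co b i (g (b j)) = 0" using g(2)[of "b j" "Suc j"] by (simp add: fl_def)
qed

text \<open>Off the middle row, coordinates are pairings and the adjunction between g and its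
  inverse applies. The coordinate at the radical vector is invisible to \<open>bet\<close>; it is
  recovered from \<open>\<alpha>\<close>, which reduces to its square once all later coordinates
  vanish.\<close>

lemma upper_inv:
  assumes b: "adapted b" and g: "g \<in> upper b" shows "inv_into UNIV g \<in> upper b"
  unfolding upper_def
proof (intro CollectI conjI allI impI)
  have go: "g \<in> orth" using g by (rule upper_orth)
  show "inv_into UNIV g \<in> orth" using go by (rule orth_inv)
  have main: "co b i (inv_into UNIV g (b j)) = 0" if ji: "j \<le> 2*n" "i \<le> 2*n" "j < i" "i \<noteq> n" for i j
  proof -
    have "co b i (inv_into UNIV g (b j)) = bet (inv_into UNIV g (b j)) (b (2*n - i))"
      using ji by (intro co_bet[OF b])
    also have "\<dots> = bet (g (b (2*n - i))) (b j)"
      unfolding orth_bet_inv[OF go] by (rule bet_sym)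
    also have "\<dots> = 0"
    proof (cases "j = n")
      case True
      then show ?thesis using adapted_radical[OF b] by simp
    next
      case False
      have "bet (g (b (2*n - i))) (b j) = co b (2*n - j) (g (b (2*n - i)))"
        using co_bet[OF b, of "2*n - j" "g (b (2*n - i))"] ji False by simp
      also have "\<dots> = 0" using ji by (intro upperD[OF g]) auto
      finally show ?thesis .
    qed
    finally show ?thesis .
  qed
  fix j i assume ji: "j \<le> 2*n" "i \<le> 2*n" "j < i"
  show "co b i (inv_into UNIV g (b j)) = 0"
  proof (cases "i = n")
    case False
    with main ji show ?thesis by blast
  next
    case True
    let ?v = "inv_into UNIV g (b j)"
    have "\<alpha> ?v = 0"
      using orthD(2)[OF orth_inv[OF go], of "b j"] adaptedD(2)[OF b, of j] ji True by simp
    moreover have "\<alpha> ?v = (co b n ?v)\<^sup>2"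
    proof -
      have "co b (2*n - k) ?v = 0" if "k < n" for k
        using that ji True by (intro main) auto
      then have "(\<Sum>k<n. co b k ?v * co b (2*n - k) ?v) = 0" by (intro sum.neutral) simp
      then show ?thesis unfolding \<alpha>_coord[OF b, of ?v] by simp
    qed
    ultimately show ?thesis using True by simp
  qed
qed

lemma upper_subgroup:
  assumes b: "adapted b" shows "subgroup (upper b) (GL_group s)"
proof (rule GLG.subgroupI)
  show "upper b \<subseteq> carrier (GL_group s)" using upper_orth orthD(1) by auto
  have "id \<in> upper b"
    by (intro upperI[OF b] orthI) (auto simp: gl_iff)
  then show "upper b \<noteq> {}" by blast
next
  fix g assume g: "g \<in> upper b"
  show "inv\<^bsub>GL_group s\<^esub> g \<in> upper b"
    using upper_inv[OF b g] orthD(1)[OF upper_orth[OF g]] by simp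
next
  fix g h assume gh: "g \<in> upper b" "h \<in> upper b"
  have "g \<circ> h \<in> upper b"
  proof (intro upperI[OF b] orthI)
    show "g \<circ> h \<in> gl s" using gh upper_orth orth_gl by (intro gl_comp) blast+
    show "\<alpha> ((g \<circ> h) v) = \<alpha> v" for v using gh[THEN upper_orth, THEN orthD(2)] by simp
    show "(g \<circ> h) v \<in> fl b j" if "v \<in> fl b j" for j v
      using upper_fl[OF b gh(1) upper_fl[OF b gh(2) that]] by simp
  qed
  then show "g \<otimes>\<^bsub>GL_group s\<^esub> h \<in> upper b" by simp
qed

lemma upper_closed:
  assumes b: "adapted b" shows "closedin (zariski s) (upper b)"
proof -
  note ib = adapted_ibasis[OF b]
  have 1: "(\<lambda>g. \<alpha> (g v) - \<alpha> v) \<in> poly_funs s" for v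
  proof -
    have "(\<lambda>g. (co b n (g v))\<^sup>2 + (\<Sum>i<n. co b i (g v) * co b (2*n - i) (g v)) - \<alpha> v) \<in> poly_funs s"
      by (intro pf_diff poly_funs.const poly_funs.add pf_power pf_sum poly_funs.mult
          poly_funs.coefficient linear_coord[OF ib])
    then show ?thesis by (simp only: \<alpha>_coord[OF b])
  qed
  have "closedin (zariski s) {g \<in> GL s. \<forall>v\<in>UNIV. \<alpha> (g v) - \<alpha> v = 0}"
    using 1 by (intro closedin_zariski_all)
  moreover have "closedin (zariski s) {g \<in> GL s.
      \<forall>p\<in>{(i, j). j \<le> 2*n \<and> i \<le> 2*n \<and> j < i}. (case p of (i, j) \<Rightarrow> co b i (g (b j))) = 0}"
    using poly_funs.coefficient[OF linear_coord[OF ib]]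
    by (intro closedin_zariski_all) auto
  ultimately have "closedin (zariski s) ({g \<in> GL s. \<forall>v\<in>UNIV. \<alpha> (g v) - \<alpha> v = 0} \<inter> {g \<in> GL s.
      \<forall>p\<in>{(i, j). j \<le> 2*n \<and> i \<le> 2*n \<and> j < i}. (case p of (i, j) \<Rightarrow> co b i (g (b j))) = 0})"
    by (rule closedin_Int)
  moreover have "{g \<in> GL s. \<forall>v\<in>UNIV. \<alpha> (g v) - \<alpha> v = 0} \<inter> {g \<in> GL s.
      \<forall>p\<in>{(i, j). j \<le> 2*n \<and> i \<le> 2*n \<and> j < i}. (case p of (i, j) \<Rightarrow> co b i (g (b j))) = 0} = upper b"
    unfolding upper_def orth_group_def by auto
  ultimately show ?thesis by simp
qed

text \<open>Elements for which g - 1 lowers the flag by k steps: all of \<open>upper b\<close> for k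
  = 0, the unipotent ones for k = 1. This filtration bounds the derived series.\<close>

definition usub :: "(nat \<Rightarrow> 'v) \<Rightarrow> nat \<Rightarrow> ('v \<Rightarrow> 'v) set" where
  "usub b k = {g \<in> upper b. \<forall>j\<le>2*n+1. \<forall>v\<in>fl b j. g v - v \<in> fl b (j - k)}"

lemma usub_subgroup:
  assumes b: "adapted b" shows "subgroup (usub b k) (GL_group s)"
proof (rule GLG.subgroupI)
  note U = upper_subgroup[OF b] and sub = subspace_fl[OF b]
  show "usub b k \<subseteq> carrier (GL_group s)"
    unfolding usub_def using subgroup.subset[OF U] by blast
  have "id \<in> usub b k" using subgroup_id[OF U] subspace_0[OF sub] by (simp add: usub_def)
  then show "usub b k \<noteq> {}" by blast
  fix g assume g: "g \<in> usub b k"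
  then have gu: "g \<in> upper b" by (simp add: usub_def)
  have gGL: "g \<in> GL s" using subgroup_GL[OF U gu] .
  have iu: "inv_into UNIV g \<in> upper b" using upper_inv[OF b gu] .
  have "inv_into UNIV g \<in> usub b k"
    unfolding usub_def
  proof (intro CollectI conjI allI impI ballI iu)
    fix j v assume j: "j \<le> 2*n+1" and v: "v \<in> fl b j"
    have "g v - v \<in> fl b (j - k)" using g j v by (simp add: usub_def)
    then have "inv_into UNIV g (g v - v) \<in> fl b (j - k)" by (rule upper_fl[OF b iu])
    then have "v - inv_into UNIV g v \<in> fl b (j - k)"
      using gGL by (simp only: gl_minus[OF GL_gl[OF GL_inv[OF gGL]]] GL_inv_app)
    then have "- (v - inv_into UNIV g v) \<in> fl b (j - k)" by (rule subspace_neg[OF sub])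
    then show "inv_into UNIV g v - v \<in> fl b (j - k)" by (simp add: add.commute)
  qed
  then show "inv\<^bsub>GL_group s\<^esub> g \<in> usub b k" using gGL by simp
next
  note U = upper_subgroup[OF b] and sub = subspace_fl[OF b]
  fix g h assume g: "g \<in> usub b k" and h: "h \<in> usub b k"
  then have gu: "g \<in> upper b" "h \<in> upper b" by (simp_all add: usub_def)
  have "g \<circ> h \<in> usub b k"
    unfolding usub_def
  proof (intro CollectI conjI allI impI ballI)
    show "g \<circ> h \<in> upper b" using subgroup_comp[OF U gu] .
    fix j v assume j: "j \<le> 2*n+1" and v: "v \<in> fl b j"
    have "h v - v \<in> fl b (j - k)" "g (h v) - h v \<in> fl b (j - k)"
      using g h j v upper_fl[OF b gu(2) v] by (simp_all add: usub_def)
    then have "(g (h v) - h v) + (h v - v) \<in> fl b (j - k)" by (intro subspace_add[OF sub])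
    then show "(g \<circ> h) v - v \<in> fl b (j - k)" by (simp add: add.assoc)
  qed
  then show "g \<otimes>\<^bsub>GL_group s\<^esub> h \<in> usub b k" by simp
qed

lemma upper_diag_commute:
  assumes b: "adapted b" and x: "x \<in> upper b" and y: "y \<in> upper b" and u: "u \<in> fl b j" and j: "j \<le> 2*n+1"
  shows "x (y u) - y (x u) \<in> fl b (j - 1)"
proof (cases "j = 0")
  case True
  then have "u = 0" using fl_0[OF b] u by simp
  then show ?thesis
    using subspace_0[OF subspace_fl[OF b]] x y
    by (simp add: gl_zero[OF orth_gl[OF upper_orth]])
next
  case False
  have diag: "co b (j - 1) (g w) = co b (j - 1) w * co b (j - 1) (g (b (j - 1)))"
    if g: "g \<in> upper b" and w: "w \<in> fl b j" for g w
  proof -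
    have "co b (j - 1) (g w) = (\<Sum>k\<in>{j - 1}. co b k w * co b (j - 1) (g (b k)))"
    proof (subst co_apply[OF b orth_gl[OF upper_orth[OF g]]], intro sum.mono_neutral_right ballI)
      fix k assume k: "k \<in> {..2*n} - {j - 1}"
      show "co b k w * co b (j - 1) (g (b k)) = 0"
      proof (cases "k < j - 1")
        case True
        then show ?thesis using upperD[OF g, of k "j - 1"] j k by simp
      next
        case F: False
        then have "j \<le> k" using k False by auto
        then show ?thesis using w k by (simp add: fl_def)
      qed
    qed (use j in auto)
    then show ?thesis by simp
  qed
  have 1: "co b (j - 1) (x (y u) - y (x u)) = 0"
  proof -
    define X Y where "X = co b (j - 1) (x (b (j - 1)))" and "Y = co b (j - 1) (y (b (j - 1)))"
    have "co b (j - 1) (x (y u)) = co b (j - 1) (y u) * X"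
      unfolding X_def by (rule diag[OF x upper_fl[OF b y u]])
    also have "co b (j - 1) (y u) = co b (j - 1) u * Y"
      unfolding Y_def by (rule diag[OF y u])
    also have "co b (j - 1) u * Y * X = co b (j - 1) u * X * Y" by (simp only: mult.assoc mult.commute[of X Y])
    also have "co b (j - 1) u * X = co b (j - 1) (x u)"
      unfolding X_def by (rule diag[OF x u, symmetric])
    also have "co b (j - 1) (x u) * Y = co b (j - 1) (y (x u))"
      unfolding Y_def by (rule diag[OF y upper_fl[OF b x u], symmetric])
    finally have eq: "co b (j - 1) (x (y u)) = co b (j - 1) (y (x u))" .
    show ?thesis unfolding diff_v coord_add[OF adapted_ibasis[OF b]] eq by (rule add_self)
  qed
  have 2: "x (y u) - y (x u) \<in> fl b j"
    by (rule subspace_diff[OF subspace_fl[OF b] upper_fl[OF b x upper_fl[OF b y u]]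
          upper_fl[OF b y upper_fl[OF b x u]]])
  show ?thesis
    unfolding fl_def
  proof (intro CollectI allI impI)
    fix i assume "i \<le> 2*n" "j - 1 \<le> i"
    then show "co b i (x (y u) - y (x u)) = 0"
      using 1 2 by (cases "i = j - 1") (auto simp: fl_def)
  qed
qed

text \<open>For k = 0 the diagonal entries commute. For k > 0 the commutator xy - yx equals that of
  x - 1 and y - 1, whose products lower the flag by 2k, which is at least k + 1.\<close>

lemma usub_commute:
  assumes b: "adapted b" and x: "x \<in> usub b k" and y: "y \<in> usub b k" and u: "u \<in> fl b j" and j: "j \<le> 2*n+1"
  shows "x (y u) - y (x u) \<in> fl b (j - Suc k)"
proof -
  have xu: "x \<in> upper b" and yu: "y \<in> upper b" using x y by (simp_all add: usub_def)
  show ?thesis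
  proof (cases k)
    case 0
    then show ?thesis using upper_diag_commute[OF b xu yu u j] by simp
  next
    case (Suc k')
    have *: "g (h u - u) - (h u - u) \<in> fl b (j - Suc k)"
      if "g \<in> usub b k" "h \<in> usub b k" for g h
    proof -
      have "h u - u \<in> fl b (j - k)" using that u j by (simp add: usub_def)
      moreover have "\<forall>j\<le>2*n+1. \<forall>v\<in>fl b j. g v - v \<in> fl b (j - k)"
        using that(1) unfolding usub_def by blast
      moreover have "j - k \<le> 2*n+1" using j by simp
      ultimately have "g (h u - u) - (h u - u) \<in> fl b (j - k - k)" by blast
      moreover have "fl b (j - k - k) \<subseteq> fl b (j - Suc k)" using Suc by (intro fl_mono) simp
      ultimately show ?thesis by blast
    qed
    have a: "x (y u - u) = x (y u) - x u" "y (x u - u) = y (x u) - y u"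
      by (rule gl_minus[OF orth_gl[OF upper_orth[OF xu]]] gl_minus[OF orth_gl[OF upper_orth[OF yu]]])+
    have "(x (y u - u) - (y u - u)) - (y (x u - u) - (x u - u)) \<in> fl b (j - Suc k)"
      by (rule subspace_diff[OF subspace_fl[OF b] *[OF x y] *[OF y x]])
    then show ?thesis by (simp only: a double_diff_cancel)
  qed
qed

lemma derived_usub:
  assumes b: "adapted b" shows "derived (GL_group s) (usub b k) \<subseteq> usub b (Suc k)"
  unfolding derived_def
proof (rule GLG.generate_subgroup_incl[OF subsetI usub_subgroup[OF b]])
  note U = upper_subgroup[OF b]
  fix z assume "z \<in> derived_set (GL_group s) (usub b k)"
  then obtain x y where xy: "x \<in> usub b k" "y \<in> usub b k"
    and z: "z = x \<otimes>\<^bsub>GL_group s\<^esub> y \<otimes>\<^bsub>GL_group s\<^esub> inv\<^bsub>GL_group s\<^esub> x \<otimes>\<^bsub>GL_group s\<^esub> inv\<^bsub>GL_group s\<^esub> y"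
    by (elim UN_E singletonE)
  have xyu: "x \<in> upper b" "y \<in> upper b" using xy by (simp_all add: usub_def)
  have xyGL: "x \<in> GL s" "y \<in> GL s" using subgroup_GL[OF U] xyu by auto
  let ?c = "x \<circ> y \<circ> inv_into UNIV x \<circ> inv_into UNIV y"
  have "?c \<in> usub b (Suc k)"
    unfolding usub_def
  proof (intro CollectI conjI allI impI ballI)
    show "?c \<in> upper b"
      by (intro subgroup_comp[OF U] subgroup_inv[OF U] xyu)
    fix j v assume j: "j \<le> 2*n+1" and v: "v \<in> fl b j"
    \<comment> \<open>With u the image of v under the inverse of yx, the commutator satisfies [x, y]
      v - v = (xy - yx) u.\<close>
    let ?u = "inv_into UNIV x (inv_into UNIV y v)"
    have "?u \<in> fl b j"
      by (rule upper_fl[OF b upper_inv[OF b xyu(1)] upper_fl[OF b upper_inv[OF b xyu(2)] v]])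
    from usub_commute[OF b xy this j] show "?c v - v \<in> fl b (j - Suc k)"
      using xyGL by simp
  qed
  then show "z \<in> usub b (Suc k)"
    unfolding z GL_simps GL_inv_eq[OF xyGL(1)] GL_inv_eq[OF xyGL(2)] .
qed

lemma upper_solvable:
  assumes b: "adapted b" shows "solvable (GL_group s\<lparr>carrier := upper b\<rparr>)"
proof -
  note U = upper_subgroup[OF b]
  interpret G: group "GL_group s\<lparr>carrier := upper b\<rparr>"
    using GLG.subgroup_imp_group[OF U] .
  have "upper b = usub b 0"
    unfolding usub_def using subspace_diff[OF subspace_fl[OF b]] upper_fl[OF b] by auto
  have "(derived (GL_group s) ^^ k) (upper b) \<subseteq> usub b k" for k
  proof (induction k)
    case 0
    show ?case using \<open>upper b = usub b 0\<close> by simp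
  next
    case (Suc k)
    have "derived (GL_group s) ((derived (GL_group s) ^^ k) (upper b)) \<subseteq> derived (GL_group s) (usub b k)"
      by (rule GLG.mono_derived[OF Suc])
    also have "\<dots> \<subseteq> usub b (Suc k)" by (rule derived_usub[OF b])
    finally show ?case by simp
  qed
  moreover have "usub b (2*n+1) \<subseteq> {id}"
  proof
    fix g assume g: "g \<in> usub b (2*n+1)"
    have "g v = v" for v
    proof -
      have "v \<in> fl b (2*n+1)" by (auto simp: fl_def)
      then have "g v - v \<in> fl b ((2*n+1) - (2*n+1))" using g unfolding usub_def by blast
      then have "g v - v = 0" by (intro fl_0[OF b]) simp
      then show ?thesis by simp
    qed
    then show "g \<in> {id}" by auto
  qed
  ultimately have "(derived (GL_group s) ^^ (2*n+1)) (upper b) \<subseteq> {id}" by blast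
  moreover have "id \<in> (derived (GL_group s) ^^ (2*n+1)) (upper b)"
    by (intro subgroup_id GLG.exp_of_derived_is_subgroup U)
  ultimately have "(derived (GL_group s) ^^ (2*n+1)) (upper b) = {id}" by blast
  then have "(derived (GL_group s\<lparr>carrier := upper b\<rparr>) ^^ (2*n+1)) (upper b) = {\<one>\<^bsub>GL_group s\<lparr>carrier := upper b\<rparr>\<^esub>}"
    using exp_derived_consistent[OF U, of "2*n+1"] by simp
  then show ?thesis
    unfolding solvable_def
    using G.trivial_derived_seq_imp_solvable[OF G.subgroup_self, of "2*n+1"] by simp
qed

text \<open>Conjugation by the one-parameter torus with weights \<open>n, n-1, \<dots>, -n\<close> contracts an upper
  triangular element to its diagonal part.\<close>

definition contract :: "(nat \<Rightarrow> 'v) \<Rightarrow> ('v \<Rightarrow> 'v) \<Rightarrow> 'k \<Rightarrow> 'v \<Rightarrow> 'v" where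
  "contract b g t = lift {..2*n} b (\<lambda>j. \<Sum>i\<le>2*n. s (t ^ (j - i) * co b i (g (b j))) (b i))"

lemma co_lift:
  assumes b: "adapted b" and i: "i \<le> 2*n" and j: "j \<le> 2*n"
  shows "co b i (lift {..2*n} b (\<lambda>j. \<Sum>i\<le>2*n. s (c i j) (b i)) (b j)) = c i j"
proof -
  have "lift {..2*n} b (\<lambda>j. \<Sum>i\<le>2*n. s (c i j) (b i)) (b j) = (\<Sum>i\<le>2*n. s (c i j) (b i))"
    using j by (intro lift_basis[OF adapted_ibasis[OF b]]) simp
  then show ?thesis
    using coord_unique[OF adapted_ibasis[OF b], of i "\<lambda>i. c i j"] i by simp
qed

lemma lift_gl: "adapted b \<Longrightarrow> lift {..2*n} b t \<in> gl s"
  unfolding gl_def using linear_lift[OF adapted_ibasis] by simp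

lemma co_contract:
  assumes "adapted b" "i \<le> 2*n" "j \<le> 2*n"
  shows "co b i (contract b g t (b j)) = t ^ (j - i) * co b i (g (b j))"
  unfolding contract_def by (rule co_lift[OF assms])

lemma contract_bet:
  assumes b: "adapted b" and g: "g \<in> upper b" and jl: "j \<le> 2*n" "l \<le> 2*n"
  shows "bet (contract b g t (b j)) (contract b g t (b l)) = t ^ (j + l - 2*n) * bet (g (b j)) (g (b l))"
  unfolding bet_coord[OF b] sum_distrib_left
proof (intro sum.cong refl)
  fix i assume i: "i \<in> {..2*n} - {n}"
  let ?a = "co b i (g (b j))" and ?c = "co b (2*n - i) (g (b l))"
  have "co b i (contract b g t (b j)) * co b (2*n - i) (contract b g t (b l))
    = (t ^ (j - i) * ?a) * (t ^ (l - (2*n - i)) * ?c)"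
    using i jl by (simp add: co_contract[OF b])
  also have "\<dots> = t ^ (j + l - 2*n) * (?a * ?c)"
  proof (cases "i \<le> j \<and> 2*n - i \<le> l")
    case True
    then have "j + l - 2*n = (j - i) + (l - (2*n - i))" using i by auto
    then show ?thesis by (simp only: power_add mult_ac)
  next
    case False
    then have "?a = 0 \<or> ?c = 0" using upperD[OF g jl(1), of i] upperD[OF g jl(2), of "2*n - i"] i by auto
    then show ?thesis by auto
  qed
  finally show "co b i (contract b g t (b j)) * co b (2*n - i) (contract b g t (b l))
    = t ^ (j + l - 2*n) * (?a * ?c)" .
qed

lemma contract_\<alpha>:
  assumes b: "adapted b" and g: "g \<in> upper b" and j: "j \<le> 2*n"
  shows "\<alpha> (contract b g t (b j)) = t ^ (2 * (j - n)) * \<alpha> (g (b j))"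
proof -
  let ?x = "contract b g t (b j)" and ?y = "g (b j)"
  have 1: "(co b n ?x)\<^sup>2 = t ^ (2 * (j - n)) * (co b n ?y)\<^sup>2"
    unfolding co_contract[OF b le_add1[of n n, folded mult_2] j] power_mult_distrib power_mult[symmetric]
    by (simp only: mult.commute[of "j - n" 2])
  have 2: "co b i ?x * co b (2*n - i) ?x = t ^ (2 * (j - n)) * (co b i ?y * co b (2*n - i) ?y)"
    if i: "i < n" for i
  proof -
    have "co b i ?x * co b (2*n - i) ?x
      = (t ^ (j - i) * co b i ?y) * (t ^ (j - (2*n - i)) * co b (2*n - i) ?y)"
      using i j by (simp add: co_contract[OF b])
    also have "\<dots> = t ^ (2 * (j - n)) * (co b i ?y * co b (2*n - i) ?y)"
    proof (cases "2*n - i \<le> j")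
      case True
      then have "2 * (j - n) = (j - i) + (j - (2*n - i))" using i by simp
      then show ?thesis by (simp only: power_add mult_ac)
    next
      case False
      then have "co b (2*n - i) ?y = 0" using upperD[OF g j, of "2*n - i"] by auto
      then show ?thesis by simp
    qed
    finally show ?thesis .
  qed
  have "(\<Sum>i<n. co b i ?x * co b (2*n - i) ?x)
    = t ^ (2 * (j - n)) * (\<Sum>i<n. co b i ?y * co b (2*n - i) ?y)"
    unfolding sum_distrib_left by (intro sum.cong refl 2) simp
  with 1 show ?thesis
    by (simp only: \<alpha>_coord[OF b, of ?x] \<alpha>_coord[OF b, of ?y] distrib_left)
qed

lemma contract_upper:
  assumes b: "adapted b" and g: "g \<in> upper b" shows "contract b g t \<in> upper b"
  unfolding upper_def
proof (intro CollectI conjI allI impI)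
  have go: "g \<in> orth" using g by (rule upper_orth)
  show "contract b g t \<in> orth"
  proof (rule orth_basisI[OF adapted_ibasis[OF b]])
    show "contract b g t \<in> gl s" unfolding contract_def by (rule lift_gl[OF b])
    show "\<alpha> (contract b g t (b i)) = \<alpha> (b i)" if "i \<in> {..2*n}" for i
      using that adaptedD(2)[OF b, of i] by (simp add: contract_\<alpha>[OF b g] orthD(2)[OF go])
    show "bet (contract b g t (b i)) (contract b g t (b j)) = bet (b i) (b j)"
      if "i \<in> {..2*n}" "j \<in> {..2*n}" for i j
      using that adaptedD(1)[OF b, of i j] by (auto simp: contract_bet[OF b g] orth_bet[OF go])
  qed
  fix j i assume "j \<le> 2*n" "i \<le> 2*n" "j < i"
  then show "co b i (contract b g t (b j)) = 0"
    using upperD[OF g] by (simp add: co_contract[OF b])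
qed

lemma gl_eq_basis:
  assumes "adapted b" "x \<in> gl s" "y \<in> gl s" "\<And>j. j \<le> 2*n \<Longrightarrow> x (b j) = y (b j)"
  shows "x = y"
  using linear_eq_on_ibasis[OF adapted_ibasis[OF assms(1)], of s x y] assms(2-4)
  by (auto simp: gl_def)

lemma contract_1:
  assumes b: "adapted b" and g: "g \<in> upper b" shows "contract b g 1 = g"
proof (rule gl_eq_basis[OF b])
  show "contract b g 1 \<in> gl s" unfolding contract_def by (rule lift_gl[OF b])
  show "g \<in> gl s" using orth_gl[OF upper_orth[OF g]] .
  fix j assume "j \<le> 2*n"
  then show "contract b g 1 (b j) = g (b j)"
    by (intro coord_eqI[OF adapted_ibasis[OF b]]) (simp add: co_contract[OF b])
qed

lemma contract_0:
  assumes b: "adapted b" and g: "g \<in> upper b" and j: "j \<le> 2*n"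
  shows "contract b g 0 (b j) = s (co b j (g (b j))) (b j)"
proof (rule coord_eqI[OF adapted_ibasis[OF b]])
  fix i assume i: "i \<in> {..2*n}"
  have "i = j \<or> i < j \<or> j < i" by auto
  then show "co b i (contract b g 0 (b j)) = co b i (s (co b j (g (b j))) (b j))"
    using i j upperD[OF g, of j i]
    by (auto simp: co_contract[OF b] coord_scale[OF adapted_ibasis[OF b]] coord_basis[OF adapted_ibasis[OF b]])
qed

lemma contract_connected:
  assumes b: "adapted b" and g: "g \<in> upper b"
  shows "connectedin (zariski s) (range (contract b g))"
proof (rule rational_curve_connected)
  show "contract b g t \<in> GL s" for t using orthD(1)[OF upper_orth[OF contract_upper[OF b g]]] .
  fix \<phi> :: "'v \<Rightarrow> 'k" and v assume \<phi>: "linf \<phi>"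
  let ?p = "\<Sum>j\<le>2*n. \<Sum>i\<le>2*n. monom (co b j v * (co b i (g (b j)) * \<phi> (b i))) (j - i)"
  have "\<phi> (contract b g t v) = poly ?p t" for t
    unfolding contract_def lift_def
    by (simp add: linf_sum[OF \<phi>] linf_scale[OF \<phi>] poly_sum poly_monom sum_distrib_left mult_ac)
  then show "\<exists>p q. \<forall>t\<in>UNIV. poly q t \<noteq> 0 \<and> \<phi> (contract b g t v) * poly q t = poly p t"
    by (intro exI[of _ ?p] exI[of _ 1]) simp
qed simp

text \<open>In each coordinate before the middle this is the line from 1 at t = 0 to
  \<open>d j\<close> at t = 1, with 1 - d written as 1 + d; the mirrored coordinate is its inverse.
  The curve is rational and defined off finitely many t.\<close>

definition torus_curve :: "(nat \<Rightarrow> 'v) \<Rightarrow> (nat \<Rightarrow> 'k) \<Rightarrow> 'k \<Rightarrow> 'v \<Rightarrow> 'v" where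
  "torus_curve b d t = lift {..2*n} b (\<lambda>j. s (if j < n then 1 + t * (d j + 1) else if j = n then 1
     else inverse (1 + t * (d (2*n - j) + 1))) (b j))"

lemma torus_curve_basis:
  assumes "adapted b" "j \<le> 2*n"
  shows "torus_curve b d t (b j) = s (if j < n then 1 + t * (d j + 1) else if j = n then 1
     else inverse (1 + t * (d (2*n - j) + 1))) (b j)"
  unfolding torus_curve_def using assms by (subst lift_basis[OF adapted_ibasis]) simp_all

lemma torus_curve_upper:
  assumes b: "adapted b" and t: "\<forall>j<n. 1 + t * (d j + 1) \<noteq> 0"
  shows "torus_curve b d t \<in> upper b"
  unfolding upper_def
proof (intro CollectI conjI allI impI)
  note tb = torus_curve_basis[OF b]
  show "torus_curve b d t \<in> orth"
  proof (rule orth_basisI[OF adapted_ibasis[OF b]])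
    show "torus_curve b d t \<in> gl s" unfolding torus_curve_def by (rule lift_gl[OF b])
    show "\<alpha> (torus_curve b d t (b i)) = \<alpha> (b i)" if "i \<in> {..2*n}" for i
      using that adaptedD(2)[OF b, of i] by (auto simp: tb \<alpha>_scale)
    show "bet (torus_curve b d t (b i)) (torus_curve b d t (b j)) = bet (b i) (b j)"
      if "i \<in> {..2*n}" "j \<in> {..2*n}" for i j
    proof (cases "i + j = 2*n \<and> i \<noteq> j")
      case True
      then have "i < n \<and> j > n \<and> 2*n - j = i \<or> j < n \<and> i > n \<and> 2*n - i = j" by auto
      with that t show ?thesis by (auto simp: tb)
    next
      case False
      then have "bet (b i) (b j) = 0" using that adaptedD(1)[OF b, of i j] by simp
      with that show ?thesis by (simp add: tb)
    qed
  qed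
  fix j i assume "j \<le> 2*n" "i \<le> 2*n" "j < i"
  then show "co b i (torus_curve b d t (b j)) = 0"
    by (simp add: tb coord_scale[OF adapted_ibasis[OF b]] coord_basis[OF adapted_ibasis[OF b]])
qed

lemma torus_connected:
  assumes b: "adapted b"
  shows "connectedin (zariski s) (torus_curve b d ` {t. \<forall>j<n. 1 + t * (d j + 1) \<noteq> 0})"
proof (rule rational_curve_connected)
  let ?S = "{t. \<forall>j<n. 1 + t * (d j + 1) \<noteq> 0}"
  let ?c = "\<lambda>j. [:1, d j + 1:]"
  let ?q = "prod ?c {..<n}"
  have pc: "poly (?c j) t = 1 + t * (d j + 1)" for j t by simp
  have "finite {t. poly ?q t = 0}" by (rule poly_roots_finite) simp
  moreover have "- ?S \<subseteq> {t. poly ?q t = 0}"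
    unfolding poly_prod pc by (auto intro!: prod_zero)
  ultimately show "finite (- ?S)" by (rule finite_subset[rotated])
  show "torus_curve b d t \<in> GL s" if "t \<in> ?S" for t
    using that by (intro orthD(1)[OF upper_orth[OF torus_curve_upper[OF b]]]) blast
  fix \<phi> :: "'v \<Rightarrow> 'k" and v assume \<phi>: "linf \<phi>"
  \<comment> \<open>The product \<open>?q\<close> of all denominators turns the diagonal entry at j
    into the polynomial \<open>?r j\<close>.\<close>
  let ?r = "\<lambda>j. if j < n then ?c j * ?q else if j = n then ?q else prod ?c ({..<n} - {2*n - j})"
  let ?p = "\<Sum>j\<le>2*n. Polynomial.smult (co b j v * \<phi> (b j)) (?r j)"
  have r: "(if j < n then 1 + t * (d j + 1) else if j = n then 1
     else inverse (1 + t * (d (2*n - j) + 1))) * poly ?q t = poly (?r j) t" if t: "t \<in> ?S" and j: "j \<le> 2*n" for t j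
  proof (cases "j \<le> n")
    case True
    show ?thesis
    proof (cases "j = n")
      case False
      with True have jn: "j < n" by simp
      show ?thesis unfolding if_P[OF jn] poly_mult pc ..
    qed simp
  next
    case False
    then have "2*n - j < n" using j by simp
    then have "?q = ?c (2*n - j) * prod ?c ({..<n} - {2*n - j})"
      by (intro prod.remove) auto
    then have "poly ?q t = (1 + t * (d (2*n - j) + 1)) * poly (prod ?c ({..<n} - {2*n - j})) t"
      by (simp only: poly_mult pc)
    moreover have "1 + t * (d (2*n - j) + 1) \<noteq> 0" using t \<open>2*n - j < n\<close> by blast
    ultimately show ?thesis using False by simp
  qed
  have val: "\<phi> (torus_curve b d t v) * poly ?q t = poly ?p t" if t: "t \<in> ?S" for t
  proof -
    let ?w = "\<lambda>j. (if j < n then 1 + t * (d j + 1) else if j = n then 1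
     else inverse (1 + t * (d (2*n - j) + 1)))"
    have "\<phi> (torus_curve b d t v) * poly ?q t = (\<Sum>j\<le>2*n. (co b j v * \<phi> (b j)) * (?w j * poly ?q t))"
      unfolding torus_curve_def lift_def linf_sum[OF \<phi>] linf_scale[OF \<phi>] sum_distrib_right
      by (intro sum.cong refl) (simp only: mult_ac)
    also have "\<dots> = (\<Sum>j\<le>2*n. (co b j v * \<phi> (b j)) * poly (?r j) t)"
      using r[OF t] by (intro sum.cong refl arg_cong2[of _ _ _ _ "(*)"]) simp
    also have "\<dots> = poly ?p t" by (simp only: poly_sum poly_smult)
    finally show ?thesis .
  qed
  have "poly ?q t \<noteq> 0" if "t \<in> ?S" for t
    unfolding poly_prod pc using that by (simp add: prod_zero_iff)
  with val have "\<forall>t\<in>?S. poly ?q t \<noteq> 0 \<and> \<phi> (torus_curve b d t v) * poly ?q t = poly ?p t"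
    by (intro ballI conjI)
  then show "\<exists>p q. \<forall>t\<in>?S. poly q t \<noteq> 0 \<and> \<phi> (torus_curve b d t v) * poly q t = poly p t"
    by (intro exI)
qed

text \<open>Two curves meet: contraction joins g to its diagonal part, and a torus curve joins the
  diagonal part to the identity.\<close>

lemma upper_connected:
  assumes b: "adapted b" shows "connectedin (zariski s) (upper b)"
proof (rule connectedin_id_Union)
  fix g assume g: "g \<in> upper b"
  note ib = adapted_ibasis[OF b]
  define d where "d j = co b j (g (b j))" for j
  let ?S = "{t. \<forall>j<n. 1 + t * (d j + 1) \<noteq> 0}"
  let ?h = "contract b g 0"
  have hu: "?h \<in> upper b" by (rule contract_upper[OF b g])
  have hb: "?h (b j) = s (d j) (b j)" if "j \<le> 2*n" for j
    unfolding d_def by (rule contract_0[OF b g that])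
  have dd: "d j * d (2*n - j) = 1" if "j < n" for j
  proof -
    have "j \<noteq> 2*n - j" "j \<le> 2*n" using that by auto
    then have 1: "bet (b j) (b (2*n - j)) = 1" using adaptedD(1)[OF b, of j "2*n - j"] by simp
    have "bet (s (d j) (b j)) (s (d (2*n - j)) (b (2*n - j))) = bet (b j) (b (2*n - j))"
      using orth_bet[OF upper_orth[OF hu], of "b j" "b (2*n - j)"] hb[of j] hb[of "2*n - j"] that by simp
    then show ?thesis by (simp add: 1 mult.commute[of "d (2*n - j)" "d j"])
  qed
  have dn: "d n = 1"
  proof -
    have "(d n)\<^sup>2 = 1\<^sup>2"
      using orthD(2)[OF upper_orth[OF hu], of "b n"] hb[of n] adaptedD(2)[OF b, of n] by (simp add: \<alpha>_scale)
    then show ?thesis by (simp only: sq_eq)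
  qed
  have 0: "torus_curve b d 0 = id"
  proof (rule gl_eq_basis[OF b])
    show "torus_curve b d 0 \<in> gl s" unfolding torus_curve_def by (rule lift_gl[OF b])
    show "id \<in> gl s" by (simp add: gl_iff)
    show "torus_curve b d 0 (b j) = id (b j)" if "j \<le> 2*n" for j
      unfolding torus_curve_basis[OF b that] by simp
  qed
  have 1: "torus_curve b d 1 = ?h"
  proof (rule gl_eq_basis[OF b])
    show "torus_curve b d 1 \<in> gl s" "?h \<in> gl s"
      unfolding torus_curve_def contract_def by (rule lift_gl[OF b])+
    fix j assume j: "j \<le> 2*n"
    have one: "1 + 1 * (d i + 1) = d i" for i by (simp add: add.commute)
    have "inverse (d (2*n - j)) = d j" if "n < j"
      using dd[of "2*n - j"] that j by (simp add: inverse_unique)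
    then have "(if j < n then d j else if j = n then 1 else inverse (d (2*n - j))) = d j"
      using dn by auto
    then show "torus_curve b d 1 (b j) = ?h (b j)"
      unfolding torus_curve_basis[OF b j] hb[OF j] one by simp
  qed
  have S: "0 \<in> ?S" "1 \<in> ?S"
  proof -
    have "d j \<noteq> 0" if "j < n" for j using dd[OF that] by auto
    then show "1 \<in> ?S" by (simp add: add.commute)
  qed simp
  have "connectedin (zariski s) (range (contract b g) \<union> torus_curve b d ` ?S)"
  proof (rule connectedin_Un[OF contract_connected[OF b g] torus_connected[OF b]])
    show "range (contract b g) \<inter> torus_curve b d ` ?S \<noteq> {}"
    proof -
      have "?h \<in> torus_curve b d ` ?S" unfolding 1[symmetric] by (rule imageI[OF S(2)])
      moreover have "?h \<in> range (contract b g)" by (rule rangeI)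
      ultimately show ?thesis by (simp only: disjoint_iff) blast
    qed
  qed
  moreover have "id \<in> torus_curve b d ` ?S" unfolding 0[symmetric] by (rule imageI[OF S(1)])
  moreover have "contract b g 1 \<in> range (contract b g)" by (rule rangeI)
  then have "g \<in> range (contract b g)" unfolding contract_1[OF b g] .
  moreover note this
  moreover have "range (contract b g) \<union> torus_curve b d ` ?S \<subseteq> upper b"
  proof (intro Un_least image_subsetI)
    show "contract b g t \<in> upper b" for t by (rule contract_upper[OF b g])
    show "torus_curve b d t \<in> upper b" if "t \<in> ?S" for t
      using that by (intro torus_curve_upper[OF b]) blast
  qed
  ultimately show "\<exists>T. connectedin (zariski s) T \<and> id \<in> T \<and> g \<in> T \<and> T \<subseteq> upper b"
    by (intro exI[of _ "range (contract b g) \<union> torus_curve b d ` ?S"] conjI UnI1 UnI2)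
next
  show "upper b \<noteq> {}" using subgroup_id[OF upper_subgroup[OF b]] by blast
qed

text \<open>\<open>upper b\<close> is itself closed, connected and solvable, so maximality turns the
  inclusion into equality.\<close>

theorem Borel_eq_upper:
  assumes "borel_subgroup s orth B" shows "\<exists>b. adapted b \<and> B = upper b"
proof -
  have *: "B \<subseteq> orth \<and> closed_connected_solvable s B \<and>
    (\<forall>H. B \<subseteq> H \<and> H \<subseteq> orth \<and> closed_connected_solvable s H \<longrightarrow> H = B)"
    using assms unfolding borel_subgroup_def .
  note B = *[THEN conjunct1] *[THEN conjunct2, THEN conjunct1]
    *[THEN conjunct2, THEN conjunct2, THEN spec, THEN mp]
  obtain b where b: "adapted b" "B \<subseteq> upper b" by (rule Borel_upper_subset[OF B(1,2)])
  have "closed_connected_solvable s (upper b)"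
    unfolding closed_connected_solvable_def
    using upper_subgroup[OF b(1)] upper_closed[OF b(1)] upper_connected[OF b(1)]
      upper_solvable[OF b(1)] by simp
  moreover have "upper b \<subseteq> orth" using upper_orth by blast
  ultimately have "upper b = B" using b(2) by (intro B(3) conjI)
  with b(1) show ?thesis by (intro exI[of _ b]) simp
qed

section \<open>The trace and the Lie algebra\<close>

lemma ibasis_extend: "ibasis (extend_basis {}) id"
  by (simp add: ibasis_def finite_Basis independent_Basis span_Basis)

lemma trace_ibasis:
  assumes f: "ibasis I f" and x: "x \<in> gl s"
  shows "lin_trace s x = (\<Sum>i\<in>I. coord I f i (x (f i)))"
proof -
  let ?E = "extend_basis {}"
  let ?c = "coord ?E id"
  have "lin_trace s x = (\<Sum>e\<in>?E. ?c e (x e))"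
    by (simp add: lin_trace_def coord_def Let_def)
  also have "\<dots> = (\<Sum>e\<in>?E. \<Sum>i\<in>I. coord I f i e * ?c e (x (f i)))"
  proof (intro sum.cong refl)
    fix e assume "e \<in> ?E"
    have "?c e (x e) = ?c e (x (\<Sum>i\<in>I. s (coord I f i e) (f i)))"
      by (simp only: sum_coord[OF f])
    then show "?c e (x e) = (\<Sum>i\<in>I. coord I f i e * ?c e (x (f i)))"
      by (simp only: gl_sum[OF x] gl_scale[OF x] coord_sum[OF ibasis_extend] coord_scale[OF ibasis_extend])
  qed
  also have "\<dots> = (\<Sum>i\<in>I. \<Sum>e\<in>?E. coord I f i e * ?c e (x (f i)))"
    by (rule sum.swap)
  also have "\<dots> = (\<Sum>i\<in>I. coord I f i (\<Sum>e\<in>?E. s (?c e (x (f i))) (id e)))"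
    by (simp only: coord_sum[OF f] coord_scale[OF f] id_apply mult.commute)
  also have "\<dots> = (\<Sum>i\<in>I. coord I f i (x (f i)))"
    by (simp only: sum_coord[OF ibasis_extend])
  finally show ?thesis .
qed

lemma trace_rank1:
  assumes \<phi>: "linf \<phi>" shows "lin_trace s (\<lambda>v. s (\<phi> v) w) = \<phi> w"
proof -
  let ?E = "extend_basis {}"
  have "(\<lambda>v. s (\<phi> v) w) \<in> gl s"
    by (simp add: gl_iff linf_add[OF \<phi>] linf_scale[OF \<phi>] scale_left_distrib)
  then have "lin_trace s (\<lambda>v. s (\<phi> v) w) = (\<Sum>e\<in>?E. \<phi> e * coord ?E id e w)"
    by (simp add: trace_ibasis[OF ibasis_extend] coord_scale[OF ibasis_extend])
  also have "\<dots> = \<phi> (\<Sum>e\<in>?E. s (coord ?E id e w) (id e))"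
    by (simp add: linf_sum[OF \<phi>] linf_scale[OF \<phi>] mult.commute)
  also have "\<dots> = \<phi> w" by (simp only: sum_coord[OF ibasis_extend])
  finally show ?thesis .
qed

lemma gl_plus: "x \<in> gl s \<Longrightarrow> y \<in> gl s \<Longrightarrow> (\<lambda>v. x v + y v) \<in> gl s"
  by (simp add: gl_iff scale_right_distrib add_ac)

lemma gl_smult: "x \<in> gl s \<Longrightarrow> (\<lambda>v. s c (x v)) \<in> gl s"
  by (simp add: gl_iff scale_right_distrib scale_left_commute)

lemma trace_add: "x \<in> gl s \<Longrightarrow> y \<in> gl s \<Longrightarrow> lin_trace s (\<lambda>v. x v + y v) = lin_trace s x + lin_trace s y"
  by (simp add: trace_ibasis[OF ibasis_extend] gl_plus coord_add[OF ibasis_extend] sum.distrib)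

lemma trace_scale: "x \<in> gl s \<Longrightarrow> lin_trace s (\<lambda>v. s c (x v)) = c * lin_trace s x"
  by (simp add: trace_ibasis[OF ibasis_extend] gl_smult coord_scale[OF ibasis_extend] sum_distrib_left)

lemma trace_comp:
  assumes f: "ibasis I f" and x: "x \<in> gl s" and y: "y \<in> gl s"
  shows "lin_trace s (x \<circ> y) = (\<Sum>i\<in>I. \<Sum>j\<in>I. coord I f j (y (f i)) * coord I f i (x (f j)))"
  unfolding trace_ibasis[OF f gl_comp[OF x y]]
proof (intro sum.cong refl)
  fix i assume "i \<in> I"
  have "(x \<circ> y) (f i) = x (\<Sum>j\<in>I. s (coord I f j (y (f i))) (f j))"
    by (simp only: sum_coord[OF f] o_apply)
  then show "coord I f i ((x \<circ> y) (f i)) = (\<Sum>j\<in>I. coord I f j (y (f i)) * coord I f i (x (f j)))"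
    by (simp only: gl_sum[OF x] gl_scale[OF x] coord_sum[OF f] coord_scale[OF f])
qed

lemma trace_comm:
  assumes x: "x \<in> gl s" and y: "y \<in> gl s"
  shows "lin_trace s (x \<circ> y) = lin_trace s (y \<circ> x)"
proof -
  let ?E = "extend_basis {}"
  have "lin_trace s (x \<circ> y) = (\<Sum>i\<in>?E. \<Sum>j\<in>?E. coord ?E id j (y (id i)) * coord ?E id i (x (id j)))"
    by (rule trace_comp[OF ibasis_extend x y])
  also have "\<dots> = (\<Sum>j\<in>?E. \<Sum>i\<in>?E. coord ?E id j (y (id i)) * coord ?E id i (x (id j)))"
    by (rule sum.swap)
  also have "\<dots> = lin_trace s (y \<circ> x)"
    unfolding trace_comp[OF ibasis_extend y x] by (simp only: mult.commute)
  finally show ?thesis .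
qed

text \<open>The element of the Lie algebra attached to the bivector of a and c. Functionals are
  studied through their values on these elements.\<close>

definition xel :: "'v \<Rightarrow> 'v \<Rightarrow> 'v \<Rightarrow> 'v" where
  "xel a c v = s (bet v a) c + s (bet v c) a"

lemma xel_gl: "xel a c \<in> gl s"
  by (simp add: gl_iff xel_def scale_left_distrib scale_right_distrib add_ac)

lemma xel_sym: "xel a c = xel c a"
  by (rule ext) (simp add: xel_def add.commute)

lemma xel_self: "xel a a = (\<lambda>v. 0)"
  by (rule ext) (simp add: xel_def)

text \<open>The endomorphism is a sum of two rank-one maps. The right-hand side is the defining
  expression of \<open>beta_xi\<close>, which shows why it does not depend on
  \<open>X\<close>.\<close>

lemma trace_xel:
  assumes X: "X \<in> gl s" shows "lin_trace s (X \<circ> xel a c) = bet (X a) c + bet a (X c)"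
proof -
  have lin: "linf (\<lambda>v. bet v a)" "linf (\<lambda>v. bet v c)" by (rule bet_linear1)+
  have gl: "(\<lambda>v. s (bet v a) (X c)) \<in> gl s" "(\<lambda>v. s (bet v c) (X a)) \<in> gl s"
    by (simp_all add: gl_iff scale_left_distrib)
  have "X \<circ> xel a c = (\<lambda>v. s (bet v a) (X c) + s (bet v c) (X a))"
    by (rule ext) (simp add: xel_def gl_add[OF X] gl_scale[OF X])
  then have "lin_trace s (X \<circ> xel a c) = bet (X c) a + bet (X a) c"
    by (simp only: trace_add[OF gl] trace_rank1[OF lin(1)] trace_rank1[OF lin(2)])
  then show ?thesis by (simp add: bet_sym[of a] add.commute)
qed

section \<open>The orthogonal Lie algebra and tangent vectors of the upper triangular group\<close>

abbreviation "olie \<equiv> orth_lie s \<alpha>"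

lemma xel_olie: "xel a c \<in> olie"
proof -
  have "lin_trace s (xel a c) = 0"
    using trace_xel[of id a c] by (simp add: gl_iff)
  then show ?thesis
    using bet_sym[of c] bet_sym[of a] by (simp add: orth_lie_def xel_gl xel_def mult.commute)
qed

lemma olieD:
  assumes "x \<in> olie"
  shows "x \<in> gl s" "bet (x v) v = 0" "lin_trace s x = 0"
  using assms by (simp_all add: orth_lie_def)

lemma olie_sym:
  assumes x: "x \<in> olie" shows "bet (x v) w = bet (x w) v"
proof -
  have "bet (x (v + w)) (v + w) = 0" by (rule olieD(2)[OF x])
  then have "bet (x v) w + bet (x w) v = 0"
    using olieD(2)[OF x] by (simp add: gl_add[OF olieD(1)[OF x]])
  then show ?thesis by simp
qed

lemma olie_add: "x \<in> olie \<Longrightarrow> y \<in> olie \<Longrightarrow> (\<lambda>v. x v + y v) \<in> olie"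
  by (simp add: orth_lie_def gl_plus trace_add)

lemma olie_smult: "x \<in> olie \<Longrightarrow> (\<lambda>v. s c (x v)) \<in> olie"
  by (simp add: orth_lie_def gl_smult trace_scale)

text \<open>The entry is a linear function vanishing on the group, so its differential is the entry
  itself.\<close>

lemma lie_upper:
  assumes b: "adapted b" and x: "x \<in> lie_algebra s (upper b)" and ij: "j \<le> 2*n" "i \<le> 2*n" "j < i"
  shows "co b i (x (b j)) = 0"
proof -
  let ?f = "\<lambda>x. co b i (x (b j))"
  have f: "?f \<in> poly_funs s" by (rule poly_funs.coefficient[OF linear_coord[OF adapted_ibasis[OF b]]])
  have z: "\<forall>h\<in>upper b. ?f h = 0" using upperD[OF _ ij] by blast
  have 1: "?f (\<lambda>v. v + s t (x v)) = poly [:0, co b i (x (b j)):] t" for t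
    using ij by (simp add: coord_add[OF adapted_ibasis[OF b]] coord_scale[OF adapted_ibasis[OF b]]
        coord_basis[OF adapted_ibasis[OF b]])
  have "\<forall>f\<in>poly_funs s. (\<forall>h\<in>upper b. f h = 0) \<longrightarrow>
        (\<forall>p. (\<forall>t. f (\<lambda>v. v + s t (x v)) = poly p t) \<longrightarrow> poly (pderiv p) 0 = 0)"
    using x unfolding lie_algebra_def by blast
  from this[THEN bspec, OF f, THEN mp, OF z, THEN spec, of "[:0, co b i (x (b j)):]"]
  show ?thesis using 1 by (simp add: pderiv_pCons)
qed

lemma poly_zero_cofinite:
  assumes "\<And>t::'k. t \<notin> A \<Longrightarrow> poly p t = 0" "finite A" shows "p = 0"
proof (rule ccontr)
  assume "p \<noteq> 0"
  then have "finite ({t. poly p t = 0} \<union> A)" using poly_roots_finite assms(2) by blast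
  moreover have "UNIV \<subseteq> {t. poly p t = 0} \<union> A" using assms(1) by blast
  ultimately show False using infinite_alg_closed finite_subset by blast
qed

text \<open>The hypothesis says that the curve is 1 + t x modulo t^2, with denominator 1 + t at
  most. Induction over \<open>poly_funs\<close> carries this expansion to f along the curve,
  multiplied by a power of 1 + t.\<close>

lemma curve_lie:
  assumes x: "x \<in> gl s" and \<gamma>: "\<And>t. 1 + t \<noteq> 0 \<Longrightarrow> \<gamma> t \<in> S"
    and coeff: "\<And>\<phi> v. linf \<phi> \<Longrightarrow> \<exists>r. \<forall>t. 1 + t \<noteq> 0 \<longrightarrow>
      \<phi> (\<gamma> t v) * (1 + t) = (\<phi> v + t * \<phi> (x v)) * (1 + t) + t * (t * poly r t)"
  shows "x \<in> lie_algebra s S"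
proof -
  let ?L = "[:1, 1:] :: 'k poly" and ?Z = "[:0, 0, 1:] :: 'k poly"
  have main: "\<exists>p N r. (\<forall>t. f (\<lambda>v. v + s t (x v)) = poly p t) \<and>
      (\<forall>t. 1 + t \<noteq> 0 \<longrightarrow> f (\<gamma> t) * (1 + t) ^ N = poly (p * ?L ^ N + ?Z * r) t)"
    if "f \<in> poly_funs s" for f
    using that
  proof induction
    case (const c)
    show ?case by (rule exI[of _ "[:c:]"], rule exI[of _ 0], rule exI[of _ 0]) simp
  next
    case (coefficient \<phi> v)
    obtain r where r: "\<forall>t. 1 + t \<noteq> 0 \<longrightarrow>
      \<phi> (\<gamma> t v) * (1 + t) = (\<phi> v + t * \<phi> (x v)) * (1 + t) + t * (t * poly r t)"
      using coeff[OF coefficient] by blast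
    show ?case
    proof (rule exI[of _ "[:\<phi> v, \<phi> (x v):]"], rule exI[of _ 1], rule exI[of _ r], intro conjI allI impI)
      show "\<phi> (v + s t (x v)) = poly [:\<phi> v, \<phi> (x v):] t" for t
        by (simp add: linf_add[OF coefficient] linf_scale[OF coefficient])
      fix t assume t: "1 + t \<noteq> (0::'k)"
      have "poly ([:\<phi> v, \<phi> (x v):] * ?L ^ 1 + ?Z * r) t
        = (\<phi> v + t * \<phi> (x v)) * (1 + t) + t * (t * poly r t)"
        by (simp add: algebra_simps)
      then show "\<phi> (\<gamma> t v) * (1 + t) ^ 1 = poly ([:\<phi> v, \<phi> (x v):] * ?L ^ 1 + ?Z * r) t"
        using r t by simp
    qed
  next
    case (add f h)
    obtain p1 N1 r1 where 1: "\<forall>t. f (\<lambda>v. v + s t (x v)) = poly p1 t"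
      "\<forall>t. 1 + t \<noteq> 0 \<longrightarrow> f (\<gamma> t) * (1 + t) ^ N1 = poly (p1 * ?L ^ N1 + ?Z * r1) t"
      using add.IH(1) by blast
    obtain p2 N2 r2 where 2: "\<forall>t. h (\<lambda>v. v + s t (x v)) = poly p2 t"
      "\<forall>t. 1 + t \<noteq> 0 \<longrightarrow> h (\<gamma> t) * (1 + t) ^ N2 = poly (p2 * ?L ^ N2 + ?Z * r2) t"
      using add.IH(2) by blast
    show ?case
    proof (rule exI[of _ "p1 + p2"], rule exI[of _ "N1 + N2"],
        rule exI[of _ "r1 * ?L ^ N2 + r2 * ?L ^ N1"], intro conjI allI impI)
      show "f (\<lambda>v. v + s t (x v)) + h (\<lambda>v. v + s t (x v)) = poly (p1 + p2) t" for t
        using 1(1) 2(1) by simp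
      fix t assume t: "1 + t \<noteq> (0::'k)"
      have L: "poly ?L t = 1 + t" by simp
      have "(f (\<gamma> t) + h (\<gamma> t)) * (1 + t) ^ (N1 + N2)
        = (f (\<gamma> t) * (1 + t) ^ N1) * (1 + t) ^ N2 + (h (\<gamma> t) * (1 + t) ^ N2) * (1 + t) ^ N1"
        by (simp only: power_add distrib_left distrib_right mult_ac)
      also have "\<dots> = poly (p1 * ?L ^ N1 + ?Z * r1) t * poly (?L ^ N2) t
          + poly (p2 * ?L ^ N2 + ?Z * r2) t * poly (?L ^ N1) t"
        unfolding 1(2)[rule_format, OF t] 2(2)[rule_format, OF t] poly_power L ..
      also have "\<dots> = poly ((p1 * ?L ^ N1 + ?Z * r1) * ?L ^ N2 + (p2 * ?L ^ N2 + ?Z * r2) * ?L ^ N1) t"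
        by (simp only: poly_mult poly_add)
      also have "(p1 * ?L ^ N1 + ?Z * r1) * ?L ^ N2 + (p2 * ?L ^ N2 + ?Z * r2) * ?L ^ N1
        = (p1 + p2) * ?L ^ (N1 + N2) + ?Z * (r1 * ?L ^ N2 + r2 * ?L ^ N1)"
        by (simp only: power_add distrib_right distrib_left mult_ac add_ac)
      finally show "(f (\<gamma> t) + h (\<gamma> t)) * (1 + t) ^ (N1 + N2)
        = poly ((p1 + p2) * ?L ^ (N1 + N2) + ?Z * (r1 * ?L ^ N2 + r2 * ?L ^ N1)) t" .
    qed
  next
    case (mult f h)
    obtain p1 N1 r1 where 1: "\<forall>t. f (\<lambda>v. v + s t (x v)) = poly p1 t"
      "\<forall>t. 1 + t \<noteq> 0 \<longrightarrow> f (\<gamma> t) * (1 + t) ^ N1 = poly (p1 * ?L ^ N1 + ?Z * r1) t"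
      using mult.IH(1) by blast
    obtain p2 N2 r2 where 2: "\<forall>t. h (\<lambda>v. v + s t (x v)) = poly p2 t"
      "\<forall>t. 1 + t \<noteq> 0 \<longrightarrow> h (\<gamma> t) * (1 + t) ^ N2 = poly (p2 * ?L ^ N2 + ?Z * r2) t"
      using mult.IH(2) by blast
    let ?r = "r1 * (p2 * ?L ^ N2) + p1 * ?L ^ N1 * r2 + ?Z * r1 * r2"
    show ?case
    proof (rule exI[of _ "p1 * p2"], rule exI[of _ "N1 + N2"], rule exI[of _ ?r], intro conjI allI impI)
      show "f (\<lambda>v. v + s t (x v)) * h (\<lambda>v. v + s t (x v)) = poly (p1 * p2) t" for t
        using 1(1) 2(1) by simp
      fix t assume t: "1 + t \<noteq> (0::'k)"
      have "(f (\<gamma> t) * h (\<gamma> t)) * (1 + t) ^ (N1 + N2)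
        = (f (\<gamma> t) * (1 + t) ^ N1) * (h (\<gamma> t) * (1 + t) ^ N2)"
        by (simp only: power_add mult_ac)
      also have "\<dots> = poly ((p1 * ?L ^ N1 + ?Z * r1) * (p2 * ?L ^ N2 + ?Z * r2)) t"
        unfolding 1(2)[rule_format, OF t] 2(2)[rule_format, OF t] poly_mult ..
      also have "(p1 * ?L ^ N1 + ?Z * r1) * (p2 * ?L ^ N2 + ?Z * r2) = p1 * p2 * ?L ^ (N1 + N2) + ?Z * ?r"
        by (simp only: power_add distrib_right distrib_left mult_ac add_ac)
      finally show "(f (\<gamma> t) * h (\<gamma> t)) * (1 + t) ^ (N1 + N2)
        = poly (p1 * p2 * ?L ^ (N1 + N2) + ?Z * ?r) t" .
    qed
  qed
  show ?thesis
    unfolding lie_algebra_def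
  proof (intro CollectI conjI ballI allI impI x)
    fix f p assume f: "f \<in> poly_funs s" and z: "\<forall>h\<in>S. f h = 0"
      and p: "\<forall>t. f (\<lambda>v. v + s t (x v)) = poly p t"
    obtain p1 N r where 1: "\<forall>t. f (\<lambda>v. v + s t (x v)) = poly p1 t"
      "\<forall>t. 1 + t \<noteq> 0 \<longrightarrow> f (\<gamma> t) * (1 + t) ^ N = poly (p1 * ?L ^ N + ?Z * r) t"
      using main[OF f] by blast
    have "p - p1 = 0"
      using p 1(1) by (intro poly_zero_cofinite[of "{}"]) simp_all
    then have pp: "p1 = p" by simp
    \<comment> \<open>This polynomial vanishes for every t other than 1, hence identically. Its
      value and its derivative at 0 give first p(0) = 0 and then p'(0) = 0, because the remainder
      carries the factor t^2.\<close>
    have q0: "p * ?L ^ N + ?Z * r = 0"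
    proof (rule poly_zero_cofinite[of "{1}"])
      fix t :: 'k assume "t \<notin> {1}"
      then have t: "1 + t \<noteq> 0" by auto
      then have "f (\<gamma> t) = 0" using z \<gamma> by blast
      then show "poly (p * ?L ^ N + ?Z * r) t = 0" using 1(2) t pp by auto
    qed simp
    have "poly (p * ?L ^ N + ?Z * r) 0 = 0" unfolding q0 by simp
    then have p0: "poly p 0 = 0" by simp
    have "poly (pderiv (p * ?L ^ N + ?Z * r)) 0 = 0" unfolding q0 by simp
    then show "poly (pderiv p) 0 = 0"
      by (simp add: pderiv_add pderiv_mult p0 pderiv_pCons)
  qed
qed

text \<open>A curve in the group is exhibited for each kind of pair: a torus curve for i + j = 2n, a
  root subgroup with quadratic correction when the radical vector is involved, and 1 + t x
  otherwise.\<close>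

lemma xel_lie:
  assumes b: "adapted b" and ij: "i + j \<le> 2*n"
  shows "xel (b i) (b j) \<in> lie_algebra s (upper b)"
proof -
  note ib = adapted_ibasis[OF b]
  have main: "xel (b i) (b j) \<in> lie_algebra s (upper b)" if ij: "i + j \<le> 2*n" "i < j" for i j
  proof -
    have i: "i < n" "i \<le> 2*n" and j: "j \<le> 2*n" using ij by auto
    have \<alpha>i: "\<alpha> (b i) = 0" and \<alpha>j: "\<alpha> (b j) = of_bool (j = n)"
      using adaptedD(2)[OF b] i j by auto
    have up: "bet (b m) (b l) = 0" if "m \<le> 2*n" "l \<le> 2*n" "m + l < 2*n" for m l
      using adaptedD(1)[OF b that(1,2)] that(3) by simp
    consider "i + j = 2*n" | "i + j < 2*n" "j = n" | "i + j < 2*n" "j \<noteq> n" using ij by linarith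
    then show ?thesis
    proof cases
      case 1
      then have jn: "j \<noteq> n" and bij: "bet (b i) (b j) = 1" "bet (b j) (b i) = 1"
        using i adaptedD(1)[OF b] j by auto
      \<comment> \<open>The torus element that scales \<open>b i\<close> by 1 + t and
        \<open>b j\<close> by the inverse, since 1 + t / (1 + t) = 1 / (1 + t) in characteristic
        2.\<close>
      let ?\<gamma> = "\<lambda>t v. v + (s (t * bet v (b j)) (b i) + s (t * inverse (1 + t) * bet v (b i)) (b j))"
      show ?thesis
      proof (rule curve_lie[OF xel_gl, where \<gamma> = ?\<gamma>])
        fix t :: 'k assume t: "1 + t \<noteq> 0"
        show "?\<gamma> t \<in> upper b"
          unfolding upper_def
        proof (intro CollectI conjI allI impI orthI)
          show "?\<gamma> t \<in> gl s"
            by (simp add: gl_iff scale_right_distrib scale_left_distrib distrib_left add_ac mult_ac)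
          fix v
          let ?x = "bet v (b i)" and ?y = "bet v (b j)"
          have "\<alpha> (?\<gamma> t v) = \<alpha> v + (t * inverse (1 + t) * ?x * (t * ?y)
              + (t * ?y * ?x + t * inverse (1 + t) * ?x * ?y))"
            using \<alpha>i \<alpha>j jn bij by (simp add: \<alpha>_add \<alpha>_scale add_ac mult_ac)
          also have "t * inverse (1 + t) * ?x * (t * ?y) + (t * ?y * ?x + t * inverse (1 + t) * ?x * ?y)
            = t * ?x * ?y * (inverse (1 + t) * (1 + t) + 1)"
            by (simp only: distrib_left distrib_right mult_1_left mult_1_right mult_ac add_ac)
          also have "\<dots> = 0" using t by simp
          finally show "\<alpha> (?\<gamma> t v) = \<alpha> v" by simp
        next
          fix m l assume ml: "m \<le> 2*n" "l \<le> 2*n" "m < l"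
          have "bet (b m) (b j) = 0 \<or> co b l (b i) = 0"
            using adaptedD(1)[OF b ml(1) j] 1 ml i coord_basis[OF ib, of l i] by auto
          moreover have "bet (b m) (b i) = 0 \<or> co b l (b j) = 0"
            using adaptedD(1)[OF b ml(1) i(2)] 1 ml j coord_basis[OF ib, of l j] by auto
          ultimately show "co b l (?\<gamma> t (b m)) = 0"
            using ml coord_basis[OF ib, of l m] by (auto simp: coord_add[OF ib] coord_scale[OF ib])
        qed
      next
        fix \<phi> :: "'v \<Rightarrow> 'k" and v assume \<phi>: "linf \<phi>"
        let ?x = "bet v (b i)" and ?y = "bet v (b j)"
        have "\<phi> (?\<gamma> t v) * (1 + t) = (\<phi> v + t * \<phi> (xel (b i) (b j) v)) * (1 + t)
            + t * (t * poly [:?x * \<phi> (b j):] t)" if t: "1 + t \<noteq> 0" for t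
        proof -
          have "\<phi> (?\<gamma> t v) * (1 + t) = \<phi> v * (1 + t) + t * ?y * \<phi> (b i) * (1 + t)
              + t * ?x * \<phi> (b j) * (inverse (1 + t) * (1 + t))"
            by (simp only: linf_add[OF \<phi>] linf_scale[OF \<phi>] distrib_left distrib_right mult_ac add_ac
                mult_1_left mult_1_right)
          also have "inverse (1 + t) * (1 + t) = 1" using t by simp
          also have "\<phi> v * (1 + t) + t * ?y * \<phi> (b i) * (1 + t) + t * ?x * \<phi> (b j) * 1
            = (\<phi> v + t * (?x * \<phi> (b j) + ?y * \<phi> (b i))) * (1 + t) + t * (t * (?x * \<phi> (b j)))"
            by (simp add: distrib_left distrib_right mult_ac add_ac)
          finally show ?thesis by (simp add: xel_def linf_add[OF \<phi>] linf_scale[OF \<phi>])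
        qed
        then show "\<exists>r. \<forall>t. 1 + t \<noteq> 0 \<longrightarrow> \<phi> (?\<gamma> t v) * (1 + t)
          = (\<phi> v + t * \<phi> (xel (b i) (b j) v)) * (1 + t) + t * (t * poly r t)"
          by (intro exI[of _ "[:?x * \<phi> (b j):]"] allI impI)
      qed
    next
      case 2
      have bn: "bet (b n) v = 0" "bet v (b n) = 0" for v using adapted_radical[OF b] by auto
      \<comment> \<open>As \<open>\<alpha> (b n) = 1\<close>, the linear term changes
        \<open>\<alpha> v\<close> by the square of t \<open>bet v (b i)\<close>; the term with t * t
        compensates for it through its pairing with v.\<close>
      let ?\<gamma> = "\<lambda>t v. v + (s (t * bet v (b i)) (b n) + s (t * t * bet v (b i)) (b i))"
      show ?thesis
      proof (rule curve_lie[OF xel_gl, where \<gamma> = ?\<gamma>])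
        fix t :: 'k
        show "?\<gamma> t \<in> upper b"
          unfolding upper_def
        proof (intro CollectI conjI allI impI orthI)
          show "?\<gamma> t \<in> gl s"
            by (simp add: gl_iff scale_right_distrib scale_left_distrib distrib_left add_ac mult_ac)
          show "\<alpha> (?\<gamma> t v) = \<alpha> v" for v
            using \<alpha>i \<alpha>j 2 by (simp add: \<alpha>_add \<alpha>_scale bn power2_eq_square mult_ac)
        next
          fix m l assume ml: "m \<le> 2*n" "l \<le> 2*n" "m < l"
          have "bet (b m) (b i) = 0 \<or> co b l (b n) = 0"
            using adaptedD(1)[OF b ml(1) i(2)] 2 i ml coord_basis[OF ib, of l n] by auto
          moreover have "bet (b m) (b i) = 0 \<or> co b l (b i) = 0"
            using adaptedD(1)[OF b ml(1) i(2)] i ml coord_basis[OF ib, of l i] by auto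
          ultimately show "co b l (?\<gamma> t (b m)) = 0"
            using ml coord_basis[OF ib, of l m] by (auto simp: coord_add[OF ib] coord_scale[OF ib])
        qed
      next
        fix \<phi> :: "'v \<Rightarrow> 'k" and v assume \<phi>: "linf \<phi>"
        let ?x = "bet v (b i)"
        have "\<phi> (?\<gamma> t v) * (1 + t) = (\<phi> v + t * \<phi> (xel (b i) (b j) v)) * (1 + t)
            + t * (t * poly [:?x * \<phi> (b i), ?x * \<phi> (b i):] t)" for t
          using 2(2) by (simp add: xel_def bn linf_add[OF \<phi>] linf_scale[OF \<phi>] distrib_left distrib_right mult_ac add_ac)
        then show "\<exists>r. \<forall>t. 1 + t \<noteq> 0 \<longrightarrow> \<phi> (?\<gamma> t v) * (1 + t)
          = (\<phi> v + t * \<phi> (xel (b i) (b j) v)) * (1 + t) + t * (t * poly r t)"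
          by (intro exI[of _ "[:?x * \<phi> (b i), ?x * \<phi> (b i):]"] allI impI)
      qed
    next
      case 3
      have bij: "bet (b i) (b j) = 0" "bet (b j) (b i) = 0" using up[of i j] up[of j i] 3 i j by auto
      let ?\<gamma> = "\<lambda>t v. v + s t (xel (b i) (b j) v)"
      show ?thesis
      proof (rule curve_lie[OF xel_gl, where \<gamma> = ?\<gamma>])
        fix t :: 'k
        show "?\<gamma> t \<in> upper b"
          unfolding upper_def
        proof (intro CollectI conjI allI impI orthI)
          show "?\<gamma> t \<in> gl s"
            by (simp add: gl_iff gl_add[OF xel_gl] gl_scale[OF xel_gl] scale_right_distrib add_ac mult_ac)
          show "\<alpha> (?\<gamma> t v) = \<alpha> v" for v
            using \<alpha>i \<alpha>j 3 bij by (simp add: \<alpha>_add \<alpha>_scale xel_def mult_ac)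
        next
          fix m l assume ml: "m \<le> 2*n" "l \<le> 2*n" "m < l"
          have "bet (b m) (b i) = 0 \<or> co b l (b j) = 0"
            using adaptedD(1)[OF b ml(1) i(2)] 3 ml j coord_basis[OF ib, of l j] by auto
          moreover have "bet (b m) (b j) = 0 \<or> co b l (b i) = 0"
            using adaptedD(1)[OF b ml(1) j] 3 ml i coord_basis[OF ib, of l i] by auto
          ultimately show "co b l (?\<gamma> t (b m)) = 0"
            using ml coord_basis[OF ib, of l m]
            by (auto simp: xel_def coord_add[OF ib] coord_scale[OF ib])
        qed
      next
        fix \<phi> :: "'v \<Rightarrow> 'k" and v assume \<phi>: "linf \<phi>"
        have "\<phi> (?\<gamma> t v) * (1 + t) = (\<phi> v + t * \<phi> (xel (b i) (b j) v)) * (1 + t) + t * (t * poly 0 t)" for t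
          by (simp add: linf_add[OF \<phi>] linf_scale[OF \<phi>])
        then show "\<exists>r. \<forall>t. 1 + t \<noteq> 0 \<longrightarrow> \<phi> (?\<gamma> t v) * (1 + t)
          = (\<phi> v + t * \<phi> (xel (b i) (b j) v)) * (1 + t) + t * (t * poly r t)"
          by (intro exI[of _ 0] allI impI)
      qed
    qed
  qed
  consider "i < j" | "j < i" | "i = j" by linarith
  then show ?thesis
  proof cases
    case 1 with main ij show ?thesis by blast
  next
    case 2
    with main[of j i] ij show ?thesis by (simp add: xel_sym[of "b i"] add.commute)
  next
    case 3
    have "(\<lambda>v. 0) \<in> lie_algebra s (upper b)"
    proof (rule curve_lie[where \<gamma> = "\<lambda>t. id"])
      show "id \<in> upper b" using subgroup_id[OF upper_subgroup[OF b]] .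
      show "(\<lambda>v. 0) \<in> gl s" by (simp add: gl_iff)
      fix \<phi> :: "'v \<Rightarrow> 'k" and v assume \<phi>: "linf \<phi>"
      show "\<exists>r. \<forall>t. 1 + t \<noteq> 0 \<longrightarrow> \<phi> (id v) * (1 + t) = (\<phi> v + t * \<phi> 0) * (1 + t) + t * (t * poly r t)"
        by (intro exI[of _ 0]) (simp add: linf_zero[OF \<phi>])
    qed
    then show ?thesis using 3 by (simp add: xel_self)
  qed
qed

section \<open>Coadjoint orbits and alternating forms\<close>

abbreviation "odual \<equiv> orth_dual s \<alpha>"

text \<open>Selects one order for each pair of distinct indices, with n always first. The
  coefficient of \<open>xel (b i) (b j)\<close> is read off from the image of the partner of
  \<open>b j\<close>, which carries no information for j = n.\<close>

definition prec :: "nat \<Rightarrow> nat \<Rightarrow> bool" where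
  "prec i j \<longleftrightarrow> j \<noteq> n \<and> (i = n \<or> i < j)"

lemma double_sum_of_bool:
  assumes "a \<le> N" "c \<le> (N::nat)"
  shows "(\<Sum>i\<le>N. \<Sum>j\<le>N. f i j * (of_bool (i = a) * of_bool (j = c))) = (f a c :: 'k)"
proof -
  have "(\<Sum>i\<le>N. \<Sum>j\<le>N. f i j * (of_bool (i = a) * of_bool (j = c)))
    = (\<Sum>i\<le>N. (\<Sum>j\<le>N. f i j * of_bool (j = c)) * of_bool (i = a))"
    unfolding sum_distrib_right by (intro sum.cong refl) (simp only: mult_ac)
  also have "\<dots> = f a c" using assms by (simp only: sum_of_bool_eq finite_atMost) simp
  finally show ?thesis .
qed

text \<open>Self-adjointness removes the coordinates off the middle. The middle one is where the
  trace condition enters: diagonal entries at mirrored places agree, so they cancel in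
  characteristic 2 and leave the entry at n as the trace.\<close>

lemma olie_radical:
  assumes b: "adapted b" and x: "x \<in> olie" shows "x (b n) = 0"
proof (rule coord_eqI[OF adapted_ibasis[OF b]])
  note ib = adapted_ibasis[OF b]
  have zero: "co b l 0 = 0" for l using linf_zero[OF linear_coord[OF ib]] .
  fix l assume l: "l \<in> {..2*n}"
  show "co b l (x (b n)) = co b l 0"
  proof (cases "l = n")
    case False
    then have "co b l (x (b n)) = bet (x (b n)) (b (2*n - l))" using l by (intro co_bet[OF b]) auto
    also have "\<dots> = 0" unfolding olie_sym[OF x, of "b n"] by (rule adapted_radical[OF b])
    finally show ?thesis by (simp add: zero)
  next
    case True
    let ?d = "\<lambda>m. co b m (x (b m))"
    have sym: "?d (2*n - m) = ?d m" if "m \<le> 2*n" "m \<noteq> n" for m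
    proof -
      have "?d (2*n - m) = bet (x (b (2*n - m))) (b (2*n - (2*n - m)))"
        using that by (intro co_bet[OF b]) auto
      also have "\<dots> = bet (x (b m)) (b (2*n - m))"
        using that olie_sym[OF x, of "b (2*n - m)" "b m"] by simp
      also have "\<dots> = ?d m" using that by (intro co_bet[OF b, symmetric])
      finally show ?thesis .
    qed
    have "sum ?d {n<..2*n} = sum ?d {..<n}"
    proof (rule sum.reindex_bij_witness[of _ "\<lambda>m. 2*n - m" "\<lambda>m. 2*n - m"])
      show "?d (2*n - m) = ?d m" if "m \<in> {n<..2*n}" for m using that by (intro sym) auto
    qed auto
    moreover have "sum ?d {..2*n} = sum ?d {..<n} + sum ?d {n<..2*n} + ?d n"
    proof -
      have split: "{..2*n} = {..<n} \<union> {n<..2*n} \<union> {n}" by auto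
      show ?thesis unfolding split by (subst sum.union_disjoint; auto simp: add.commute)+
    qed
    moreover have "sum ?d {..2*n} = 0"
      using trace_ibasis[OF ib olieD(1)[OF x]] olieD(3)[OF x] by simp
    ultimately have "?d n = 0" by simp
    then show ?thesis using True by (simp add: zero)
  qed
qed

text \<open>In the coordinate l of the image of \<open>b m\<close>, two coefficients with exchanged
  indices occur; \<open>prec\<close> retains one, and self-adjointness identifies it with the entry
  of x.\<close>

lemma olie_expand:
  assumes b: "adapted b" and x: "x \<in> olie"
  shows "x v = (\<Sum>i\<le>2*n. \<Sum>j\<le>2*n.
    s (of_bool (prec i j) * co b i (x (b (2*n - j)))) (xel (b i) (b j) v))"
proof -
  note ib = adapted_ibasis[OF b]
  let ?c = "\<lambda>i j. of_bool (prec i j) * co b i (x (b (2*n - j)))"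
  let ?y = "\<lambda>v. \<Sum>i\<le>2*n. \<Sum>j\<le>2*n. s (?c i j) (xel (b i) (b j) v)"
  have "?y \<in> gl s"
    by (simp add: gl_iff gl_add[OF xel_gl] gl_scale[OF xel_gl] scale_right_distrib sum.distrib
        scale_sum_right mult.commute)
  have "x = ?y"
  proof (rule gl_eq_basis[OF b olieD(1)[OF x] \<open>?y \<in> gl s\<close>])
    fix m assume m: "m \<le> 2*n"
    show "x (b m) = ?y (b m)"
    proof (cases "m = n")
      case True
      have "xel (b i) (b j) (b n) = 0" for i j
        using adapted_radical[OF b] by (simp add: xel_def)
      then show ?thesis using True olie_radical[OF b x] by simp
    next
      case False
      let ?m = "2*n - m"
      have m': "?m \<noteq> n" "?m \<le> 2*n" using False m by auto
      show ?thesis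
      proof (rule coord_eqI[OF ib])
        fix l assume "l \<in> {..2*n}"
        then have l: "l \<le> 2*n" by simp
        have bm: "bet (b m) (b i) = of_bool (i = ?m)" if "i \<le> 2*n" for i
          using adaptedD(1)[OF b m that] False m by (intro trans[OF adaptedD(1)[OF b m that]]) auto
        have "co b l (?y (b m)) = (\<Sum>i\<le>2*n. \<Sum>j\<le>2*n. ?c i j * co b l (xel (b i) (b j) (b m)))"
          by (simp only: coord_sum[OF ib] coord_scale[OF ib])
        also have "\<dots> = (\<Sum>i\<le>2*n. \<Sum>j\<le>2*n. ?c i j * (of_bool (i = ?m) * of_bool (j = l))
            + ?c i j * (of_bool (i = l) * of_bool (j = ?m)))"
        proof (intro sum.cong refl)
          fix i j assume "i \<in> {..2*n}" "j \<in> {..2*n}"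
          then have ij: "i \<le> 2*n" "j \<le> 2*n" by auto
          have "co b l (xel (b i) (b j) (b m)) = of_bool (i = ?m) * of_bool (j = l) + of_bool (i = l) * of_bool (j = ?m)"
            unfolding xel_def coord_add[OF ib] coord_scale[OF ib] bm[OF ij(1)] bm[OF ij(2)]
            using coord_basis[OF ib, of l j] coord_basis[OF ib, of l i] ij l
            by (simp add: eq_commute[of l])
          then show "?c i j * co b l (xel (b i) (b j) (b m)) = ?c i j * (of_bool (i = ?m) * of_bool (j = l))
            + ?c i j * (of_bool (i = l) * of_bool (j = ?m))" by (simp only: distrib_left)
        qed
        also have "\<dots> = ?c ?m l + ?c l ?m"
          unfolding sum.distrib double_sum_of_bool[OF m'(2) l] double_sum_of_bool[OF l m'(2)] ..
        also have "\<dots> = co b l (x (b m))"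
        proof -
          have 2: "co b l (x (b (2*n - ?m))) = co b l (x (b m))" using m by simp
          have 1: "co b ?m (x (b (2*n - l))) = co b l (x (b m))" if "l \<noteq> n"
          proof -
            have "co b ?m (x (b (2*n - l))) = bet (x (b (2*n - l))) (b (2*n - ?m))"
              using m' by (intro co_bet[OF b])
            also have "\<dots> = bet (x (b m)) (b (2*n - l))" using m olie_sym[OF x, of "b (2*n - l)" "b m"] by simp
            also have "\<dots> = co b l (x (b m))" using l that by (intro co_bet[OF b, symmetric])
            finally show ?thesis .
          qed
          show ?thesis
          proof (cases "l = ?m")
            case True
            then have "co b l (x (b m)) = bet (x (b m)) (b (2*n - ?m))"
              using m' by (simp only:) (intro co_bet[OF b])
            also have "\<dots> = 0" using olieD(2)[OF x, of "b m"] m by simp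
            finally have z: "co b l (x (b m)) = 0" .
            have "\<not> prec l l" by (auto simp: prec_def)
            then show ?thesis using True z by simp
          next
            case F: False
            have "prec ?m l \<noteq> prec l ?m" "prec ?m l \<longrightarrow> l \<noteq> n"
              using F m' by (auto simp: prec_def)
            then show ?thesis unfolding 2 using 1 by (cases "prec ?m l") auto
          qed
        qed
        finally show "co b l (x (b m)) = co b l (?y (b m))" by simp
      qed
    qed
  qed
  then show ?thesis by (rule fun_cong)
qed

text \<open>Linearity on the Lie algebra alone, so as to include x -> tr(X x), which is not extended
  by 0.\<close>

definition dual_linear :: "(('v \<Rightarrow> 'v) \<Rightarrow> 'k) \<Rightarrow> bool" where
  "dual_linear \<xi> \<longleftrightarrow> (\<forall>x\<in>olie. \<forall>y\<in>olie. \<xi> (\<lambda>v. x v + y v) = \<xi> x + \<xi> y) \<and>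
     (\<forall>c. \<forall>x\<in>olie. \<xi> (\<lambda>v. s c (x v)) = c * \<xi> x)"

lemma odual_iff: "\<xi> \<in> odual \<longleftrightarrow> dual_linear \<xi> \<and> (\<forall>x. x \<notin> olie \<longrightarrow> \<xi> x = 0)"
  by (simp add: orth_dual_def dual_linear_def)

lemma zero_olie: "(\<lambda>v. 0) \<in> olie"
  using olie_smult[OF xel_olie, of 0] by simp

lemma dual_linear_add:
  "dual_linear \<xi> \<Longrightarrow> x \<in> olie \<Longrightarrow> y \<in> olie \<Longrightarrow> \<xi> (\<lambda>v. x v + y v) = \<xi> x + \<xi> y"
  by (simp add: dual_linear_def)

lemma dual_linear_scale: "dual_linear \<xi> \<Longrightarrow> x \<in> olie \<Longrightarrow> \<xi> (\<lambda>v. s c (x v)) = c * \<xi> x"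
  by (simp add: dual_linear_def)

lemma dual_linear_sum:
  assumes \<xi>: "dual_linear \<xi>" and "finite A" "\<And>p. p \<in> A \<Longrightarrow> x p \<in> olie"
  shows "(\<lambda>v. \<Sum>p\<in>A. s (c p) (x p v)) \<in> olie \<and> \<xi> (\<lambda>v. \<Sum>p\<in>A. s (c p) (x p v)) = (\<Sum>p\<in>A. c p * \<xi> (x p))"
  using assms(2,3)
proof induction
  case empty
  have "\<xi> (\<lambda>v. s 0 0) = 0 * \<xi> (\<lambda>v. 0)"
    by (rule dual_linear_scale[OF \<xi> zero_olie])
  then show ?case using zero_olie by simp
next
  case (insert p A)
  let ?y = "\<lambda>v. \<Sum>p\<in>A. s (c p) (x p v)" and ?z = "\<lambda>v. s (c p) (x p v)"
  have y: "?y \<in> olie" "\<xi> ?y = (\<Sum>p\<in>A. c p * \<xi> (x p))" using insert by auto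
  have xp: "x p \<in> olie" using insert by simp
  have z: "?z \<in> olie" using xp by (rule olie_smult)
  have "\<xi> ?z = c p * \<xi> (x p)" by (rule dual_linear_scale[OF \<xi> xp])
  moreover have "\<xi> (\<lambda>v. ?z v + ?y v) = \<xi> ?z + \<xi> ?y" by (rule dual_linear_add[OF \<xi> z y(1)])
  ultimately show ?case using insert(1,2) y olie_add[OF z y(1)] by simp
qed

lemma dual_expand:
  assumes b: "adapted b" and \<xi>: "dual_linear \<xi>" and x: "x \<in> olie"
  shows "\<xi> x = (\<Sum>i\<le>2*n. \<Sum>j\<le>2*n. of_bool (prec i j) * co b i (x (b (2*n - j))) * \<xi> (xel (b i) (b j)))"
proof -
  let ?c = "\<lambda>i j. of_bool (prec i j) * co b i (x (b (2*n - j)))"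
  let ?A = "{..2*n} \<times> {..2*n}"
  have "x = (\<lambda>v. \<Sum>p\<in>?A. s (?c (fst p) (snd p)) (xel (b (fst p)) (b (snd p)) v))"
    by (rule ext, rule trans[OF olie_expand[OF b x]]) (simp add: sum.cartesian_product case_prod_unfold)
  then have "\<xi> x = \<xi> (\<lambda>v. \<Sum>p\<in>?A. s (?c (fst p) (snd p)) (xel (b (fst p)) (b (snd p)) v))" by (rule arg_cong)
  also have "\<dots> = (\<Sum>p\<in>?A. ?c (fst p) (snd p) * \<xi> (xel (b (fst p)) (b (snd p))))"
    by (rule dual_linear_sum[OF \<xi>, THEN conjunct2]) (simp_all add: xel_olie)
  also have "\<dots> = (\<Sum>i\<le>2*n. \<Sum>j\<le>2*n. ?c i j * \<xi> (xel (b i) (b j)))"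
    by (simp add: sum.cartesian_product case_prod_unfold)
  finally show ?thesis .
qed

section \<open>The correspondence between functionals and alternating forms\<close>

definition bilinear_alt :: "('v \<Rightarrow> 'v \<Rightarrow> 'k) \<Rightarrow> bool" where
  "bilinear_alt \<omega> \<longleftrightarrow> (\<forall>v. linf (\<omega> v)) \<and> (\<forall>w. linf (\<lambda>v. \<omega> v w)) \<and> (\<forall>v. \<omega> v v = 0)"

lemma bilinear_altI:
  assumes "\<And>v w z. \<omega> v (w + z) = \<omega> v w + \<omega> v z" "\<And>v c w. \<omega> v (s c w) = c * \<omega> v w"
    "\<And>v w. \<omega> v w = \<omega> w v" "\<And>v. \<omega> v v = 0"
  shows "bilinear_alt \<omega>"
  unfolding bilinear_alt_def
proof (intro conjI allI linear_formI assms(1,2,4))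
  show "\<omega> (x + y) w = \<omega> x w + \<omega> y w" for x y w using assms(1)[of w x y] assms(3) by metis
  show "\<omega> (s c x) w = c * \<omega> x w" for x w c using assms(2)[of w c x] assms(3) by metis
qed

lemma bilinear_altD:
  assumes "bilinear_alt \<omega>"
  shows "\<omega> (v + w) z = \<omega> v z + \<omega> w z" "\<omega> z (v + w) = \<omega> z v + \<omega> z w"
    "\<omega> (s c v) z = c * \<omega> v z" "\<omega> z (s c v) = c * \<omega> z v" "\<omega> 0 z = 0" "\<omega> z 0 = 0"
    "\<omega> v v = 0" "\<omega> v w = \<omega> w v"
    "\<omega> (sum f A) z = (\<Sum>x\<in>A. \<omega> (f x) z)" "\<omega> z (sum f A) = (\<Sum>x\<in>A. \<omega> z (f x))"
proof -
  have l: "linf (\<omega> z)" "linf (\<lambda>v. \<omega> v z)" and a: "\<omega> z z = 0" for z using assms by (auto simp: bilinear_alt_def)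
  show "\<omega> (v + w) z = \<omega> v z + \<omega> w z" "\<omega> z (v + w) = \<omega> z v + \<omega> z w"
    "\<omega> (s c v) z = c * \<omega> v z" "\<omega> z (s c v) = c * \<omega> z v" "\<omega> 0 z = 0" "\<omega> z 0 = 0" "\<omega> v v = 0"
    "\<omega> (sum f A) z = (\<Sum>x\<in>A. \<omega> (f x) z)" "\<omega> z (sum f A) = (\<Sum>x\<in>A. \<omega> z (f x))"
    using linf_add[OF l(1)] linf_add[OF l(2)] linf_scale[OF l(1)] linf_scale[OF l(2)]
      linf_zero[OF l(1)] linf_zero[OF l(2)] linf_sum[OF l(1)] linf_sum[OF l(2)] a by auto
  have "\<omega> (v + w) (v + w) = (\<omega> v v + \<omega> w v) + (\<omega> v w + \<omega> w w)"
    by (simp only: linf_add[OF l(1)] linf_add[OF l(2)])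
  then have "0 = \<omega> w v + \<omega> v w"
    by (simp only: a add_0_left add_0_right)
  then have "\<omega> v w + \<omega> w v = 0" by (simp only: add.commute)
  then show "\<omega> v w = \<omega> w v" by (rule add_eq_0[THEN iffD1])
qed

lemma bilinear_alt_xel:
  assumes \<xi>: "dual_linear \<xi>" shows "bilinear_alt (\<lambda>v w. \<xi> (xel v w))"
proof (rule bilinear_altI)
  have add: "\<xi> (\<lambda>v. x v + y v) = \<xi> x + \<xi> y" if "x \<in> olie" "y \<in> olie" for x y
    using \<xi> that unfolding dual_linear_def by blast
  have scale: "\<xi> (\<lambda>v. s c (x v)) = c * \<xi> x" if "x \<in> olie" for x c
    using \<xi> that unfolding dual_linear_def by blast
  fix v w z c
  have "xel v (w + z) = (\<lambda>u. xel v w u + xel v z u)"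
    by (rule ext) (simp add: xel_def scale_right_distrib scale_left_distrib add_ac)
  then show "\<xi> (xel v (w + z)) = \<xi> (xel v w) + \<xi> (xel v z)" by (simp only: add[OF xel_olie xel_olie])
  have "xel v (s c w) = (\<lambda>u. s c (xel v w u))"
    by (rule ext) (simp add: xel_def scale_right_distrib mult.commute)
  then show "\<xi> (xel v (s c w)) = c * \<xi> (xel v w)" by (simp only: scale[OF xel_olie])
  show "\<xi> (xel v w) = \<xi> (xel w v)" by (simp only: xel_sym)
  have "\<xi> (\<lambda>u. s 0 (xel v v u)) = 0 * \<xi> (xel v v)" by (rule scale[OF xel_olie])
  then show "\<xi> (xel v v) = 0" by (simp add: xel_self)
qed

lemma dual_eqI:
  assumes "dual_linear \<xi>" "dual_linear \<xi>'" "\<And>v w. \<xi> (xel v w) = \<xi>' (xel v w)" "x \<in> olie" "adapted b"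
  shows "\<xi> x = \<xi>' x"
  by (simp only: dual_expand[OF assms(5,1,4)] dual_expand[OF assms(5,2,4)] assms(3))

text \<open>\<open>\<omega>\<close> cannot be halved in characteristic 2, so \<open>X\<close> is
  built from the half of the Gram matrix that \<open>prec\<close> selects. Keeping n out of the
  second place ensures that \<open>bet\<close> can represent this half.\<close>

lemma form_operator:
  assumes b: "adapted b" and \<omega>: "bilinear_alt \<omega>"
  shows "\<exists>X\<in>gl s. \<forall>v w. bet (X v) w + bet v (X w) = \<omega> v w"
proof -
  note ib = adapted_ibasis[OF b]
  let ?X = "lift {..2*n} b (\<lambda>i. \<Sum>j\<le>2*n. s (of_bool (prec i j) * \<omega> (b i) (b j)) (b (2*n - j)))"
  have X: "?X \<in> gl s" by (rule lift_gl[OF b])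
  have Xb: "bet (?X (b i)) (b l) = of_bool (prec i l) * \<omega> (b i) (b l)" if il: "i \<le> 2*n" "l \<le> 2*n" for i l
  proof -
    have "?X (b i) = (\<Sum>j\<le>2*n. s (of_bool (prec i j) * \<omega> (b i) (b j)) (b (2*n - j)))"
      using il by (intro lift_basis[OF ib]) simp
    then have "bet (?X (b i)) (b l) = (\<Sum>j\<le>2*n. of_bool (prec i j) * \<omega> (b i) (b j) * bet (b (2*n - j)) (b l))"
      by (simp only: bet_sum1 bet_simps)
    also have "\<dots> = (\<Sum>j\<le>2*n. of_bool (prec i j) * \<omega> (b i) (b j) * of_bool (j = l))"
    proof (intro sum.cong refl)
      fix j assume "j \<in> {..2*n}"
      then have j: "j \<le> 2*n" by simp
      have 1: "bet (b (2*n - j)) (b l) = of_bool (2*n - j + l = 2*n \<and> 2*n - j \<noteq> l)"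
        using il by (intro adaptedD(1)[OF b]) auto
      have "prec i j \<Longrightarrow> (2*n - j + l = 2*n \<and> 2*n - j \<noteq> l) = (j = l)" using j by (auto simp: prec_def)
      then show "of_bool (prec i j) * \<omega> (b i) (b j) * bet (b (2*n - j)) (b l)
        = of_bool (prec i j) * \<omega> (b i) (b j) * of_bool (j = l)" unfolding 1 by (cases "prec i j") simp_all
    qed
    also have "\<dots> = of_bool (prec i l) * \<omega> (b i) (b l)"
      using il by (simp only: sum_of_bool_eq finite_atMost) simp
    finally show ?thesis .
  qed
  have basis: "bet (?X (b i)) (b l) + bet (b i) (?X (b l)) = \<omega> (b i) (b l)" if il: "i \<le> 2*n" "l \<le> 2*n" for i l
  proof -
    have sum: "bet (?X (b i)) (b l) + bet (b i) (?X (b l))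
      = of_bool (prec i l) * \<omega> (b i) (b l) + of_bool (prec l i) * \<omega> (b i) (b l)"
      unfolding bet_sym[of "b i"] Xb[OF il] Xb[OF il(2,1)] bilinear_altD(8)[OF \<omega>, of "b l"] ..
    show ?thesis
    proof (cases "i = l")
      case True
      then show ?thesis unfolding sum using bilinear_altD(7)[OF \<omega>] by simp
    next
      case False
      then have "prec i l \<noteq> prec l i" by (auto simp: prec_def)
      then show ?thesis unfolding sum by (cases "prec i l") simp_all
    qed
  qed
  let ?L = "\<lambda>v w. bet (?X v) w + bet v (?X w)"
  have lin: "linf (?L v)" "linf (\<lambda>v. ?L v w)" for v w
    by (rule linear_formI; simp add: gl_add[OF X] gl_scale[OF X] distrib_left add_ac)+
  have "?L (b i) w = \<omega> (b i) w" if "i \<le> 2*n" for i w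
  proof (rule linear_eq_on_ibasis[OF ib lin(1)])
    show "linf (\<omega> (b i))" using \<omega> by (simp add: bilinear_alt_def)
    show "?L (b i) (b l) = \<omega> (b i) (b l)" if "l \<in> {..2*n}" for l
      using that \<open>i \<le> 2*n\<close> by (intro basis) auto
  qed
  note eq = this
  have "?L v w = \<omega> v w" for v w
  proof (rule linear_eq_on_ibasis[OF ib lin(2)])
    show "linf (\<lambda>v. \<omega> v w)" using \<omega> by (simp add: bilinear_alt_def)
    show "?L (b i) w = \<omega> (b i) w" if "i \<in> {..2*n}" for i using that by (intro eq) auto
  qed
  with X show ?thesis by (intro bexI[of _ ?X] allI)
qed

lemma dual_linear_trace: assumes X: "X \<in> gl s" shows "dual_linear (\<lambda>x. lin_trace s (X \<circ> x))"
  unfolding dual_linear_def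
proof (intro conjI ballI allI)
  fix x y c assume x: "x \<in> olie" and y: "y \<in> olie"
  note gl = gl_comp[OF X olieD(1)]
  have "X \<circ> (\<lambda>v. x v + y v) = (\<lambda>v. (X \<circ> x) v + (X \<circ> y) v)" by (rule ext) (simp add: gl_add[OF X])
  then show "lin_trace s (X \<circ> (\<lambda>v. x v + y v)) = lin_trace s (X \<circ> x) + lin_trace s (X \<circ> y)"
    by (simp only: trace_add[OF gl[OF x] gl[OF y]])
next
  fix x c assume x: "x \<in> olie"
  have "X \<circ> (\<lambda>v. s c (x v)) = (\<lambda>v. s c ((X \<circ> x) v))" by (rule ext) (simp add: gl_scale[OF X])
  then show "lin_trace s (X \<circ> (\<lambda>v. s c (x v))) = c * lin_trace s (X \<circ> x)"
    by (simp only: trace_scale[OF gl_comp[OF X olieD(1)[OF x]]])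
qed

text \<open>Whatever X the choice operator yields, its trace form agrees with \<open>\<xi>\<close>
  on \<open>xel v w\<close>. This formula replaces the definition of \<open>beta_xi\<close> from
  here on.\<close>

lemma beta_xi_xel:
  assumes b: "adapted b" and \<xi>: "\<xi> \<in> odual"
  shows "beta_xi s \<alpha> \<xi> v w = \<xi> (xel v w)"
proof -
  have \<xi>l: "dual_linear \<xi>" using \<xi> by (simp add: odual_iff)
  define P where "P X \<longleftrightarrow> X \<in> gl s \<and> (\<forall>x\<in>olie. \<xi> x = lin_trace s (X \<circ> x))" for X
  obtain X where X: "X \<in> gl s" "\<forall>v w. bet (X v) w + bet v (X w) = \<xi> (xel v w)"
    using form_operator[OF b bilinear_alt_xel[OF \<xi>l]] by blast
  have "\<xi> x = lin_trace s (X \<circ> x)" if "x \<in> olie" for x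
    using X by (intro dual_eqI[OF \<xi>l dual_linear_trace[OF X(1)] _ that b]) (simp add: trace_xel[OF X(1)])
  with X(1) have "P X" unfolding P_def by blast
  define Y where "Y = (SOME X. P X)"
  have "P Y" unfolding Y_def using \<open>P X\<close> by (rule someI[of P X])
  then have Y: "Y \<in> gl s" "\<forall>x\<in>olie. \<xi> x = lin_trace s (Y \<circ> x)" unfolding P_def by blast+
  have "beta_xi s \<alpha> \<xi> v w = bet (Y v) w + bet v (Y w)"
    by (simp only: beta_xi_def Let_def Y_def P_def)
  also have "\<dots> = \<xi> (xel v w)" using Y(2) xel_olie by (simp add: trace_xel[OF Y(1)])
  finally show ?thesis .
qed

lemma dual_of_form:
  assumes b: "adapted b" and \<omega>: "bilinear_alt \<omega>"
  shows "\<exists>\<xi>\<in>odual. \<forall>v w. \<xi> (xel v w) = \<omega> v w"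
proof -
  obtain X where X: "X \<in> gl s" "\<forall>v w. bet (X v) w + bet v (X w) = \<omega> v w"
    using form_operator[OF b \<omega>] by blast
  let ?\<xi> = "\<lambda>x. if x \<in> olie then lin_trace s (X \<circ> x) else 0"
  have "dual_linear ?\<xi>"
    using dual_linear_trace[OF X(1)] olie_add olie_smult unfolding dual_linear_def by simp
  then have "?\<xi> \<in> odual" by (simp add: odual_iff)
  moreover have "?\<xi> (xel v w) = \<omega> v w" for v w using X xel_olie by (simp add: trace_xel)
  ultimately show ?thesis by (intro bexI[of _ ?\<xi>] allI)
qed

text \<open>The coefficient of \<open>xel (b i) (b j)\<close> is the entry in row i and column 2n -
  j, so upper triangularity leaves only the terms with i + j at most 2n.\<close>

lemma dual_vanish:
  assumes b: "adapted b" and \<xi>: "dual_linear \<xi>"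
    and z: "\<And>i j. i + j \<le> 2*n \<Longrightarrow> \<xi> (xel (b i) (b j)) = 0"
    and x: "x \<in> olie" "\<And>i j. j \<le> 2*n \<Longrightarrow> i \<le> 2*n \<Longrightarrow> j < i \<Longrightarrow> co b i (x (b j)) = 0"
  shows "\<xi> x = 0"
  unfolding dual_expand[OF b \<xi> x(1)]
proof (intro sum.neutral ballI)
  fix i j assume "i \<in> {..2*n}" "j \<in> {..2*n}"
  then show "of_bool (prec i j) * co b i (x (b (2*n - j))) * \<xi> (xel (b i) (b j)) = 0"
    using z[of i j] x(2)[of "2*n - j" i] by (cases "i + j \<le> 2*n") auto
qed

section \<open>The coadjoint action and its orbits\<close>

lemma olie_conj:
  assumes g: "g \<in> orth" and x: "x \<in> olie" shows "inv_into UNIV g \<circ> x \<circ> g \<in> olie"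
  unfolding orth_lie_def
proof (intro CollectI conjI allI)
  let ?h = "inv_into UNIV g"
  note glg = orth_gl[OF g] and glh = orth_gl[OF orth_inv[OF g]] and glx = olieD(1)[OF x]
  show "?h \<circ> x \<circ> g \<in> gl s" by (intro gl_comp glg glh glx)
  fix v
  have "bet ((?h \<circ> x \<circ> g) v) v = bet v (?h (x (g v)))" by (simp add: bet_sym[of v])
  also have "\<dots> = bet (g v) (x (g v))" using orth_bet_inv[OF g] by simp
  also have "\<dots> = 0" using olieD(2)[OF x] bet_sym[of "g v"] by simp
  finally show "bet ((?h \<circ> x \<circ> g) v) v = 0" .
  have "lin_trace s (?h \<circ> x \<circ> g) = lin_trace s (g \<circ> (?h \<circ> x))" by (intro trace_comm gl_comp glg glh glx)
  also have "g \<circ> (?h \<circ> x) = x" by (rule ext) (simp add: orthD(1)[OF g])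
  finally show "lin_trace s (?h \<circ> x \<circ> g) = 0" unfolding olieD(3)[OF x] .
qed

lemma olie_conj_iff:
  assumes g: "g \<in> orth" shows "inv_into UNIV g \<circ> x \<circ> g \<in> olie \<longleftrightarrow> x \<in> olie"
proof
  assume "inv_into UNIV g \<circ> x \<circ> g \<in> olie"
  from olie_conj[OF orth_inv[OF g] this]
  have "inv_into UNIV (inv_into UNIV g) \<circ> (inv_into UNIV g \<circ> x \<circ> g) \<circ> inv_into UNIV g \<in> olie" .
  moreover have "inv_into UNIV (inv_into UNIV g) = g"
    using GL_bij[OF orthD(1)[OF g]] by (rule inv_inv_eq)
  ultimately have "g \<circ> (inv_into UNIV g \<circ> x \<circ> g) \<circ> inv_into UNIV g \<in> olie" by (simp only:)
  moreover have "g \<circ> (inv_into UNIV g \<circ> x \<circ> g) \<circ> inv_into UNIV g = x"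
    by (rule ext) (simp add: orthD(1)[OF g])
  ultimately show "x \<in> olie" by (simp only:)
qed (rule olie_conj[OF g])

lemma coad_odual:
  assumes g: "g \<in> orth" and \<xi>: "\<xi> \<in> odual" shows "coad g \<xi> \<in> odual"
  unfolding orth_dual_def
proof (intro CollectI conjI ballI allI impI)
  let ?h = "inv_into UNIV g"
  note glh = orth_gl[OF orth_inv[OF g]]
  have \<xi>l: "\<And>x y. x \<in> olie \<Longrightarrow> y \<in> olie \<Longrightarrow> \<xi> (\<lambda>v. x v + y v) = \<xi> x + \<xi> y"
    "\<And>c x. x \<in> olie \<Longrightarrow> \<xi> (\<lambda>v. s c (x v)) = c * \<xi> x" "\<And>x. x \<notin> olie \<Longrightarrow> \<xi> x = 0"
    using \<xi> by (simp_all add: orth_dual_def)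
  fix x y assume x: "x \<in> olie" and y: "y \<in> olie"
  have "?h \<circ> (\<lambda>v. x v + y v) \<circ> g = (\<lambda>v. (?h \<circ> x \<circ> g) v + (?h \<circ> y \<circ> g) v)"
    by (rule ext) (simp add: gl_add[OF glh])
  then show "coad g \<xi> (\<lambda>v. x v + y v) = coad g \<xi> x + coad g \<xi> y"
    unfolding coad_def by (simp only: \<xi>l(1)[OF olie_conj[OF g x] olie_conj[OF g y]])
next
  let ?h = "inv_into UNIV g"
  note glh = orth_gl[OF orth_inv[OF g]]
  have \<xi>l: "\<And>c x. x \<in> olie \<Longrightarrow> \<xi> (\<lambda>v. s c (x v)) = c * \<xi> x" using \<xi> by (simp add: orth_dual_def)
  fix c x assume x: "x \<in> olie"
  have "?h \<circ> (\<lambda>v. s c (x v)) \<circ> g = (\<lambda>v. s c ((?h \<circ> x \<circ> g) v))" by (rule ext) (simp add: gl_scale[OF glh])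
  then show "coad g \<xi> (\<lambda>v. s c (x v)) = c * coad g \<xi> x"
    unfolding coad_def by (simp only: \<xi>l[OF olie_conj[OF g x]])
next
  fix x assume "x \<notin> olie"
  then show "coad g \<xi> x = 0" using \<xi> by (simp add: coad_def orth_dual_def olie_conj_iff[OF g])
qed

lemma coad_xel:
  assumes g: "g \<in> orth"
  shows "coad g \<xi> (xel v w) = \<xi> (xel (inv_into UNIV g v) (inv_into UNIV g w))"
proof -
  note glh = orth_gl[OF orth_inv[OF g]]
  have "inv_into UNIV g \<circ> xel v w \<circ> g = xel (inv_into UNIV g v) (inv_into UNIV g w)"
    by (rule ext) (simp add: xel_def gl_add[OF glh] gl_scale[OF glh] orth_bet_inv[OF g])
  then show ?thesis by (simp only: coad_def)
qed

lemma coad_comp: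
  assumes "g \<in> orth" "h \<in> orth" shows "coad (g \<circ> h) \<xi> = coad g (coad h \<xi>)"
proof (rule ext)
  fix x
  have "inv_into UNIV (g \<circ> h) = inv_into UNIV h \<circ> inv_into UNIV g"
    by (rule o_inv_distrib) (use assms GL_bij orthD(1) in auto)
  then have "inv_into UNIV (g \<circ> h) \<circ> x \<circ> (g \<circ> h) = inv_into UNIV h \<circ> (inv_into UNIV g \<circ> x \<circ> g) \<circ> h"
    by (simp only: o_assoc)
  then show "coad (g \<circ> h) \<xi> x = coad g (coad h \<xi>) x" by (simp only: coad_def)
qed

lemma orth_comp: "g \<in> orth \<Longrightarrow> h \<in> orth \<Longrightarrow> g \<circ> h \<in> orth"
  by (simp add: orth_group_def GL_comp)

lemma orth_id: "id \<in> orth" by (simp add: orth_group_def GL_id)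

lemma coad_id: "coad id \<xi> = \<xi>" by (rule ext) (simp add: coad_def)

lemma coad_orbit_eq_iff:
  "coad_orbit s \<alpha> \<xi> = coad_orbit s \<alpha> \<xi>' \<longleftrightarrow> (\<exists>g\<in>orth. coad g \<xi> = \<xi>')"
proof
  assume "coad_orbit s \<alpha> \<xi> = coad_orbit s \<alpha> \<xi>'"
  moreover have "\<xi>' \<in> coad_orbit s \<alpha> \<xi>'"
    unfolding coad_orbit_def using orth_id coad_id[of \<xi>'] by (metis imageI)
  ultimately have "\<xi>' \<in> coad_orbit s \<alpha> \<xi>" by (simp only:)
  then show "\<exists>g\<in>orth. coad g \<xi> = \<xi>'" unfolding coad_orbit_def by (elim imageE) (intro bexI, simp_all)
next
  assume "\<exists>g\<in>orth. coad g \<xi> = \<xi>'"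
  then obtain g where g: "g \<in> orth" "coad g \<xi> = \<xi>'" by blast
  have 1: "coad h \<xi>' = coad (h \<circ> g) \<xi>" if "h \<in> orth" for h by (simp only: coad_comp[OF that g(1)] g(2))
  have 2: "coad h \<xi> = coad (h \<circ> inv_into UNIV g) \<xi>'" if "h \<in> orth" for h
  proof -
    have "h \<circ> inv_into UNIV g \<circ> g = h" by (rule ext) (simp add: orthD(1)[OF g(1)])
    then show ?thesis using 1[OF orth_comp[OF that orth_inv[OF g(1)]]] by simp
  qed
  show "coad_orbit s \<alpha> \<xi> = coad_orbit s \<alpha> \<xi>'"
    unfolding coad_orbit_def
  proof (intro equalityI image_subsetI)
    show "coad h \<xi> \<in> (\<lambda>g. coad g \<xi>') ` orth" if "h \<in> orth" for h
      unfolding 2[OF that] by (intro imageI orth_comp that orth_inv g)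
    show "coad h \<xi>' \<in> (\<lambda>g. coad g \<xi>) ` orth" if "h \<in> orth" for h
      unfolding 1[OF that] by (intro imageI orth_comp that g)
  qed
qed

lemma form_equiv_iff_coad:
  assumes b: "adapted b" and \<xi>: "\<xi> \<in> odual" "\<xi>' \<in> odual"
  shows "form_equiv (xi_module s \<alpha> \<xi>) (xi_module s \<alpha> \<xi>') \<longleftrightarrow> (\<exists>g\<in>orth. coad g \<xi> = \<xi>')"
proof
  assume "form_equiv (xi_module s \<alpha> \<xi>) (xi_module s \<alpha> \<xi>')"
  then obtain f where f: "bij f" "\<And>v w. f (v + w) = f v + f w" "\<And>c v. f (s c v) = s c (f v)"
    "\<And>v. \<alpha> (f v) = \<alpha> v" "\<And>v w. \<xi>' (xel (f v) (f w)) = \<xi> (xel v w)"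
    unfolding form_equiv_def xi_module_def by (auto simp: beta_xi_xel[OF b \<xi>(1)] beta_xi_xel[OF b \<xi>(2)])
  have fo: "f \<in> orth" using f(2-4) by (intro orthI) (simp_all add: gl_iff)
  have "coad f \<xi> x = \<xi>' x" for x
  proof (cases "x \<in> olie")
    case True
    show ?thesis
    proof (rule dual_eqI[OF _ _ _ True b])
      show "dual_linear (coad f \<xi>)" "dual_linear \<xi>'" using coad_odual[OF fo \<xi>(1)] \<xi>(2) by (simp_all add: odual_iff)
      show "coad f \<xi> (xel v w) = \<xi>' (xel v w)" for v w
        using f(5)[of "inv_into UNIV f v" "inv_into UNIV f w"] orthD(1)[OF fo] by (simp add: coad_xel[OF fo])
    qed
  next
    case False
    then show ?thesis using coad_odual[OF fo \<xi>(1)] \<xi>(2) by (simp add: odual_iff)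
  qed
  with fo show "\<exists>g\<in>orth. coad g \<xi> = \<xi>'" by blast
next
  assume "\<exists>g\<in>orth. coad g \<xi> = \<xi>'"
  then obtain g where g: "g \<in> orth" "coad g \<xi> = \<xi>'" by blast
  have "\<xi>' (xel (g v) (g w)) = \<xi> (xel v w)" for v w
    using coad_xel[OF g(1), of \<xi> "g v" "g w"] orthD(1)[OF g(1)] by (simp add: g(2))
  then show "form_equiv (xi_module s \<alpha> \<xi>) (xi_module s \<alpha> \<xi>')"
    unfolding form_equiv_def xi_module_def using GL_bij[OF orthD(1)[OF g(1)]]
    by (intro exI[of _ g]) (simp add: beta_xi_xel[OF b \<xi>(1)] beta_xi_xel[OF b \<xi>(2)] gl_add[OF orth_gl[OF g(1)]]
        gl_scale[OF orth_gl[OF g(1)]] orthD(2)[OF g(1)])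
qed

text \<open>The Gram matrix of \<open>\<omega>\<close> vanishes up to and including the
  antidiagonal; relative to \<open>bet\<close>, this is strict triangularity.\<close>

definition nilp :: "('v \<Rightarrow> 'v \<Rightarrow> 'k) \<Rightarrow> (nat \<Rightarrow> 'v) \<Rightarrow> bool" where
  "nilp \<omega> b \<longleftrightarrow> adapted b \<and> (\<forall>i j. i + j \<le> 2*n \<longrightarrow> \<omega> (b i) (b j) = 0)"

text \<open>Two bounds on the Lie algebra of \<open>upper b0\<close> are enough: it contains the
  \<open>xel (b0 i) (b0 j)\<close> with i + j at most 2n, and its elements have no entries below the
  diagonal.\<close>

lemma nilpotent_dual_iff:
  assumes b0: "adapted b0"
  shows "\<xi> \<in> nilpotent_dual s \<alpha> (upper b0) \<longleftrightarrow> \<xi> \<in> odual \<and> (\<exists>b. nilp (\<lambda>v w. \<xi> (xel v w)) b)"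
proof
  assume "\<xi> \<in> nilpotent_dual s \<alpha> (upper b0)"
  then obtain g where \<xi>: "\<xi> \<in> odual" and g: "g \<in> orth" "\<forall>x\<in>lie_algebra s (upper b0). coad g \<xi> x = 0"
    by (auto simp: nilpotent_dual_def)
  let ?b = "\<lambda>i. inv_into UNIV g (b0 i)"
  have "adapted ?b"
    using b0 unfolding adapted_def
    by (simp add: orth_bet[OF orth_inv[OF g(1)]] orthD(2)[OF orth_inv[OF g(1)]])
  moreover have "\<xi> (xel (?b i) (?b j)) = 0" if "i + j \<le> 2*n" for i j
    using g(2) xel_lie[OF b0 that] unfolding coad_xel[OF g(1), symmetric] by blast
  ultimately show "\<xi> \<in> odual \<and> (\<exists>b. nilp (\<lambda>v w. \<xi> (xel v w)) b)"
    using \<xi> unfolding nilp_def by blast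
next
  assume R: "\<xi> \<in> odual \<and> (\<exists>b. nilp (\<lambda>v w. \<xi> (xel v w)) b)"
  then obtain b where \<xi>: "\<xi> \<in> odual" and b: "adapted b" and
    z: "\<And>i j. i + j \<le> 2*n \<Longrightarrow> \<xi> (xel (b i) (b j)) = 0" unfolding nilp_def by blast
  let ?g = "lift {..2*n} b b0"
  have gb: "?g (b i) = b0 i" if "i \<le> 2*n" for i using that by (intro lift_basis[OF adapted_ibasis[OF b]]) simp
  have g: "?g \<in> orth"
    by (intro orth_basisI[OF adapted_ibasis[OF b] lift_gl[OF b]])
      (simp_all add: gb adaptedD[OF b] adaptedD[OF b0])
  have gi: "inv_into UNIV ?g (b0 i) = b i" if "i \<le> 2*n" for i
    using GL_inv_app(2)[OF orthD(1)[OF g], of "b i"] gb[OF that] by simp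
  have "coad ?g \<xi> x = 0" if x: "x \<in> lie_algebra s (upper b0)" for x
  proof (cases "x \<in> olie")
    case True
    show ?thesis
    proof (rule dual_vanish[OF b0 _ _ True lie_upper[OF b0 x]])
      show "dual_linear (coad ?g \<xi>)" using coad_odual[OF g \<xi>] by (simp add: odual_iff)
      show "coad ?g \<xi> (xel (b0 i) (b0 j)) = 0" if "i + j \<le> 2*n" for i j
        using z[OF that] that by (simp add: coad_xel[OF g] gi)
    qed
  next
    case False
    then show ?thesis using coad_odual[OF g \<xi>] by (simp add: odual_iff)
  qed
  with g \<xi> show "\<xi> \<in> nilpotent_dual s \<alpha> (upper b0)" by (auto simp: nilpotent_dual_def)
qed

end

section \<open>Families of vectors in normal position\<close>

text \<open>Pairs of a block and a place, matching the coordinates of \<open>direct_sum\<close>: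
  block 0 is the module of dimension 2m + 1, block \<open>Suc a\<close> is the one with parameter
  \<open>K a\<close>.\<close>

definition Idx :: "nat \<Rightarrow> nat \<Rightarrow> (nat \<Rightarrow> nat) \<Rightarrow> (nat \<times> (nat + nat)) set" where
  "Idx m S K = Sigma {..S} (\<lambda>t. Inl ` (if t = 0 then {..m} else {..<K (t - 1)}) \<union>
     Inr ` (if t = 0 then {..<m} else {..<K (t - 1)}))"

lemma finite_Idx [simp]: "finite (Idx m S K)"
  unfolding Idx_def by (intro finite_SigmaI) auto

lemma Idx_simps [simp]:
  "(0, Inl i) \<in> Idx m S K \<longleftrightarrow> i \<le> m" "(0, Inr i) \<in> Idx m S K \<longleftrightarrow> i < m"
  "(Suc a, Inl i) \<in> Idx m S K \<longleftrightarrow> a < S \<and> i < K a" "(Suc a, Inr i) \<in> Idx m S K \<longleftrightarrow> a < S \<and> i < K a"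
  by (auto simp: Idx_def)

lemma Idx_cases [consumes 1, case_names v u X Y]:
  assumes "x \<in> Idx m S K"
    "\<And>i. x = (0, Inl i) \<Longrightarrow> i \<le> m \<Longrightarrow> Q" "\<And>i. x = (0, Inr i) \<Longrightarrow> i < m \<Longrightarrow> Q"
    "\<And>a i. x = (Suc a, Inl i) \<Longrightarrow> a < S \<Longrightarrow> i < K a \<Longrightarrow> Q"
    "\<And>a i. x = (Suc a, Inr i) \<Longrightarrow> a < S \<Longrightarrow> i < K a \<Longrightarrow> Q"
  shows Q
proof -
  obtain t e where x: "x = (t, e)" by fastforce
  show Q
    using assms unfolding x by (cases t; cases e) auto
qed

lemma sum_Inl_Inr:
  assumes "finite I" "finite J"
  shows "(\<Sum>e\<in>Inl ` I \<union> Inr ` J. f e) = (\<Sum>i\<in>I. f (Inl i)) + (\<Sum>j\<in>J. f (Inr j) :: 'a::comm_monoid_add)"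
  using assms by (subst sum.union_disjoint) (auto simp: sum.reindex)

lemma sum_Idx:
  "sum f (Idx m S K) = (\<Sum>i\<le>m. f (0, Inl i)) + (\<Sum>j<m. f (0, Inr j)) +
     (\<Sum>a<S. (\<Sum>i<K a. f (Suc a, Inl i)) + (\<Sum>i<K a. f (Suc a, Inr i)) :: 'a::comm_monoid_add)"
proof -
  let ?D = "\<lambda>t. Inl ` (if t = 0 then {..m} else {..<K (t - 1)}) \<union> Inr ` (if t = 0 then {..<m} else {..<K (t - 1)}) :: (nat + nat) set"
  have "sum f (Idx m S K) = (\<Sum>t\<le>S. \<Sum>e\<in>?D t. f (t, e))"
    unfolding Idx_def by (subst sum.Sigma) auto
  also have "\<dots> = (\<Sum>e\<in>?D 0. f (0, e)) + (\<Sum>a<S. \<Sum>e\<in>?D (Suc a). f (Suc a, e))"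
    by (rule sum.atMost_shift)
  finally show ?thesis by (simp add: sum_Inl_Inr)
qed

lemma card_Idx: "card (Idx m S K) = 2 * (m + (\<Sum>a<S. K a)) + 1"
proof -
  have "card (Idx m S K) = (\<Sum>x\<in>Idx m S K. 1)" by simp
  also have "\<dots> = 2 * (m + (\<Sum>a<S. K a)) + 1"
    by (simp only: sum_Idx) (simp add: sum.distrib mult_2)
  finally show ?thesis .
qed

abbreviation nfp :: "nat \<Rightarrow> nat \<Rightarrow> (nat \<Rightarrow> nat) \<Rightarrow> (nat \<Rightarrow> nat) \<Rightarrow> ('k::field, nat \<Rightarrow> nat + nat \<Rightarrow> 'k) form_module" where
  "nfp m S L K \<equiv> normal_form_module (m, map (\<lambda>a. (L a, K a)) [0..<S])"

definition nfmods :: "nat \<Rightarrow> (nat \<Rightarrow> nat) \<Rightarrow> (nat \<Rightarrow> nat) \<Rightarrow> nat \<Rightarrow> ('k::field, nat + nat \<Rightarrow> 'k) form_module" where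
  "nfmods m L K t = (if t = 0 then V_module m else W_module (L (t - 1)) (K (t - 1)))"

definition nfMs :: "nat \<Rightarrow> nat \<Rightarrow> (nat \<Rightarrow> nat) \<Rightarrow> (nat \<Rightarrow> nat) \<Rightarrow> ('k::field, nat + nat \<Rightarrow> 'k) form_module list" where
  "nfMs m S L K = V_module m # map (\<lambda>(l, k). W_module l k) (map (\<lambda>a. (L a, K a)) [0..<S])"

lemma nfm_eq: "nfp m S L K = direct_sum (nfMs m S L K)"
  by (simp add: normal_form_module_def nfMs_def)

lemma Ms_length: "length (nfMs m S L K) = Suc S"
  by (simp add: nfMs_def)

lemma Ms_nth: "t \<le> S \<Longrightarrow> nfMs m S L K ! t = nfmods m L K t"
  by (cases t) (auto simp: nfmods_def nfMs_def)

lemma nfm_space: "fm_space (nfp m S L K) = {F. (\<forall>t\<le>S. F t \<in> fm_space (nfmods m L K t)) \<and> (\<forall>t>S. F t = 0)}"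
  unfolding nfm_eq direct_sum_def form_module.simps Ms_length
  by (simp add: Ms_nth less_Suc_eq_le Suc_le_eq)

lemma nfm_quad: "fm_quad (nfp m S L K) F = (\<Sum>t\<le>S. fm_quad (nfmods m L K t) (F t))"
  unfolding nfm_eq direct_sum_def form_module.simps Ms_length lessThan_Suc_atMost
  by (simp add: Ms_nth)

lemma nfm_bil: "fm_bil (nfp m S L K) F F' = (\<Sum>t\<le>S. fm_bil (nfmods m L K t) (F t) (F' t))"
  unfolding nfm_eq direct_sum_def form_module.simps Ms_length lessThan_Suc_atMost
  by (simp add: Ms_nth)

lemma nfm_scale:
  fixes c :: "'k::field"
  shows "fm_scale (nfp m S L K) c F t = (if t \<le> S then coord_scale c (F t) else 0)"
proof -
  have "fm_scale (nfmods m L K t :: ('k, _) form_module) = coord_scale" by (simp add: nfmods_def V_module_def W_module_def)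
  then show ?thesis
    unfolding nfm_eq direct_sum_def form_module.simps Ms_length by (simp add: less_Suc_eq_le Ms_nth)
qed

lemma Idx_le: "(t, e) \<in> Idx m S K \<Longrightarrow> t \<le> S"
  by (simp add: Idx_def)

lemma mods_space: "t \<le> S \<Longrightarrow> fm_space (nfmods m L K t) = {a. \<forall>e. (t, e) \<notin> Idx m S K \<longrightarrow> a e = 0}"
  by (auto simp: nfmods_def V_module_def W_module_def coord_space_def Idx_def)

lemma nfm_space_iff: "F \<in> fm_space (nfp m S L K) \<longleftrightarrow> (\<forall>t e. (t, e) \<notin> Idx m S K \<longrightarrow> F t e = 0)"
proof
  assume F: "F \<in> fm_space (nfp m S L K)"
  show "\<forall>t e. (t, e) \<notin> Idx m S K \<longrightarrow> F t e = 0"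
  proof (intro allI impI)
    fix t e assume "(t, e) \<notin> Idx m S K"
    then show "F t e = 0"
      using F by (cases "t \<le> S") (auto simp: nfm_space mods_space)
  qed
next
  assume "\<forall>t e. (t, e) \<notin> Idx m S K \<longrightarrow> F t e = 0"
  moreover have "(t, e) \<notin> Idx m S K" if "S < t" for t e using Idx_le[of t e m S K] that by auto
  ultimately show "F \<in> fm_space (nfp m S L K)"
    by (auto simp: nfm_space mods_space fun_eq_iff)
qed

text \<open>The \<open>v i\<close>, \<open>u j\<close> correspond to the basis of \<open>V_{2m+1}\<close> and \<open>X a i\<close>, \<open>Y a i\<close> to the vectors
  \<open>T^i \<rho>_1\<close>, \<open>T^i \<rho>_2\<close> of \<open>W_{L a}(K a)\<close>. All families are extended by 0, so that a shift never
  leaves the index range.\<close>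

locale ab_family = quad_space s \<alpha> n
  for s :: "'k::alg_closed_field \<Rightarrow> 'v::ab_group_add \<Rightarrow> 'v" and \<alpha> :: "'v \<Rightarrow> 'k" and n +
  fixes m :: nat and v u :: "nat \<Rightarrow> 'v" and S :: nat and K L :: "nat \<Rightarrow> nat"
    and X Y :: "nat \<Rightarrow> nat \<Rightarrow> 'v"
  assumes v0: "m < i \<Longrightarrow> v i = 0" and u0: "m \<le> i \<Longrightarrow> u i = 0"
    and X0: "a < S \<Longrightarrow> K a \<le> i \<Longrightarrow> X a i = 0" and Y0: "a < S \<Longrightarrow> K a \<le> i \<Longrightarrow> Y a i = 0"
    and av: "\<alpha> (v i) = of_bool (i = m)" and au: "\<alpha> (u i) = 0"
    and aX: "a < S \<Longrightarrow> \<alpha> (X a i) = of_bool (i + 1 = L a)" and aY: "a < S \<Longrightarrow> \<alpha> (Y a i) = 0"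
    and bvv: "bet (v i) (v j) = 0" and buu: "bet (u i) (u j) = 0"
    and bvu: "bet (v i) (u j) = of_bool (i = j \<and> j < m)"
    and bvX: "a < S \<Longrightarrow> bet (v i) (X a j) = 0" and bvY: "a < S \<Longrightarrow> bet (v i) (Y a j) = 0"
    and buX: "a < S \<Longrightarrow> bet (u i) (X a j) = 0" and buY: "a < S \<Longrightarrow> bet (u i) (Y a j) = 0"
    and bXX: "a < S \<Longrightarrow> c < S \<Longrightarrow> bet (X a i) (X c j) = 0"
    and bYY: "a < S \<Longrightarrow> c < S \<Longrightarrow> bet (Y a i) (Y c j) = 0"
    and bXY: "a < S \<Longrightarrow> c < S \<Longrightarrow> bet (X a i) (Y c j) = of_bool (a = c \<and> i + j + 1 = K a)"
    and KL: "a < S \<Longrightarrow> 1 \<le> K a \<and> K a \<le> 2 * L a \<and> L a \<le> K a"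
begin

lemma buv: "bet (u j) (v i) = of_bool (i = j \<and> j < m)"
  and bXv: "a < S \<Longrightarrow> bet (X a j) (v i) = 0" and bYv: "a < S \<Longrightarrow> bet (Y a j) (v i) = 0"
  and bXu: "a < S \<Longrightarrow> bet (X a j) (u i) = 0" and bYu: "a < S \<Longrightarrow> bet (Y a j) (u i) = 0"
  and bYX: "a < S \<Longrightarrow> c < S \<Longrightarrow> bet (Y c j) (X a i) = of_bool (a = c \<and> i + j + 1 = K a)"
  using bvu bvX bvY buX buY bXY by (subst bet_sym; simp)+

lemmas btab = bvv buu bvu buv bvX bvY buX buY bXv bYv bXu bYu bXX bYY bXY bYX

abbreviation "idx \<equiv> Idx m S K"

fun E :: "nat \<times> (nat + nat) \<Rightarrow> 'v" where
  "E (0, Inl i) = v i" | "E (0, Inr i) = u i" | "E (Suc a, Inl i) = X a i" | "E (Suc a, Inr i) = Y a i"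

text \<open>The dual basis: \<open>E (partner x)\<close> pairs to 1 with \<open>E x\<close> and to 0
  with the other basis vectors, for every index but that of the radical vector
  \<open>v m\<close>.\<close>

fun partner :: "nat \<times> (nat + nat) \<Rightarrow> nat \<times> (nat + nat)" where
  "partner (0, Inl i) = (0, Inr i)" | "partner (0, Inr i) = (0, Inl i)"
| "partner (Suc a, Inl i) = (Suc a, Inr (K a - 1 - i))" | "partner (Suc a, Inr i) = (Suc a, Inl (K a - 1 - i))"

lemma bet_partner:
  assumes x: "x \<in> idx" "x \<noteq> (0, Inl m)" and y: "y \<in> idx"
  shows "bet (E y) (E (partner x)) = of_bool (y = x)"
  using y
proof (cases rule: Idx_cases)
  case (v i)
  then show ?thesis using x by (elim Idx_cases) (auto simp: btab)
next
  case (u i)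
  then show ?thesis using x by (elim Idx_cases) (auto simp: btab)
next
  case (X a i)
  show ?thesis using x(1)
  proof (cases rule: Idx_cases)
    case (X a' i')
    then show ?thesis using \<open>y = (Suc a, Inl i)\<close> \<open>a < S\<close> \<open>i < K a\<close> by (auto simp: btab)
  qed (use X in \<open>auto simp: btab\<close>)
next
  case (Y a i)
  show ?thesis using x(1)
  proof (cases rule: Idx_cases)
    case (Y a' i')
    then show ?thesis using \<open>y = (Suc a, Inr i)\<close> \<open>a < S\<close> \<open>i < K a\<close> by (auto simp: btab)
  qed (use Y in \<open>auto simp: btab\<close>)
qed

lemma bet_sum_partner:
  assumes x: "x \<in> idx" "x \<noteq> (0, Inl m)"
  shows "bet (\<Sum>y\<in>idx. s (c y) (E y)) (E (partner x)) = c x"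
proof -
  have "bet (\<Sum>y\<in>idx. s (c y) (E y)) (E (partner x)) = (\<Sum>y\<in>idx. c y * of_bool (y = x))"
    unfolding bet_sum1 bet_simps by (intro sum.cong refl) (simp only: bet_partner[OF x])
  then show ?thesis using x by (simp only: sum_of_bool_eq finite_Idx) simp
qed

text \<open>Pairing with partners removes all coefficients but that of the radical vector
  \<open>v m\<close>, which \<open>\<alpha>\<close> detects.\<close>

lemma E_independent:
  assumes c: "(\<Sum>y\<in>idx. s (c y) (E y)) = 0" shows "\<forall>x\<in>idx. c x = 0"
proof -
  have 1: "c x = 0" if "x \<in> idx" "x \<noteq> (0, Inl m)" for x
    using bet_sum_partner[OF that, of c] unfolding c by simp
  have "(\<Sum>y\<in>idx. s (c y) (E y)) = (\<Sum>y\<in>{(0, Inl m)}. s (c y) (E y))"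
    using 1 by (intro sum.mono_neutral_right) auto
  then have "s (c (0, Inl m)) (v m) = 0" using c by simp
  then have "(c (0, Inl m))\<^sup>2 * \<alpha> (v m) = 0" unfolding \<alpha>_scale[symmetric] by (simp only: \<alpha>_0)
  then have "c (0, Inl m) = 0" by (simp add: av)
  with 1 show ?thesis by blast
qed

lemma size_le: "m + (\<Sum>a<S. K a) \<le> n"
proof -
  note ind = independent_familyI[OF finite_Idx E_independent]
  have "card (E ` idx) \<le> dim UNIV" using ind(2) by (intro independent_card_le_dim) auto
  then show ?thesis using ind(1) by (simp add: card_image card_Idx dim_space)
qed

end

locale ab_full = ab_family +
  assumes size: "m + (\<Sum>a<S. K a) = n"
begin

lemma E_ibasis: "ibasis idx E"
  using E_independent by (intro ibasis_dimI) (auto simp: card_Idx size dim_space)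

abbreviation "ce \<equiv> coord idx E"

lemma ce_partner:
  assumes "x \<in> idx" "x \<noteq> (0, Inl m)" shows "ce x z = bet z (E (partner x))"
  using bet_sum_partner[OF assms, of "\<lambda>y. ce y z"] unfolding sum_coord[OF E_ibasis] by simp

definition cvec :: "'b \<Rightarrow> nat \<Rightarrow> nat + nat \<Rightarrow> 'a" where
  "cvec z t e = (if (t, e) \<in> idx then ce (t, e) z else 0)"

definition blk :: "nat \<Rightarrow> (nat + nat \<Rightarrow> 'a) \<Rightarrow> 'b" where
  "blk t a = (\<Sum>i\<in>(if t = 0 then {..m} else {..<K (t - 1)}). s (a (Inl i)) (E (t, Inl i))) +
     (\<Sum>j\<in>(if t = 0 then {..<m} else {..<K (t - 1)}). s (a (Inr j)) (E (t, Inr j)))"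

lemma sum_blk: "(\<Sum>t\<le>S. blk t (cvec z t)) = z"
proof -
  have "z = (\<Sum>x\<in>idx. s (ce x z) (E x))" by (simp only: sum_coord[OF E_ibasis])
  also have "\<dots> = (\<Sum>t\<le>S. blk t (cvec z t))"
    by (simp only: sum_Idx sum.atMost_shift[where n = S]) (simp add: blk_def cvec_def)
  finally show ?thesis by simp
qed

abbreviation "nfm \<equiv> nfp m S L K :: ('a, nat \<Rightarrow> nat + nat \<Rightarrow> 'a) form_module"

abbreviation "mods \<equiv> nfmods m L K :: nat \<Rightarrow> ('a, nat + nat \<Rightarrow> 'a) form_module"

lemma cvec_bij: "bij_betw cvec UNIV (fm_space nfm)"
proof (rule bij_betwI')
  fix x y
  show "(cvec x = cvec y) = (x = y)"
  proof
    assume eq: "cvec x = cvec y"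
    show "x = y"
    proof (rule coord_eqI[OF E_ibasis])
      fix i assume "i \<in> idx"
      then show "ce i x = ce i y"
        using fun_cong[OF fun_cong[OF eq, of "fst i"], of "snd i"] by (simp add: cvec_def)
    qed
  qed simp
next
  fix x show "cvec x \<in> fm_space nfm" unfolding nfm_space_iff by (simp add: cvec_def)
next
  fix F assume F: "F \<in> fm_space nfm"
  let ?z = "\<Sum>x\<in>idx. s (F (fst x) (snd x)) (E x)"
  have "cvec ?z t e = F t e" for t e
    using coord_unique[OF E_ibasis, of "(t, e)" "\<lambda>x. F (fst x) (snd x)"] F
    by (simp add: cvec_def nfm_space_iff)
  then have "cvec ?z = F" by (intro ext)
  then show "\<exists>x\<in>UNIV. F = cvec x" by (intro bexI[of _ ?z]) simp_all
qed

lemma cvec_add: "cvec (x + y) = cvec x + cvec y"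
  by (intro ext) (simp add: cvec_def coord_add[OF E_ibasis] plus_fun_def)

lemma cvec_scale: "cvec (s c x) = fm_scale nfm c (cvec x)"
proof (intro ext)
  fix t e
  show "cvec (s c x) t e = fm_scale nfm c (cvec x) t e"
    unfolding nfm_scale using Idx_le[of t e]
    by (auto simp: cvec_def coord_scale[OF E_ibasis] coord_scale_def)
qed

lemma \<alpha>_comb:
  assumes fin: "finite I" "finite J"
    and xx: "\<And>i j. bet (x i) (x j) = 0" and yy: "\<And>i j. bet (y i) (y j) = 0" and ay: "\<And>j. \<alpha> (y j) = 0"
  shows "\<alpha> ((\<Sum>i\<in>I. s (a (Inl i)) (x i)) + (\<Sum>j\<in>J. s (a (Inr j)) (y j)))
    = pair_quad I J (\<lambda>i j. bet (x i) (y j)) (\<lambda>i. \<alpha> (x i)) a"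
proof -
  have 1: "\<alpha> (\<Sum>i\<in>I. s (a (Inl i)) (x i)) = (\<Sum>i\<in>I. (a (Inl i))\<^sup>2 * \<alpha> (x i))"
    by (subst \<alpha>_sum_isotropic) (simp_all add: xx \<alpha>_scale)
  have 2: "\<alpha> (\<Sum>j\<in>J. s (a (Inr j)) (y j)) = 0"
    by (subst \<alpha>_sum_isotropic) (simp_all add: yy \<alpha>_scale ay)
  have 3: "bet (\<Sum>i\<in>I. s (a (Inl i)) (x i)) (\<Sum>j\<in>J. s (a (Inr j)) (y j))
    = (\<Sum>i\<in>I. \<Sum>j\<in>J. bet (x i) (y j) * a (Inl i) * a (Inr j))"
    by (simp only: bet_sum1) (simp only: bet_sum2 bet_simps sum_distrib_left mult_ac)
  show ?thesis unfolding \<alpha>_add 1 2 3 pair_quad_def by (simp add: mult.commute)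
qed

lemma blk_quad:
  assumes "t \<le> S" shows "\<alpha> (blk t a) = fm_quad (mods t) a"
proof (cases t)
  case 0
  show ?thesis
    unfolding 0 blk_def using \<alpha>_comb[of "{..m}" "{..<m}" v u a]
    by (simp add: btab au av nfmods_def V_module_def pair_quad_def)
next
  case (Suc b)
  then have b: "b < S" using assms by simp
  show ?thesis
    unfolding Suc blk_def using \<alpha>_comb[of "{..<K b}" "{..<K b}" "X b" "Y b" a] b
    by (simp add: btab aX aY nfmods_def W_module_def)
qed

lemma blk_orth:
  assumes "t \<le> S" "t' \<le> S" "t \<noteq> t'" shows "bet (blk t a) (blk t' a') = 0"
proof -
  have "bet (E (t, e)) (E (t', e')) = 0" for e e'
    using assms by (cases t; cases t'; cases e; cases e') (auto simp: btab)
  then show ?thesis by (simp add: blk_def bet_sum1 bet_sum2)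
qed

lemma cvec_quad: "fm_quad nfm (cvec z) = \<alpha> z"
proof -
  have "\<alpha> z = \<alpha> (\<Sum>t\<le>S. blk t (cvec z t))" by (simp only: sum_blk)
  also have "\<dots> = (\<Sum>t\<le>S. \<alpha> (blk t (cvec z t)))"
    by (rule \<alpha>_sum_isotropic) (auto intro: blk_orth)
  finally show ?thesis unfolding nfm_quad by (simp add: blk_quad)
qed

lemma params_iff: "normal_form_params (m, map (\<lambda>a. (L a, K a)) [0..<S]) \<longleftrightarrow>
  (\<forall>a c. a < c \<longrightarrow> c < S \<longrightarrow> K c \<le> K a \<and> L c \<le> L a \<and> K c - L c \<le> K a - L a) \<and> (\<forall>a<S. K a - L a \<le> m)"
proof -
  have "(K a + 1) div 2 \<le> L a \<longleftrightarrow> K a \<le> 2 * L a" for a by linarith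
  then have 1: "(\<forall>(l, k)\<in>set (map (\<lambda>a. (L a, K a)) [0..<S]). 1 \<le> k \<and> (k + 1) div 2 \<le> l \<and> l \<le> k)"
    using KL by auto
  have up: "sorted_wrt P [0..<S] \<longleftrightarrow> (\<forall>a c. a < c \<longrightarrow> c < S \<longrightarrow> P a c)" for P
    by (auto simp: sorted_wrt_iff_nth_less)
  have 2: "sorted_wrt (\<ge>) (map snd (map (\<lambda>a. (L a, K a)) [0..<S])) \<longleftrightarrow> (\<forall>a c. a < c \<longrightarrow> c < S \<longrightarrow> K c \<le> K a)"
    "sorted_wrt (\<ge>) (map fst (map (\<lambda>a. (L a, K a)) [0..<S])) \<longleftrightarrow> (\<forall>a c. a < c \<longrightarrow> c < S \<longrightarrow> L c \<le> L a)"
    by (simp_all add: sorted_wrt_map up)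
  have 3: "sorted_wrt (\<ge>) (m # map (\<lambda>(l, k). k - l) (map (\<lambda>a. (L a, K a)) [0..<S])) \<longleftrightarrow>
    (\<forall>a<S. K a - L a \<le> m) \<and> (\<forall>a c. a < c \<longrightarrow> c < S \<longrightarrow> K c - L c \<le> K a - L a)"
    by (simp add: sorted_wrt_map up) auto
  show ?thesis
    unfolding normal_form_params_def prod.case 2 3 using 1 by blast
qed

end

section \<open>Families along which the second form acts as a shift\<close>

locale form_space = quad_space s \<alpha> n
  for s :: "'k::alg_closed_field \<Rightarrow> 'v::ab_group_add \<Rightarrow> 'v" and \<alpha> :: "'v \<Rightarrow> 'k" and n +
  fixes \<omega> :: "'v \<Rightarrow> 'v \<Rightarrow> 'k"
  assumes omega: "bilinear_alt \<omega>"
begin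

lemmas om [simp] = bilinear_altD(1-7)[OF omega]
lemmas om_sum1 = bilinear_altD(9)[OF omega]
lemmas om_sum2 = bilinear_altD(10)[OF omega]

lemma om_sym: "\<omega> v w = \<omega> w v" by (rule bilinear_altD(8)[OF omega])

abbreviation "omod \<equiv> \<lparr>fm_space = UNIV, fm_scale = s, fm_quad = \<alpha>, fm_bil = \<omega>\<rparr>"

end

text \<open>The row v is shifted downwards and the rows u, X, Y upwards. The relation for u stops
  before \<open>u (m - 1)\<close>: that vector has \<open>\<omega>\<close>-value 1 with the radical
  vector \<open>v m\<close>, so \<open>bet\<close> cannot represent it.\<close>

locale chain_family = ab_family s \<alpha> n m v u S K L X Y + form_space s \<alpha> n \<omega>
  for s :: "'k::alg_closed_field \<Rightarrow> 'v::ab_group_add \<Rightarrow> 'v" and \<alpha> n m v u S K L X Y \<omega> +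
  assumes cv0: "\<omega> (v 0) z = 0" and cv: "\<omega> (v (Suc i)) z = bet (v i) z"
    and cu: "Suc j < m \<Longrightarrow> \<omega> (u j) z = bet (u (Suc j)) z"
    and cX: "a < S \<Longrightarrow> \<omega> (X a i) z = bet (X a (Suc i)) z"
    and cY: "a < S \<Longrightarrow> \<omega> (Y a i) z = bet (Y a (Suc i)) z"
begin

text \<open>\<open>v (Suc m)\<close> is 0 by the extension convention, so the shift relation puts
  \<open>v m\<close> in the radical.\<close>

lemma rad: "bet (v m) z = 0" "bet z (v m) = 0"
  using cv[of m z] v0[of "Suc m"] bet_sym[of z] by simp_all

lemma ovv: "\<omega> (v i) (v j) = 0" by (cases i) (simp_all add: cv0 cv btab)

lemma ovu: "\<omega> (v i) (u j) = of_bool (i = Suc j \<and> j < m)"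
  by (cases i) (auto simp: cv0 cv btab)

lemma ovX: "a < S \<Longrightarrow> \<omega> (v i) (X a j) = 0" and ovY: "a < S \<Longrightarrow> \<omega> (v i) (Y a j) = 0"
  by (cases i; simp add: cv0 cv btab)+

lemma oXX: "a < S \<Longrightarrow> c < S \<Longrightarrow> \<omega> (X a i) (X c j) = 0"
  and oYY: "a < S \<Longrightarrow> c < S \<Longrightarrow> \<omega> (Y a i) (Y c j) = 0"
  and oXY: "a < S \<Longrightarrow> c < S \<Longrightarrow> \<omega> (X a i) (Y c j) = of_bool (a = c \<and> i + j + 2 = K a)"
  and oXu: "a < S \<Longrightarrow> \<omega> (X a i) (u j) = 0" and oYu: "a < S \<Longrightarrow> \<omega> (Y a i) (u j) = 0"
  by (simp_all add: cX cY btab)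

lemma ouu: "\<omega> (u i) (u j) = 0"
proof -
  consider "Suc i < m" | "Suc j < m" | "i \<ge> m" | "j \<ge> m" | "i = j" by linarith
  then show ?thesis
  proof cases
    case 1 then show ?thesis by (simp add: cu btab)
  next
    case 2 then show ?thesis by (subst om_sym) (simp add: cu btab)
  qed (simp_all add: u0)
qed

lemma ouv: "\<omega> (u j) (v i) = of_bool (i = Suc j \<and> j < m)"
  and oXv: "a < S \<Longrightarrow> \<omega> (X a j) (v i) = 0" and oYv: "a < S \<Longrightarrow> \<omega> (Y a j) (v i) = 0"
  and ouX: "a < S \<Longrightarrow> \<omega> (u j) (X a i) = 0" and ouY: "a < S \<Longrightarrow> \<omega> (u j) (Y a i) = 0"
  and oYX: "a < S \<Longrightarrow> c < S \<Longrightarrow> \<omega> (Y c j) (X a i) = of_bool (a = c \<and> i + j + 2 = K a)"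
  using ovu ovX ovY oXu oYu oXY by (subst om_sym; simp)+

lemmas otab = ovv ovu ovX ovY oXX oYY oXY oXu oYu ouu ouv oXv oYv ouX ouY oYX

text \<open>A change of basis in two blocks that increases one of the \<open>L a\<close>. The two shifts by \<open>p\<close> and
  \<open>p + d\<close> make the old value of \<open>\<alpha>\<close> on \<open>X a (L a - 1)\<close> cancel.\<close>

lemma move_blocks:
  assumes ac: "a < S" "c < S" "a \<noteq> c" and p: "K a + p = K c + p'" and l: "p + L a < L c"
  shows "\<exists>X' Y'. chain_family s \<alpha> n m v u S K (L(a := L c - p)) X' Y' \<omega>"
proof -
  define d where "d = L c - p - L a"
  have d: "0 < d" "L c = p + d + L a" using l by (auto simp: d_def)
  let ?X = "X(a := \<lambda>i. X a i + X c (i + p) + X c (i + p + d))"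
  \<comment> \<open>\<open>Y c\<close> receives the adjoint shifts, so that the new
    \<open>X a\<close> and \<open>Y c\<close> stay orthogonal; K a + p = K c + p' is the adjointness
    condition.\<close>
  let ?Y = "Y(c := \<lambda>j. Y c j + Y a (j + p') + Y a (j + p' + d))"
  note t = btab av au aX aY \<alpha>_add
  have "chain_family s \<alpha> n m v u S K (L(a := L c - p)) ?X ?Y \<omega>"
  proof unfold_locales
    show "?X b i = 0" if "b < S" "K b \<le> i" for b i
      using that ac p X0[of a i] X0[of c "i + p"] X0[of c "i + p + d"] X0[of b i] by auto
    show "?Y b i = 0" if "b < S" "K b \<le> i" for b i
      using that ac p Y0[of c i] Y0[of a "i + p'"] Y0[of a "i + p' + d"] Y0[of b i] by auto
    show "\<alpha> (?X b i) = of_bool (i + 1 = (L(a := L c - p)) b)" if "b < S" for b i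
      using that ac d by (auto simp: t)
    show "\<alpha> (?Y b i) = 0" if "b < S" for b i
      using that ac by (auto simp: t)
    show "bet (?X b i) (?Y e j) = of_bool (b = e \<and> i + j + 1 = K b)" if "b < S" "e < S" for b e i j
    proof -
      have e: "i + (j + p') + 1 = K a \<longleftrightarrow> i + p + j + 1 = K c"
        "i + (j + p' + d) + 1 = K a \<longleftrightarrow> i + p + d + j + 1 = K c" using p by auto
      consider "b = a" "e = c" | "b = a" "e \<noteq> c" | "b \<noteq> a" "e = c" | "b \<noteq> a" "e \<noteq> c" by blast
      then show ?thesis
      proof cases
        case 1
        have "bet (?X b i) (?Y e j) = (of_bool (i + (j + p') + 1 = K a) + of_bool (i + (j + p' + d) + 1 = K a))
          + (of_bool (i + p + j + 1 = K c) + of_bool (i + p + d + j + 1 = K c))"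
          using 1 ac by (simp add: btab add_ac)
        then show ?thesis using 1 ac by (simp only: e add_self) simp
      qed (use that ac in \<open>auto simp: btab\<close>)
    qed
    show "1 \<le> K b \<and> K b \<le> 2 * (L(a := L c - p)) b \<and> (L(a := L c - p)) b \<le> K b" if "b < S" for b
      using KL[OF that] KL[OF ac(1)] KL[OF ac(2)] p l by auto
  qed (auto simp: v0 u0 t ac cv0 cv cu cX cY)
  then show ?thesis by blast
qed

text \<open>The row \<open>X a\<close> absorbs the row v read backwards, since v is shifted in the
  opposite direction. The copy in \<open>cvv 0\<close> puts the value 1 of
  \<open>\<alpha> (v m)\<close> at place K a - m - 1; the copy delayed by d cancels the old value at
  L a - 1. The \<open>u j\<close> take up the corresponding \<open>Y a\<close> terms to keep the
  pairings.\<close>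

lemma move_radical:
  assumes a: "a < S" and l: "m + L a < K a"
  shows "\<exists>u' X'. chain_family s \<alpha> n m v u' S K (L(a := K a - m)) X' Y \<omega>"
proof -
  define d where "d = K a - m - L a"
  define cvv where "cvv e i = (if i + e < K a then v (K a - 1 - i - e) else 0)" for e i
  let ?X = "X(a := \<lambda>i. X a i + cvv 0 i + cvv d i)"
  let ?u = "\<lambda>j. if j < m then u j + Y a j + Y a (j + d) else 0"
  have d: "0 < d" "K a = m + L a + d" using l by (auto simp: d_def)
  note t = btab av au aX aY \<alpha>_add
  have c1: "bet (cvv e i) (v j) = 0" "bet (cvv e i) (cvv f j) = 0" "bet (v j) (cvv e i) = 0" for e f i j by (simp_all add: cvv_def t)
  have c2: "bet (cvv e i) (X b j) = 0" "bet (cvv e i) (Y b j) = 0" "bet (X b j) (cvv e i) = 0" "bet (Y b j) (cvv e i) = 0"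
    if "b < S" for b e i j using that by (simp_all add: cvv_def t)
  have c3: "bet (cvv e i) (u j) = of_bool (i + e + j + 1 = K a \<and> j < m)"
    "bet (u j) (cvv e i) = of_bool (i + e + j + 1 = K a \<and> j < m)" for e i j
    by (auto simp: cvv_def t)
  have c4: "\<alpha> (cvv e i) = of_bool (i + e + m + 1 = K a)" for e i by (auto simp: cvv_def t)
  have c5: "\<omega> (cvv e i) z = bet (cvv e (Suc i)) z" for e i z
  proof (cases "Suc i + e < K a")
    case True
    then have "K a - 1 - i - e = Suc (K a - 1 - Suc i - e)" by simp
    then show ?thesis using True by (simp add: cvv_def cv)
  next
    case False
    then have "i + e < K a \<Longrightarrow> K a - 1 - i - e = 0" by simp
    then show ?thesis using False cv0 by (auto simp: cvv_def)
  qed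
  note c = c1 c2 c3 c4 c5
  have "chain_family s \<alpha> n m v ?u S K (L(a := K a - m)) ?X Y \<omega>"
  proof unfold_locales
    show "?X b i = 0" if "b < S" "K b \<le> i" for b i
      using that X0[of b i] by (auto simp: cvv_def)
    show "\<alpha> (?X b i) = of_bool (i + 1 = (L(a := K a - m)) b)" if "b < S" for b i
      using that d by (auto simp: t c)
    show "bet (?X b i) (Y e j) = of_bool (b = e \<and> i + j + 1 = K b)" if "b < S" "e < S" for b e i j
      using that by (auto simp: t c)
    show "1 \<le> K b \<and> K b \<le> 2 * (L(a := K a - m)) b \<and> (L(a := K a - m)) b \<le> K b" if "b < S" for b
      using KL[OF that] KL[OF a] l by auto
    show "bet (v i) (?u j) = of_bool (i = j \<and> j < m)" for i j using a by (simp add: t)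
    show "bet (?u i) (?X b j) = 0" if "b < S" for b i j
      using that a by (auto simp: t c of_bool_def)
    show "\<omega> (?u j) z = bet (?u (Suc j)) z" if "Suc j < m" for j z
      using that a by (simp add: cu cY)
  qed (auto simp: v0 t a c cv0 cv cX cY Y0)
  then show ?thesis by blast
qed

end

locale nf_family = chain_family +
  assumes size': "m + (\<Sum>a<S. K a) = n"
begin

sublocale ab_full s \<alpha> n m v u S K L X Y
  by unfold_locales (rule size')

end

section \<open>Splitting off the blocks of a nilpotent operator\<close>

text \<open>Read backwards, g becomes a power series with nonzero constant term, and d consists of
  the coefficients of its inverse.\<close>

lemma convolution_inverse:
  fixes g :: "nat \<Rightarrow> 'k::field"
  assumes "g N \<noteq> 0" "\<And>j. N < j \<Longrightarrow> g j = 0"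
  shows "\<exists>d. d 0 \<noteq> 0 \<and> (\<forall>i. (\<Sum>j\<le>N. d j * g (i + j)) = of_bool (i = N))"
proof -
  define G where "G = Abs_fps (\<lambda>j. if j \<le> N then g (N - j) else 0)"
  define D where "D = inverse G"
  have G0: "fps_nth G 0 \<noteq> 0" using assms(1) by (simp add: G_def)
  have DG: "D * G = 1" unfolding D_def using G0 by (rule inverse_mult_eq_1)
  have "(\<Sum>j\<le>N. fps_nth D j * g (i + j)) = of_bool (i = N)" for i
  proof (cases "i \<le> N")
    case True
    have "(\<Sum>j\<le>N. fps_nth D j * g (i + j)) = (\<Sum>j\<le>N - i. fps_nth D j * g (i + j))"
      by (intro sum.mono_neutral_right) (auto simp: assms(2))
    also have "\<dots> = (\<Sum>j=0..N - i. fps_nth D j * fps_nth G (N - i - j))"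
      unfolding atMost_atLeast0 using True by (intro sum.cong) (auto simp: G_def)
    also have "\<dots> = fps_nth (D * G) (N - i)" by (simp add: fps_mult_nth)
    finally show ?thesis using True by (auto simp: DG)
  next
    case False
    then show ?thesis by (simp add: assms(2))
  qed
  moreover have "fps_nth D 0 \<noteq> 0" using G0 by (simp add: D_def)
  ultimately show ?thesis by blast
qed

lemma (in quad_space) quadratic_root: "\<exists>r::'k. r\<^sup>2 + r = c"
proof -
  have "degree [:c, 1, 1 :: 'k:] > 0" by simp
  then obtain r where "poly [:c, 1, 1 :: 'k:] r = 0" using alg_closed_imp_poly_has_root by blast
  then have "c + (r + r * r) = 0" by (simp add: algebra_simps)
  then show ?thesis by (intro exI[of _ r]) (simp add: power2_eq_square add.commute)
qed

text \<open>In terms of \<open>j = l - 1 - i\<close> the equations express \<open>c j\<^sup>2\<close> through \<open>c (2 j - j\<^sub>0)\<close> with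
  \<open>j\<^sub>0 = 2 l - k - 1\<close>; they are solved in the order of decreasing distance from \<open>j\<^sub>0\<close>.\<close>

lemma (in quad_space) frobenius_system:
  fixes b :: "nat \<Rightarrow> 'k"
  assumes "k \<le> 2 * l"
  shows "\<exists>c. \<forall>i<l. (c (l - 1 - i))\<^sup>2 + (\<Sum>j<l. c j * of_bool (2 * i + j + 1 = k)) = b i"
proof -
  define j0 where "j0 = 2 * int l - int k - 1"
  \<comment> \<open>The measure decreases as the distance from j0 grows, so far indices are solved
    first; 2l + k + 2 exceeds every distance that occurs and keeps the difference positive.\<close>
  define f where "f j = nat (int (2 * l + k + 2) - \<bar>int j - j0\<bar>)" for j :: nat
  \<comment> \<open>The only index that refers to itself is j = j0, where the equation is r^2 + r =
    const, solved by \<open>quadratic_root\<close>. At any other index it is a plain square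
    root.\<close>
  define P where "P c j r \<longleftrightarrow> (j < l \<longrightarrow> r\<^sup>2 + (if 2 * (l - 1 - j) + j + 1 = k then r
    else \<Sum>i\<in>{..<l} - {j}. c i * of_bool (2 * (l - 1 - j) + i + 1 = k)) = b (l - 1 - j))"
    for c :: "nat \<Rightarrow> 'k" and j r
  have less: "f i < f j" if "j < l" "i < l" "i \<noteq> j" "2 * (l - 1 - j) + i + 1 = k" for i j
  proof -
    have "int i - j0 = 2 * (int j - j0)" using that by (simp add: j0_def)
    moreover from this have "int j \<noteq> j0" using that(3) by auto
    ultimately have "\<bar>int j - j0\<bar> < \<bar>int i - j0\<bar>" by auto
    moreover have "\<bar>int i - j0\<bar> < int (2 * l + k + 2)" "\<bar>int j - j0\<bar> < int (2 * l + k + 2)"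
      using that assms by (auto simp: j0_def)
    ultimately show ?thesis by (simp add: f_def)
  qed
  have "\<exists>c. \<forall>j. P c j (c j)"
  proof (rule dependent_wf_choice[OF wf_measure[of f]])
    fix c c' :: "nat \<Rightarrow> 'k" and j r assume eq: "\<And>i. (i, j) \<in> measure f \<Longrightarrow> c i = c' i"
    have "(\<Sum>i\<in>{..<l} - {j}. c i * of_bool (2 * (l - 1 - j) + i + 1 = k))
      = (\<Sum>i\<in>{..<l} - {j}. c' i * of_bool (2 * (l - 1 - j) + i + 1 = k))" if "j < l"
    proof (intro sum.cong refl)
      fix i assume i: "i \<in> {..<l} - {j}"
      show "c i * of_bool (2 * (l - 1 - j) + i + 1 = k) = c' i * of_bool (2 * (l - 1 - j) + i + 1 = k)"
        using less[of j i] eq[of i] i that by (cases "2 * (l - 1 - j) + i + 1 = k") auto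
    qed
    then show "P c j r = P c' j r" unfolding P_def by (cases "j < l") simp_all
  next
    fix j and c :: "nat \<Rightarrow> 'k"
    let ?R = "\<Sum>i\<in>{..<l} - {j}. c i * of_bool (2 * (l - 1 - j) + i + 1 = k)"
    obtain r1 where "r1\<^sup>2 + r1 = b (l - 1 - j)" using quadratic_root by blast
    moreover obtain r2 where "r2\<^sup>2 = b (l - 1 - j) + ?R" using sqrt_ex by blast
    then have "r2\<^sup>2 + ?R = b (l - 1 - j)" by (simp add: add.assoc)
    ultimately show "\<exists>r. P c j r"
      unfolding P_def by (cases "2 * (l - 1 - j) + j + 1 = k") auto
  qed
  then obtain c where c: "\<And>j. P c j (c j)" by blast
  have "(c (l - 1 - i))\<^sup>2 + (\<Sum>j<l. c j * of_bool (2 * i + j + 1 = k)) = b i" if i: "i < l" for i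
  proof -
    let ?j = "l - 1 - i"
    have j: "?j < l" "l - 1 - ?j = i" using i by auto
    have "(\<Sum>j<l. c j * of_bool (2 * i + j + 1 = k)) = c ?j * of_bool (2 * i + ?j + 1 = k)
      + (\<Sum>j\<in>{..<l} - {?j}. c j * of_bool (2 * i + j + 1 = k))"
      using j by (intro sum.remove) auto
    also have "\<dots> = (if 2 * i + ?j + 1 = k then c ?j
      else \<Sum>j\<in>{..<l} - {?j}. c j * of_bool (2 * i + j + 1 = k))"
    proof (cases "2 * i + ?j + 1 = k")
      case True
      then have "(\<Sum>j\<in>{..<l} - {?j}. c j * of_bool (2 * i + j + 1 = k)) = 0"
        by (intro sum.neutral) auto
      with True show ?thesis by simp
    qed simp
    finally have eq: "(\<Sum>j<l. c j * of_bool (2 * i + j + 1 = k)) = (if 2 * i + ?j + 1 = k then c ?j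
      else \<Sum>j\<in>{..<l} - {?j}. c j * of_bool (2 * i + j + 1 = k))" .
    show ?thesis by (subst eq) (rule c[of ?j, unfolded P_def j(2), THEN mp, OF j(1)])
  qed
  then show ?thesis by blast
qed

text \<open>\<open>T\<close> represents \<open>\<omega>\<close> against all vectors of the space,
  not only those of \<open>U\<close>. Nondegeneracy on \<open>U\<close> makes it linear, and
  symmetry of \<open>\<omega>\<close> makes its powers self-adjoint.\<close>

locale nil_op = form_space s \<alpha> n \<omega>
  for s :: "'k::alg_closed_field \<Rightarrow> 'v::ab_group_add \<Rightarrow> 'v" and \<alpha> n \<omega> +
  fixes U :: "'v set" and T :: "'v \<Rightarrow> 'v"
  assumes subU: "subspace U" and TU: "z \<in> U \<Longrightarrow> T z \<in> U"
    and T\<omega>: "z \<in> U \<Longrightarrow> bet (T z) w = \<omega> z w"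
    and nondegU: "z \<in> U \<Longrightarrow> (\<And>w. w \<in> U \<Longrightarrow> bet z w = 0) \<Longrightarrow> z = 0"
    and nilT: "\<exists>N. \<forall>z\<in>U. (T ^^ N) z = 0"
begin

lemmas U0 = subspace_0[OF subU] and Uadd = subspace_add[OF subU] and Uscale = subspace_scale[OF subU]
lemmas Usum = subspace_sum[OF subU]

lemma U_eqI: "z \<in> U \<Longrightarrow> z' \<in> U \<Longrightarrow> (\<And>w. w \<in> U \<Longrightarrow> bet z w = bet z' w) \<Longrightarrow> z = z'"
  using nondegU[of "z + z'"] Uadd by simp

lemma T_add: "z \<in> U \<Longrightarrow> z' \<in> U \<Longrightarrow> T (z + z') = T z + T z'"
  by (rule U_eqI) (simp_all add: TU Uadd T\<omega>)

lemma T_scale: "z \<in> U \<Longrightarrow> T (s c z) = s c (T z)"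
  by (rule U_eqI) (simp_all add: TU Uscale T\<omega>)

lemma Tp_U: "z \<in> U \<Longrightarrow> (T ^^ i) z \<in> U"
  by (induction i) (simp_all add: TU)

lemma Tp_add: "z \<in> U \<Longrightarrow> z' \<in> U \<Longrightarrow> (T ^^ i) (z + z') = (T ^^ i) z + (T ^^ i) z'"
  by (induction i) (simp_all add: T_add Tp_U)

lemma Tp_scale: "z \<in> U \<Longrightarrow> (T ^^ i) (s c z) = s c ((T ^^ i) z)"
  by (induction i) (simp_all add: T_scale Tp_U)

lemma Tp_0: "(T ^^ i) 0 = 0"
  using Tp_scale[OF U0, of i 0] by simp

lemma Tp_sum: "(\<And>x. x \<in> A \<Longrightarrow> f x \<in> U) \<Longrightarrow> (T ^^ i) (sum f A) = (\<Sum>x\<in>A. (T ^^ i) (f x))"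
  by (induction A rule: infinite_finite_induct) (simp_all add: Tp_0 Tp_add Usum)

lemma Tp_Tp: "(T ^^ i) ((T ^^ j) z) = (T ^^ (i + j)) z"
  by (simp add: funpow_add)

lemma T_selfadj: "z \<in> U \<Longrightarrow> w \<in> U \<Longrightarrow> bet (T z) w = bet z (T w)"
  unfolding bet_sym[of z] by (simp only: T\<omega>) (rule om_sym)

lemma Tp_selfadj: "z \<in> U \<Longrightarrow> w \<in> U \<Longrightarrow> bet ((T ^^ i) z) w = bet z ((T ^^ i) w)"
proof (induction i arbitrary: w)
  case (Suc i)
  have "bet ((T ^^ Suc i) z) w = bet ((T ^^ i) z) (T w)" using Suc by (simp add: T_selfadj Tp_U)
  also have "\<dots> = bet z ((T ^^ i) (T w))" using Suc by (simp add: TU)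
  finally show ?case by (simp add: funpow_swap1)
qed simp

lemma bet_Tp_Tp: "z \<in> U \<Longrightarrow> w \<in> U \<Longrightarrow> bet ((T ^^ i) z) ((T ^^ j) w) = bet ((T ^^ (i + j)) z) w"
  by (simp add: Tp_selfadj[of _ w j, symmetric] Tp_U Tp_Tp add.commute)

text \<open>By self-adjointness only i + j matters: for 2p it is \<open>bet\<close> of T^p z with
  itself, for 2p + 1 it is \<open>\<omega>\<close> of T^p z with itself. Hence
  \<open>\<alpha>\<close> is additive on polynomials in \<open>T\<close> applied to one
  vector.\<close>

lemma bet_Tp_self: assumes z: "z \<in> U" shows "bet ((T ^^ i) z) ((T ^^ j) z) = 0"
proof -
  have "bet ((T ^^ i) z) ((T ^^ j) z) = bet ((T ^^ (i + j)) z) z" using z by (rule bet_Tp_Tp) fact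
  also have "\<dots> = 0"
  proof (cases "even (i + j)")
    case True
    then obtain p where p: "i + j = p + p" by (metis evenE mult_2)
    show ?thesis unfolding p bet_Tp_Tp[OF z z, symmetric] by simp
  next
    case False
    then obtain p where p: "i + j = Suc p + p" by (metis oddE mult_2 Suc_eq_plus1 add_Suc)
    show ?thesis unfolding p bet_Tp_Tp[OF z z, symmetric] by (simp add: T\<omega> Tp_U z)
  qed
  finally show ?thesis .
qed

lemma \<alpha>_Tp_comb:
  assumes z: "z \<in> U"
  shows "\<alpha> ((T ^^ i) (\<Sum>j\<in>A. s (c j) ((T ^^ j) z))) = (\<Sum>j\<in>A. (c j)\<^sup>2 * \<alpha> ((T ^^ (i + j)) z))"
proof -
  have "(T ^^ i) (\<Sum>j\<in>A. s (c j) ((T ^^ j) z)) = (\<Sum>j\<in>A. s (c j) ((T ^^ (i + j)) z))"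
    by (simp add: Tp_sum Uscale Tp_U z Tp_scale Tp_Tp)
  then show ?thesis
    by (simp only:) (subst \<alpha>_sum_isotropic; simp add: bet_Tp_self z \<alpha>_scale)
qed

text \<open>k is the nilpotency order, and l - 1 is the last exponent j for which
  \<open>\<alpha>\<close> is not identically 0 on the image of T^j. A vector that is extremal for
  both is normalized to x, a dual vector to y, and a polynomial in T applied to x is added to y to
  kill \<open>\<alpha>\<close> on its chain.\<close>

lemma block_exists:
  assumes ne: "z0 \<in> U" "z0 \<noteq> 0"
  obtains k l x y where "x \<in> U" "y \<in> U" "1 \<le> k" "k \<le> 2 * l" "l \<le> k" "\<And>z. z \<in> U \<Longrightarrow> (T ^^ k) z = 0"
    "\<And>i. \<alpha> ((T ^^ i) x) = of_bool (i + 1 = l)" "\<And>i. \<alpha> ((T ^^ i) y) = 0"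
    "\<And>i. bet ((T ^^ i) x) y = of_bool (i + 1 = k)"
proof -
  let ?N = "\<lambda>k. \<forall>z\<in>U. (T ^^ k) z = 0"
  define k where "k = (LEAST k. ?N k)"
  have Nk: "?N k" using nilT unfolding k_def by (rule LeastI_ex)
  have kmin: "k \<le> j" if "?N j" for j unfolding k_def using that by (rule Least_le)
  have k1: "1 \<le> k"
  proof (rule ccontr)
    assume "\<not> 1 \<le> k"
    then have "k = 0" by simp
    with Nk ne show False by simp
  qed
  have Tk: "(T ^^ i) z = 0" if "z \<in> U" "k \<le> i" for i z
    using Nk Tp_Tp[of "i - k" k z] that by (simp add: Tp_0)
  let ?P = "\<lambda>j. \<exists>z\<in>U. \<alpha> ((T ^^ j) z) \<noteq> 0"
  have Pk: "j < k" if "?P j" for j using that Tk[of _ j] by (cases "k \<le> j") auto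
  \<comment> \<open>If \<open>\<alpha>\<close> vanishes on the image of T^j, so does its
    polarization bet(T^j z, T^j w) = bet(T^(2j) z, w), and T^(2j) = 0 by nondegeneracy. For j = l
    this gives k at most 2l.\<close>
  have noP: "k \<le> 2 * j" if "\<not> ?P j" for j
  proof (rule kmin, rule ballI)
    fix z assume z: "z \<in> U"
    show "(T ^^ (2 * j)) z = 0"
    proof (rule nondegU[OF Tp_U[OF z]])
      fix w assume w: "w \<in> U"
      have "\<alpha> ((T ^^ j) (z + w)) = 0" "\<alpha> ((T ^^ j) z) = 0" "\<alpha> ((T ^^ j) w) = 0"
        using that z w Uadd by blast+
      then have "bet ((T ^^ j) z) ((T ^^ j) w) = 0" by (simp add: Tp_add z w \<alpha>_add)
      then show "bet ((T ^^ (2 * j)) z) w = 0" by (simp add: bet_Tp_Tp z w mult_2)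
    qed
  qed
  have "\<exists>j. ?P j"
  proof (rule ccontr)
    assume "\<nexists>j. ?P j"
    then have "\<not> ?P 0" by blast
    from noP[OF this] k1 show False by simp
  qed
  then obtain j0 where "?P j0" by blast
  then have "\<exists>j. ?P j \<and> (\<forall>i. ?P i \<longrightarrow> i \<le> j)"
    using Nat.ex_has_greatest_nat[of ?P j0 k] Pk by (meson less_imp_le)
  then obtain j where j: "?P j" "\<And>i. ?P i \<Longrightarrow> i \<le> j" by blast
  define l where "l = Suc j"
  have lk: "l \<le> k" using Pk[OF j(1)] by (simp add: l_def)
  have "\<not> ?P l" using j(2)[of l] by (auto simp: l_def)
  then have kl: "k \<le> 2 * l" by (rule noP)
  have \<alpha>l: "\<alpha> ((T ^^ i) z) = 0" if "z \<in> U" "l \<le> i" for i z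
    using j(2)[of i] that by (auto simp: l_def)
  have "\<not> ?N (k - 1)"
  proof
    assume "?N (k - 1)"
    from kmin[OF this] k1 show False by simp
  qed
  then obtain z where z: "z \<in> U" "(T ^^ (k - 1)) z \<noteq> 0" by blast
  obtain w where w: "w \<in> U" "\<alpha> ((T ^^ j) w) \<noteq> 0" using j(1) by blast
  \<comment> \<open>If w and z have one property each, a combination w + c z has both, provided that
    c avoids 0 and one value at which \<open>\<alpha>\<close> cancels.\<close>
  have "\<exists>x\<in>U. (T ^^ (k - 1)) x \<noteq> 0 \<and> \<alpha> ((T ^^ j) x) \<noteq> 0"
  proof (cases "(T ^^ (k - 1)) w = 0 \<and> \<alpha> ((T ^^ j) z) = 0")
    case False
    then show ?thesis using z w by blast
  next
    case True
    let ?p = "bet ((T ^^ j) w) ((T ^^ j) z)"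
    obtain c where c: "c \<notin> {0, \<alpha> ((T ^^ j) w) / ?p}"
      using ex_new_if_finite[OF infinite_alg_closed, of "{0, \<alpha> ((T ^^ j) w) / ?p}"] by auto
    have "\<alpha> ((T ^^ j) (w + s c z)) = \<alpha> ((T ^^ j) w) + c * ?p"
      using z w True by (simp add: Tp_add Uscale Tp_scale \<alpha>_add \<alpha>_scale)
    moreover have "\<alpha> ((T ^^ j) w) + c * ?p \<noteq> 0"
      using c w(2) by (cases "?p = 0") (auto simp: field_simps)
    moreover have "(T ^^ (k - 1)) (w + s c z) \<noteq> 0"
      using z w True c by (simp add: Tp_add Uscale Tp_scale)
    ultimately show ?thesis using z(1) w(1) Uadd Uscale by (intro bexI[of _ "w + s c z"]) auto
  qed
  then obtain x0 where x0: "x0 \<in> U" "(T ^^ (k - 1)) x0 \<noteq> 0" "\<alpha> ((T ^^ j) x0) \<noteq> 0" by blast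
  obtain d where d: "d 0 \<noteq> 0" "\<And>i. (\<Sum>p\<le>j. d p * \<alpha> ((T ^^ (i + p)) x0)) = of_bool (i = j)"
    using convolution_inverse[of "\<lambda>i. \<alpha> ((T ^^ i) x0)" j, OF x0(3)] \<alpha>l[OF x0(1)] by (auto simp: l_def)
  \<comment> \<open>Coefficients enter \<open>\<alpha>\<close> through their squares, so roots of
    the convolution inverse are taken. In the pairing with y below they enter linearly.\<close>
  have "\<forall>p. \<exists>c. c\<^sup>2 = d p" using sqrt_ex by blast
  then obtain c where c: "\<And>p. (c p)\<^sup>2 = d p" by metis
  define x where "x = (\<Sum>p\<le>j. s (c p) ((T ^^ p) x0))"
  have xU: "x \<in> U" unfolding x_def by (intro Usum Uscale Tp_U x0)
  have \<alpha>x: "\<alpha> ((T ^^ i) x) = of_bool (i + 1 = l)" for i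
    unfolding x_def \<alpha>_Tp_comb[OF x0(1)] c d(2) by (simp add: l_def)
  have "(T ^^ (k - 1)) x = (\<Sum>p\<le>j. s (c p) ((T ^^ (k - 1 + p)) x0))"
    unfolding x_def by (simp add: Tp_sum Uscale Tp_U x0 Tp_scale Tp_Tp)
  also have "\<dots> = (\<Sum>p\<in>{0}. s (c p) ((T ^^ (k - 1 + p)) x0))"
    using Tk[OF x0(1)] by (intro sum.mono_neutral_right) auto
  finally have "(T ^^ (k - 1)) x = s (c 0) ((T ^^ (k - 1)) x0)" by simp
  moreover have "c 0 \<noteq> 0" using c[of 0] d(1) by auto
  ultimately have xk: "(T ^^ (k - 1)) x \<noteq> 0" using x0(2) by simp
  then obtain y0 where y0: "y0 \<in> U" "bet ((T ^^ (k - 1)) x) y0 \<noteq> 0"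
    using nondegU[OF Tp_U[OF xU]] by blast
  obtain e where e: "\<And>i. (\<Sum>p\<le>k - 1. e p * bet ((T ^^ (i + p)) x) y0) = of_bool (i = k - 1)"
  proof -
    have xy0: "bet ((T ^^ i) x) y0 = 0" if "k - 1 < i" for i
    proof -
      have "k \<le> i" using that by simp
      then show ?thesis by (simp add: Tk[OF xU])
    qed
    have "\<exists>e. e 0 \<noteq> 0 \<and> (\<forall>i. (\<Sum>p\<le>k - 1. e p * bet ((T ^^ (i + p)) x) y0) = of_bool (i = k - 1))"
      by (rule convolution_inverse[of "\<lambda>i. bet ((T ^^ i) x) y0" "k - 1"]) (rule y0(2), rule xy0)
    then show thesis by (elim exE conjE) (rule that, erule spec)
  qed
  define y1 where "y1 = (\<Sum>p\<le>k - 1. s (e p) ((T ^^ p) y0))"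
  have y1U: "y1 \<in> U" unfolding y1_def by (intro Usum Uscale Tp_U y0)
  have xy1: "bet ((T ^^ i) x) y1 = of_bool (i + 1 = k)" for i
  proof -
    have "bet ((T ^^ i) x) y1 = of_bool (i = k - 1)"
      unfolding y1_def bet_sum2 by (simp only: bet_simps bet_Tp_Tp[OF xU y0(1)] e)
    also have "(i = k - 1) = (i + 1 = k)" using k1 by auto
    finally show ?thesis .
  qed
  \<comment> \<open>The value of \<open>\<alpha>\<close> at T^i (y1 + x1) is the sum of
    \<open>\<alpha>\<close> at T^i y1, the square from x1 and the pairing of the two; this is the
    system solved by \<open>frobenius_system\<close>. Adding x1 leaves the pairings with the chain
    of x unchanged.\<close>
  obtain f where f: "\<forall>i<l. (f (l - 1 - i))\<^sup>2 + (\<Sum>p<l. f p * of_bool (2 * i + p + 1 = k)) = \<alpha> ((T ^^ i) y1)"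
    using frobenius_system[OF kl, of "\<lambda>i. \<alpha> ((T ^^ i) y1)"] ..
  define x1 where "x1 = (\<Sum>p<l. s (f p) ((T ^^ p) x))"
  have x1U: "x1 \<in> U" unfolding x1_def by (intro Usum Uscale Tp_U xU)
  have y: "\<alpha> ((T ^^ i) (y1 + x1)) = 0" for i
  proof (cases "i < l")
    case True
    have 1: "\<alpha> ((T ^^ i) x1) = (f (l - 1 - i))\<^sup>2"
    proof -
      have "\<alpha> ((T ^^ i) x1) = (\<Sum>p<l. (f p)\<^sup>2 * of_bool (i + p + 1 = l))"
        unfolding x1_def \<alpha>_Tp_comb[OF xU] \<alpha>x ..
      also have "\<dots> = (\<Sum>p<l. (f p)\<^sup>2 * of_bool (p = l - 1 - i))"
        using True by (intro sum.cong refl arg_cong2[of _ _ _ _ "(*)"] arg_cong[of _ _ of_bool]) auto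
      also have "\<dots> = (f (l - 1 - i))\<^sup>2" using True by (simp only: sum_of_bool_eq finite_lessThan) auto
      finally show ?thesis .
    qed
    have 2: "bet ((T ^^ i) y1) ((T ^^ i) x1) = (\<Sum>p<l. f p * of_bool (2 * i + p + 1 = k))"
    proof -
      have "(T ^^ i) x1 = (\<Sum>p<l. s (f p) ((T ^^ (i + p)) x))"
        unfolding x1_def by (simp add: Tp_sum Uscale Tp_U xU Tp_scale Tp_Tp)
      then have "bet ((T ^^ i) y1) ((T ^^ i) x1) = (\<Sum>p<l. f p * bet ((T ^^ (i + p)) x) ((T ^^ i) y1))"
        by (simp only: bet_sum2 bet_simps bet_sym[of "(T ^^ i) y1"])
      also have "\<dots> = (\<Sum>p<l. f p * of_bool (2 * i + p + 1 = k))"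
        unfolding bet_Tp_Tp[OF xU y1U] xy1
        by (intro sum.cong refl arg_cong2[of _ _ _ _ "(*)"] arg_cong[of _ _ of_bool]) auto
      finally show ?thesis .
    qed
    show ?thesis
      unfolding Tp_add[OF y1U x1U] \<alpha>_add 1 2 f[rule_format, OF True, symmetric]
      by (simp add: add_ac)
  next
    case False
    then show ?thesis using \<alpha>l[OF Uadd[OF y1U x1U]] by simp
  qed
  have xy: "bet ((T ^^ i) x) (y1 + x1) = of_bool (i + 1 = k)" for i
  proof -
    have "bet ((T ^^ i) x) x1 = 0"
      unfolding x1_def bet_sum2 bet_simps bet_Tp_self[OF xU] by simp
    then show ?thesis by (simp add: xy1)
  qed
  show thesis
    by (rule that[OF xU Uadd[OF y1U x1U] k1 kl lk _ \<alpha>x y xy]) (use Nk in blast)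
qed

end

context form_space
begin

text \<open>The last clause expresses that the blocks exhaust \<open>U\<close>: nothing nonzero in
  \<open>U\<close> is orthogonal to all of them.\<close>

definition block_family :: "'v set \<Rightarrow> nat \<Rightarrow> (nat \<Rightarrow> nat) \<Rightarrow> (nat \<Rightarrow> nat) \<Rightarrow> (nat \<Rightarrow> nat \<Rightarrow> 'v) \<Rightarrow> (nat \<Rightarrow> nat \<Rightarrow> 'v) \<Rightarrow> bool" where
  "block_family U S K L X Y \<longleftrightarrow> (\<forall>a<S. (\<forall>i. X a i \<in> U \<and> Y a i \<in> U \<and> (K a \<le> i \<longrightarrow> X a i = 0 \<and> Y a i = 0) \<and>
      \<alpha> (X a i) = of_bool (i + 1 = L a) \<and> \<alpha> (Y a i) = 0 \<and>
      (\<forall>z. \<omega> (X a i) z = bet (X a (Suc i)) z \<and> \<omega> (Y a i) z = bet (Y a (Suc i)) z)) \<and>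
      1 \<le> K a \<and> K a \<le> 2 * L a \<and> L a \<le> K a) \<and>
    (\<forall>a<S. \<forall>c<S. \<forall>i j. bet (X a i) (X c j) = 0 \<and> bet (Y a i) (Y c j) = 0 \<and>
      bet (X a i) (Y c j) = of_bool (a = c \<and> i + j + 1 = K a)) \<and>
    (\<forall>z\<in>U. (\<forall>a<S. \<forall>i. bet (X a i) z = 0 \<and> bet (Y a i) z = 0) \<longrightarrow> z = 0)"

lemma block_family_exists:
  assumes "nil_op s \<alpha> n \<omega> U T" shows "\<exists>S K L X Y. block_family U S K L X Y"
  using assms
proof (induction "dim U" arbitrary: U rule: less_induct)
  case (less U)
  interpret nil_op s \<alpha> n \<omega> U T by fact
  show ?case
  proof (cases "U \<subseteq> {0}")
    case True
    then have "block_family U 0 K L X Y" for K L X Y unfolding block_family_def by auto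
    then show ?thesis by blast
  next
    case False
    then obtain z0 where "z0 \<in> U" "z0 \<noteq> 0" by blast
    then obtain k l x y where xy: "x \<in> U" "y \<in> U" and kl: "1 \<le> k" "k \<le> 2 * l" "l \<le> k"
      and Tk: "\<And>z. z \<in> U \<Longrightarrow> (T ^^ k) z = 0"
      and \<alpha>x: "\<And>i. \<alpha> ((T ^^ i) x) = of_bool (i + 1 = l)" and \<alpha>y: "\<And>i. \<alpha> ((T ^^ i) y) = 0"
      and bxy: "\<And>i. bet ((T ^^ i) x) y = of_bool (i + 1 = k)"
      by (rule block_exists) (rule that)
    let ?x = "\<lambda>i. (T ^^ i) x" and ?y = "\<lambda>i. (T ^^ i) y"
    have xyU: "?x i \<in> U" "?y i \<in> U" for i using xy Tp_U by auto
    have xy': "bet (?x i) (?y j) = of_bool (i + j + 1 = k)" "bet (?y j) (?x i) = of_bool (i + j + 1 = k)" for i j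
      using bet_Tp_Tp[OF xy] bxy bet_sym[of "?y j"] by simp_all
    have xx: "bet (?x i) (?x j) = 0" "bet (?y i) (?y j) = 0" for i j
      using bet_Tp_self[OF xy(1)] bet_Tp_self[OF xy(2)] by simp_all
    have Tk': "(T ^^ i) z = 0" if "z \<in> U" "k \<le> i" for z i
      using Tk Tp_Tp[of "i - k" k z] that by (simp add: Tp_0)
    let ?V = "{z \<in> U. \<forall>i. bet (?x i) z = 0 \<and> bet (?y i) z = 0}"
    have VU: "?V \<subseteq> U" by blast
    have subV: "subspace ?V" using U0 Uadd Uscale by (intro subspaceI) auto
    have "x \<in> U" "x \<notin> ?V"
    proof -
      have "bet (?y (k - 1)) (?x 0) = 1" using xy'(2)[of "k - 1" 0] kl by simp
      then have "bet (?y (k - 1)) x \<noteq> 0" by simp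
      then show "x \<notin> ?V" by blast
    qed (rule xy)
    then have "?V \<subset> U" by blast
    then have dim: "dim ?V < dim U"
      using subV subU by (intro dim_psubset) (simp only: span_eq_iff[THEN iffD2])
    \<comment> \<open>A vector of \<open>U\<close> differs from one of \<open>?V\<close> by a
      combination of the block, and the block is orthogonal to \<open>?V\<close>; this is how
      nondegeneracy passes to \<open>?V\<close>.\<close>
    have proj: "\<exists>p\<in>?V. \<forall>w\<in>?V. bet w z = bet w p" if z: "z \<in> U" for z
    proof -
      let ?q = "(\<Sum>i<k. s (bet z (?y (k - 1 - i))) (?x i)) + (\<Sum>i<k. s (bet z (?x (k - 1 - i))) (?y i))"
      have qU: "?q \<in> U" by (intro Uadd Usum Uscale xyU)
      have "bet (?x j) ?q = bet (?x j) z" for j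
      proof (cases "j < k")
        case True
        have "bet (?x j) ?q = (\<Sum>i<k. bet z (?x (k - 1 - i)) * of_bool (j + i + 1 = k))"
          by (simp only: bet_simps bet_sum2 xx xy' mult_zero_right sum.neutral_const add_0_left)
        also have "\<dots> = (\<Sum>i<k. bet z (?x (k - 1 - i)) * of_bool (i = k - 1 - j))"
          using True by (intro sum.cong refl arg_cong2[of _ _ _ _ "(*)"] arg_cong[of _ _ of_bool]) auto
        also have "\<dots> = bet z (?x (k - 1 - (k - 1 - j)))" using True by (simp only: sum_of_bool_eq finite_lessThan) auto
        finally show ?thesis using True bet_sym[of z] by simp
      qed (simp add: Tk'[OF xy(1)])
      moreover have "bet (?y j) ?q = bet (?y j) z" for j
      proof (cases "j < k")
        case True
        have "bet (?y j) ?q = (\<Sum>i<k. bet z (?y (k - 1 - i)) * of_bool (i + j + 1 = k))"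
          by (simp only: bet_simps bet_sum2 xx xy' mult_zero_right sum.neutral_const add_0_right)
        also have "\<dots> = (\<Sum>i<k. bet z (?y (k - 1 - i)) * of_bool (i = k - 1 - j))"
          using True by (intro sum.cong refl arg_cong2[of _ _ _ _ "(*)"] arg_cong[of _ _ of_bool]) auto
        also have "\<dots> = bet z (?y (k - 1 - (k - 1 - j)))" using True by (simp only: sum_of_bool_eq finite_lessThan) auto
        finally show ?thesis using True bet_sym[of z] by simp
      qed (simp add: Tk'[OF xy(2)])
      ultimately have "z + ?q \<in> ?V" using Uadd[OF z qU] by (simp only: mem_Collect_eq bet_simps add_self simp_thms)
      moreover have "bet w z = bet w (z + ?q)" if "w \<in> ?V" for w
      proof -
        have "bet w (?x i) = 0" "bet w (?y i) = 0" for i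
          using that bet_sym[of w] by auto
        then have "bet w ?q = 0" by (simp only: bet_simps bet_sum2 mult_zero_right sum.neutral_const add_0_left)
        then show ?thesis by (simp only: bet_simps add_0_right)
      qed
      ultimately show ?thesis by blast
    qed
    have "nil_op s \<alpha> n \<omega> ?V T"
    proof unfold_locales
      show "subspace ?V" by (rule subV)
      show "T z \<in> ?V" if "z \<in> ?V" for z
      proof -
        have z: "z \<in> U" "\<And>i. bet (?x i) z = 0" "\<And>i. bet (?y i) z = 0" using that by auto
        have "bet (?x i) (T z) = 0" "bet (?y i) (T z) = 0" for i
          using z(2)[of "Suc i"] z(3)[of "Suc i"] T_selfadj[OF xyU(1) z(1), of i] T_selfadj[OF xyU(2) z(1), of i]
          by simp_all
        then show ?thesis using TU[OF z(1)] by blast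
      qed
      show "bet (T z) w = \<omega> z w" if "z \<in> ?V" for z w using T\<omega> that by blast
      show "z = 0" if "z \<in> ?V" "\<And>w. w \<in> ?V \<Longrightarrow> bet z w = 0" for z
      proof (rule nondegU)
        show "z \<in> U" using that(1) by blast
        fix w assume "w \<in> U"
        then obtain p where "p \<in> ?V" "\<forall>w'\<in>?V. bet w' w = bet w' p" using proj by blast
        then show "bet z w = 0" using that by simp
      qed
      show "\<exists>N. \<forall>z\<in>?V. (T ^^ N) z = 0" using nilT by blast
    qed
    from less(1)[OF dim this] obtain S K L X Y where F: "block_family ?V S K L X Y" by blast
    let ?K = "K(S := k)" and ?L = "L(S := l)" and ?X = "X(S := ?x)" and ?Y = "Y(S := ?y)"
    have F1: "X a i \<in> ?V" "Y a i \<in> ?V" "K a \<le> i \<Longrightarrow> X a i = 0" "K a \<le> i \<Longrightarrow> Y a i = 0"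
      "\<alpha> (X a i) = of_bool (i + 1 = L a)" "\<alpha> (Y a i) = 0" "\<omega> (X a i) z = bet (X a (Suc i)) z"
      "\<omega> (Y a i) z = bet (Y a (Suc i)) z" "1 \<le> K a" "K a \<le> 2 * L a" "L a \<le> K a" if "a < S" for a i z
      using F[unfolded block_family_def, THEN conjunct1, rule_format, OF that] by blast+
    have F2: "bet (X a i) (X c j) = 0" "bet (Y a i) (Y c j) = 0"
      "bet (X a i) (Y c j) = of_bool (a = c \<and> i + j + 1 = K a)" if "a < S" "c < S" for a c i j
      using F[unfolded block_family_def, THEN conjunct2, THEN conjunct1, rule_format, OF that] by blast+
    have F3: "z = 0" if "z \<in> ?V" "\<And>a i. a < S \<Longrightarrow> bet (X a i) z = 0" "\<And>a i. a < S \<Longrightarrow> bet (Y a i) z = 0" for z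
      using F[unfolded block_family_def, THEN conjunct2, THEN conjunct2, rule_format, OF that(1)] that(2,3) by blast
    have cross: "bet (?x j) (X a i) = 0" "bet (?y j) (X a i) = 0" "bet (?x j) (Y a i) = 0" "bet (?y j) (Y a i) = 0"
      "bet (X a i) (?x j) = 0" "bet (X a i) (?y j) = 0" "bet (Y a i) (?x j) = 0" "bet (Y a i) (?y j) = 0" if "a < S" for a i j
      using F1(1)[OF that, of i] F1(2)[OF that, of i] bet_sym[of "X a i"] bet_sym[of "Y a i"] by simp_all
    have "block_family U (Suc S) ?K ?L ?X ?Y"
      unfolding block_family_def
    proof (intro conjI allI impI ballI)
      fix a i z assume a: "a < Suc S"
      then consider "a = S" | "a \<noteq> S" "a < S" by linarith
      then have "?X a i \<in> U \<and> ?Y a i \<in> U \<and> (?K a \<le> i \<longrightarrow> ?X a i = 0 \<and> ?Y a i = 0) \<and>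
         \<alpha> (?X a i) = of_bool (i + 1 = ?L a) \<and> \<alpha> (?Y a i) = 0 \<and> \<omega> (?X a i) z = bet (?X a (Suc i)) z \<and>
         \<omega> (?Y a i) z = bet (?Y a (Suc i)) z \<and> 1 \<le> ?K a \<and> ?K a \<le> 2 * ?L a \<and> ?L a \<le> ?K a"
      proof cases
        case 1
        then show ?thesis
          using xyU Tk' xy \<alpha>x \<alpha>y kl by (simp add: T\<omega>)
      next
        case 2
        note G = F1(1,2,3,4,5,6)[OF \<open>a < S\<close>, of i] F1(7,8)[OF \<open>a < S\<close>, of i z] F1(9,10,11)[OF \<open>a < S\<close>]
        show ?thesis using 2 G VU by auto
      qed
      then show "?X a i \<in> U" "?Y a i \<in> U" "?K a \<le> i \<Longrightarrow> ?X a i = 0" "?K a \<le> i \<Longrightarrow> ?Y a i = 0"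
        "\<alpha> (?X a i) = of_bool (i + 1 = ?L a)" "\<alpha> (?Y a i) = 0" "\<omega> (?X a i) z = bet (?X a (Suc i)) z"
        "\<omega> (?Y a i) z = bet (?Y a (Suc i)) z" "1 \<le> ?K a" "?K a \<le> 2 * ?L a" "?L a \<le> ?K a" by blast+
    next
      fix a c i j assume ac: "a < Suc S" "c < Suc S"
      consider "a = S" "c = S" | "a = S" "c < S" "c \<noteq> S" | "a < S" "c = S" "a \<noteq> S" | "a < S" "c < S" "a \<noteq> S" "c \<noteq> S"
        using ac by linarith
      then have "bet (?X a i) (?X c j) = 0 \<and> bet (?Y a i) (?Y c j) = 0 \<and>
        bet (?X a i) (?Y c j) = of_bool (a = c \<and> i + j + 1 = ?K a)"
        by cases (simp_all add: xx xy' cross F2)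
      then show "bet (?X a i) (?X c j) = 0" "bet (?Y a i) (?Y c j) = 0"
        "bet (?X a i) (?Y c j) = of_bool (a = c \<and> i + j + 1 = ?K a)" by blast+
    next
      fix z assume z: "z \<in> U" and p: "\<forall>a<Suc S. \<forall>i. bet (?X a i) z = 0 \<and> bet (?Y a i) z = 0"
      show "z = 0"
      proof (rule F3)
        show "z \<in> ?V" using z p[rule_format, of S] by simp
        show "bet (X a i) z = 0" "bet (Y a i) z = 0" if "a < S" for a i
          using p[rule_format, of a i] that by simp_all
      qed
    qed
    then show ?thesis by blast
  qed
qed

section \<open>Decomposition of nilpotent forms\<close>

text \<open>\<open>bet\<close> represents exactly the functionals that vanish on the radical. The
  representing vector is free up to the radical, and that freedom is used to achieve
  \<open>\<alpha> t = 0\<close>.\<close>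

lemma riesz:
  assumes b: "adapted b" and \<psi>: "Vector_Spaces.linear s (*) \<psi>" "\<psi> (b n) = 0"
  shows "\<exists>t. (\<forall>z. bet t z = \<psi> z) \<and> \<alpha> t = 0"
proof -
  let ?t = "\<Sum>i\<le>2*n. s (\<psi> (b (2*n - i))) (b i)"
  have t: "bet ?t z = \<psi> z" for z
  proof (rule linear_eq_on_ibasis[OF adapted_ibasis[OF b] bet_linear2 \<psi>(1)])
    fix j assume j: "j \<in> {..2*n}"
    have "bet ?t (b j) = (\<Sum>i\<le>2*n. \<psi> (b (2*n - i)) * of_bool (i = 2*n - j))"
      unfolding bet_sum1 bet_simps
    proof (intro sum.cong refl)
      fix i assume i: "i \<in> {..2*n}"
      have e: "i + j = 2*n \<longleftrightarrow> i = 2*n - j" using j by auto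
      show "\<psi> (b (2*n - i)) * bet (b i) (b j) = \<psi> (b (2*n - i)) * of_bool (i = 2*n - j)"
      proof (cases "i = n \<and> j = n")
        case True
        then have "2*n - i = n" by simp
        then show ?thesis using \<psi>(2) by simp
      next
        case False
        then have "i = j \<Longrightarrow> i \<noteq> 2*n - j" using i j by auto
        then show ?thesis using i j adaptedD(1)[OF b, of i j] e by (cases "i = j") simp_all
      qed
    qed
    also have "\<dots> = \<psi> (b j)" using j by (simp only: sum_of_bool_eq finite_atMost) simp
    finally show "bet ?t (b j) = \<psi> (b j)" .
  qed
  obtain c where "c\<^sup>2 = \<alpha> ?t" using sqrt_ex by blast
  then have "\<alpha> (?t + s c (b n)) = 0"
    using adapted_radical[OF b] adaptedD(2)[OF b, of n] by (simp add: \<alpha>_add \<alpha>_scale)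
  moreover have "bet (?t + s c (b n)) z = \<psi> z" for z
    using t adapted_radical[OF b] by simp
  ultimately show ?thesis by blast
qed

lemma om_linear: "Vector_Spaces.linear s (*) (\<omega> z)"
  by (rule linear_formI) simp_all

text \<open>The operator of \<open>\<omega>\<close> with values in the quadric \<open>\<alpha> = 0\<close>; it is only defined on the vectors
  orthogonal to the radical of \<open>bet\<close> with respect to \<open>\<omega>\<close>.\<close>

definition Sop :: "'v \<Rightarrow> 'v" where
  "Sop z = (SOME t. (\<forall>w. bet t w = \<omega> z w) \<and> \<alpha> t = 0)"

lemma Sop:
  assumes b: "adapted b" and z: "\<omega> z (b n) = 0"
  shows "bet (Sop z) w = \<omega> z w" "\<alpha> (Sop z) = 0"
proof -
  have "(\<forall>w. bet (Sop z) w = \<omega> z w) \<and> \<alpha> (Sop z) = 0"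
    unfolding Sop_def by (rule someI_ex) (rule riesz[OF b om_linear z])
  then show "bet (Sop z) w = \<omega> z w" "\<alpha> (Sop z) = 0" by simp_all
qed

text \<open>\<open>fl b i\<close> involves the indices below i only, so the largest index sum is i +
  j - 2; hence the bound 2n + 2.\<close>

lemma om_fl:
  assumes b: "nilp \<omega> b" and z: "z \<in> fl b i" "w \<in> fl b j" and ij: "i + j \<le> 2*n + 2"
  shows "\<omega> z w = 0"
proof -
  have ad: "adapted b" using b by (simp add: nilp_def)
  have "\<omega> (\<Sum>i\<le>2*n. s (co b i z) (b i)) (\<Sum>i\<le>2*n. s (co b i w) (b i)) = 0"
    unfolding om_sum1 om_sum2
  proof (intro sum.neutral ballI)
    fix p q assume "p \<in> {..2*n}" "q \<in> {..2*n}"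
    then show "\<omega> (s (co b p z) (b p)) (s (co b q w) (b q)) = 0"
      using z b ij by (cases "i \<le> p \<or> j \<le> q") (auto simp: fl_def nilp_def)
  qed
  then show ?thesis unfolding sum_coord[OF adapted_ibasis[OF ad]] .
qed

lemma b_fl: assumes "adapted b" "i < j" "i \<le> 2*n" shows "b i \<in> fl b j"
  using assms(2,3) by (auto simp: fl_def coord_basis[OF adapted_ibasis[OF assms(1)]])

text \<open>Off the middle, coordinates of \<open>Sop z\<close> are values of
  \<open>\<omega>\<close> and vanish by \<open>om_fl\<close>. The middle coordinate is invisible to
  \<open>bet\<close> but follows from \<open>\<alpha> (Sop z) = 0\<close>.\<close>

lemma Sop_fl:
  assumes b: "nilp \<omega> b" and z: "z \<in> fl b (Suc j)" "\<omega> z (b n) = 0"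
  shows "Sop z \<in> fl b j"
proof -
  have ad: "adapted b" using b by (simp add: nilp_def)
  have co: "co b i (Sop z) = 0" if "i \<le> 2*n" "i \<noteq> n" "j \<le> i" for i
  proof -
    have "co b i (Sop z) = \<omega> z (b (2*n - i))" using that by (simp add: co_bet[OF ad] Sop[OF ad z(2)])
    also have "\<dots> = 0" using that by (intro om_fl[OF b z(1) b_fl[OF ad, of _ "2*n - i + 1"]]) auto
    finally show ?thesis .
  qed
  have "co b n (Sop z) = 0" if "j \<le> n"
  proof -
    have "(\<Sum>i<n. co b i (Sop z) * co b (2*n - i) (Sop z)) = 0"
      using that by (intro sum.neutral) (auto simp: co)
    then show ?thesis using \<alpha>_coord[OF ad, of "Sop z"] Sop(2)[OF ad z(2)] by simp
  qed
  with co have "co b i (Sop z) = 0" if "i \<le> 2*n" "j \<le> i" for i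
    using that by (cases "i = n") simp_all
  then show ?thesis by (simp add: fl_def)
qed

text \<open>Iterating \<open>Sop\<close> from \<open>b n\<close> descends the flag from level n + 1.
  Vectors at such a level are \<open>\<omega>\<close>-orthogonal to \<open>b n\<close>, so
  \<open>Sop\<close> applies again, and the chain ends after at most n steps.\<close>

lemma radical_chain_exists:
  assumes b: "nilp \<omega> b"
  shows "\<exists>m v. v m = b n \<and> v 0 \<noteq> 0 \<and> (\<forall>i>m. v i = 0) \<and> (\<forall>i. \<alpha> (v i) = of_bool (i = m)) \<and>
    (\<forall>z. \<omega> (v 0) z = 0) \<and> (\<forall>i z. \<omega> (v (Suc i)) z = bet (v i) z)"
proof -
  have ad: "adapted b" using b by (simp add: nilp_def)
  define w where "w i = (Sop ^^ i) (b n)" for i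
  have w: "w 0 = b n" "w (Suc i) = Sop (w i)" for i by (simp_all add: w_def)
  have wfl: "w i \<in> fl b (n + 1 - i) \<and> \<omega> (w i) (b n) = 0" for i
  proof (induction i)
    case 0
    show ?case using b_fl[OF ad, of n "n + 1"] by (simp add: w)
  next
    case (Suc i)
    have "w (Suc i) \<in> fl b (n + 1 - Suc i)"
    proof (cases "i \<le> n")
      case True
      then have "n + 1 - i = Suc (n - i)" by simp
      with Suc have "w i \<in> fl b (Suc (n - i))" by simp
      then show ?thesis unfolding w using Suc Sop_fl[OF b] by simp
    next
      case False
      then have "w i = 0" using Suc fl_0[OF ad, of "w i"] by simp
      then have "Sop (w i) = 0" using Suc by (intro nondeg) (simp_all add: Sop[OF ad])
      then show ?thesis unfolding w using subspace_0[OF subspace_fl[OF ad]] by simp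
    qed
    moreover from this have "\<omega> (w (Suc i)) (b n) = 0"
      using b_fl[OF ad, of n "n + 1"] by (intro om_fl[OF b, of _ "n + 1 - Suc i" _ "n + 1"]) auto
    ultimately show ?case by blast
  qed
  have bw: "bet (w (Suc i)) z = \<omega> (w i) z" "\<alpha> (w (Suc i)) = 0" for i z
    using Sop[OF ad] wfl by (simp_all add: w)
  have "w (Suc n) = 0" using fl_0[OF ad, of "w (Suc n)"] wfl[of "Suc n"] by simp
  then have ex: "\<exists>i. w (Suc i) = 0" by blast
  define m where "m = (LEAST i. w (Suc i) = 0)"
  have m: "w (Suc m) = 0" unfolding m_def using ex by (rule LeastI_ex)
  have \<alpha>0: "\<alpha> (w 0) = 1" using adaptedD(2)[OF ad, of n] by (simp add: w)
  have wm: "w m \<noteq> 0"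
  proof (cases m)
    case 0
    then show ?thesis using \<alpha>0 by auto
  next
    case (Suc p)
    then show ?thesis using not_less_Least[of p "\<lambda>i. w (Suc i) = 0"] unfolding m_def[symmetric] by simp
  qed
  \<comment> \<open>The chain is numbered backwards, so that its radical end gets index m and
    \<open>\<omega>\<close> vanishes at index 0.\<close>
  let ?v = "\<lambda>i. if i \<le> m then w (m - i) else 0"
  have "?v m = b n \<and> ?v 0 \<noteq> 0 \<and> (\<forall>i>m. ?v i = 0)" using wm by (simp add: w)
  moreover have "\<alpha> (?v i) = of_bool (i = m)" for i
  proof (cases "i < m")
    case True
    then have "m - i = Suc (m - Suc i)" by simp
    then show ?thesis using True bw by simp
  qed (simp add: \<alpha>0)
  moreover have "\<omega> (?v 0) z = 0" for z using bw(1)[of m z] m by simp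
  moreover have "\<omega> (?v (Suc i)) z = bet (?v i) z" for i z
  proof (cases "i < m")
    case True
    then have "m - i = Suc (m - Suc i)" by simp
    then show ?thesis using True bw by simp
  next
    case False
    then show ?thesis by (auto simp: w adapted_radical[OF ad])
  qed
  ultimately show ?thesis by (intro exI[of _ m] exI[of _ ?v]) blast
qed

text \<open>Through \<open>\<omega>\<close>, the pair of indices (i, j + 1) may be traded for (i +
  1, j), until j = 0, where \<open>\<omega> (v 0)\<close> vanishes.\<close>

lemma radical_chain_isotropic:
  assumes "\<And>z. \<omega> (v 0) z = 0" "\<And>i z. \<omega> (v (Suc i)) z = bet (v i) z"
  shows "bet (v i) (v j) = 0"
proof (induction j arbitrary: i)
  case 0
  show ?case unfolding assms(2)[symmetric] om_sym[of _ "v 0"] by (rule assms(1))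
next
  case (Suc j)
  have "bet (v i) (v (Suc j)) = \<omega> (v (Suc j)) (v (Suc i))" unfolding assms(2)[symmetric] by (rule om_sym)
  also have "\<dots> = bet (v (Suc i)) (v j)" unfolding assms(2) by (rule bet_sym)
  finally show ?case using Suc by simp
qed

text \<open>Applying \<open>\<omega>\<close> to a relation shifts it down by one place. The shifted
  sum is in the radical and has \<open>\<alpha>\<close> equal to 0 because it avoids index m, so it
  is again a relation, with fewer terms.\<close>

lemma radical_chain_independent:
  assumes "v 0 \<noteq> 0" "\<And>i. \<alpha> (v i) = of_bool (i = m)"
    and v: "\<And>z. \<omega> (v 0) z = 0" "\<And>i z. \<omega> (v (Suc i)) z = bet (v i) z"
  shows "j \<le> m \<Longrightarrow> (\<Sum>i\<le>j. s (c i) (v i)) = 0 \<Longrightarrow> \<forall>i\<le>j. c i = 0"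
proof (induction j arbitrary: c)
  case 0
  then show ?case using assms(1) by simp
next
  case (Suc j)
  have S: "(\<Sum>i\<le>Suc j. s (c i) (v i)) = s (c 0) (v 0) + (\<Sum>i\<le>j. s (c (Suc i)) (v (Suc i)))"
    by (rule sum.atMost_Suc_shift)
  have "(\<Sum>i\<le>j. s (c (Suc i)) (v i)) = 0"
  proof (rule nondeg)
    fix z
    have "bet (\<Sum>i\<le>j. s (c (Suc i)) (v i)) z = \<omega> (s (c 0) (v 0) + (\<Sum>i\<le>j. s (c (Suc i)) (v (Suc i)))) z"
      by (simp add: bet_sum1 om_sum1 v)
    then show "bet (\<Sum>i\<le>j. s (c (Suc i)) (v i)) z = 0" unfolding S[symmetric] Suc.prems by simp
    show "\<alpha> (\<Sum>i\<le>j. s (c (Suc i)) (v i)) = 0"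
      using Suc.prems(1) by (subst \<alpha>_sum_isotropic)
        (auto simp: radical_chain_isotropic[OF v] \<alpha>_scale assms(2) intro!: sum.neutral)
  qed
  then have c: "\<forall>i\<le>j. c (Suc i) = 0" using Suc.prems(1) by (intro Suc.IH) auto
  then have "s (c 0) (v 0) = 0" using Suc.prems(2) unfolding S by simp
  then have "c 0 = 0" using assms(1) by simp
  with c show ?case by (metis Suc_le_mono not0_implies_Suc)
qed

text \<open>A singular vector dual to \<open>v 0\<close> is moved up by \<open>Sop\<close>. The
  value of \<open>\<omega> (u j)\<close> at \<open>b n\<close> is
  \<open>bet (v (m - 1)) (u j)\<close>, which is 0 until j = m - 1; this is why exactly m vectors u
  arise.\<close>

lemma radical_dual_exists:
  assumes b: "adapted b" and vm: "v m = b n" and vne: "v 0 \<noteq> 0" and v\<alpha>: "\<And>i. \<alpha> (v i) = of_bool (i = m)"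
    and v0: "\<And>i. m < i \<Longrightarrow> v i = 0"
    and v: "\<And>z. \<omega> (v 0) z = 0" "\<And>i z. \<omega> (v (Suc i)) z = bet (v i) z"
  shows "\<exists>u. chain_family s \<alpha> n m v u 0 K L X Y \<omega>"
proof (cases "m = 0")
  case True
  have rad: "bet (v i) z = 0" for i z using True vm v0[of i] adapted_radical(1)[OF b] by (cases i) simp_all
  have "chain_family s \<alpha> n m v (\<lambda>_. 0) 0 K L X Y \<omega>"
    using True by unfold_locales (simp_all add: v0 v\<alpha> v rad radical_chain_isotropic[OF v])
  then show ?thesis by blast
next
  case False
  note ind = independent_familyI[of "{..m}" v]
  have c: "\<forall>i\<in>{..m}. c i = 0" if "(\<Sum>i\<in>{..m}. s (c i) (v i)) = 0" for c
    using radical_chain_independent[OF vne v\<alpha> v order.refl that] by simp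
  note ind = independent_familyI[of "{..m}" v, OF finite_atMost c]
  let ?B = "extend_basis (v ` {..m})"
  have B: "independent ?B" "span ?B = UNIV" "v ` {..m} \<subseteq> ?B"
    using independent_extend_basis[OF ind(2)] span_extend_basis[OF ind(2)] extend_basis_superset[OF ind(2)] by auto
  let ?\<psi> = "\<lambda>z. representation ?B z (v 0)"
  have \<psi>: "Vector_Spaces.linear s (*) ?\<psi>"
    by (rule linear_formI) (simp_all add: representation_add[OF B(1)] representation_scale[OF B(1)] B(2))
  have \<psi>v: "?\<psi> (v i) = of_bool (i = 0)" if "i \<le> m" for i
  proof -
    have "v i \<in> ?B" using B(3) that by auto
    then have "?\<psi> (v i) = of_bool (v 0 = v i)" by (simp add: representation_basis[OF B(1)])
    also have "(v 0 = v i) = (i = 0)" using inj_on_eq_iff[OF ind(1), of 0 i] that by auto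
    finally show ?thesis .
  qed
  have "?\<psi> (b n) = 0" using \<psi>v[of m] False by (simp add: vm)
  from riesz[OF b \<psi> this] obtain z0 where z0: "\<And>z. bet z0 z = ?\<psi> z" "\<alpha> z0 = 0" by blast
  define u where "u j = (if j < m then (Sop ^^ j) z0 else 0)" for j
  have ub: "\<omega> (u j) (b n) = 0" if "Suc j < m" "\<And>i. bet (v i) (u j) = of_bool (i = j)" for j
  proof -
    have "\<omega> (u j) (b n) = bet (v (m - 1)) (u j)"
      unfolding vm[symmetric] om_sym[of "u j"] using v(2)[of "m - 1"] that(1) by simp
    then show ?thesis using that by simp
  qed
  have bvu: "bet (v i) (u j) = of_bool (i = j)" if "j < m" for i j
    using that
  proof (induction j arbitrary: i)
    case 0
    then show ?case
      using \<psi>v[of i] v0[of i] by (cases "i \<le> m") (simp_all add: u_def bet_sym[of _ z0] z0)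
  next
    case (Suc j)
    have "u (Suc j) = Sop (u j)" using Suc.prems by (simp add: u_def)
    moreover have "\<omega> (u j) (b n) = 0" using Suc by (intro ub) simp_all
    ultimately have "bet (v i) (u (Suc j)) = \<omega> (v i) (u j)"
      unfolding bet_sym[of "v i"] om_sym[of "v i"] using Sop(1)[OF b] by simp
    also have "\<dots> = of_bool (i = Suc j)"
      using Suc by (cases i) (simp_all add: v)
    finally show ?case .
  qed
  have uS: "\<omega> (u j) (b n) = 0" if "Suc j < m" for j
    by (rule ub[OF that]) (use that bvu in simp)
  have cu: "\<omega> (u j) z = bet (u (Suc j)) z" and au': "\<alpha> (u (Suc j)) = 0" if "Suc j < m" for j z
    using that Sop[OF b uS[OF that]] by (simp_all add: u_def)
  have buu: "bet (u i) (u j) = 0" for i j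
  proof -
    \<comment> \<open>The shift relation moves the two indices towards each other by one step each,
      down to distance 0 or 1, where one of the alternating forms meets equal arguments.\<close>
    have *: "bet (u i) (u (i + d)) = 0" for i d
    proof (induction d arbitrary: i rule: less_induct)
      case (less d)
      show ?case
      proof (cases "i + d < m \<and> d \<noteq> 0")
        case False
        then show ?thesis by (cases "d = 0") (simp_all add: u_def)
      next
        case True
        then obtain e where e: "d = Suc e" by (cases d) auto
        have "bet (u i) (u (i + d)) = \<omega> (u i) (u (i + e))"
          using cu[of "i + e" "u i"] True e by (simp add: bet_sym[of "u i"] om_sym[of "u i"])
        also have "\<dots> = bet (u (Suc i)) (u (i + e))" using cu[of i] True e by simp
        also have "\<dots> = 0"
        proof (cases e)
          case 0
          then show ?thesis using cu[of i "u i"] True e by simp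
        next
          case (Suc f)
          then show ?thesis using less[of f "Suc i"] e by simp
        qed
        finally show ?thesis .
      qed
    qed
    show ?thesis using *[of i "j - i"] *[of j "i - j"] bet_sym[of "u i"] by (cases "i \<le> j") simp_all
  qed
  have "chain_family s \<alpha> n m v u 0 K L X Y \<omega>"
  proof unfold_locales
    show "\<alpha> (u i) = 0" for i
    proof (cases i)
      case 0
      then show ?thesis using z0 False by (simp add: u_def)
    next
      case (Suc j)
      then show ?thesis using au'[of j] by (cases "i < m") (simp_all add: u_def)
    qed
    show "bet (v i) (u j) = of_bool (i = j \<and> j < m)" for i j
      using bvu[of j i] by (cases "j < m") (simp_all add: u_def)
    show "u i = 0" if "m \<le> i" for i using that by (simp add: u_def)
  qed (simp_all add: v0 v\<alpha> v radical_chain_isotropic[OF v] buu cu)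
  then show ?thesis by blast
qed

text \<open>The complement of the span of the two chains. The functional \<open>\<omega> (u (m - 1))\<close> in the place of
  \<open>bet (u m)\<close> makes it invariant.\<close>

lemma complement_nil_op:
  assumes ch: "chain_family s \<alpha> n m v u 0 K L X Y \<omega>" and b: "nilp \<omega> b" and vm: "v m = b n"
  defines "\<phi> \<equiv> (if m = 0 then co b n else \<omega> (u (m - 1)))"
  defines "W \<equiv> {z. (\<forall>i. bet (v i) z = 0 \<and> bet (u i) z = 0) \<and> \<phi> z = 0}"
  shows "\<exists>T. nil_op s \<alpha> n \<omega> W T" "\<exists>p\<in>W. \<exists>c d. z = p + ((\<Sum>i\<le>m. s (c i) (v i)) + (\<Sum>i<m. s (d i) (u i)))"
proof -
  interpret chain_family s \<alpha> n m v u 0 K L X Y \<omega> by (rule ch)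
  have ad: "adapted b" using b by (simp add: nilp_def)
  have \<phi>l: "Vector_Spaces.linear s (*) \<phi>"
    unfolding \<phi>_def using om_linear linear_coord[OF adapted_ibasis[OF ad]] by simp
  have \<phi>_add [simp]: "\<phi> (x + y) = \<phi> x + \<phi> y" and \<phi>_scale [simp]: "\<phi> (s c x) = c * \<phi> x"
    and \<phi>_sum: "\<phi> (sum f A) = (\<Sum>x\<in>A. \<phi> (f x))" for x y c and f :: "nat \<Rightarrow> 'v" and A
    using linf_add[OF \<phi>l] linf_scale[OF \<phi>l] linf_sum[OF \<phi>l] by auto
  \<comment> \<open>\<open>\<phi>\<close> reads off the coefficient of the radical vector. For m = 0
    there is no \<open>u\<close>, and the coordinate at \<open>b n\<close>, which is then
    \<open>v 0\<close>, takes over.\<close>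
  have \<phi>v: "\<phi> (v i) = of_bool (i = m)" for i
  proof (cases "m = 0")
    case True
    then show ?thesis using vm v0[of i] linf_zero[OF \<phi>l] coord_basis[OF adapted_ibasis[OF ad], of n n]
      by (cases "i = 0") (auto simp: \<phi>_def)
  next
    case False
    then show ?thesis by (auto simp: \<phi>_def ouv)
  qed
  have \<phi>u: "\<phi> (u i) = 0" for i
    using u0[of i] linf_zero[OF \<phi>l] by (cases "m = 0") (simp_all add: \<phi>_def ouu)
  have WI: "z \<in> W" if "\<And>i. bet (v i) z = 0" "\<And>i. bet (u i) z = 0" "\<phi> z = 0" for z
    using that by (simp add: W_def)
  have WD: "bet (v i) z = 0" "bet (u i) z = 0" "\<phi> z = 0" "bet z (v i) = 0" "bet z (u i) = 0" if "z \<in> W" for z i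
    using that unfolding bet_sym[of z] by (simp_all add: W_def)
  define q where "q z = (\<Sum>i\<le>m. s (if i < m then bet (u i) z else \<phi> z) (v i)) + (\<Sum>i<m. s (bet (v i) z) (u i))" for z
  have q: "z + q z \<in> W" for z
  proof (rule WI)
    show "bet (v i) (z + q z) = 0" for i
    proof (cases "i < m")
      case True
      have "bet (v i) (q z) = (\<Sum>j<m. bet (v j) z * of_bool (j = i))"
        unfolding q_def by (simp add: bet_sum2 btab)
      also have "\<dots> = bet (v i) z" using True by (simp only: sum_of_bool_eq finite_lessThan) simp
      finally show ?thesis by simp
    next
      case False
      then show ?thesis using v0[of i] rad by (cases "i = m") simp_all
    qed
    show "bet (u i) (z + q z) = 0" for i
    proof (cases "i < m")
      case True
      have "bet (u i) (q z) = (\<Sum>j\<le>m. (if j < m then bet (u j) z else \<phi> z) * of_bool (j = i))"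
        unfolding q_def bet_simps bet_sum2 btab using True
        by (simp only: mult_zero_right sum.neutral_const add_0_right simp_thms)
      also have "\<dots> = bet (u i) z" using True by (simp only: sum_of_bool_eq finite_atMost) simp
      finally show ?thesis by simp
    next
      case False
      then show ?thesis using u0[of i] by simp
    qed
    have "\<phi> (q z) = (\<Sum>j\<le>m. (if j < m then bet (u j) z else \<phi> z) * of_bool (j = m))"
      unfolding q_def \<phi>_add \<phi>_sum \<phi>_scale \<phi>u \<phi>v by (simp only: mult_zero_right sum.neutral_const add_0_right)
    also have "\<dots> = \<phi> z" by (simp only: sum_of_bool_eq finite_atMost) simp
    finally show "\<phi> (z + q z) = 0" by simp
  qed
  show "\<exists>p\<in>W. \<exists>c d. z = p + ((\<Sum>i\<le>m. s (c i) (v i)) + (\<Sum>i<m. s (d i) (u i)))"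
  proof (intro bexI exI)
    show "z = (z + q z) + ((\<Sum>i\<le>m. s (if i < m then bet (u i) z else \<phi> z) (v i)) + (\<Sum>i<m. s (bet (v i) z) (u i)))"
      unfolding q_def[of z, symmetric] by (simp add: add.assoc)
  qed (rule q)
  \<comment> \<open>\<open>Sop\<close> need not preserve \<open>W\<close>. A multiple of the radical
    vector \<open>v m\<close> restores \<phi> = 0 and leaves all pairings unchanged.\<close>
  define T where "T z = Sop z + s (\<phi> (Sop z)) (v m)" for z
  have oWv: "\<omega> z (v i) = 0" if "z \<in> W" for z i
    using WD[OF that] unfolding om_sym[of z] by (cases i) (simp_all add: cv0 cv)
  have T: "bet (T z) w = \<omega> z w" if "z \<in> W" for z w
  proof -
    have "\<omega> z (b n) = 0" using oWv[OF that, of m] by (simp only: vm)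
    then show ?thesis using Sop(1)[OF ad, of z] by (simp add: T_def rad)
  qed
  have TW: "T z \<in> W" if z: "z \<in> W" for z
  proof (rule WI)
    show "bet (v i) (T z) = 0" for i unfolding bet_sym[of "v i"] T[OF z] by (rule oWv[OF z])
    show "bet (u i) (T z) = 0" for i
    proof -
      consider "Suc i < m" | "Suc i = m" | "m \<le> i" by linarith
      then have "\<omega> (u i) z = 0"
      proof cases
        case 1
        then show ?thesis using WD[OF z] by (simp add: cu)
      next
        case 2
        then show ?thesis using WD(3)[OF z] by (auto simp: \<phi>_def)
      qed (simp add: u0)
      then show ?thesis unfolding bet_sym[of "u i"] T[OF z] om_sym[of z] .
    qed
    show "\<phi> (T z) = 0" by (simp add: T_def \<phi>v)
  qed
  have subW: "subspace W"
    using linf_zero[OF \<phi>l] by (intro subspaceI) (simp_all add: W_def)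
  have \<alpha>m: "\<alpha> (v m) = 1" by (simp add: av)
  \<comment> \<open>On \<open>W\<close> the operator is \<open>Sop\<close> up to the span of the v
    i, so descent is tracked in the flag enlarged by that span. After 2n + 1 steps a vector of
    \<open>W\<close> lies in the span itself, which meets \<open>W\<close> only in 0.\<close>
  define A where "A j = {z. \<exists>f\<in>fl b j. \<exists>c. z = f + (\<Sum>i\<le>m. s (c i) (v i))}" for j
  have Tpow: "(T ^^ i) z \<in> W \<and> (T ^^ i) z \<in> A (2*n + 1 - i)" if z: "z \<in> W" "i \<le> 2*n + 1" for z i
    using z(2)
  proof (induction i)
    case 0
    have "z \<in> A (2*n + 1)"
      unfolding A_def by (intro CollectI bexI[of _ z] exI[of _ "\<lambda>_. 0"]) (simp_all add: fl_def)
    then show ?case using z by simp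
  next
    case (Suc i)
    let ?z = "(T ^^ i) z"
    have j: "2*n + 1 - i = Suc (2*n + 1 - Suc i)" using Suc.prems by simp
    have zW: "?z \<in> W" using Suc by simp
    obtain f c where f: "f \<in> fl b (2*n + 1 - i)" and zf: "?z = f + (\<Sum>i\<le>m. s (c i) (v i))"
      using Suc by (auto simp: A_def)
    have "\<omega> ?z (b n) = 0" using oWv[OF zW, of m] by (simp only: vm)
    moreover have "\<omega> (\<Sum>i\<le>m. s (c i) (v i)) (b n) = 0" by (simp add: vm[symmetric] om_sum1 ovv)
    ultimately have of: "\<omega> f (b n) = 0" unfolding zf by simp
    let ?c = "\<lambda>i. if i < m then c (Suc i) else 0"
    have rad0: "bet (T ?z + (Sop f + (\<Sum>i\<le>m. s (?c i) (v i)))) w = 0" for w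
    proof -
      have "\<omega> (\<Sum>i\<le>m. s (c i) (v i)) w = (\<Sum>i<m. c (Suc i) * bet (v i) w)"
        unfolding sum.atMost_shift by (simp add: om_sum1 cv0 cv)
      moreover have "bet (\<Sum>i\<le>m. s (?c i) (v i)) w = (\<Sum>i<m. c (Suc i) * bet (v i) w)"
        unfolding bet_sum1 by (intro sum.mono_neutral_cong_right) auto
      moreover have "\<omega> ?z w = \<omega> f w + \<omega> (\<Sum>i\<le>m. s (c i) (v i)) w" by (simp only: zf om)
      ultimately show ?thesis by (simp only: bet_simps T[OF zW] Sop(1)[OF ad of] add_self)
    qed
    obtain e where e: "T ?z + (Sop f + (\<Sum>i\<le>m. s (?c i) (v i))) = s e (v m)"
      by (rule radical_scalar[OF rad(1) \<alpha>m rad0]) (rule that)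
    have "T ?z = (T ?z + (Sop f + (\<Sum>i\<le>m. s (?c i) (v i)))) + (Sop f + (\<Sum>i\<le>m. s (?c i) (v i)))"
      by (simp only: add.assoc[of "T ?z"] addv_self add_0_right)
    then have "T ?z = s e (v m) + (Sop f + (\<Sum>i\<le>m. s (?c i) (v i)))" unfolding e .
    also have "s e (v m) = (\<Sum>i\<le>m. s (e * of_bool (i = m)) (v i))"
    proof -
      have "(\<Sum>i\<le>m. s (e * of_bool (i = m)) (v i)) = (\<Sum>i\<in>{m}. s (e * of_bool (i = m)) (v i))"
        by (intro sum.mono_neutral_right) auto
      then show ?thesis by simp
    qed
    finally have eq: "T ?z = Sop f + (\<Sum>i\<le>m. s (?c i + e * of_bool (i = m)) (v i))"
      by (simp only: scale_left_distrib sum.distrib add_ac)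
    have "f \<in> fl b (Suc (2*n + 1 - Suc i))" using f unfolding j .
    then have mem: "Sop f \<in> fl b (2*n + 1 - Suc i)" using of by (rule Sop_fl[OF b])
    have "T ?z \<in> A (2*n + 1 - Suc i)"
      unfolding A_def by (rule CollectI, rule bexI, rule exI) (fact eq, fact mem)
    then show ?case using TW[OF zW] by simp
  qed
  have Tnil: "(T ^^ (2*n + 1)) z = 0" if z: "z \<in> W" for z
  proof -
    let ?z = "(T ^^ (2*n + 1)) z"
    have zW: "?z \<in> W" by (rule Tpow[OF z order.refl, THEN conjunct1])
    have "?z \<in> A 0" using Tpow[OF z order.refl, THEN conjunct2] by (simp only: diff_self_eq_0)
    then obtain f c where f: "f \<in> fl b 0" and zf: "?z = f + (\<Sum>i\<le>m. s (c i) (v i))"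
      unfolding A_def by blast
    have zf: "?z = (\<Sum>i\<le>m. s (c i) (v i))" using zf fl_0[OF ad f] by simp
    have "c j = 0" if "j \<le> m" for j
    proof (cases "j < m")
      case True
      have "bet (u j) ?z = (\<Sum>i\<le>m. c i * of_bool (i = j))"
        unfolding zf bet_sum2 bet_simps btab using True by (simp only: simp_thms)
      also have "\<dots> = c j" using True by (simp only: sum_of_bool_eq finite_atMost) simp
      finally show ?thesis using WD(2)[OF zW] by simp
    next
      case False
      have "\<phi> ?z = (\<Sum>i\<le>m. c i * of_bool (i = m))"
        unfolding zf \<phi>_sum \<phi>_scale \<phi>v ..
      also have "\<dots> = c m" by (simp only: sum_of_bool_eq finite_atMost) simp
      finally show ?thesis using WD(3)[OF zW] False that by simp
    qed
    then show ?thesis unfolding zf by (intro sum.neutral) simp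
  qed
  have "nil_op s \<alpha> n \<omega> W T"
  proof unfold_locales
    show "z = 0" if z: "z \<in> W" "\<And>w. w \<in> W \<Longrightarrow> bet z w = 0" for z
    proof -
      have zr: "bet z w = 0" for w
      proof -
        have "bet z (q w) = 0"
          unfolding q_def by (simp add: bet_sum2 WD[OF z(1)])
        then show ?thesis using z(2)[OF q[of w]] by simp
      qed
      obtain e where e: "z = s e (v m)"
        by (rule radical_scalar[OF rad(1) \<alpha>m zr]) (rule that)
      then have "e = 0" using WD(3)[OF z(1)] by (simp add: \<phi>v)
      then show ?thesis using e by simp
    qed
    show "\<exists>N. \<forall>z\<in>W. (T ^^ N) z = 0" using Tnil by blast
  qed (fact subW TW T)+
  then show "\<exists>T. nil_op s \<alpha> n \<omega> W T" by (rule exI[of _ T])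
qed

lemma nf_family_exists:
  assumes b: "nilp \<omega> b"
  shows "\<exists>m v u S K L X Y. nf_family s \<alpha> n m v u S K L X Y \<omega>"
proof -
  have ad: "adapted b" using b by (simp add: nilp_def)
  obtain m v where vm: "v m = b n" and v: "v 0 \<noteq> 0" "\<And>i. \<alpha> (v i) = of_bool (i = m)" "\<And>i. m < i \<Longrightarrow> v i = 0"
    "\<And>z. \<omega> (v 0) z = 0" "\<And>i z. \<omega> (v (Suc i)) z = bet (v i) z"
    using radical_chain_exists[OF b] by blast
  have ex: "\<exists>u. chain_family s \<alpha> n m v u 0 K L X Y \<omega>" for K L X Y
    by (rule radical_dual_exists[OF ad vm v])
  then obtain u where ch: "chain_family s \<alpha> n m v u 0 (\<lambda>_. 0) (\<lambda>_. 0) (\<lambda>_ _. 0) (\<lambda>_ _. 0) \<omega>" by blast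
  interpret A: chain_family s \<alpha> n m v u 0 "\<lambda>_. 0" "\<lambda>_. 0" "\<lambda>_ _. 0" "\<lambda>_ _. 0" \<omega> by (rule ch)
  define \<phi> where "\<phi> = (if m = 0 then co b n else \<omega> (u (m - 1)))"
  define W where "W = {z. (\<forall>i. bet (v i) z = 0 \<and> bet (u i) z = 0) \<and> \<phi> z = 0}"
  have ex: "\<exists>T. nil_op s \<alpha> n \<omega> W T"
    and split: "\<And>z. \<exists>p\<in>W. \<exists>c d. z = p + ((\<Sum>i\<le>m. s (c i) (v i)) + (\<Sum>i<m. s (d i) (u i)))"
    unfolding W_def \<phi>_def by (rule complement_nil_op[OF ch b vm])+
  obtain T where N: "nil_op s \<alpha> n \<omega> W T" using ex by blast
  obtain S K L X Y where F: "block_family W S K L X Y" using block_family_exists[OF N] by blast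
  interpret N: nil_op s \<alpha> n \<omega> W T by (rule N)
  have F1: "X a i \<in> W" "Y a i \<in> W" "K a \<le> i \<Longrightarrow> X a i = 0" "K a \<le> i \<Longrightarrow> Y a i = 0"
    "\<alpha> (X a i) = of_bool (i + 1 = L a)" "\<alpha> (Y a i) = 0" "\<omega> (X a i) z = bet (X a (Suc i)) z"
    "\<omega> (Y a i) z = bet (Y a (Suc i)) z" "1 \<le> K a" "K a \<le> 2 * L a" "L a \<le> K a" if "a < S" for a i z
    using F[unfolded block_family_def, THEN conjunct1, rule_format, OF that] by blast+
  have F2: "bet (X a i) (X c j) = 0" "bet (Y a i) (Y c j) = 0"
    "bet (X a i) (Y c j) = of_bool (a = c \<and> i + j + 1 = K a)" if "a < S" "c < S" for a c i j
    using F[unfolded block_family_def, THEN conjunct2, THEN conjunct1, rule_format, OF that] by blast+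
  have F3: "z = 0" if "z \<in> W" "\<And>a i. a < S \<Longrightarrow> bet (X a i) z = 0" "\<And>a i. a < S \<Longrightarrow> bet (Y a i) z = 0" for z
    using F[unfolded block_family_def, THEN conjunct2, THEN conjunct2, rule_format, OF that(1)] that(2,3) by blast
  have WD: "bet (v i) z = 0" "bet (u i) z = 0" if "z \<in> W" for z i
    using that by (simp_all add: W_def)
  have "chain_family s \<alpha> n m v u S K L X Y \<omega>"
  proof unfold_locales
    show "1 \<le> K a \<and> K a \<le> 2 * L a \<and> L a \<le> K a" if "a < S" for a using F1(9-11)[OF that] by blast
  qed (simp_all add: F1(3-6) F1(7,8) F2 WD F1(1,2) A.v0 A.u0 A.av A.au A.btab v A.cu)
  then interpret C: chain_family s \<alpha> n m v u S K L X Y \<omega> .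
  have span: "z \<in> span (C.E ` C.idx)" for z
  proof -
    have E: "C.E e \<in> span (C.E ` C.idx)" if "e \<in> C.idx" for e using that by (intro span_base imageI)
    have vE: "v i \<in> span (C.E ` C.idx)" if "i \<le> m" for i using E[of "(0, Inl i)"] that by simp
    have uE: "u i \<in> span (C.E ` C.idx)" if "i < m" for i using E[of "(0, Inr i)"] that by simp
    have XE: "X a i \<in> span (C.E ` C.idx)" "Y a i \<in> span (C.E ` C.idx)" if "a < S" for a i
    proof -
      show "X a i \<in> span (C.E ` C.idx)"
        using E[of "(Suc a, Inl i)"] that C.X0[of a i] span_zero by (cases "i < K a") simp_all
      show "Y a i \<in> span (C.E ` C.idx)"
        using E[of "(Suc a, Inr i)"] that C.Y0[of a i] span_zero by (cases "i < K a") simp_all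
    qed
    obtain p c d where p: "p \<in> W" and z: "z = p + ((\<Sum>i\<le>m. s (c i) (v i)) + (\<Sum>i<m. s (d i) (u i)))"
      using split by blast
    \<comment> \<open>The expansion of \<open>p\<close> along the blocks: pairing with
      \<open>Y a (K a - 1 - i)\<close> extracts the coefficient of \<open>X a i\<close>, and
      conversely. As p + q is orthogonal to all blocks, the last clause of
      \<open>block_family\<close> gives p = q.\<close>
    define q where "q = (\<Sum>a<S. (\<Sum>i<K a. s (bet (Y a (K a - 1 - i)) p) (X a i)) + (\<Sum>i<K a. s (bet (X a (K a - 1 - i)) p) (Y a i)))"
    have qW: "q \<in> W" unfolding q_def by (intro N.Usum N.Uadd N.Uscale F1(1,2)) auto
    have qs: "q \<in> span (C.E ` C.idx)" unfolding q_def by (intro span_sum span_add span_scale XE) auto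
    have "bet (X a j) q = bet (X a j) p" if a: "a < S" for a j
    proof (cases "j < K a")
      case True
      have "bet (X a j) q = (\<Sum>c<S. \<Sum>i<K c. bet (X c (K c - 1 - i)) p * of_bool (a = c \<and> j + i + 1 = K a))"
        unfolding q_def bet_sum2 bet_simps by (intro sum.cong refl) (simp add: F2 a)
      also have "\<dots> = (\<Sum>c\<in>{a}. \<Sum>i<K c. bet (X c (K c - 1 - i)) p * of_bool (a = c \<and> j + i + 1 = K a))"
        using a by (intro sum.mono_neutral_right) auto
      also have "\<dots> = (\<Sum>i<K a. bet (X a (K a - 1 - i)) p * of_bool (i = K a - 1 - j))"
        using True by (simp only: sum.insert sum.empty finite.emptyI empty_iff simp_thms not_False_eq_True add_0_right)
          (intro sum.cong refl arg_cong2[of _ _ _ _ "(*)"] arg_cong[of _ _ of_bool], auto)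
      also have "\<dots> = bet (X a j) p" using True by (simp only: sum_of_bool_eq finite_lessThan) simp
      finally show ?thesis .
    qed (simp add: C.X0 a)
    moreover have "bet (Y a j) q = bet (Y a j) p" if a: "a < S" for a j
    proof (cases "j < K a")
      case True
      have bYX': "bet (Y a j) (X c i) = of_bool (a = c \<and> j + i + 1 = K a)" if "c < S" for c i
        using that a by (subst C.bYX) auto
      have "bet (Y a j) q = (\<Sum>c<S. \<Sum>i<K c. bet (Y c (K c - 1 - i)) p * of_bool (a = c \<and> j + i + 1 = K a))"
        unfolding q_def bet_sum2 bet_simps by (intro sum.cong refl) (simp add: F2 bYX' a)
      also have "\<dots> = (\<Sum>c\<in>{a}. \<Sum>i<K c. bet (Y c (K c - 1 - i)) p * of_bool (a = c \<and> j + i + 1 = K a))"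
        using a by (intro sum.mono_neutral_right) auto
      also have "\<dots> = (\<Sum>i<K a. bet (Y a (K a - 1 - i)) p * of_bool (i = K a - 1 - j))"
        using True by (simp only: sum.insert sum.empty finite.emptyI empty_iff simp_thms not_False_eq_True add_0_right)
          (intro sum.cong refl arg_cong2[of _ _ _ _ "(*)"] arg_cong[of _ _ of_bool], auto)
      also have "\<dots> = bet (Y a j) p" using True by (simp only: sum_of_bool_eq finite_lessThan) simp
      finally show ?thesis .
    qed (simp add: C.Y0 a)
    ultimately have "p + q = 0" by (intro F3 N.Uadd p qW) simp_all
    then have "p = q" by simp
    then show ?thesis unfolding z using qs by (intro span_add span_sum span_scale vE uE) auto
  qed
  have "dim UNIV \<le> card (C.E ` C.idx)"
    using span by (intro dim_le_card) auto
  also have "\<dots> \<le> card C.idx" by (rule card_image_le) simp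
  finally have "n \<le> m + (\<Sum>a<S. K a)" by (simp add: card_Idx dim_space)
  then have "m + (\<Sum>a<S. K a) = n" using C.size_le by simp
  then have "nf_family s \<alpha> n m v u S K L X Y \<omega>" by unfold_locales
  then show ?thesis by blast
qed

end

lemma (in quad_space) bil_comb:
  assumes w: "bilinear_alt w"
    and xx: "\<And>i j. w (x i) (x j) = 0" and yy: "\<And>i j. w (y i) (y j) = 0"
  shows "w ((\<Sum>i\<in>I. s (a (Inl i)) (x i)) + (\<Sum>j\<in>J. s (a (Inr j)) (y j)))
      ((\<Sum>i\<in>I. s (a' (Inl i)) (x i)) + (\<Sum>j\<in>J. s (a' (Inr j)) (y j)))
    = pair_bil I J (\<lambda>i j. w (x i) (y j)) a a'"
proof -
  note D = bilinear_altD[OF w]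
  have 1: "w (\<Sum>i\<in>I. s (a (Inl i)) (x i)) (\<Sum>j\<in>J. s (a' (Inr j)) (y j))
    = (\<Sum>i\<in>I. \<Sum>j\<in>J. w (x i) (y j) * (a (Inl i) * a' (Inr j)))" for a a' :: "nat + nat \<Rightarrow> 'k"
    by (simp only: D(9)) (simp only: D(10) D(3,4) sum_distrib_left mult_ac)
  have 2: "w (\<Sum>j\<in>J. s (a (Inr j)) (y j)) (\<Sum>i\<in>I. s (a' (Inl i)) (x i))
    = (\<Sum>i\<in>I. \<Sum>j\<in>J. w (x i) (y j) * (a' (Inl i) * a (Inr j)))"
    by (subst D(8)) (rule 1)
  have 3: "w (\<Sum>i\<in>I. s (a (Inl i)) (x i)) (\<Sum>i\<in>I. s (a' (Inl i)) (x i)) = 0"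
    "w (\<Sum>j\<in>J. s (a (Inr j)) (y j)) (\<Sum>j\<in>J. s (a' (Inr j)) (y j)) = 0"
    by (simp_all only: D(9)) (simp_all only: D(10) D(3,4) xx yy mult_zero_right sum.neutral_const)
  show ?thesis
    unfolding D(1,2) 1 2 3 pair_bil_def add_0_left add_0_right distrib_left sum.distrib
    by (simp only: mult.commute[of "a (Inr _)"] add.commute)
qed

lemma (in quad_space) bilinear_alt_bet: "bilinear_alt bet"
  by (rule bilinear_altI) (simp_all add: bet_sym)

context nf_family
begin

lemma blk_shift:
  assumes b: "b < S" shows "\<omega> (blk (Suc b) a) z = bet (blk (Suc b) (W_shift (K b) a)) z"
proof -
  obtain k where k: "K b = Suc k" using KL[OF b] by (cases "K b") auto
  have 1: "(\<Sum>i<Suc k. W_shift (Suc k) a (Inl i) * bet (X b i) z) = (\<Sum>i<Suc k. a (Inl i) * bet (X b (Suc i)) z)"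
    using X0[OF b, of "Suc k"] k by (subst sum.lessThan_Suc_shift) (simp add: W_shift_def)
  have 2: "(\<Sum>i<Suc k. W_shift (Suc k) a (Inr i) * bet (Y b i) z) = (\<Sum>i<Suc k. a (Inr i) * bet (Y b (Suc i)) z)"
    using Y0[OF b, of "Suc k"] k by (subst sum.lessThan_Suc_shift) (simp add: W_shift_def)
  show ?thesis
    unfolding blk_def using b k
    by (simp only: nat.distinct if_False diff_Suc_1 E.simps om om_sum1 bet_simps bet_sum1 1 2 cX cY)
qed

lemma blk_bil:
  assumes "t \<le> S" shows "\<omega> (blk t a) (blk t a') = fm_bil (mods t) a a'"
proof (cases t)
  case 0
  have "pair_bil {..m} {..<m} (\<lambda>i j. \<omega> (v i) (u j)) a a' = pair_bil {..m} {..<m} (\<lambda>i j. of_bool (i = j + 1)) a a'"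
    unfolding pair_bil_def by (intro sum.cong refl) (simp add: ovu)
  then show ?thesis
    unfolding 0 blk_def using bil_comb[OF omega, of v u a "{..m}" "{..<m}" a']
    by (simp add: ovv ouu nfmods_def V_module_def)
next
  case (Suc b)
  then have b: "b < S" using assms by simp
  show ?thesis
    unfolding Suc blk_shift[OF b]
    unfolding blk_def using bil_comb[OF bilinear_alt_bet, of "X b" "Y b" "W_shift (K b) a" "{..<K b}" "{..<K b}" a'] b
    by (simp add: btab nfmods_def W_module_def)
qed

lemma blk_om_orth:
  assumes "t \<le> S" "t' \<le> S" "t \<noteq> t'" shows "\<omega> (blk t a) (blk t' a') = 0"
proof -
  have "\<omega> (E (t, e)) (E (t', e')) = 0" for e e'
    using assms by (cases t; cases t'; cases e; cases e') (auto simp: otab)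
  then show ?thesis by (simp add: blk_def om_sum1 om_sum2)
qed

lemma cvec_bil: "fm_bil nfm (cvec z) (cvec z') = \<omega> z z'"
proof -
  have "\<omega> z z' = \<omega> (\<Sum>t\<le>S. blk t (cvec z t)) (\<Sum>t\<le>S. blk t (cvec z' t))" by (simp only: sum_blk)
  also have "\<dots> = (\<Sum>t\<le>S. \<Sum>t'\<le>S. \<omega> (blk t (cvec z t)) (blk t' (cvec z' t')))"
    by (simp only: om_sum1) (simp only: om_sum2)
  also have "\<dots> = (\<Sum>t\<le>S. \<Sum>t'\<in>{t}. \<omega> (blk t (cvec z t)) (blk t' (cvec z' t')))"
    by (intro sum.cong refl sum.mono_neutral_right) (auto intro: blk_om_orth)
  finally show ?thesis unfolding nfm_bil by (simp add: blk_bil)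
qed

lemma equiv_nfm: "form_equiv omod nfm"
  unfolding form_equiv_def using cvec_bij cvec_add cvec_scale cvec_quad cvec_bil
  by (intro exI[of _ cvec]) simp

lemma permute:
  assumes \<pi>: "bij_betw \<pi> {..<S} {..<S}"
  shows "nf_family s \<alpha> n m v u S (\<lambda>a. K (\<pi> a)) (\<lambda>a. L (\<pi> a)) (\<lambda>a. X (\<pi> a)) (\<lambda>a. Y (\<pi> a)) \<omega>"
proof -
  have S: "\<pi> a < S" if "a < S" for a using \<pi> that by (auto simp: bij_betw_def)
  have inj: "\<pi> a = \<pi> c \<longleftrightarrow> a = c" if "a < S" "c < S" for a c
    using \<pi> that by (auto simp: bij_betw_def inj_on_def)
  show ?thesis
  proof unfold_locales
    show "1 \<le> K (\<pi> a) \<and> K (\<pi> a) \<le> 2 * L (\<pi> a) \<and> L (\<pi> a) \<le> K (\<pi> a)" if "a < S" for a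
      using KL[OF S[OF that]] .
    show "m + (\<Sum>a<S. K (\<pi> a)) = n"
      using size' sum.reindex_bij_betw[OF \<pi>, of K] by simp
  qed (simp_all add: v0 u0 X0 Y0 av au aX aY btab S inj cv0 cv cu cX cY)
qed

end

lemma decreasing_permutation:
  fixes K :: "nat \<Rightarrow> nat"
  shows "\<exists>\<pi>. bij_betw \<pi> {..<S} {..<S} \<and> (\<forall>a c. a < c \<longrightarrow> c < S \<longrightarrow> K (\<pi> c) \<le> K (\<pi> a))"
proof -
  let ?xs = "rev (sort_key K [0..<S])"
  have "bij_betw ((!) ?xs) {..<length ?xs} (set ?xs)"
    by (intro bij_betw_nth) auto
  then have "bij_betw ((!) ?xs) {..<S} {..<S}" by (simp add: lessThan_atLeast0)
  moreover have "K (?xs ! c) \<le> K (?xs ! a)" if "a < c" "c < S" for a c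
  proof -
    have "sorted (rev (map K ?xs))" by (simp add: rev_map sorted_sort_key)
    then have "map K ?xs ! c \<le> map K ?xs ! a" using that by (intro sorted_rev_nth_mono) simp_all
    then show ?thesis using that by (simp only: nth_map length_rev length_sort length_upt diff_zero order.strict_trans)
  qed
  ultimately show ?thesis by blast
qed

context form_space
begin

lemma normal_form_exists:
  assumes b: "nilp \<omega> b" shows "\<exists>P. has_normal_form omod P"
proof -
  obtain m v u S K0 L0 X0 Y0 where "nf_family s \<alpha> n m v u S K0 L0 X0 Y0 \<omega>"
    using nf_family_exists[OF b] by blast
  then interpret F0: nf_family s \<alpha> n m v u S K0 L0 X0 Y0 \<omega> .
  obtain \<pi> where \<pi>: "bij_betw \<pi> {..<S} {..<S}" "\<And>a c. a < c \<Longrightarrow> c < S \<Longrightarrow> K0 (\<pi> c) \<le> K0 (\<pi> a)"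
    using decreasing_permutation[of S K0] by blast
  define K where "K a = K0 (\<pi> a)" for a
  have K: "K c \<le> K a" if "a \<le> c" "c < S" for a c using \<pi>(2)[of a c] that unfolding K_def by (cases "a = c") auto
  \<comment> \<open>The radical chain v, its length and the \<open>K a\<close> stay fixed, since the
    two changes of basis alter only u, X and Y. The sum of the \<open>L a\<close> is bounded by that
    of the \<open>K a\<close>, so a maximum exists.\<close>
  define P where "P L \<longleftrightarrow> (\<exists>u X Y. nf_family s \<alpha> n m v u S K L X Y \<omega>)" for L
  have P0: "P (\<lambda>a. L0 (\<pi> a))"
    using F0.permute[OF \<pi>(1)] unfolding P_def K_def by blast
  have bound: "(\<Sum>a<S. L a) \<le> (\<Sum>a<S. K a)" if "P L" for L
  proof -
    obtain u X Y where "nf_family s \<alpha> n m v u S K L X Y \<omega>" using \<open>P L\<close> unfolding P_def by blast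
    then interpret nf_family s \<alpha> n m v u S K L X Y \<omega> .
    show ?thesis using KL by (intro sum_mono) simp
  qed
  have "\<exists>L. P L \<and> (\<forall>L'. P L' \<longrightarrow> (\<Sum>a<S. L' a) \<le> (\<Sum>a<S. L a))"
    by (rule ex_has_greatest_nat[of P, OF P0, of _ "Suc (\<Sum>a<S. K a)"]) (use bound in \<open>simp add: less_Suc_eq_le\<close>)
  then obtain L where L: "P L" "\<And>L'. P L' \<Longrightarrow> (\<Sum>a<S. L' a) \<le> (\<Sum>a<S. L a)" by blast
  from L(1) obtain u X Y where "nf_family s \<alpha> n m v u S K L X Y \<omega>" unfolding P_def by blast
  then interpret nf_family s \<alpha> n m v u S K L X Y \<omega> .
  have max: False if "chain_family s \<alpha> n m v u' S K (L(a := l)) X' Y' \<omega>" "a < S" "L a < l" for u' X' Y' a l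
  proof -
    interpret C: chain_family s \<alpha> n m v u' S K "L(a := l)" X' Y' \<omega> by (rule that)
    have "nf_family s \<alpha> n m v u' S K (L(a := l)) X' Y' \<omega>" by unfold_locales (rule size')
    then have "P (L(a := l))" unfolding P_def by blast
    from L(2)[OF this] have "(\<Sum>c<S. (L(a := l)) c) \<le> (\<Sum>c<S. L c)" .
    moreover have "(\<Sum>c<S. L c) < (\<Sum>c<S. (L(a := l)) c)"
      using that by (intro sum_strict_mono_ex1) auto
    ultimately show False by simp
  qed
  have le1: "L c \<le> p + L a" if "a < S" "c < S" "a \<noteq> c" "K a + p = K c + p'" for a c p p'
  proof (rule ccontr)
    assume "\<not> L c \<le> p + L a"
    then have l: "p + L a < L c" by simp
    then have "L a < L c - p" by simp
    with move_blocks[OF that l] show False using max[OF _ that(1)] by blast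
  qed
  have le2: "K a \<le> m + L a" if "a < S" for a
  proof (rule ccontr)
    assume "\<not> K a \<le> m + L a"
    then have l: "m + L a < K a" by simp
    then have "L a < K a - m" by simp
    with move_radical[OF that l] show False using max[OF _ that] by blast
  qed
  have "normal_form_params (m, map (\<lambda>a. (L a, K a)) [0..<S])"
    unfolding params_iff
  proof (intro conjI allI impI)
    fix a c assume ac: "a < c" "c < S"
    show "K c \<le> K a" using ac K by simp
    \<comment> \<open>The shift 0 from block c to block a gives the order of the \<open>L\<close>.
      With the blocks exchanged and shift \<open>K a - K c\<close> it gives the order of the
      differences \<open>K - L\<close>.\<close>
    then have "L c \<le> 0 + L a" using ac by (intro le1[of a c 0 "K a - K c"]) simp_all
    then show "L c \<le> L a" by simp
    have "L a \<le> K a - K c + L c" using ac \<open>K c \<le> K a\<close> by (intro le1[of c a "K a - K c" 0]) simp_all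
    then show "K c - L c \<le> K a - L a" using \<open>K c \<le> K a\<close> by simp
  next
    fix a assume "a < S"
    then show "K a - L a \<le> m" using le2[of a] by simp
  qed
  then show ?thesis using equiv_nfm unfolding has_normal_form_def by blast
qed

end

section \<open>Models of the normal forms\<close>

lemma (in quad_space) sum_sym_eq_0:
  fixes f :: "'a \<Rightarrow> 'a \<Rightarrow> 'k"
  assumes "finite A" "\<And>x y. f x y = f y x" "\<And>x. f x x = 0"
  shows "(\<Sum>x\<in>A. \<Sum>y\<in>A. f x y) = 0"
  using assms(1)
proof induction
  case (insert a A)
  have "(\<Sum>x\<in>A. f x a) = (\<Sum>x\<in>A. f a x)" by (intro sum.cong refl assms(2))
  then show ?case using insert by (simp add: sum.distrib assms(3))
qed simp

context ab_full
begin

text \<open>The image of a basis vector under the shift operator. The form of this operator has to be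
  corrected in one entry as \<open>v m\<close> is orthogonal to everything.\<close>

fun NE :: "nat \<times> (nat + nat) \<Rightarrow> 'b" where
  "NE (0, Inl 0) = 0" | "NE (0, Inl (Suc i)) = v i" | "NE (0, Inr j) = u (Suc j)"
| "NE (Suc a, Inl i) = X a (Suc i)" | "NE (Suc a, Inr i) = Y a (Suc i)"

definition Om :: "nat \<times> (nat + nat) \<Rightarrow> nat \<times> (nat + nat) \<Rightarrow> 'a" where
  "Om x y = bet (NE x) (E y) + of_bool (0 < m \<and> x = (0, Inr (m - 1)) \<and> y = (0, Inl m))"

lemma Om_sym:
  assumes "x \<in> idx" "y \<in> idx" shows "Om x y = Om y x" "Om x x = 0"
proof -
  have NE0: "NE (0, Inl i) = (if i = 0 then 0 else v (i - 1))" for i by (cases i) simp_all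
  show "Om x y = Om y x"
    using assms by (elim Idx_cases) (auto simp: Om_def NE0 btab of_bool_def)
  show "Om x x = 0"
    using assms(1) by (elim Idx_cases) (auto simp: Om_def NE0 btab)
qed

lemma form_exists: "\<exists>\<omega>. nf_family s \<alpha> n m v u S K L X Y \<omega>"
proof -
  define \<omega> where "\<omega> z w = (\<Sum>x\<in>idx. \<Sum>y\<in>idx. ce x z * ce y w * Om x y)" for z w
  note ca = coord_add[OF E_ibasis] and cs = coord_scale[OF E_ibasis]
  have alt: "bilinear_alt \<omega>"
  proof (rule bilinear_altI)
    show "\<omega> z (w + w') = \<omega> z w + \<omega> z w'" for z w w'
      by (simp add: \<omega>_def ca algebra_simps sum.distrib)
    show "\<omega> z (s c w) = c * \<omega> z w" for z w c
      by (simp add: \<omega>_def cs sum_distrib_left mult_ac)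
    show "\<omega> z w = \<omega> w z" for z w
      unfolding \<omega>_def by (subst sum.swap) (intro sum.cong refl, simp add: Om_sym mult_ac)
    show "\<omega> z z = 0" for z
    proof -
      have "\<omega> z z = (\<Sum>x\<in>idx. \<Sum>y\<in>idx. if x \<in> idx \<and> y \<in> idx then ce x z * ce y z * Om x y else 0)"
        unfolding \<omega>_def by (intro sum.cong refl) simp
      also have "\<dots> = 0"
      proof (rule sum_sym_eq_0[OF finite_Idx])
        fix x y
        show "(if x \<in> idx \<and> y \<in> idx then ce x z * ce y z * Om x y else 0)
          = (if y \<in> idx \<and> x \<in> idx then ce y z * ce x z * Om y x else 0)"
          using Om_sym(1)[of x y] by (simp add: mult_ac)
        show "(if x \<in> idx \<and> x \<in> idx then ce x z * ce x z * Om x x else 0) = 0"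
          using Om_sym(2)[of x x] by simp
      qed
      finally show ?thesis .
    qed
  qed
  have \<omega>E: "\<omega> (E x) z = bet (NE x) z + of_bool (0 < m \<and> x = (0, Inr (m - 1))) * ce (0, Inl m) z"
    if x: "x \<in> idx" for x z
  proof -
    have "\<omega> (E x) z = (\<Sum>x'\<in>idx. (\<Sum>y\<in>idx. ce y z * Om x' y) * of_bool (x' = x))"
      unfolding \<omega>_def sum_distrib_right
      by (intro sum.cong refl) (simp add: coord_basis[OF E_ibasis _ x] mult_ac)
    also have "\<dots> = (\<Sum>y\<in>idx. ce y z * Om x y)" using x by (simp only: sum_of_bool_eq finite_Idx if_True)
    also have "\<dots> = (\<Sum>y\<in>idx. ce y z * bet (NE x) (E y))
      + (\<Sum>y\<in>idx. (of_bool (0 < m \<and> x = (0, Inr (m - 1))) * ce y z) * of_bool (y = (0, Inl m)))"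
      unfolding sum.distrib[symmetric] by (intro sum.cong refl) (auto simp: Om_def algebra_simps)
    also have "(\<Sum>y\<in>idx. ce y z * bet (NE x) (E y)) = bet (NE x) (\<Sum>y\<in>idx. s (ce y z) (E y))"
      by (simp add: bet_sum2)
    also have "\<dots> = bet (NE x) z" by (simp only: sum_coord[OF E_ibasis])
    finally show ?thesis by (simp only: sum_of_bool_eq finite_Idx) simp
  qed
  interpret form_space s \<alpha> n \<omega> by unfold_locales (rule alt)
  have vm: "bet (v m) z = 0" for z
  proof -
    have "bet (v m) (\<Sum>y\<in>idx. s (ce y z) (E y)) = 0"
      unfolding bet_sum2 by (intro sum.neutral ballI, erule Idx_cases) (simp_all add: btab)
    then show ?thesis unfolding sum_coord[OF E_ibasis] .
  qed
  have "nf_family s \<alpha> n m v u S K L X Y \<omega>"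
  proof unfold_locales
    show "\<omega> (v 0) z = 0" for z using \<omega>E[of "(0, Inl 0)" z] by simp
    show "\<omega> (v (Suc i)) z = bet (v i) z" for i z
    proof (cases "Suc i \<le> m")
      case True
      then show ?thesis using \<omega>E[of "(0, Inl (Suc i))" z] by simp
    next
      case False
      then show ?thesis using v0[of "Suc i"] v0[of i] vm by (cases "i = m") simp_all
    qed
    show "\<omega> (u j) z = bet (u (Suc j)) z" if "Suc j < m" for j z
      using \<omega>E[of "(0, Inr j)" z] that by simp
    show "\<omega> (X a i) z = bet (X a (Suc i)) z" if "a < S" for a i z
      using \<omega>E[of "(Suc a, Inl i)" z] that X0[of a i] X0[of a "Suc i"] by (cases "i < K a") simp_all
    show "\<omega> (Y a i) z = bet (Y a (Suc i)) z" if "a < S" for a i z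
      using \<omega>E[of "(Suc a, Inr i)" z] that Y0[of a i] Y0[of a "Suc i"] by (cases "i < K a") simp_all
  qed (rule size)
  then show ?thesis by blast
qed

end

context quad_space
begin

text \<open>The blocks are laid out in the given basis \<open>b\<close>, so the form is nilpotent
  for the same flag. \<open>Of\<close> gives the block offsets: the \<open>Y a\<close> fill the
  first positions, the v follow up to the middle, and u and X occupy the mirrored positions.\<close>

lemma model_exists:
  assumes b: "adapted b" and KL: "\<And>a. a < S \<Longrightarrow> 1 \<le> K a \<and> K a \<le> 2 * L a \<and> L a \<le> K a"
    and size: "m + (\<Sum>a<S. K a) = n"
  shows "\<exists>\<omega> v u X Y. nf_family s \<alpha> n m v u S K L X Y \<omega> \<and> nilp \<omega> b"
proof -
  define Of where "Of a = (\<Sum>c<a. K c)" for a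
  have OS: "Of (Suc a) = Of a + K a" for a by (simp add: Of_def)
  have Omono: "Of a \<le> Of c" if "a \<le> c" for a c unfolding Of_def using that by (intro sum_mono2) auto
  have On: "Of S + m = n" using size by (simp add: Of_def)
  have lo: "Of a + i < Of S" if "a < S" "i < K a" for a i
    using Omono[of "Suc a" S] OS[of a] that by simp
  have lo': "Of a + (K a - Suc i) < Of S" if "a < S" "i < K a" for a i
    using lo[of a "K a - Suc i"] that by simp
  have inj: "a = c \<and> i = j" if "a < S" "c < S" "i < K a" "j < K c" "Of a + i = Of c + j" for a c i j
    using Omono[of "Suc a" c] Omono[of "Suc c" a] OS[of a] OS[of c] that
    by (cases a c rule: linorder_cases) auto
  have block: "\<exists>a i. a < N \<and> i < K a \<and> p = Of a + i" if "p < Of N" for p N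
    using that
  proof (induction N)
    case (Suc N)
    show ?case
    proof (cases "p < Of N")
      case True
      then show ?thesis using Suc.IH less_SucI by blast
    next
      case False
      then have "p - Of N < K N \<and> p = Of N + (p - Of N)" using Suc.prems OS[of N] by auto
      then show ?thesis by blast
    qed
  qed (simp add: Of_def)
  have bb: "bet (b p) (b q) = of_bool (p + q = 2*n \<and> p \<noteq> q)" if "p \<le> 2*n" "q \<le> 2*n" for p q
    using adaptedD(1)[OF b that] .
  have rad: "bet (b n) z = 0" "bet z (b n) = 0" for z by (rule adapted_radical[OF b])+
  have ab: "\<alpha> (b p) = of_bool (p = n)" if "p \<le> 2*n" for p using adaptedD(2)[OF b that] .
  define v where "v i = (if i \<le> m then b (Of S + i) else 0)" for i
  define u where "u j = (if j < m then b (2*n - Of S - j) else 0)" for j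
  define Y where "Y a j = (if j < K a then b (Of a + (K a - Suc j)) else 0)" for a j
  \<comment> \<open>Adding the radical vector \<open>b n\<close> at the place L a - 1 gives
    \<open>\<alpha>\<close> the value 1 there and affects no pairing.\<close>
  define X where "X a j = (if j < K a then b (2*n - (Of a + j)) + (if Suc j = L a then b n else 0) else 0)" for a j
  have bX: "bet (X a i) z = (if i < K a then bet (b (2*n - (Of a + i))) z else 0)"
    "bet z (X a i) = (if i < K a then bet z (b (2*n - (Of a + i))) else 0)" for a i z
    by (simp_all add: X_def rad)
  have "ab_full s \<alpha> n m v u S K L X Y"
  proof unfold_locales
    show "1 \<le> K a \<and> K a \<le> 2 * L a \<and> L a \<le> K a" if "a < S" for a using KL[OF that] .
    show "m + (\<Sum>a<S. K a) = n" by (rule size)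
    show "\<alpha> (v i) = of_bool (i = m)" for i using On by (auto simp: v_def ab)
    show "\<alpha> (u i) = 0" for i using On by (auto simp: u_def ab)
    show "\<alpha> (X a i) = of_bool (i + 1 = L a)" if "a < S" for a i
      using lo[OF that, of i] On KL[OF that] by (auto simp: X_def ab \<alpha>_add rad)
    show "\<alpha> (Y a i) = 0" if "a < S" for a i
      using lo'[OF that, of i] On by (auto simp: Y_def ab)
    show "bet (v i) (v j) = 0" "bet (u i) (u j) = 0" for i j
      using On by (auto simp: v_def u_def bb)
    show "bet (v i) (u j) = of_bool (i = j \<and> j < m)" for i j
      using On by (auto simp: v_def u_def bb)
    show "bet (v i) (X a j) = 0" "bet (v i) (Y a j) = 0" "bet (u i) (X a j) = 0" "bet (u i) (Y a j) = 0"
      if "a < S" for a i j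
      using lo[OF that, of j] lo'[OF that, of j] On by (auto simp: v_def u_def Y_def bX bb)
    show "bet (X a i) (X c j) = 0" "bet (Y a i) (Y c j) = 0" if "a < S" "c < S" for a c i j
      using lo[OF that(1), of i] lo'[OF that(1), of i] lo[OF that(2), of j] lo'[OF that(2), of j] On
      by (auto simp: Y_def bX bb)
    show "bet (X a i) (Y c j) = of_bool (a = c \<and> i + j + 1 = K a)" if ac: "a < S" "c < S" for a c i j
    proof (cases "i < K a \<and> j < K c")
      case True
      have "bet (X a i) (Y c j) = of_bool (Of a + i = Of c + (K c - Suc j))"
        using True lo[OF ac(1), of i] lo'[OF ac(2), of j] On by (auto simp: Y_def bX bb)
      also have "(Of a + i = Of c + (K c - Suc j)) = (a = c \<and> i + j + 1 = K a)"
        using inj[OF ac, of i "K c - Suc j"] True by auto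
      finally show ?thesis .
    qed (auto simp: X_def Y_def)
  qed (simp_all add: v_def u_def X_def Y_def)
  then interpret ab_full s \<alpha> n m v u S K L X Y .
  obtain \<omega> where \<omega>: "nf_family s \<alpha> n m v u S K L X Y \<omega>" using form_exists by blast
  then interpret F: nf_family s \<alpha> n m v u S K L X Y \<omega> .
  \<comment> \<open>The position in \<open>b\<close> of the vector \<open>E x\<close>, up to the
    radical. Positions of vectors with nonzero \<open>\<omega>\<close> add up to 2n + 1, just
    outside the range required by \<open>nilp\<close>.\<close>
  define dd where "dd x = (case x of (t, e) \<Rightarrow> case t of
      0 \<Rightarrow> (case e of Inl i \<Rightarrow> Of S + i | Inr j \<Rightarrow> 2*n - Of S - j)
    | Suc a \<Rightarrow> (case e of Inl j \<Rightarrow> 2*n - (Of a + j) | Inr j \<Rightarrow> Of a + (K a - Suc j)))" for x :: "nat \<times> (nat + nat)"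
  have table: "dd x + dd y = 2*n + 1" if "x \<in> idx" "y \<in> idx" "\<omega> (E x) (E y) \<noteq> 0" for x y
    using that(1)
  proof (cases rule: Idx_cases)
    case (v i)
    then show ?thesis using that On by (elim Idx_cases[of y]) (auto simp: dd_def F.otab)
  next
    case (u i)
    then show ?thesis using that On by (elim Idx_cases[of y]) (auto simp: dd_def F.otab)
  next
    case (X a i)
    then show ?thesis using that On lo[of a i] by (elim Idx_cases[of y]) (auto simp: dd_def F.otab)
  next
    case (Y a i)
    then show ?thesis using that On Omono[of "Suc a" S] OS[of a] by (elim Idx_cases[of y]) (auto simp: dd_def F.otab)
  qed
  \<comment> \<open>A correction by the radical vector occurs only for p > n. As that vector sits at
    position n, its products with \<open>E y\<close> also vanish for p + q at most 2n.\<close>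
  have rep: "\<exists>x\<in>idx. \<exists>c. dd x = p \<and> b p = E x + s c (v m) \<and> (c \<noteq> 0 \<longrightarrow> n < p)" if p: "p \<le> 2*n" for p
  proof -
    consider "p < Of S" | "Of S \<le> p" "p \<le> n" | "n < p" "p \<le> 2*n - Of S" | "2*n - p < Of S" "n < p"
      using On p by arith
    then show ?thesis
    proof cases
      case 1
      obtain a i where a: "a < S" "i < K a" "p = Of a + i" using block[OF 1] by blast
      then have "(Suc a, Inr (K a - Suc i)) \<in> idx" "dd (Suc a, Inr (K a - Suc i)) = p"
        "b p = E (Suc a, Inr (K a - Suc i)) + s 0 (v m)" by (auto simp: dd_def Y_def)
      then show ?thesis by blast
    next
      case 2
      then have "(0, Inl (p - Of S)) \<in> idx" "dd (0, Inl (p - Of S)) = p"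
        "b p = E (0, Inl (p - Of S)) + s 0 (v m)" using On by (auto simp: dd_def v_def)
      then show ?thesis by blast
    next
      case 3
      then have "(0, Inr (2*n - Of S - p)) \<in> idx" "dd (0, Inr (2*n - Of S - p)) = p"
        "b p = E (0, Inr (2*n - Of S - p)) + s 0 (v m)" using On by (auto simp: dd_def u_def)
      then show ?thesis by blast
    next
      case 4
      obtain a i where a: "a < S" "i < K a" "2*n - p = Of a + i" using block[OF 4(1)] by blast
      then have p': "p = 2*n - (Of a + i)" using p by simp
      have "X a i = b p + s (of_bool (Suc i = L a)) (v m)" using a p' On by (simp add: X_def v_def)
      then have "b p = X a i + s (of_bool (Suc i = L a)) (v m)" by (simp add: add.assoc)
      then have "(Suc a, Inl i) \<in> idx" "dd (Suc a, Inl i) = p"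
        "b p = E (Suc a, Inl i) + s (of_bool (Suc i = L a)) (v m)" using a p' by (simp_all add: dd_def)
      then show ?thesis using 4(2) by blast
    qed
  qed
  have "nilp \<omega> b"
    unfolding nilp_def
  proof (intro conjI allI impI b)
    fix p q assume pq: "p + q \<le> 2*n"
    then have "p \<le> 2*n" "q \<le> 2*n" by simp_all
    obtain x c where x: "x \<in> idx" "dd x = p" "b p = E x + s c (v m)" "c \<noteq> 0 \<longrightarrow> n < p"
      using rep[OF \<open>p \<le> 2*n\<close>] by blast
    obtain y d where y: "y \<in> idx" "dd y = q" "b q = E y + s d (v m)" "d \<noteq> 0 \<longrightarrow> n < q"
      using rep[OF \<open>q \<le> 2*n\<close>] by blast
    have m: "(0, Inl m) \<in> idx" "dd (0, Inl m) = n" "E (0, Inl m) = v m" using On by (simp_all add: dd_def)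
    have "\<omega> (E x) (E y) = 0" using table[OF x(1) y(1)] x y pq by auto
    moreover have "c * \<omega> (v m) (E y) = 0" using table[OF m(1) y(1)] m x y pq by auto
    moreover have "d * \<omega> (E x) (v m) = 0" using table[OF x(1) m(1)] m x y pq by auto
    ultimately show "\<omega> (b p) (b q) = 0" by (auto simp: x(3) y(3) F.ovv)
  qed
  with \<omega> show ?thesis by blast
qed

end

context form_space
begin

lemma equiv_nfp_size:
  assumes eq: "form_equiv omod (nfp m S L K)" shows "m + (\<Sum>a<S. K a) = n"
proof -
  let ?N = "nfp m S L K :: ('k, nat \<Rightarrow> nat + nat \<Rightarrow> 'k) form_module"
  let ?I = "Idx m S K"
  obtain f where f: "bij_betw f UNIV (fm_space ?N)" "\<And>x y. f (x + y) = f x + f y"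
    "\<And>c x. f (s c x) = fm_scale ?N c (f x)"
    using eq unfolding form_equiv_def by auto
  have fN: "f x t e = 0" if "(t, e) \<notin> ?I" for x t e
    using f(1) that nfm_space_iff[where F = "f x" and m = m and S = S and K = K] by (auto simp: bij_betw_def)
  define \<delta> :: "nat \<times> (nat + nat) \<Rightarrow> nat \<Rightarrow> nat + nat \<Rightarrow> 'k" where "\<delta> x t e = of_bool (x = (t, e))" for x t e
  have \<delta>: "\<delta> x \<in> fm_space ?N" if "x \<in> ?I" for x
    using that unfolding nfm_space_iff by (auto simp: \<delta>_def)
  define E where "E x = inv_into UNIV f (\<delta> x)" for x
  have fE: "f (E x) = \<delta> x" if "x \<in> ?I" for x
    unfolding E_def using \<delta>[OF that] f(1) by (intro f_inv_into_f) (simp add: bij_betw_def)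
  have f0: "f 0 t e = 0" for t e
  proof -
    have "f 0 t e + f 0 t e = f 0 t e" using f(2)[of 0 0] by (simp add: plus_fun_def fun_eq_iff)
    then show ?thesis by simp
  qed
  have sum: "f (\<Sum>x\<in>A. s (c x) (E x)) t e = (if (t, e) \<in> A then c (t, e) else 0)" if "finite A" "A \<subseteq> ?I" for A c t e
    using that
  proof induction
    case (insert x A)
    have "f (s (c x) (E x)) t e = c x * \<delta> x t e"
      unfolding f(3) nfm_scale using insert.prems fE[of x] Idx_le[of t e m S K]
      by (auto simp: coord_scale_def \<delta>_def)
    then show ?case using insert by (auto simp: f(2) plus_fun_def \<delta>_def)
  qed (simp add: f0)
  have "ibasis ?I E"
  proof (rule ibasis_spanI)
    fix c assume "(\<Sum>x\<in>?I. s (c x) (E x)) = 0"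
    then show "\<forall>x\<in>?I. c x = 0" using sum[of ?I c] f0 by (metis finite_Idx order.refl prod.collapse)
  next
    fix z
    have "f z = f (\<Sum>x\<in>?I. s (f z (fst x) (snd x)) (E x))"
      using fN by (intro ext) (simp add: sum)
    then have "z = (\<Sum>x\<in>?I. s (f z (fst x) (snd x)) (E x))"
      using f(1) by (auto simp: bij_betw_def dest: injD)
    then show "\<exists>c. z = (\<Sum>x\<in>?I. s (c x) (E x))" by (rule exI[of _ "\<lambda>x. f z (fst x) (snd x)"])
  qed simp
  from ibasis_card[OF this] show ?thesis by (simp add: card_Idx dim_space)
qed

text \<open>The model for the same parameters, with its own form, has a coordinate map to the same
  normal form module. Composing it with the inverse of the equivalence transports the basis of the
  model to one for \<open>\<omega>\<close>.\<close>

lemma equiv_nfp_family: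
  assumes b: "adapted b" and eq: "form_equiv omod (nfp m S L K)"
    and KL: "\<And>a. a < S \<Longrightarrow> 1 \<le> K a \<and> K a \<le> 2 * L a \<and> L a \<le> K a"
  shows "\<exists>v u X Y. nf_family s \<alpha> n m v u S K L X Y \<omega>"
proof -
  let ?N = "nfp m S L K :: ('k, nat \<Rightarrow> nat + nat \<Rightarrow> 'k) form_module"
  obtain f where f: "bij_betw f UNIV (fm_space ?N)" "\<And>x y. f (x + y) = f x + f y"
    "\<And>x. fm_quad ?N (f x) = \<alpha> x" "\<And>x y. fm_bil ?N (f x) (f y) = \<omega> x y"
    using eq unfolding form_equiv_def by auto
  obtain \<omega>' v u X Y where "nf_family s \<alpha> n m v u S K L X Y \<omega>'"
    using model_exists[OF b KL equiv_nfp_size[OF eq]] by blast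
  then interpret M: nf_family s \<alpha> n m v u S K L X Y \<omega>' .
  define g where "g x = inv_into UNIV f (M.cvec x)" for x
  have fg: "f (g x) = M.cvec x" for x
    unfolding g_def using M.cvec_bij f(1) by (intro f_inv_into_f) (auto simp: bij_betw_def)
  have finj: "x = y" if "f x = f y" for x y using f(1) that by (auto simp: bij_betw_def dest: injD)
  have ga: "g (x + y) = g x + g y" for x y by (rule finj) (simp add: f(2) fg M.cvec_add)
  have g0: "g 0 = 0" using ga[of 0 0] by simp
  have \<alpha>g: "\<alpha> (g x) = \<alpha> x" for x by (simp add: f(3)[symmetric] fg M.cvec_quad)
  have \<omega>g: "\<omega> (g x) (g y) = \<omega>' x y" for x y by (simp add: f(4)[symmetric] fg M.cvec_bil)
  have bg: "bet (g x) (g y) = bet x y" for x y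
    unfolding polar_def ga[symmetric] \<alpha>g ..
  have surj: "\<exists>z'. z = g z'" for z
  proof -
    have "f z \<in> range M.cvec" using f(1) M.cvec_bij by (auto simp: bij_betw_def)
    then obtain z' where "f z = M.cvec z'" by blast
    then have "z = g z'" by (intro finj) (simp add: fg)
    then show ?thesis by blast
  qed
  have tr: "\<omega> (g x) z = bet (g y) z" if "\<And>w. \<omega>' x w = bet y w" for x y z
    using surj[of z] that by (auto simp: \<omega>g bg)
  have "nf_family s \<alpha> n m (\<lambda>i. g (v i)) (\<lambda>i. g (u i)) S K L (\<lambda>a i. g (X a i)) (\<lambda>a i. g (Y a i)) \<omega>"
  proof unfold_locales
    show "1 \<le> K a \<and> K a \<le> 2 * L a \<and> L a \<le> K a" if "a < S" for a using KL[OF that] .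
    show "\<omega> (g (v 0)) z = 0" for z using tr[of "v 0" 0 z] by (simp add: M.cv0 g0)
    show "\<omega> (g (v (Suc i))) z = bet (g (v i)) z" for i z by (rule tr) (rule M.cv)
    show "\<omega> (g (u j)) z = bet (g (u (Suc j))) z" if "Suc j < m" for j z by (rule tr) (rule M.cu[OF that])
    show "\<omega> (g (X a i)) z = bet (g (X a (Suc i))) z" if "a < S" for a i z by (rule tr) (rule M.cX[OF that])
    show "\<omega> (g (Y a i)) z = bet (g (Y a (Suc i))) z" if "a < S" for a i z by (rule tr) (rule M.cY[OF that])
    show "m + (\<Sum>a<S. K a) = n" by (rule M.size')
  qed (simp_all add: \<alpha>g bg g0 M.v0 M.u0 M.X0 M.Y0 M.av M.au M.aX M.aY M.btab)
  then show ?thesis by blast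
qed

end

section \<open>Uniqueness of the normal form\<close>

lemma initial_segment_iff:
  fixes D :: "nat set"
  assumes "finite D" "\<And>a c. a \<le> c \<Longrightarrow> c \<in> D \<Longrightarrow> a \<in> D"
  shows "a \<in> D \<longleftrightarrow> a < card D"
proof
  assume "a \<in> D"
  then have "{..a} \<subseteq> D" using assms(2) by auto
  from card_mono[OF assms(1) this] show "a < card D" by simp
next
  assume "a < card D"
  show "a \<in> D"
  proof (rule ccontr)
    assume a: "a \<notin> D"
    have "D \<subseteq> {..<a}"
    proof
      fix c assume "c \<in> D"
      then show "c \<in> {..<a}" using assms(2)[of a c] a by (cases "a \<le> c") auto
    qed
    from card_mono[OF _ this] \<open>a < card D\<close> show False by simp
  qed
qed

text \<open>Consecutive differences in N count the parts exceeding N. These numbers form the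
  conjugate partition, which determines the sequence.\<close>

lemma min_sums_determine:
  fixes K K' :: "nat \<Rightarrow> nat"
  assumes K: "\<And>a c. a < c \<Longrightarrow> c < S \<Longrightarrow> K c \<le> K a" "\<And>a. a < S \<Longrightarrow> 1 \<le> K a"
    and K': "\<And>a c. a < c \<Longrightarrow> c < S' \<Longrightarrow> K' c \<le> K' a" "\<And>a. a < S' \<Longrightarrow> 1 \<le> K' a"
    and eq: "\<And>N. (\<Sum>a<S. min N (K a)) = (\<Sum>a<S'. min N (K' a))"
  shows "S = S' \<and> (\<forall>a<S. K a = K' a)"
proof -
  have step: "(\<Sum>a<S. min (Suc N) (K a)) = (\<Sum>a<S. min N (K a)) + card {a\<in>{..<S}. N < K a}" for S N and K :: "nat \<Rightarrow> nat"
  proof -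
    have "(\<Sum>a<S. min (Suc N) (K a)) = (\<Sum>a<S. min N (K a) + of_bool (N < K a))"
      by (intro sum.cong) auto
    also have "\<dots> = (\<Sum>a<S. min N (K a)) + (\<Sum>a<S. of_bool (N < K a))" by (rule sum.distrib)
    also have "(\<Sum>a<S. of_bool (N < K a) :: nat) = card {a\<in>{..<S}. N < K a}"
      by (simp add: sum_of_bool_eq Int_def)
    finally show ?thesis .
  qed
  have c: "card {a\<in>{..<S}. N < K a} = card {a\<in>{..<S'}. N < K' a}" for N
    using step[of N K S] step[of N K' S'] eq[of N] eq[of "Suc N"] by simp
  have "{a\<in>{..<S}. 0 < K a} = {..<S}" "{a\<in>{..<S'}. 0 < K' a} = {..<S'}"
    using K(2) K'(2) by fastforce+
  then have S: "S = S'" using c[of 0] by simp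
  have "K a = K' a" if a: "a < S" for a
  proof -
    have "N < K a \<longleftrightarrow> N < K' a" for N
    proof -
      have "a \<in> {a\<in>{..<S}. N < K a} \<longleftrightarrow> a < card {a\<in>{..<S}. N < K a}"
      proof (rule initial_segment_iff)
        fix e f assume "e \<le> f" "f \<in> {a\<in>{..<S}. N < K a}"
        then show "e \<in> {a\<in>{..<S}. N < K a}" using K(1)[of e f] by (cases "e = f") auto
      qed simp
      moreover have "a \<in> {a\<in>{..<S'}. N < K' a} \<longleftrightarrow> a < card {a\<in>{..<S'}. N < K' a}"
      proof (rule initial_segment_iff)
        fix e f assume "e \<le> f" "f \<in> {a\<in>{..<S'}. N < K' a}"
        then show "e \<in> {a\<in>{..<S'}. N < K' a}" using K'(1)[of e f] by (cases "e = f") auto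
      qed simp
      ultimately show ?thesis using a c[of N] S by simp
    qed
    then show ?thesis by (meson linorder_neqE_nat order.irrefl)
  qed
  with S show ?thesis by blast
qed

section \<open>Terminating chains as invariants of the second form\<close>

context form_space
begin

text \<open>A chain is what x, T x, T^2 x, ... would be for an operator T of
  \<open>\<omega>\<close>; the heads of chains that are 0 from place N on replace the kernel of
  T^N.\<close>

definition chain :: "nat \<Rightarrow> (nat \<Rightarrow> 'v) \<Rightarrow> bool" where
  "chain N x \<longleftrightarrow> (\<forall>i z. \<omega> (x i) z = bet (x (Suc i)) z) \<and> (\<forall>i\<ge>N. x i = 0)"

lemma chainD:
  assumes "chain N x"
  shows "\<omega> (x i) z = bet (x (Suc i)) z" "\<omega> z (x i) = bet z (x (Suc i))" "N \<le> i \<Longrightarrow> x i = 0"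
  using assms unfolding om_sym[of z] bet_sym[of z] by (auto simp: chain_def)

definition chain_heads :: "nat \<Rightarrow> 'v set" where
  "chain_heads N = {x 0 |x. chain N x}"

lemma chain_headsI: "chain N x \<Longrightarrow> x 0 \<in> chain_heads N"
  by (auto simp: chain_heads_def)

lemma subspace_chain_heads: "subspace (chain_heads N)"
proof (rule subspaceI)
  have "chain N (\<lambda>_. 0)" by (simp add: chain_def)
  from chain_headsI[OF this] show "0 \<in> chain_heads N" .
next
  fix y z assume "y \<in> chain_heads N" "z \<in> chain_heads N"
  then obtain x x' where x: "chain N x" "chain N x'" "y = x 0" "z = x' 0" unfolding chain_heads_def by blast
  then have "chain N (\<lambda>i. x i + x' i)" by (simp add: chain_def)
  from chain_headsI[OF this] show "y + z \<in> chain_heads N" unfolding x(3,4) .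
next
  fix c y assume "y \<in> chain_heads N"
  then obtain x where x: "chain N x" "y = x 0" unfolding chain_heads_def by blast
  then have "chain N (\<lambda>i. s c (x i))" by (simp add: chain_def)
  from chain_headsI[OF this] show "s c y \<in> chain_heads N" unfolding x(2) .
qed

end

context nf_family
begin

text \<open>Raising both indices does not change the pairing, until v reaches the radical vector
  \<open>v m\<close>.\<close>

lemma chain_v: "chain N x \<Longrightarrow> bet (v j) (x i) = 0"
proof (induction "m - j" arbitrary: j i rule: less_induct)
  case less
  show ?case
  proof (cases "j < m")
    case True
    have "bet (v j) (x i) = \<omega> (v (Suc j)) (x i)" by (simp add: cv)
    also have "\<dots> = bet (v (Suc j)) (x (Suc i))" by (rule chainD(2)[OF less.prems])
    also have "\<dots> = 0" using True by (intro less.hyps less.prems) simp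
    finally show ?thesis .
  next
    case False
    then show ?thesis using v0[of j] rad by (cases "j = m") simp_all
  qed
qed

lemma chain_shift_X: assumes "chain N x" "c < S" shows "bet (x (p + q)) (X c j) = bet (x p) (X c (j + q))"
proof (induction q arbitrary: j)
  case (Suc q)
  have "bet (x (p + Suc q)) (X c j) = \<omega> (x (p + q)) (X c j)" by (simp add: chainD(1)[OF assms(1)])
  also have "\<dots> = bet (x (p + q)) (X c (Suc j))"
    unfolding om_sym[of "x _"] cX[OF assms(2)] by (rule bet_sym)
  finally show ?case using Suc by simp
qed simp

lemma chain_shift_Y: assumes "chain N x" "c < S" shows "bet (x (p + q)) (Y c j) = bet (x p) (Y c (j + q))"
proof (induction q arbitrary: j)
  case (Suc q)
  have "bet (x (p + Suc q)) (Y c j) = \<omega> (x (p + q)) (Y c j)" by (simp add: chainD(1)[OF assms(1)])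
  also have "\<dots> = bet (x (p + q)) (Y c (Suc j))"
    unfolding om_sym[of "x _"] cY[OF assms(2)] by (rule bet_sym)
  finally show ?case using Suc by simp
qed simp

lemma chain_shift_u: assumes "chain N x" "j + q < m" shows "bet (x (p + q)) (u j) = bet (x p) (u (j + q))"
  using assms(2)
proof (induction q arbitrary: j)
  case (Suc q)
  have "bet (x (p + Suc q)) (u j) = \<omega> (x (p + q)) (u j)" by (simp add: chainD(1)[OF assms(1)])
  also have "\<dots> = bet (x (p + q)) (u (Suc j))"
    unfolding om_sym[of "x _"] using Suc.prems by (subst cu) (simp_all add: bet_sym)
  finally show ?case using Suc by simp
qed simp

lemma ce_Inl:
  "j < m \<Longrightarrow> ce (0, Inl j) z = bet z (u j)" "j < m \<Longrightarrow> ce (0, Inr j) z = bet z (v j)"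
  "a < S \<Longrightarrow> i < K a \<Longrightarrow> ce (Suc a, Inl i) z = bet z (Y a (K a - 1 - i))"
  "a < S \<Longrightarrow> i < K a \<Longrightarrow> ce (Suc a, Inr i) z = bet z (X a (K a - 1 - i))"
  by (simp_all add: ce_partner)

text \<open>The coefficient of the radical vector cannot be read with \<open>bet\<close>; among the
  basis vectors only \<open>v m\<close> has nonzero \<open>\<omega>\<close> with
  \<open>u (m - 1)\<close>.\<close>

lemma ce_vm:
  assumes "0 < m" shows "ce (0, Inl m) z = \<omega> z (u (m - 1))"
proof -
  have "\<omega> (\<Sum>y\<in>idx. s (ce y z) (E y)) (u (m - 1)) = (\<Sum>y\<in>idx. ce y z * of_bool (y = (0, Inl m)))"
    unfolding om_sum1 om
  proof (intro sum.cong refl arg_cong2[of _ _ _ _ "(*)"])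
    fix y assume "y \<in> idx"
    then show "\<omega> (E y) (u (m - 1)) = of_bool (y = (0, Inl m))"
      using assms by (elim Idx_cases) (auto simp: otab)
  qed
  also have "\<dots> = ce (0, Inl m) z" by (simp only: sum_of_bool_eq finite_Idx) simp
  finally show ?thesis unfolding sum_coord[OF E_ibasis] ..
qed

text \<open>A coordinate of \<open>x p\<close> is a pairing with a basis vector, and shifts may be
  moved between the two. Moved onto the chain they reach a place from N on, where it is 0; moved
  onto X or Y they run past the end of the row.\<close>

lemma chain_coords:
  assumes x: "chain N x"
  shows "j < m \<Longrightarrow> ce (0, Inr j) (x p) = 0"
    and "j \<le> m \<Longrightarrow> N \<le> p + j \<Longrightarrow> ce (0, Inl j) (x p) = 0"
    and "a < S \<Longrightarrow> i < K a \<Longrightarrow> i + N < K a + p \<or> i < p \<Longrightarrow> ce (Suc a, Inl i) (x p) = 0"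
    and "a < S \<Longrightarrow> i < K a \<Longrightarrow> i + N < K a + p \<or> i < p \<Longrightarrow> ce (Suc a, Inr i) (x p) = 0"
proof -
  have ce0: "ce e 0 = 0" for e using coord_scale[OF E_ibasis, of e 0 0] by simp
  have x0: "x p = 0" if "N \<le> p" for p using chainD(3)[OF x that] .
  show "ce (0, Inr j) (x p) = 0" if "j < m" using that chain_v[OF x] by (simp add: ce_Inl bet_sym[of "x p"])
  show "ce (0, Inl j) (x p) = 0" if j: "j \<le> m" "N \<le> p + j"
  proof -
    consider "N \<le> p" | "p < N" "j < m" | "p < N" "j = m" using j by linarith
    then show ?thesis
    proof cases
      case 1
      then show ?thesis by (simp add: x0 ce0)
    next
      case 2
      have "bet (x (p + (N - p))) (u (j - (N - p))) = bet (x p) (u (j - (N - p) + (N - p)))"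
        using 2 j by (intro chain_shift_u[OF x]) simp
      then show ?thesis using 2 j by (simp add: ce_Inl x0)
    next
      case 3
      then have m: "0 < m" using j by simp
      have "bet (x (Suc p + (N - Suc p))) (u (m - 1 - (N - Suc p))) = bet (x (Suc p)) (u (m - 1 - (N - Suc p) + (N - Suc p)))"
        using 3 j m by (intro chain_shift_u[OF x]) simp
      moreover have "Suc p + (N - Suc p) = N" "m - 1 - (N - Suc p) + (N - Suc p) = m - 1" using 3 j m by simp_all
      ultimately have "bet (x (Suc p)) (u (m - 1)) = 0" by (simp add: x0)
      then show ?thesis using 3 m by (simp add: ce_vm chainD(1)[OF x])
    qed
  qed
  have *: "i < K a \<Longrightarrow> i + N < K a + p \<or> i < p \<Longrightarrow> N \<le> p \<or> p < N \<and> N - p \<le> K a - 1 - i \<or> K a \<le> K a - 1 - i + p" for a i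
    by linarith
  show "ce (Suc a, Inl i) (x p) = 0" if a: "a < S" "i < K a" "i + N < K a + p \<or> i < p"
  proof -
    consider "N \<le> p" | "p < N" "N - p \<le> K a - 1 - i" | "K a \<le> K a - 1 - i + p" using *[OF a(2,3)] by blast
    then have "bet (x p) (Y a (K a - 1 - i)) = 0"
    proof cases
      case 2
      then show ?thesis using chain_shift_Y[OF x a(1), of p "N - p" "K a - 1 - i - (N - p)"] by (simp add: x0)
    next
      case 3
      then show ?thesis using chain_shift_Y[OF x a(1), of 0 p "K a - 1 - i"] Y0[OF a(1)] by simp
    qed (simp add: x0)
    then show ?thesis using a by (simp add: ce_Inl)
  qed
  show "ce (Suc a, Inr i) (x p) = 0" if a: "a < S" "i < K a" "i + N < K a + p \<or> i < p"
  proof -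
    consider "N \<le> p" | "p < N" "N - p \<le> K a - 1 - i" | "K a \<le> K a - 1 - i + p" using *[OF a(2,3)] by blast
    then have "bet (x p) (X a (K a - 1 - i)) = 0"
    proof cases
      case 2
      then show ?thesis using chain_shift_X[OF x a(1), of p "N - p" "K a - 1 - i - (N - p)"] by (simp add: x0)
    next
      case 3
      then show ?thesis using chain_shift_X[OF x a(1), of 0 p "K a - 1 - i"] X0[OF a(1)] by simp
    qed (simp add: x0)
    then show ?thesis using a by (simp add: ce_Inl)
  qed
qed

text \<open>The basis vectors that head such a chain: the last N places of each row X and Y, and the
  first N of the v, which are shifted downwards. No \<open>u j\<close> heads a terminating
  chain.\<close>

definition heads_idx :: "nat \<Rightarrow> (nat \<times> (nat + nat)) set" where
  "heads_idx N = (\<lambda>i. (0, Inl i)) ` {..<min N (Suc m)} \<union>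
    (SIGMA t:Suc ` {..<S}. (Inl ` {K (t - 1) - N..<K (t - 1)} \<union> Inr ` {K (t - 1) - N..<K (t - 1)}))"

lemma heads_idx_iff:
  "(0, Inl i) \<in> heads_idx N \<longleftrightarrow> i < N \<and> i \<le> m" "(0, Inr i) \<notin> heads_idx N"
  "(Suc a, Inl i) \<in> heads_idx N \<longleftrightarrow> a < S \<and> i < K a \<and> K a \<le> i + N"
  "(Suc a, Inr i) \<in> heads_idx N \<longleftrightarrow> a < S \<and> i < K a \<and> K a \<le> i + N"
  by (auto simp: heads_idx_def)

lemma heads_idx_subset: "heads_idx N \<subseteq> idx"
proof
  fix x assume x: "x \<in> heads_idx N"
  obtain t e where "x = (t, e)" by fastforce
  then show "x \<in> idx" using x by (cases t; cases e) (auto simp: heads_idx_iff)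
qed

lemma card_heads_idx: "card (heads_idx N) = min N (Suc m) + 2 * (\<Sum>a<S. min N (K a))"
proof -
  have "card (heads_idx N) = card ((\<lambda>i. (0::nat, Inl i :: nat + nat)) ` {..<min N (Suc m)}) +
    card (SIGMA t:Suc ` {..<S}. (Inl ` {K (t - 1) - N..<K (t - 1)} \<union> Inr ` {K (t - 1) - N..<K (t - 1)}))"
    unfolding heads_idx_def by (intro card_Un_disjoint) auto
  also have "card ((\<lambda>i. (0::nat, Inl i :: nat + nat)) ` {..<min N (Suc m)}) = min N (Suc m)"
    by (subst card_image) (auto simp: inj_on_def)
  also have "card (SIGMA t:Suc ` {..<S}. (Inl ` {K (t - 1) - N..<K (t - 1)} \<union> Inr ` {K (t - 1) - N..<K (t - 1)}))
    = (\<Sum>t\<in>Suc ` {..<S}. card (Inl ` {K (t - 1) - N..<K (t - 1)} \<union> Inr ` {K (t - 1) - N..<K (t - 1)} :: (nat + nat) set))"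
    by (intro card_SigmaI) auto
  also have "\<dots> = (\<Sum>a<S. 2 * min N (K a))"
    unfolding sum.reindex[OF inj_Suc]
  proof (intro sum.cong refl)
    fix a
    have "card (Inl ` A \<union> Inr ` A :: (nat + nat) set) = 2 * card A" if "finite A" for A :: "nat set"
      using that by (subst card_Un_disjoint) (auto simp: card_image)
    then show "((\<lambda>t. card (Inl ` {K (t - 1) - N..<K (t - 1)} \<union> Inr ` {K (t - 1) - N..<K (t - 1)} :: (nat + nat) set)) \<circ> Suc) a = 2 * min N (K a)"
      by (simp add: min_def)
  qed
  finally show ?thesis by (simp add: sum_distrib_left)
qed

lemma chain_heads_eq: "chain_heads N = span (E ` heads_idx N)"
proof
  show "chain_heads N \<subseteq> span (E ` heads_idx N)"
  proof
    fix z assume "z \<in> chain_heads N"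
    then obtain x where x: "chain N x" "z = x 0" unfolding chain_heads_def by blast
    have "ce y z = 0" if "y \<in> idx" "y \<notin> heads_idx N" for y
      using that(1)
    proof (cases rule: Idx_cases)
      case (v i)
      then show ?thesis unfolding x(2) using that(2) chain_coords(2)[OF x(1), of i 0] by (simp add: heads_idx_iff)
    next
      case (u i)
      then show ?thesis unfolding x(2) using chain_coords(1)[OF x(1), of i 0] by simp
    next
      case (X a i)
      then show ?thesis unfolding x(2) using that(2) chain_coords(3)[OF x(1), of a i 0] by (simp add: heads_idx_iff)
    next
      case (Y a i)
      then show ?thesis unfolding x(2) using that(2) chain_coords(4)[OF x(1), of a i 0] by (simp add: heads_idx_iff)
    qed
    then have "(\<Sum>y\<in>idx. s (ce y z) (E y)) = (\<Sum>y\<in>heads_idx N. s (ce y z) (E y))"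
      using heads_idx_subset by (intro sum.mono_neutral_right) auto
    then have "z = (\<Sum>y\<in>heads_idx N. s (ce y z) (E y))" unfolding sum_coord[OF E_ibasis] .
    also have "\<dots> \<in> span (E ` heads_idx N)" by (intro span_sum span_scale span_base imageI)
    finally show "z \<in> span (E ` heads_idx N)" .
  qed
  show "span (E ` heads_idx N) \<subseteq> chain_heads N"
  proof (rule span_minimal[OF _ subspace_chain_heads], rule image_subsetI)
    fix y assume y: "y \<in> heads_idx N"
    then have "y \<in> idx" using heads_idx_subset by blast
    then have "\<exists>x. chain N x \<and> E y = x 0"
    proof (cases rule: Idx_cases)
      case (v i)
      have "chain N (\<lambda>p. if p \<le> i then v (i - p) else 0)"
        unfolding chain_def
      proof (intro conjI allI impI)
        fix p z
        show "\<omega> (if p \<le> i then v (i - p) else 0) z = bet (if Suc p \<le> i then v (i - Suc p) else 0) z"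
        proof (cases "Suc p \<le> i")
          case True
          then have "i - p = Suc (i - Suc p)" by simp
          then show ?thesis using True by (simp add: cv)
        qed (auto simp: cv0 le_less Suc_le_eq)
        show "(if p \<le> i then v (i - p) else 0) = 0" if "N \<le> p" using that y v by (simp add: heads_idx_iff)
      qed
      then show ?thesis using v by (intro exI[of _ "\<lambda>p. if p \<le> i then v (i - p) else 0"]) simp
    next
      case (u i)
      then show ?thesis using y by (simp add: heads_idx_iff)
    next
      case (X a i)
      then have "chain N (\<lambda>p. X a (i + p))" using y by (auto simp: chain_def cX heads_idx_iff intro!: X0)
      then show ?thesis using X by (intro exI[of _ "\<lambda>p. X a (i + p)"]) simp
    next
      case (Y a i)
      then have "chain N (\<lambda>p. Y a (i + p))" using y by (auto simp: chain_def cY heads_idx_iff intro!: Y0)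
      then show ?thesis using Y by (intro exI[of _ "\<lambda>p. Y a (i + p)"]) simp
    qed
    then show "E y \<in> chain_heads N" unfolding chain_heads_def by auto
  qed
qed

lemma dim_chain_heads: "dim (chain_heads N) = min N (Suc m) + 2 * (\<Sum>a<S. min N (K a))"
proof -
  have "independent (E ` heads_idx N)"
    using E_ibasis heads_idx_subset independent_mono[of "E ` idx" "E ` heads_idx N"] by (auto simp: ibasis_def)
  then have "dim (chain_heads N) = card (E ` heads_idx N)"
    unfolding chain_heads_eq by (rule dim_span_eq_card_independent)
  also have "\<dots> = card (heads_idx N)"
    using E_ibasis heads_idx_subset by (intro card_image) (auto simp: ibasis_def intro: inj_on_subset)
  finally show ?thesis by (simp add: card_heads_idx)
qed

text \<open>The normal form inequalities make every coordinate on which \<open>\<alpha>\<close>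
  depends vanish from place \<open>L a\<close> on: \<open>K a - L a \<le> m\<close> settles
  \<open>v m\<close>, and in each block the coordinate at \<open>L c - 1\<close> and one factor of
  each hyperbolic product are 0.\<close>

lemma chain_quad:
  assumes nf: "normal_form_params (m, map (\<lambda>a. (L a, K a)) [0..<S])"
    and x: "chain (K a) x" and a: "a < S" and j: "L a \<le> j"
  shows "\<alpha> (x j) = 0"
proof (cases "j < K a")
  case False
  then show ?thesis using chainD(3)[OF x, of j] by simp
next
  case True
  have nf: "c < S \<Longrightarrow> K c - L c \<le> m" "c < d \<Longrightarrow> d < S \<Longrightarrow> K d \<le> K c \<and> L d \<le> L c \<and> K d - L d \<le> K c - L c" for c d
    using nf unfolding params_iff by blast+
  have "fm_quad (mods 0) (cvec (x j) 0) = 0"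
  proof -
    have "cvec (x j) 0 (Inl m) = 0"
      using chain_coords(2)[OF x, of m j] nf(1)[OF a] j by (simp add: cvec_def)
    moreover have "cvec (x j) 0 (Inr i) = 0" if "i < m" for i
      using chain_coords(1)[OF x that, of j] by (simp add: cvec_def)
    ultimately show ?thesis by (auto simp: nfmods_def V_module_def pair_quad_def intro!: sum.neutral)
  qed
  moreover have "fm_quad (mods (Suc c)) (cvec (x j) (Suc c)) = 0" if c: "c < S" for c
  proof -
    \<comment> \<open>Blocks after \<open>a\<close> satisfy the first alternative, blocks before
      \<open>a\<close> the second.\<close>
    have ac: "K c \<le> K a \<and> L c \<le> L a \<or> K a - L a \<le> K c - L c"
      using nf(2)[of a c] nf(2)[of c a] a c by (cases a c rule: linorder_cases) auto
    have l: "cvec (x j) (Suc c) (Inl i) = 0" if "i + 1 = L c" for i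
    proof -
      have "i + K a < K c + j \<or> i < j" using ac KL[OF c] KL[OF a] that j by linarith
      then show ?thesis using chain_coords(3)[OF x c, of i j] by (simp add: cvec_def)
    qed
    have q: "cvec (x j) (Suc c) (Inl i) * cvec (x j) (Suc c) (Inr i') = 0" if "i + i' + 1 = K c" for i i'
    proof -
      have "(i + K a < K c + j \<or> i < j) \<or> (i' + K a < K c + j \<or> i' < j)"
        using ac KL[OF c] KL[OF a] that j True by linarith
      then show ?thesis
        using chain_coords(3)[OF x c, of i j] chain_coords(4)[OF x c, of i' j] that by (auto simp: cvec_def)
    qed
    have "(\<Sum>i<K c. of_bool (i + 1 = L c) * (cvec (x j) (Suc c) (Inl i))\<^sup>2) = 0"
      using l by (intro sum.neutral) auto
    moreover have "(\<Sum>i<K c. \<Sum>i'<K c. of_bool (i + i' + 1 = K c) * cvec (x j) (Suc c) (Inl i) * cvec (x j) (Suc c) (Inr i')) = 0"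
      using q by (intro sum.neutral ballI) (auto simp: mult.assoc simp del: mult_eq_0_iff)
    ultimately show ?thesis by (simp add: nfmods_def W_module_def pair_quad_def)
  qed
  ultimately have "(\<Sum>t\<le>S. fm_quad (mods t) (cvec (x j) t)) = 0"
    by (intro sum.neutral ballI) (metis atMost_iff less_eq_Suc_le not0_implies_Suc)
  then show ?thesis unfolding nfm_quad[symmetric] cvec_quad .
qed

end

context form_space
begin

text \<open>From the radical vector downwards both chains are determined by \<open>bet\<close> and
  \<open>\<alpha>\<close>, so they coincide. If the second were longer,
  \<open>\<omega> (v 0) = 0\<close> would put one of its later vectors in the radical, although that
  vector pairs to 1 with its partner u'.\<close>

lemma radical_chains_le:
  assumes "nf_family s \<alpha> n m v u S K L X Y \<omega>" "nf_family s \<alpha> n m' v' u' S' K' L' X' Y' \<omega>"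
  shows "m' \<le> m"
proof (rule ccontr)
  assume "\<not> m' \<le> m"
  then have mm: "m < m'" by simp
  interpret A: nf_family s \<alpha> n m v u S K L X Y \<omega> by (rule assms)
  interpret B: nf_family s \<alpha> n m' v' u' S' K' L' X' Y' \<omega> by (rule assms)
  have eq: "i \<le> m \<Longrightarrow> v (m - i) = v' (m' - i)" for i
  proof (induction i)
    case 0
    show ?case by (rule radical_eqI) (simp_all add: A.rad B.rad A.av B.av)
  next
    case (Suc i)
    then have e: "m - i = Suc (m - Suc i)" "m' - i = Suc (m' - Suc i)" using mm by simp_all
    show ?case
    proof (rule radical_eqI)
      show "bet (v (m - Suc i)) z = bet (v' (m' - Suc i)) z" for z
        using Suc unfolding A.cv[symmetric] B.cv[symmetric] e by simp
      show "\<alpha> (v (m - Suc i)) = \<alpha> (v' (m' - Suc i))" 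
      proof -
        have "m - Suc i \<noteq> m" "m' - Suc i \<noteq> m'" using Suc.prems mm by auto
        then show ?thesis by (simp add: A.av B.av)
      qed
    qed
  qed
  let ?j = "m' - m - 1"
  have "v 0 = v' (Suc ?j)" using eq[of m] mm by (simp del: diff_diff_left)
  then have "bet (v' ?j) z = 0" for z using A.cv0[of z] B.cv[of ?j z] by simp
  moreover have "bet (v' ?j) (u' ?j) = 1" using mm by (simp add: B.bvu)
  ultimately show False by simp
qed

lemma nf_family_unique:
  assumes F: "nf_family s \<alpha> n m v u S K L X Y \<omega>" "normal_form_params (m, map (\<lambda>a. (L a, K a)) [0..<S])"
    and F': "nf_family s \<alpha> n m' v' u' S' K' L' X' Y' \<omega>" "normal_form_params (m', map (\<lambda>a. (L' a, K' a)) [0..<S'])"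
  shows "(m, map (\<lambda>a. (L a, K a)) [0..<S]) = (m', map (\<lambda>a. (L' a, K' a)) [0..<S'])"
proof -
  interpret A: nf_family s \<alpha> n m v u S K L X Y \<omega> by (rule F)
  interpret B: nf_family s \<alpha> n m' v' u' S' K' L' X' Y' \<omega> by (rule F')
  have m: "m = m'" using radical_chains_le[OF F(1) F'(1)] radical_chains_le[OF F'(1) F(1)] by simp
  note pA = F(2)[unfolded A.params_iff] and pB = F'(2)[unfolded B.params_iff]
  have "S = S' \<and> (\<forall>a<S. K a = K' a)"
  proof (rule min_sums_determine)
    show "(\<Sum>a<S. min N (K a)) = (\<Sum>a<S'. min N (K' a))" for N
      using A.dim_chain_heads[of N] B.dim_chain_heads[of N] m by simp
    show "K c \<le> K a" if "a < c" "c < S" for a c using pA that by blast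
    show "K' c \<le> K' a" if "a < c" "c < S'" for a c using pB that by blast
  qed (use A.KL B.KL in blast)+
  then have S: "S = S'" and K: "\<And>a. a < S \<Longrightarrow> K a = K' a" by auto
  have "L a = L' a" if a: "a < S" for a
  proof (rule antisym)
    have a': "a < S'" using a S by simp
    \<comment> \<open>The row \<open>X a\<close> of one family is a chain with
      \<open>\<alpha>\<close> equal to 1 at place L a - 1; the vanishing statement of the other
      family then bounds \<open>L a\<close>, and conversely.\<close>
    have "chain (K' a) (X a)" using a by (simp add: chain_def A.cX A.X0 K)
    from B.chain_quad[OF F'(2) this a', of "L a - 1"] show "L a \<le> L' a"
      using A.aX[OF a, of "L a - 1"] A.KL[OF a] by (cases "L a \<le> L' a") auto
    have "chain (K a) (X' a)" using a a' by (simp add: chain_def B.cX B.X0 K)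
    from A.chain_quad[OF F(2) this a, of "L' a - 1"] show "L' a \<le> L a"
      using B.aX[OF a', of "L' a - 1"] B.KL[OF a'] by (cases "L' a \<le> L a") auto
  qed
  with m S K show ?thesis by simp
qed

lemma nf_params_family:
  assumes b: "adapted b" and P: "has_normal_form omod P"
  shows "\<exists>m v u S K L X Y. P = (m, map (\<lambda>a. (L a, K a)) [0..<S]) \<and> nf_family s \<alpha> n m v u S K L X Y \<omega>"
proof -
  obtain m lks where Pm: "P = (m, lks)" by (cases P)
  let ?S = "length lks" and ?L = "\<lambda>a. fst (lks ! a)" and ?K = "\<lambda>a. snd (lks ! a)"
  have l: "lks = map (\<lambda>a. (?L a, ?K a)) [0..<?S]" by (simp add: map_nth)
  have eq: "form_equiv omod (nfp m ?S ?L ?K)" using P unfolding has_normal_form_def Pm l[symmetric] by blast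
  have "1 \<le> ?K a \<and> ?K a \<le> 2 * ?L a \<and> ?L a \<le> ?K a" if "a < ?S" for a
  proof -
    have "\<forall>(l, k)\<in>set lks. 1 \<le> k \<and> (k + 1) div 2 \<le> l \<and> l \<le> k"
      using P unfolding has_normal_form_def Pm normal_form_params_def by simp
    from bspec[OF this nth_mem[OF that]] have "1 \<le> ?K a \<and> (?K a + 1) div 2 \<le> ?L a \<and> ?L a \<le> ?K a"
      by (simp add: case_prod_beta)
    then show ?thesis by linarith
  qed
  from equiv_nfp_family[OF b eq this]
  obtain v u X Y where F: "nf_family s \<alpha> n m v u ?S ?K ?L X Y \<omega>" by blast
  from F l Pm show ?thesis
    by (intro exI[of _ m] exI[of _ v] exI[of _ u] exI[of _ ?S] exI[of _ ?K] exI[of _ ?L] exI[of _ X] exI[of _ Y]) simp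
qed

lemma normal_form_unique:
  assumes b: "adapted b" and P: "has_normal_form omod P" "has_normal_form omod P'"
  shows "P = P'"
proof -
  obtain m v u S K L X Y where F: "P = (m, map (\<lambda>a. (L a, K a)) [0..<S])" "nf_family s \<alpha> n m v u S K L X Y \<omega>"
    using nf_params_family[OF b P(1)] by blast
  obtain m' v' u' S' K' L' X' Y' where F': "P' = (m', map (\<lambda>a. (L' a, K' a)) [0..<S'])" "nf_family s \<alpha> n m' v' u' S' K' L' X' Y' \<omega>"
    using nf_params_family[OF b P(2)] by blast
  show ?thesis
    using P unfolding has_normal_form_def F(1) F'(1) using nf_family_unique[OF F(2) _ F'(2)] by blast
qed

end

section \<open>Pairs of partitions\<close>

lemma support_subset:
  fixes p :: "nat \<Rightarrow> nat"
  assumes "\<And>i. N \<le> i \<Longrightarrow> p i = 0" shows "{i. p i \<noteq> 0} \<subseteq> {..<N}"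
proof
  fix i assume "i \<in> {i. p i \<noteq> 0}"
  then show "i \<in> {..<N}" using assms[of i] by (cases "N \<le> i") auto
qed

lemma part_size_lessThan:
  assumes "\<And>i. N \<le> i \<Longrightarrow> p i = 0" shows "part_size p = (\<Sum>i<N. p i)"
  unfolding part_size_def using support_subset[OF assms] by (intro sum.mono_neutral_left) auto

lemma partition_bound:
  assumes "is_partition p" shows "\<exists>N. \<forall>i\<ge>N. p i = 0"
proof -
  have "finite {i. p i \<noteq> 0}" using assms by (simp add: is_partition_def)
  then obtain N where "{i. p i \<noteq> 0} \<subseteq> {..<N}" by (auto simp: finite_nat_set_iff_bounded)
  then show ?thesis by (intro exI[of _ N]) force
qed

lemma is_partitionI:
  assumes "\<And>i. p (Suc i) \<le> p i" "\<And>i. N \<le> i \<Longrightarrow> p i = 0" shows "is_partition p"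
  unfolding is_partition_def
proof
  show "antimono p" using assms(1) by (rule decseq_SucI)
  have "{i. p i \<noteq> 0} \<subseteq> {..<N}" using assms(2) by (rule support_subset)
  then show "finite {i. p i \<noteq> 0}" by (rule finite_subset) simp
qed

lemma is_partitionD: "is_partition p \<Longrightarrow> i \<le> j \<Longrightarrow> p j \<le> p i"
  by (simp add: is_partition_def antimonoD)

lemma partition_pos_iff:
  assumes "is_partition p" shows "p i \<noteq> 0 \<longleftrightarrow> i < card {i. p i \<noteq> 0}"
proof -
  have "i < card {i. p i \<noteq> 0}" if "p i \<noteq> 0"
  proof -
    have "{..i} \<subseteq> {i. p i \<noteq> 0}" using is_partitionD[OF assms] that by fastforce
    from card_mono[OF _ this] show ?thesis using assms by (simp add: is_partition_def)
  qed
  moreover have "card {i. p i \<noteq> 0} \<le> i" if "p i = 0"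
  proof -
    have "{i. p i \<noteq> 0} \<subseteq> {..<i}"
    proof
      fix j assume "j \<in> {i. p i \<noteq> 0}"
      then show "j \<in> {..<i}" using is_partitionD[OF assms, of i j] that by (cases "i \<le> j") auto
    qed
    from card_mono[OF _ this] show ?thesis by simp
  qed
  ultimately show ?thesis by fastforce
qed

lemma partition_le_size: assumes "is_partition p" shows "p i \<le> part_size p" "part_size p \<le> i \<Longrightarrow> p i = 0"
proof -
  have fin: "finite {i. p i \<noteq> 0}" using assms by (simp add: is_partition_def)
  show "p i \<le> part_size p"
    unfolding part_size_def using fin member_le_sum[of i "{i. p i \<noteq> 0}" p] by (cases "p i = 0") auto
  have "card {i. p i \<noteq> 0} = (\<Sum>i | p i \<noteq> 0. 1)" by simp
  also have "\<dots> \<le> part_size p" unfolding part_size_def by (intro sum_mono) auto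
  finally show "p i = 0" if "part_size p \<le> i" using partition_pos_iff[OF assms, of i] that by linarith
qed

definition pair_set :: "nat \<Rightarrow> ((nat \<Rightarrow> nat) \<times> (nat \<Rightarrow> nat)) set" where
  "pair_set n = {(\<nu>, \<mu>). is_partition \<nu> \<and> is_partition \<mu> \<and> part_size \<mu> + part_size \<nu> = n}"

lemma finite_pair_set: "finite (pair_set n)"
proof -
  let ?F = "{f :: nat \<Rightarrow> nat. \<forall>x. (x \<in> {..<n} \<longrightarrow> f x \<in> {..n}) \<and> (x \<notin> {..<n} \<longrightarrow> f x = 0)}"
  have F: "p \<in> ?F" if "is_partition p" "part_size p \<le> n" for p
  proof -
    have "p i \<le> n" "n \<le> i \<Longrightarrow> p i = 0" for i
      using partition_le_size[OF that(1), of i] that(2) by simp_all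
    then show ?thesis by auto
  qed
  have "pair_set n \<subseteq> ?F \<times> ?F"
  proof
    fix x assume "x \<in> pair_set n"
    then obtain \<nu> \<mu> where x: "x = (\<nu>, \<mu>)" "is_partition \<nu>" "is_partition \<mu>" "part_size \<mu> + part_size \<nu> = n"
      by (auto simp: pair_set_def)
    then show "x \<in> ?F \<times> ?F" unfolding x(1) by (intro SigmaI F) simp_all
  qed
  moreover have "finite ?F" by (rule finite_set_of_finite_funs) simp_all
  then have "finite (?F \<times> ?F)" by (intro finite_cartesian_product)
  ultimately show ?thesis by (rule finite_subset)
qed

lemma p2_eq: "p2 (int n) = card (pair_set n)"
proof -
  have "bij_betw prod.swap (pair_set n) {(\<mu>, \<nu>). is_partition \<mu> \<and> is_partition \<nu> \<and> int (part_size \<mu> + part_size \<nu>) = int n}"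
    by (rule bij_betwI[where g = prod.swap]) (auto simp: pair_set_def)
  from bij_betw_same_card[OF this] show ?thesis by (simp add: p2_def)
qed

definition bad_pairs :: "nat \<Rightarrow> ((nat \<Rightarrow> nat) \<times> (nat \<Rightarrow> nat)) set" where
  "bad_pairs n = {(\<nu>, \<mu>). (\<nu>, \<mu>) \<in> pair_set n \<and> (\<exists>j. \<mu> j < \<nu> (Suc j))}"

lemma orbit_pairs_eq: "orbit_partition_pairs n = pair_set n - bad_pairs n"
proof -
  have "(\<forall>i\<ge>1. \<nu> i \<le> \<mu> (i - 1)) \<longleftrightarrow> \<not> (\<exists>j. \<mu> j < \<nu> (Suc j))" for \<nu> \<mu> :: "nat \<Rightarrow> nat"
  proof
    assume R: "\<not> (\<exists>j. \<mu> j < \<nu> (Suc j))"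
    show "\<forall>i\<ge>1. \<nu> i \<le> \<mu> (i - 1)"
    proof (intro allI impI)
      fix i :: nat assume "1 \<le> i"
      then obtain j where "i = Suc j" by (cases i) auto
      then show "\<nu> i \<le> \<mu> (i - 1)" using R by (simp add: not_less)
    qed
  next
    assume R: "\<forall>i\<ge>1. \<nu> i \<le> \<mu> (i - 1)"
    show "\<not> (\<exists>j. \<mu> j < \<nu> (Suc j))"
    proof
      assume "\<exists>j. \<mu> j < \<nu> (Suc j)"
      then obtain j where "\<mu> j < \<nu> (Suc j)" ..
      then show False using R[rule_format, of "Suc j"] by simp
    qed
  qed
  then show ?thesis by (auto simp: orbit_partition_pairs_def pair_set_def bad_pairs_def)
qed

text \<open>The pair \<open>(\<nu>, \<mu>)\<close> is transformed at its first violation \<open>j\<close> of the inequalities: the tails of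
  \<open>\<nu>\<close> and \<open>\<mu>\<close> are exchanged, the initial part of \<open>\<nu>\<close> is lowered and that of \<open>\<mu>\<close> is raised by 1.\<close>

definition tail_swap :: "nat \<Rightarrow> (nat \<Rightarrow> nat) \<times> (nat \<Rightarrow> nat) \<Rightarrow> (nat \<Rightarrow> nat) \<times> (nat \<Rightarrow> nat)" where
  "tail_swap j = (\<lambda>(\<nu>, \<mu>). (\<lambda>i. if i \<le> Suc j then \<nu> i - 1 else \<mu> (i - 2), \<lambda>i. if i < j then \<mu> i + 1 else \<nu> (i + 2)))"

definition tail_unswap :: "nat \<Rightarrow> (nat \<Rightarrow> nat) \<times> (nat \<Rightarrow> nat) \<Rightarrow> (nat \<Rightarrow> nat) \<times> (nat \<Rightarrow> nat)" where
  "tail_unswap j = (\<lambda>(c, a). (\<lambda>i. if i \<le> Suc j then c i + 1 else a (i - 2), \<lambda>i. if i < j then a i - 1 else c (i + 2)))"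

definition viol :: "(nat \<Rightarrow> nat) \<times> (nat \<Rightarrow> nat) \<Rightarrow> nat" where
  "viol = (\<lambda>(\<nu>, \<mu>). LEAST j. \<mu> j < \<nu> (Suc j))"

text \<open>Recovers the exchange index from the image. Before it, a i = \<mu> i + 1 and c (i + 1) =
  \<nu> (i + 1) - 1 with \<nu> (i + 1) at most \<mu> i, so the inequality fails by at least 1; at
  the index, a j = \<nu> (j + 2) is at most \<nu> (j + 1) = c (j + 1) + 1.\<close>

definition unviol :: "(nat \<Rightarrow> nat) \<times> (nat \<Rightarrow> nat) \<Rightarrow> nat" where
  "unviol = (\<lambda>(c, a). LEAST j. a j \<le> c (Suc j) + 1)"

text \<open>The tails only change places. Meanwhile j + 2 entries are lowered by 1 and j entries are
  raised by 1, which explains the total loss of 2.\<close>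

lemma tail_swap_size:
  assumes 1: "\<And>i. i \<le> Suc j \<Longrightarrow> \<nu> i = c i + 1" "\<And>i. j \<le> i \<Longrightarrow> \<mu> i = c (i + 2)"
    and 2: "\<And>i. i < j \<Longrightarrow> a i = \<mu> i + 1" "\<And>i. j \<le> i \<Longrightarrow> a i = \<nu> (i + 2)"
    and p: "\<And>i. N \<le> i \<Longrightarrow> \<nu> i = 0" "\<And>i. N \<le> i \<Longrightarrow> \<mu> i = 0"
  shows "part_size \<mu> + part_size \<nu> = part_size a + part_size c + 2"
proof -
  have split: "(\<Sum>i<q + M. f i) = (\<Sum>i<q. f i) + (\<Sum>i<M. f (q + i))" for q M and f :: "nat \<Rightarrow> nat"
    by (induction M) simp_all
  have \<nu>: "part_size \<nu> = (\<Sum>i<j + 2. \<nu> i) + (\<Sum>i<N. \<nu> (j + 2 + i))"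
    using p by (subst part_size_lessThan[of "j + 2 + N"]) (simp_all only: split)
  have \<mu>: "part_size \<mu> = (\<Sum>i<j. \<mu> i) + (\<Sum>i<N. \<mu> (j + i))"
    using p by (subst part_size_lessThan[of "j + N"]) (simp_all only: split)
  have c0: "c i = 0" if "j + 2 + N \<le> i" for i
  proof -
    have "i - 2 + 2 = i" using that by simp
    then show ?thesis using 1(2)[of "i - 2"] p(2)[of "i - 2"] that by (simp only:)
  qed
  have c: "part_size c = (\<Sum>i<j + 2. c i) + (\<Sum>i<N. c (j + 2 + i))"
    using c0 by (subst part_size_lessThan[of "j + 2 + N"]) (simp_all only: split)
  have a0: "a i = 0" if "j + N \<le> i" for i
    using 2(2)[of i] p(1)[of "i + 2"] that by simp
  have a: "part_size a = (\<Sum>i<j. a i) + (\<Sum>i<N. a (j + i))"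
    using a0 by (subst part_size_lessThan[of "j + N"]) (simp_all only: split)
  have "(\<Sum>i<j + 2. \<nu> i) = (\<Sum>i<j + 2. c i + 1)" using 1(1) by (intro sum.cong) auto
  moreover have "(\<Sum>i<N. \<nu> (j + 2 + i)) = (\<Sum>i<N. a (j + i))" using 2(2) by (intro sum.cong) (auto simp: add_ac)
  moreover have "(\<Sum>i<j. a i) = (\<Sum>i<j. \<mu> i + 1)" using 2(1) by (intro sum.cong) auto
  moreover have "(\<Sum>i<N. \<mu> (j + i)) = (\<Sum>i<N. c (j + 2 + i))" using 1(2) by (intro sum.cong) (auto simp: add_ac)
  ultimately show ?thesis unfolding \<nu> \<mu> c a sum.distrib by simp
qed

lemma bij_bad_pairs:
  "bij_betw (\<lambda>x. tail_swap (viol x) x) (bad_pairs n) {(c, a). is_partition c \<and> is_partition a \<and> part_size a + part_size c + 2 = n}"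
    (is "bij_betw ?F _ ?C")
proof -
  let ?G = "\<lambda>y. tail_unswap (unviol y) y"
  have F: "?F x \<in> ?C \<and> ?G (?F x) = x" if x: "x \<in> bad_pairs n" for x
  proof -
    obtain \<nu> \<mu> where xe: "x = (\<nu>, \<mu>)" by fastforce
    with x have P: "is_partition \<nu>" "is_partition \<mu>" "part_size \<mu> + part_size \<nu> = n"
      and ex: "\<exists>j. \<mu> j < \<nu> (Suc j)" by (auto simp: bad_pairs_def pair_set_def)
    define j where "j = viol x"
    have j: "\<mu> j < \<nu> (Suc j)" unfolding j_def viol_def xe prod.case using ex by (rule LeastI_ex)
    have less: "\<nu> (Suc i) \<le> \<mu> i" if "i < j" for i
      using not_less_Least[of i "\<lambda>j. \<mu> j < \<nu> (Suc j)"] that unfolding j_def viol_def xe prod.case by simp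
    define c where "c i = (if i \<le> Suc j then \<nu> i - 1 else \<mu> (i - 2))" for i
    define a where "a i = (if i < j then \<mu> i + 1 else \<nu> (i + 2))" for i
    have Fx: "?F x = (c, a)" unfolding j_def[symmetric] by (simp add: tail_swap_def xe c_def[abs_def] a_def[abs_def])
    \<comment> \<open>The violation makes \<nu> (j + 1) positive, hence all earlier parts too, so
      lowering them by 1 involves no truncation.\<close>
    have pos: "0 < \<nu> i" if "i \<le> Suc j" for i using is_partitionD[OF P(1) that] j by linarith
    obtain N where N: "\<And>i. N \<le> i \<Longrightarrow> \<nu> i = 0" "\<And>i. N \<le> i \<Longrightarrow> \<mu> i = 0"
    proof -
      obtain N1 N2 where "\<forall>i\<ge>N1. \<nu> i = 0" "\<forall>i\<ge>N2. \<mu> i = 0" using partition_bound P by blast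
      then show thesis by (intro that[of "max N1 N2"]) simp_all
    qed
    have D: "\<nu> (Suc i) \<le> \<nu> i" "\<mu> (Suc i) \<le> \<mu> i" for i by (simp_all add: is_partitionD P)
    have "is_partition c"
    proof (rule is_partitionI)
      fix i
      have e: "Suc i - 2 = Suc (i - 2)" if "\<not> i \<le> Suc j" using that by simp
      have "i = Suc j \<Longrightarrow> \<mu> (Suc i - 2) \<le> \<nu> i - 1" using j by simp
      then show "c (Suc i) \<le> c i"
        using D[of i] D(2)[of "i - 2"] e by (cases "i = Suc j") (auto simp: c_def diff_le_mono)
    next
      show "c i = 0" if "N + j + 2 \<le> i" for i using that N by (simp add: c_def)
    qed
    moreover have "is_partition a"
    proof (rule is_partitionI)
      fix i
      show "a (Suc i) \<le> a i"
      proof (cases "Suc i = j")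
        case True
        then have "\<nu> (Suc i + 2) \<le> \<mu> i + 1" using less[of i] is_partitionD[OF P(1), of "Suc i" "Suc i + 2"] by simp
        then show ?thesis using True by (simp add: a_def)
      qed (use D[of i] D(1)[of "i + 2"] in \<open>auto simp: a_def\<close>)
    next
      show "a i = 0" if "N + j \<le> i" for i using that N by (simp add: a_def)
    qed
    moreover have "part_size \<mu> + part_size \<nu> = part_size a + part_size c + 2"
    proof (rule tail_swap_size[of j \<nu> c \<mu> a N])
      show "\<nu> i = c i + 1" if "i \<le> Suc j" for i using that pos[OF that] by (simp add: c_def)
    qed (simp_all add: N c_def a_def)
    moreover have "unviol (c, a) = j"
      unfolding unviol_def prod.case
    proof (rule Least_equality)
      show "a j \<le> c (Suc j) + 1" using D(1)[of "Suc j"] by (simp add: a_def c_def)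
      fix y assume y: "a y \<le> c (Suc y) + 1"
      show "j \<le> y"
      proof (rule ccontr)
        assume "\<not> j \<le> y"
        then have "y < j" by simp
        then show False using y less[of y] pos[of "Suc y"] by (simp add: a_def c_def)
      qed
    qed
    then have "?G (c, a) = (\<lambda>i. if i \<le> Suc j then c i + 1 else a (i - 2), \<lambda>i. if i < j then a i - 1 else c (i + 2))"
      by (simp add: tail_unswap_def)
    moreover have "(\<lambda>i. if i \<le> Suc j then c i + 1 else a (i - 2)) = \<nu>"
    proof
      fix i
      have e: "\<not> i \<le> Suc j \<Longrightarrow> \<not> i - 2 < j \<and> Suc (Suc (i - 2)) = i" by auto
      then show "(if i \<le> Suc j then c i + 1 else a (i - 2)) = \<nu> i" using pos[of i] by (simp add: a_def c_def)
    qed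
    moreover have "(\<lambda>i. if i < j then a i - 1 else c (i + 2)) = \<mu>" by (rule ext) (simp add: a_def c_def)
    ultimately show ?thesis unfolding Fx using P by (simp add: xe)
  qed
  have G: "?G y \<in> bad_pairs n \<and> ?F (?G y) = y" if y: "y \<in> ?C" for y
  proof -
    obtain c a where ye: "y = (c, a)" by fastforce
    with y have P: "is_partition c" "is_partition a" "part_size a + part_size c + 2 = n" by auto
    obtain N where N: "\<And>i. N \<le> i \<Longrightarrow> c i = 0" "\<And>i. N \<le> i \<Longrightarrow> a i = 0"
    proof -
      obtain N1 N2 where "\<forall>i\<ge>N1. c i = 0" "\<forall>i\<ge>N2. a i = 0" using partition_bound P by blast
      then show thesis by (intro that[of "max N1 N2"]) simp_all
    qed
    have "a N \<le> c (Suc N) + 1" using N by simp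
    then have ex: "\<exists>j. a j \<le> c (Suc j) + 1" by blast
    define j where "j = unviol y"
    have j: "a j \<le> c (Suc j) + 1" unfolding j_def unviol_def ye prod.case using ex by (rule LeastI_ex)
    have less: "c (Suc i) + 2 \<le> a i" if "i < j" for i
      using not_less_Least[of i "\<lambda>j. a j \<le> c (Suc j) + 1"] that unfolding j_def unviol_def ye prod.case by simp
    define \<nu> where "\<nu> i = (if i \<le> Suc j then c i + 1 else a (i - 2))" for i
    define \<mu> where "\<mu> i = (if i < j then a i - 1 else c (i + 2))" for i
    have Gy: "?G y = (\<nu>, \<mu>)" unfolding j_def[symmetric] by (simp add: tail_unswap_def ye \<nu>_def[abs_def] \<mu>_def[abs_def])
    have D: "c (Suc i) \<le> c i" "a (Suc i) \<le> a i" for i by (simp_all add: is_partitionD P)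
    have N': "\<nu> i = 0" "\<mu> i = 0" if "N + j + 2 \<le> i" for i using that N by (simp_all add: \<nu>_def \<mu>_def)
    have "is_partition \<nu>"
    proof (rule is_partitionI[OF _ N'(1)])
      fix i
      have e: "Suc i - 2 = Suc (i - 2)" if "\<not> i \<le> Suc j" using that by simp
      have "i = Suc j \<Longrightarrow> a (Suc i - 2) \<le> c i + 1" using j by simp
      then show "\<nu> (Suc i) \<le> \<nu> i"
        using D[of i] D(2)[of "i - 2"] e by (cases "i = Suc j") (auto simp: \<nu>_def)
    qed
    moreover have "is_partition \<mu>"
    proof (rule is_partitionI[OF _ N'(2)])
      fix i
      show "\<mu> (Suc i) \<le> \<mu> i"
      proof (cases "Suc i = j")
        case True
        then have "c (Suc i + 2) \<le> a i - 1" using less[of i] is_partitionD[OF P(1), of "Suc i" "Suc i + 2"] by simp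
        then show ?thesis using True by (simp add: \<mu>_def)
      qed (use D[of i] D(1)[of "i + 2"] in \<open>auto simp: \<mu>_def diff_le_mono\<close>)
    qed
    moreover have "part_size \<mu> + part_size \<nu> = part_size a + part_size c + 2"
    proof (rule tail_swap_size[of j \<nu> c \<mu> a "N + j + 2"])
      show "a i = \<mu> i + 1" if "i < j" for i using that less[OF that] by (simp add: \<mu>_def)
      show "\<nu> i = 0" "\<mu> i = 0" if "N + j + 2 \<le> i" for i using N'[OF that] by simp_all
    qed (simp_all add: \<nu>_def \<mu>_def)
    moreover have v: "\<mu> j < \<nu> (Suc j)" using D(1)[of "Suc j"] by (simp add: \<mu>_def \<nu>_def)
    moreover have "viol (\<nu>, \<mu>) = j"
      unfolding viol_def prod.case
    proof (rule Least_equality)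
      show "\<mu> j < \<nu> (Suc j)" by (rule v)
      fix i assume i: "\<mu> i < \<nu> (Suc i)"
      show "j \<le> i"
      proof (rule ccontr)
        assume "\<not> j \<le> i"
        then have "i < j" by simp
        then show False using i less[of i] by (simp add: \<mu>_def \<nu>_def)
      qed
    qed
    then have "?F (\<nu>, \<mu>) = (\<lambda>i. if i \<le> Suc j then \<nu> i - 1 else \<mu> (i - 2), \<lambda>i. if i < j then \<mu> i + 1 else \<nu> (i + 2))"
      by (simp add: tail_swap_def)
    moreover have "(\<lambda>i. if i \<le> Suc j then \<nu> i - 1 else \<mu> (i - 2)) = c"
    proof
      fix i
      have e: "\<not> i \<le> Suc j \<Longrightarrow> \<not> i - 2 < j \<and> Suc (Suc (i - 2)) = i" by auto
      then show "(if i \<le> Suc j then \<nu> i - 1 else \<mu> (i - 2)) = c i" by (simp add: \<mu>_def \<nu>_def)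
    qed
    moreover have "(\<lambda>i. if i < j then \<mu> i + 1 else \<nu> (i + 2)) = a"
    proof
      fix i
      have "i < j \<Longrightarrow> 0 < a i" using less[of i] by simp
      then show "(if i < j then \<mu> i + 1 else \<nu> (i + 2)) = a i" by (simp add: \<mu>_def \<nu>_def)
    qed
    ultimately show ?thesis unfolding Gy using P by (auto simp: ye bad_pairs_def pair_set_def)
  qed
  show ?thesis
  proof (rule bij_betwI[where g = ?G])
    show "?F \<in> bad_pairs n \<rightarrow> ?C" by (rule Pi_I) (rule F[THEN conjunct1])
    show "?G \<in> ?C \<rightarrow> bad_pairs n" by (rule Pi_I) (rule G[THEN conjunct1])
    show "?G (?F x) = x" if "x \<in> bad_pairs n" for x by (rule F[OF that, THEN conjunct2])
    show "?F (?G y) = y" if "y \<in> ?C" for y by (rule G[OF that, THEN conjunct2])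
  qed
qed

lemma finite_orbit_pairs: "finite (orbit_partition_pairs n)"
  unfolding orbit_pairs_eq using finite_pair_set by blast

lemma card_orbit_pairs: "int (card (orbit_partition_pairs n)) = int (p2 (int n)) - int (p2 (int n - 2))"
proof -
  let ?C = "{(c, a). is_partition c \<and> is_partition a \<and> part_size a + part_size c + 2 = n}"
  have sub: "bad_pairs n \<subseteq> pair_set n" by (auto simp: bad_pairs_def)
  have "bij_betw prod.swap ?C {(\<mu>, \<nu>). is_partition \<mu> \<and> is_partition \<nu> \<and> int (part_size \<mu> + part_size \<nu>) = int n - 2}"
    by (rule bij_betwI[where g = prod.swap]) auto
  from bij_betw_same_card[OF this] have "card ?C = p2 (int n - 2)" by (simp only: p2_def)
  then have "card (bad_pairs n) = p2 (int n - 2)" using bij_betw_same_card[OF bij_bad_pairs[of n]] by simp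
  moreover have "card (bad_pairs n) \<le> card (pair_set n)" using sub finite_pair_set by (rule card_mono[rotated])
  moreover have "card (orbit_partition_pairs n) = card (pair_set n) - card (bad_pairs n)"
    unfolding orbit_pairs_eq using sub finite_subset[OF sub finite_pair_set] by (rule card_Diff_subset[rotated])
  ultimately show ?thesis unfolding p2_eq by simp
qed

section \<open>Normal form parameters as pairs of partitions\<close>

lemma parts_partition: "is_partition (parts xs) \<longleftrightarrow> sorted_wrt (\<ge>) xs"
proof
  assume p: "is_partition (parts xs)"
  show "sorted_wrt (\<ge>) xs"
    unfolding sorted_wrt_iff_nth_less
  proof (intro allI impI)
    fix i j assume "i < j" "j < length xs"
    then show "xs ! j \<le> xs ! i" using is_partitionD[OF p, of i j] by (simp add: parts_def)
  qed
next
  assume x: "sorted_wrt (\<ge>) xs"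
  show "is_partition (parts xs)"
  proof (rule is_partitionI[of _ "length xs"])
    fix i
    show "parts xs (Suc i) \<le> parts xs i"
      using x unfolding sorted_wrt_iff_nth_less parts_def by auto
  qed (simp add: parts_def)
qed

lemma part_size_parts: "part_size (parts xs) = sum_list xs"
proof -
  have "part_size (parts xs) = (\<Sum>i<length xs. parts xs i)" by (rule part_size_lessThan) (simp add: parts_def)
  also have "\<dots> = (\<Sum>i<length xs. xs ! i)" by (intro sum.cong) (simp_all add: parts_def)
  finally show ?thesis by (simp add: sum_list_sum_nth atLeast0LessThan)
qed

definition psize :: "nat \<times> (nat \<times> nat) list \<Rightarrow> nat" where
  "psize = (\<lambda>(m, lks). m + sum_list (map snd lks))"

text \<open>The inverse takes a block with l = \<mu> a and k = \<mu> a + \<nu> (a + 1) for each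
  nonzero part of \<mu>. For a block, the bound (k + 1) div 2 at most l says exactly that \<nu> (a +
  1) is at most \<mu> a, and it forces l > 0, so no block is lost among the zeros of \<mu>.\<close>

lemma bij_partition_pair:
  "bij_betw partition_pair {P. normal_form_params P \<and> psize P = n} (orbit_partition_pairs n)"
proof -
  define G where "G = (\<lambda>(\<nu>, \<mu>). (\<nu> 0 :: nat, map (\<lambda>a. (\<mu> a, \<mu> a + \<nu> (Suc a))) [0..<card {i. \<mu> i \<noteq> (0::nat)}]))"
  show ?thesis
  proof (rule bij_betwI[where g = G])
    show "partition_pair \<in> {P. normal_form_params P \<and> psize P = n} \<rightarrow> orbit_partition_pairs n"
    proof
      fix P assume P: "P \<in> {P. normal_form_params P \<and> psize P = n}"
      obtain m lks where Pm: "P = (m, lks)" by (cases P)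
      have lk: "\<forall>(l, k)\<in>set lks. 1 \<le> k \<and> (k + 1) div 2 \<le> l \<and> l \<le> k"
        and so: "sorted_wrt (\<ge>) (map fst lks)" "sorted_wrt (\<ge>) (m # map (\<lambda>(l, k). k - l) lks)"
        and sz: "m + sum_list (map snd lks) = n"
        using P unfolding Pm normal_form_params_def psize_def by auto
      have "sum_list (map (\<lambda>(l, k). k - l) lks) + sum_list (map fst lks) = sum_list (map snd lks)"
        using lk by (induction lks) auto
      then have "sum_list (map fst lks) + sum_list (m # map (\<lambda>(l, k). k - l) lks) = n" using sz by simp
      moreover have "parts (m # map (\<lambda>(l, k). k - l) lks) i \<le> parts (map fst lks) (i - 1)" if i: "1 \<le> i" for i
      proof -
        obtain j where j: "i = Suc j" using i by (cases i) auto
        show ?thesis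
        proof (cases "j < length lks")
          case True
          then have "snd (lks ! j) - fst (lks ! j) \<le> fst (lks ! j)"
            using bspec[OF lk nth_mem[OF True]] by (auto simp: case_prod_beta)
          then show ?thesis using True by (simp add: j parts_def case_prod_beta)
        qed (simp add: j parts_def)
      qed
      ultimately show "partition_pair P \<in> orbit_partition_pairs n"
        using so unfolding Pm partition_pair_def orbit_partition_pairs_def prod.case mem_Collect_eq
          parts_partition part_size_parts by blast
    qed
    show "G \<in> orbit_partition_pairs n \<rightarrow> {P. normal_form_params P \<and> psize P = n}"
    proof
      fix x assume x: "x \<in> orbit_partition_pairs n"
      obtain \<nu> \<mu> where xe: "x = (\<nu>, \<mu>)" by fastforce
      have p: "is_partition \<nu>" "is_partition \<mu>" "part_size \<mu> + part_size \<nu> = n" and le: "\<And>i. \<nu> (Suc i) \<le> \<mu> i"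
        using x by (auto simp: xe orbit_partition_pairs_def)
      define S where "S = card {i. \<mu> i \<noteq> 0}"
      have S: "\<mu> i \<noteq> 0 \<longleftrightarrow> i < S" for i unfolding S_def by (rule partition_pos_iff[OF p(2)])
      have dec: "sorted_wrt (\<ge>) (map f [0..<S])" if "\<And>a c. a \<le> c \<Longrightarrow> f c \<le> f a" for f :: "nat \<Rightarrow> nat"
        unfolding sorted_wrt_iff_nth_less using that by simp
      have Gx: "G x = (\<nu> 0, map (\<lambda>a. (\<mu> a, \<mu> a + \<nu> (Suc a))) [0..<S])" by (simp add: G_def xe S_def)
      have "part_size \<mu> = (\<Sum>a<S. \<mu> a)" using S by (intro part_size_lessThan) (meson not_le)
      moreover have "part_size \<nu> = (\<Sum>a<Suc S. \<nu> a)"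
      proof (rule part_size_lessThan)
        fix i assume "Suc S \<le> i"
        then obtain k where "i = Suc k" "S \<le> k" by (cases i) auto
        then show "\<nu> i = 0" using S[of k] le[of k] by simp
      qed
      moreover have "(\<Sum>a<Suc S. \<nu> a) = \<nu> 0 + (\<Sum>a<S. \<nu> (Suc a))" by (rule sum.lessThan_Suc_shift)
      ultimately have "psize (G x) = n"
        using p(3) unfolding Gx psize_def by (simp add: o_def interv_sum_list_conv_sum_set_nat sum.distrib atLeast0LessThan)
      moreover have "normal_form_params (G x)"
        unfolding Gx normal_form_params_def prod.case
      proof (intro conjI)
        show "\<forall>(l, k)\<in>set (map (\<lambda>a. (\<mu> a, \<mu> a + \<nu> (Suc a))) [0..<S]). 1 \<le> k \<and> (k + 1) div 2 \<le> l \<and> l \<le> k"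
        proof
          fix lk assume "lk \<in> set (map (\<lambda>a. (\<mu> a, \<mu> a + \<nu> (Suc a))) [0..<S])"
          then obtain a where "a < S" "lk = (\<mu> a, \<mu> a + \<nu> (Suc a))" by auto
          then show "case lk of (l, k) \<Rightarrow> 1 \<le> k \<and> (k + 1) div 2 \<le> l \<and> l \<le> k" using S[of a] le[of a] by auto
        qed
        show "sorted_wrt (\<ge>) (map snd (map (\<lambda>a. (\<mu> a, \<mu> a + \<nu> (Suc a))) [0..<S]))"
          "sorted_wrt (\<ge>) (map fst (map (\<lambda>a. (\<mu> a, \<mu> a + \<nu> (Suc a))) [0..<S]))"
          using dec[of "\<lambda>a. \<mu> a + \<nu> (Suc a)"] dec[of \<mu>] is_partitionD[OF p(1)] is_partitionD[OF p(2)]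
          by (simp_all add: o_def add_mono)
        show "sorted_wrt (\<ge>) (\<nu> 0 # map (\<lambda>(l, k). k - l) (map (\<lambda>a. (\<mu> a, \<mu> a + \<nu> (Suc a))) [0..<S]))"
          using dec[of "\<lambda>a. \<nu> (Suc a)"] is_partitionD[OF p(1)] by (simp add: o_def)
      qed
      ultimately show "G x \<in> {P. normal_form_params P \<and> psize P = n}" by simp
    qed
    show "G (partition_pair P) = P" if "P \<in> {P. normal_form_params P \<and> psize P = n}" for P
    proof -
      obtain m lks where Pm: "P = (m, lks)" by (cases P)
      have lk: "\<forall>(l, k)\<in>set lks. 1 \<le> k \<and> (k + 1) div 2 \<le> l \<and> l \<le> k"
        using that unfolding Pm normal_form_params_def by auto
      have lkj: "1 \<le> fst (lks ! j) \<and> fst (lks ! j) \<le> snd (lks ! j)" if "j < length lks" for j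
        using bspec[OF lk nth_mem[OF that]] by (auto simp: case_prod_beta)
      have "{i. parts (map fst lks) i \<noteq> 0} = {..<length lks}"
        using lkj by (fastforce simp: parts_def split: if_splits)
      then have "G (partition_pair P) = (m, map (\<lambda>a. (fst (lks ! a), fst (lks ! a) + (snd (lks ! a) - fst (lks ! a)))) [0..<length lks])"
        unfolding Pm partition_pair_def G_def prod.case
        by (simp add: parts_def case_prod_beta)
      also have "map (\<lambda>a. (fst (lks ! a), fst (lks ! a) + (snd (lks ! a) - fst (lks ! a)))) [0..<length lks] = lks"
        using lkj by (intro nth_equalityI) (simp_all add: prod_eq_iff)
      finally show ?thesis using Pm by simp
    qed
    show "partition_pair (G x) = x" if x: "x \<in> orbit_partition_pairs n" for x
    proof -
      obtain \<nu> \<mu> where xe: "x = (\<nu>, \<mu>)" by fastforce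
      have p: "is_partition \<mu>" and le: "\<And>i. \<nu> (Suc i) \<le> \<mu> i"
        using x by (auto simp: xe orbit_partition_pairs_def)
      define S where "S = card {i. \<mu> i \<noteq> 0}"
      have S: "\<mu> i \<noteq> 0 \<longleftrightarrow> i < S" for i unfolding S_def by (rule partition_pos_iff[OF p])
      have "parts (map \<mu> [0..<S]) = \<mu>"
        using S by (intro ext) (auto simp: parts_def)
      moreover have "parts (\<nu> 0 # map (\<lambda>a. \<nu> (Suc a)) [0..<S]) = \<nu>"
      proof
        fix i
        show "parts (\<nu> 0 # map (\<lambda>a. \<nu> (Suc a)) [0..<S]) i = \<nu> i"
          using S[of "i - 1"] le[of "i - 1"] by (cases i) (auto simp: parts_def)
      qed
      ultimately show ?thesis
        unfolding xe G_def partition_pair_def prod.case S_def[symmetric] by (simp add: o_def)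
    qed
  qed
qed

section \<open>Equivalence of form modules and the bijection with orbits\<close>

lemma form_equiv_sym:
  assumes "form_equiv M N" "fm_space M = UNIV" shows "form_equiv N M"
proof -
  obtain f where f: "bij_betw f UNIV (fm_space N)" "\<And>v w. f (v + w) = f v + f w"
    "\<And>c v. f (fm_scale M c v) = fm_scale N c (f v)" "\<And>v. fm_quad N (f v) = fm_quad M v"
    "\<And>v w. fm_bil N (f v) (f w) = fm_bil M v w"
    using assms unfolding form_equiv_def by auto
  define g where "g = inv_into UNIV f"
  have gf: "g (f v) = v" for v using f(1) by (simp add: g_def bij_betw_def)
  have N: "\<exists>v. x = f v" if "x \<in> fm_space N" for x using f(1) that by (auto simp: bij_betw_def)
  show ?thesis
    unfolding form_equiv_def assms(2)
  proof (intro exI[of _ g] conjI ballI allI)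
    show "bij_betw g (fm_space N) UNIV" unfolding g_def by (rule bij_betw_inv_into[OF f(1)])
    fix x y c assume x: "x \<in> fm_space N" and y: "y \<in> fm_space N"
    from N[OF x] obtain v where v: "x = f v" ..
    from N[OF y] obtain w where w: "y = f w" ..
    show "g (x + y) = g x + g y" unfolding v w f(2)[symmetric] gf ..
    show "fm_bil M (g x) (g y) = fm_bil N x y" unfolding v w gf f(5) ..
  next
    fix x c assume x: "x \<in> fm_space N"
    from N[OF x] obtain v where v: "x = f v" ..
    show "g (fm_scale N c x) = fm_scale M c (g x)" unfolding v f(3)[symmetric] gf ..
    show "fm_quad M (g x) = fm_quad N x" unfolding v gf f(4) ..
  qed
qed

lemma form_equiv_trans:
  assumes "form_equiv M N" "form_equiv N R" shows "form_equiv M R"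
proof -
  obtain f where f: "bij_betw f (fm_space M) (fm_space N)"
    "\<forall>v\<in>fm_space M. \<forall>w\<in>fm_space M. f (v + w) = f v + f w"
    "\<forall>c. \<forall>v\<in>fm_space M. f (fm_scale M c v) = fm_scale N c (f v)"
    "\<forall>v\<in>fm_space M. fm_quad N (f v) = fm_quad M v"
    "\<forall>v\<in>fm_space M. \<forall>w\<in>fm_space M. fm_bil N (f v) (f w) = fm_bil M v w"
    using assms(1) unfolding form_equiv_def by blast
  obtain g where g: "bij_betw g (fm_space N) (fm_space R)"
    "\<forall>v\<in>fm_space N. \<forall>w\<in>fm_space N. g (v + w) = g v + g w"
    "\<forall>c. \<forall>v\<in>fm_space N. g (fm_scale N c v) = fm_scale R c (g v)"
    "\<forall>v\<in>fm_space N. fm_quad R (g v) = fm_quad N v"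
    "\<forall>v\<in>fm_space N. \<forall>w\<in>fm_space N. fm_bil R (g v) (g w) = fm_bil N v w"
    using assms(2) unfolding form_equiv_def by blast
  have N: "f v \<in> fm_space N" if "v \<in> fm_space M" for v using f(1) that by (auto simp: bij_betw_def)
  show ?thesis
    unfolding form_equiv_def
    using bij_betw_trans[OF f(1) g(1)] f(2-5) g(2-5) N by (intro exI[of _ "g \<circ> f"]) simp
qed

context quad_space
begin

lemma xi_module_form:
  assumes b: "adapted b" and \<xi>: "\<xi> \<in> odual"
  shows "form_space s \<alpha> n (\<lambda>v w. \<xi> (xel v w))"
    "xi_module s \<alpha> \<xi> = \<lparr>fm_space = UNIV, fm_scale = s, fm_quad = \<alpha>, fm_bil = \<lambda>v w. \<xi> (xel v w)\<rparr>"
proof -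
  have "dual_linear \<xi>" using \<xi> by (simp add: odual_iff)
  then show "form_space s \<alpha> n (\<lambda>v w. \<xi> (xel v w))"
    by unfold_locales (rule bilinear_alt_xel)
  have "beta_xi s \<alpha> \<xi> = (\<lambda>v w. \<xi> (xel v w))"
    by (intro ext) (rule beta_xi_xel[OF b \<xi>])
  then show "xi_module s \<alpha> \<xi> = \<lparr>fm_space = UNIV, fm_scale = s, fm_quad = \<alpha>, fm_bil = \<lambda>v w. \<xi> (xel v w)\<rparr>"
    unfolding xi_module_def by (simp only:)
qed

lemma xi_module_space: "fm_space (xi_module s \<alpha> \<xi>) = UNIV"
  by (simp add: xi_module_def)

lemma normal_form_ex1:
  assumes b: "adapted b" and \<xi>: "\<xi> \<in> nilpotent_dual s \<alpha> (upper b)"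
  shows "\<exists>!P. has_normal_form (xi_module s \<alpha> \<xi>) P"
proof -
  have \<xi>o: "\<xi> \<in> odual" and "\<exists>b'. nilp (\<lambda>v w. \<xi> (xel v w)) b'"
    using \<xi> unfolding nilpotent_dual_iff[OF b] by auto
  then obtain b' where b': "nilp (\<lambda>v w. \<xi> (xel v w)) b'" by blast
  interpret form_space s \<alpha> n "\<lambda>v w. \<xi> (xel v w)" by (rule xi_module_form(1)[OF b \<xi>o])
  obtain P where P: "has_normal_form (xi_module s \<alpha> \<xi>) P"
    using normal_form_exists[OF b'] unfolding xi_module_form(2)[OF b \<xi>o] ..
  show ?thesis
  proof (rule ex1I[of _ P])
    show "has_normal_form (xi_module s \<alpha> \<xi>) P" by (rule P)
    show "P' = P" if "has_normal_form (xi_module s \<alpha> \<xi>) P'" for P'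
      using normal_form_unique[OF b] that P unfolding xi_module_form(2)[OF b \<xi>o] by blast
  qed
qed

lemma normal_form_has:
  assumes "adapted b" "\<xi> \<in> nilpotent_dual s \<alpha> (upper b)"
  shows "has_normal_form (xi_module s \<alpha> \<xi>) (normal_form (xi_module s \<alpha> \<xi>))"
  unfolding normal_form_def by (rule theI') (rule normal_form_ex1[OF assms])

lemma normal_form_eqI:
  assumes "adapted b" "\<xi> \<in> nilpotent_dual s \<alpha> (upper b)" "has_normal_form (xi_module s \<alpha> \<xi>) P"
  shows "normal_form (xi_module s \<alpha> \<xi>) = P"
  unfolding normal_form_def using normal_form_ex1[OF assms(1,2)] assms(3) by (rule the1_equality)

lemma normal_form_size:
  assumes b: "adapted b" and \<xi>: "\<xi> \<in> nilpotent_dual s \<alpha> (upper b)"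
  shows "psize (normal_form (xi_module s \<alpha> \<xi>)) = n"
proof -
  have \<xi>o: "\<xi> \<in> odual" using \<xi> unfolding nilpotent_dual_iff[OF b] by auto
  interpret form_space s \<alpha> n "\<lambda>v w. \<xi> (xel v w)" by (rule xi_module_form(1)[OF b \<xi>o])
  have "has_normal_form omod (normal_form (xi_module s \<alpha> \<xi>))"
    using normal_form_has[OF b \<xi>] unfolding xi_module_form(2)[OF b \<xi>o] .
  from nf_params_family[OF b this]
  obtain m v u S K L X Y where P: "normal_form (xi_module s \<alpha> \<xi>) = (m, map (\<lambda>a. (L a, K a)) [0..<S])"
    and F: "nf_family s \<alpha> n m v u S K L X Y (\<lambda>v w. \<xi> (xel v w))" by blast
  interpret F: nf_family s \<alpha> n m v u S K L X Y "\<lambda>v w. \<xi> (xel v w)" by (rule F)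
  show ?thesis
    using F.size' unfolding P psize_def
    by (simp add: o_def interv_sum_list_conv_sum_set_nat atLeast0LessThan)
qed

text \<open>The model form is nilpotent with respect to the very basis that defines the Borel
  subgroup, and every alternating form comes from a functional.\<close>

lemma normal_form_realized:
  assumes b: "adapted b" and P: "normal_form_params P" "psize P = n"
  shows "\<exists>\<xi>\<in>nilpotent_dual s \<alpha> (upper b). normal_form (xi_module s \<alpha> \<xi>) = P"
proof -
  obtain m lks where Pm: "P = (m, lks)" by (cases P)
  define S where "S = length lks"
  define L where "L a = fst (lks ! a)" for a
  define K where "K a = snd (lks ! a)" for a
  have l: "lks = map (\<lambda>a. (L a, K a)) [0..<S]" by (simp add: L_def K_def S_def map_nth)
  have KL: "1 \<le> K a \<and> K a \<le> 2 * L a \<and> L a \<le> K a" if "a < S" for a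
  proof -
    have "\<forall>(l, k)\<in>set lks. 1 \<le> k \<and> (k + 1) div 2 \<le> l \<and> l \<le> k"
      using P(1) unfolding Pm normal_form_params_def by simp
    from bspec[OF this nth_mem] have "1 \<le> K a \<and> (K a + 1) div 2 \<le> L a \<and> L a \<le> K a"
      using that by (simp add: case_prod_beta L_def K_def S_def)
    then show ?thesis by linarith
  qed
  have "m + (\<Sum>a<S. K a) = n"
    using P(2) unfolding Pm psize_def l by (simp add: o_def interv_sum_list_conv_sum_set_nat atLeast0LessThan)
  from model_exists[OF b KL this]
  obtain \<omega> v u X Y where F: "nf_family s \<alpha> n m v u S K L X Y \<omega>" and \<omega>: "nilp \<omega> b" by blast
  interpret F: nf_family s \<alpha> n m v u S K L X Y \<omega> by (rule F)
  obtain \<xi> where \<xi>: "\<xi> \<in> odual" "\<And>v w. \<xi> (xel v w) = \<omega> v w"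
    using dual_of_form[OF b F.omega] by blast
  have e: "(\<lambda>v w. \<xi> (xel v w)) = \<omega>" by (intro ext) (rule \<xi>(2))
  have nil: "\<xi> \<in> nilpotent_dual s \<alpha> (upper b)"
    unfolding nilpotent_dual_iff[OF b] e using \<xi>(1) \<omega> by blast
  have "has_normal_form (xi_module s \<alpha> \<xi>) P"
    unfolding has_normal_form_def xi_module_form(2)[OF b \<xi>(1)] e
    using F.equiv_nfm P(1) unfolding Pm l by blast
  from normal_form_eqI[OF b nil this] nil show ?thesis by blast
qed

lemma orbit_eq_iff_normal_form_eq:
  assumes b: "adapted b" and \<xi>: "\<xi> \<in> nilpotent_dual s \<alpha> (upper b)" "\<xi>' \<in> nilpotent_dual s \<alpha> (upper b)"
  shows "coad_orbit s \<alpha> \<xi> = coad_orbit s \<alpha> \<xi>' \<longleftrightarrow> normal_form (xi_module s \<alpha> \<xi>) = normal_form (xi_module s \<alpha> \<xi>')"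
proof -
  have o: "\<xi> \<in> odual" "\<xi>' \<in> odual" using \<xi> unfolding nilpotent_dual_iff[OF b] by auto
  note H = normal_form_has[OF b \<xi>(1)] normal_form_has[OF b \<xi>(2)]
  have "form_equiv (xi_module s \<alpha> \<xi>) (xi_module s \<alpha> \<xi>') \<longleftrightarrow> normal_form (xi_module s \<alpha> \<xi>) = normal_form (xi_module s \<alpha> \<xi>')"
  proof
    assume eq: "form_equiv (xi_module s \<alpha> \<xi>) (xi_module s \<alpha> \<xi>')"
    show "normal_form (xi_module s \<alpha> \<xi>) = normal_form (xi_module s \<alpha> \<xi>')"
      using H(2) form_equiv_trans[OF eq, of "normal_form_module (normal_form (xi_module s \<alpha> \<xi>'))"]
      by (intro normal_form_eqI[OF b \<xi>(1)]) (simp add: has_normal_form_def)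
  next
    assume eq: "normal_form (xi_module s \<alpha> \<xi>) = normal_form (xi_module s \<alpha> \<xi>')"
    show "form_equiv (xi_module s \<alpha> \<xi>) (xi_module s \<alpha> \<xi>')"
      using H unfolding eq has_normal_form_def
      by (intro form_equiv_trans[OF _ form_equiv_sym[OF _ xi_module_space]]) blast+
  qed
  then show ?thesis unfolding coad_orbit_eq_iff form_equiv_iff_coad[OF b o] .
qed

lemma orbit_bijection:
  assumes b: "adapted b"
  shows "\<exists>\<Phi>. (\<forall>\<xi>\<in>nilpotent_dual s \<alpha> (upper b).
      \<Phi> (coad_orbit s \<alpha> \<xi>) = partition_pair (normal_form (xi_module s \<alpha> \<xi>))) \<and>
    bij_betw \<Phi> (coad_orbit s \<alpha> ` nilpotent_dual s \<alpha> (upper b)) (orbit_partition_pairs n)"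
proof -
  let ?N = "nilpotent_dual s \<alpha> (upper b)" and ?nf = "\<lambda>\<xi>. normal_form (xi_module s \<alpha> \<xi>)"
  let ?P = "{P. normal_form_params P \<and> psize P = n}"
  define \<Phi> where "\<Phi> Q = partition_pair (?nf (SOME \<xi>. \<xi> \<in> ?N \<and> coad_orbit s \<alpha> \<xi> = Q))" for Q
  have \<Phi>: "\<Phi> (coad_orbit s \<alpha> \<xi>) = partition_pair (?nf \<xi>)" if \<xi>: "\<xi> \<in> ?N" for \<xi>
  proof -
    define \<xi>' where "\<xi>' = (SOME \<xi>'. \<xi>' \<in> ?N \<and> coad_orbit s \<alpha> \<xi>' = coad_orbit s \<alpha> \<xi>)"
    have "\<xi>' \<in> ?N \<and> coad_orbit s \<alpha> \<xi>' = coad_orbit s \<alpha> \<xi>"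
      unfolding \<xi>'_def by (rule someI[of _ \<xi>]) (simp add: \<xi>)
    then have "?nf \<xi>' = ?nf \<xi>" using orbit_eq_iff_normal_form_eq[OF b _ \<xi>, of \<xi>'] by blast
    then show ?thesis by (simp add: \<Phi>_def \<xi>'_def)
  qed
  have nfP: "?nf \<xi> \<in> ?P" if "\<xi> \<in> ?N" for \<xi>
    using normal_form_has[OF b that] normal_form_size[OF b that] by (simp add: has_normal_form_def)
  have "bij_betw \<Phi> (coad_orbit s \<alpha> ` ?N) (orbit_partition_pairs n)"
    unfolding bij_betw_def
  proof
    show "inj_on \<Phi> (coad_orbit s \<alpha> ` ?N)"
    proof (rule inj_onI, elim imageE, simp only:)
      fix \<xi> \<xi>' assume \<xi>: "\<xi> \<in> ?N" "\<xi>' \<in> ?N" "\<Phi> (coad_orbit s \<alpha> \<xi>) = \<Phi> (coad_orbit s \<alpha> \<xi>')"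
      then have "partition_pair (?nf \<xi>) = partition_pair (?nf \<xi>')" by (simp add: \<Phi>)
      then have "?nf \<xi> = ?nf \<xi>'"
        by (rule inj_onD[OF bij_betw_imp_inj_on[OF bij_partition_pair[of n]] _ nfP[OF \<xi>(1)] nfP[OF \<xi>(2)]])
      then show "coad_orbit s \<alpha> \<xi> = coad_orbit s \<alpha> \<xi>'"
        using orbit_eq_iff_normal_form_eq[OF b \<xi>(1,2)] by blast
    qed
    have "\<Phi> ` coad_orbit s \<alpha> ` ?N = partition_pair ` ?nf ` ?N"
      unfolding image_image using \<Phi> by (intro image_cong refl)
    also have "?nf ` ?N = ?P"
    proof
      show "?nf ` ?N \<subseteq> ?P" using nfP by (intro image_subsetI)
      show "?P \<subseteq> ?nf ` ?N"
      proof
        fix P assume "P \<in> ?P"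
        then obtain \<xi> where "\<xi> \<in> ?N" "?nf \<xi> = P" using normal_form_realized[OF b, of P] by blast
        then show "P \<in> ?nf ` ?N" by (intro image_eqI[of _ _ \<xi>]) simp_all
      qed
    qed
    also have "partition_pair ` ?P = orbit_partition_pairs n"
      using bij_partition_pair[of n] by (simp add: bij_betw_def)
    finally show "\<Phi> ` coad_orbit s \<alpha> ` ?N = orbit_partition_pairs n" .
  qed
  with \<Phi> show ?thesis by blast
qed

end

theorem mainTheorem5:
  fixes s :: "'k::alg_closed_field \<Rightarrow> 'v::ab_group_add \<Rightarrow> 'v" and \<alpha> :: "'v \<Rightarrow> 'k"
    and n :: nat and B :: "('v \<Rightarrow> 'v) set"
    and s' :: "'k \<Rightarrow> 'w::ab_group_add \<Rightarrow> 'w" and \<alpha>' :: "'w \<Rightarrow> 'k"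
    and n' :: nat and B' :: "('w \<Rightarrow> 'w) set"
  assumes "CHAR('k) = 2"
    and "odd_quadratic_space s \<alpha> n"
    and "borel_subgroup s (orth_group s \<alpha>) B"
    and "odd_quadratic_space s' \<alpha>' n'"
    and "borel_subgroup s' (orth_group s' \<alpha>') B'"
  shows "(\<forall>\<xi>\<in>nilpotent_dual s \<alpha> B. \<exists>!P. has_normal_form (xi_module s \<alpha> \<xi>) P) \<and>
    (\<forall>\<xi>\<in>nilpotent_dual s \<alpha> B. \<forall>\<xi>'\<in>nilpotent_dual s' \<alpha>' B'.
       form_equiv (xi_module s \<alpha> \<xi>) (xi_module s' \<alpha>' \<xi>') \<longleftrightarrow>
       normal_form (xi_module s \<alpha> \<xi>) = normal_form (xi_module s' \<alpha>' \<xi>')) \<and>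
    (\<exists>\<Phi>. (\<forall>\<xi>\<in>nilpotent_dual s \<alpha> B.
            \<Phi> (coad_orbit s \<alpha> \<xi>) = partition_pair (normal_form (xi_module s \<alpha> \<xi>))) \<and>
         bij_betw \<Phi> (coad_orbit s \<alpha> ` nilpotent_dual s \<alpha> B) (orbit_partition_pairs n)) \<and>
    finite (orbit_partition_pairs n) \<and>
    int (card (orbit_partition_pairs n)) = int (p2 (int n)) - int (p2 (int n - 2))"
proof -
  have "vector_space s" "vector_space s'" using assms(2,4) by (simp_all add: odd_quadratic_space_def)
  then interpret A: quad_space s \<alpha> n + A': quad_space s' \<alpha>' n'
    using assms(1,2,4) by (simp_all add: quad_space_def vspace_def quad_space_axioms_def)
  obtain b where b: "A.adapted b" "B = A.upper b" using A.Borel_eq_upper[OF assms(3)] by blast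
  obtain b' where b': "A'.adapted b'" "B' = A'.upper b'" using A'.Borel_eq_upper[OF assms(5)] by blast
  \<comment> \<open>The two spaces may have different types. They are compared through the normal
    form module, whose type depends on the field only.\<close>
  have equiv: "form_equiv (xi_module s \<alpha> \<xi>) (xi_module s' \<alpha>' \<xi>') \<longleftrightarrow>
      normal_form (xi_module s \<alpha> \<xi>) = normal_form (xi_module s' \<alpha>' \<xi>')"
    if \<xi>: "\<xi> \<in> nilpotent_dual s \<alpha> B" "\<xi>' \<in> nilpotent_dual s' \<alpha>' B'" for \<xi> \<xi>'
  proof -
    note H = A.normal_form_has[OF b(1) \<xi>(1)[unfolded b(2)]] A'.normal_form_has[OF b'(1) \<xi>(2)[unfolded b'(2)]]
    show ?thesis
    proof
      assume eq: "form_equiv (xi_module s \<alpha> \<xi>) (xi_module s' \<alpha>' \<xi>')"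
      show "normal_form (xi_module s \<alpha> \<xi>) = normal_form (xi_module s' \<alpha>' \<xi>')"
        using H(2) form_equiv_trans[OF eq, of "normal_form_module (normal_form (xi_module s' \<alpha>' \<xi>'))"]
        by (intro A.normal_form_eqI[OF b(1) \<xi>(1)[unfolded b(2)]]) (simp add: has_normal_form_def)
    next
      assume eq: "normal_form (xi_module s \<alpha> \<xi>) = normal_form (xi_module s' \<alpha>' \<xi>')"
      show "form_equiv (xi_module s \<alpha> \<xi>) (xi_module s' \<alpha>' \<xi>')"
        using H unfolding eq has_normal_form_def
        by (intro form_equiv_trans[OF _ form_equiv_sym[OF _ A'.xi_module_space]]) blast+
    qed
  qed
  show ?thesis
    using equiv A.normal_form_ex1[OF b(1)] A.orbit_bijection[OF b(1)] finite_orbit_pairs card_orbit_pairs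
    unfolding b(2) by blast
qed

end
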